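(* Let $h$ be the log-correlated Gaussian field on $\mathbb R^2$, let $D\subset\mathbb R^2$ be an open domain with harmonically non-trivial boundary, and let $\rho,\sigma$ be admissible mollifiers on $\mathbb R^2$. If there is $p\in(0,1]$ such that both $\rho$ and $\sigma$ satisfy Condition $(A_p)$ with respect to $h$, then almost surely $$\mathcal T_{\alpha,\star}^{D,\rho}=\mathcal T_{\alpha,\star}^{D,\sigma}\qquad\text{for every }\alpha\in\mathbb R\text{ and every }\star\in\{\liminf,\limsup,\lim\}.$$
   Context: Let $\mathcal S(\mathbb R^2)$ be the Schwartz space and $\mathcal S_0(\mathbb R^2)=\{f\in\mathcal S(\mathbb R^2):\int f\,dx=0\}$. The log-correlated Gaussian field (equivalently, whole-plane Gaussian free field) $h$ on $\mathbb R^2$ is the centered Gaussian random tempered distribution modulo additive constants with $\operatorname{Cov}[(h,f_1),(h,f_2)]=\iint\log\frac1{|x-y|}f_1(x)f_2(y)\,dx\,dy$ for $f_1,f_2\in\mathcal S_0(\mathbb R^2)$. Its additive constant is fixed by requiring that the average of $h$ over the unit circle is $0$. An admissible mollifier is a nonnegative Radon measure $\rho$ on $\mathbb R^2$ such that (i) $\operatorname{supp}(\rho)\subseteq\overline{B(0,1)}$; (ii) $\rho(\mathbb R^2)=1$; (iii) $\iint\left|\log\frac1{|x-y|}\right|\rho(dx)\rho(dy)<\infty$. For a nonnegative Radon measure $\mu$ with total mass $1$ and finite logarithmic energy (as in (iii)), $(h,\mu)$ is the $L^2(\mathbb P)$-limit of $(h,\mu*\psi_n)$, where $\psi_n(x)=n^2\psi(nx)$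 and $\psi$ is smooth, nonnegative, symmetric, supported in $B(0,1)$, with integral $1$ (the limit does not depend on $\psi$). For $\epsilon>0$, $z\in\mathbb R^2$, $\rho_{z,\epsilon}$ is the pushforward of $\rho$ under $y\mapsto z+\epsilon y$, and $h_\epsilon^\rho(z):=(h,\rho_{z,\epsilon})$. Condition $(A_p)$ with respect to $h$, for $p\in(0,1]$: there is a constant $C$ (which may depend on $\rho,p$) such that $\mathbb E[(h_\epsilon^\rho(z)-h_r^\rho(w))^2]\le C\left(\frac{|(z,\epsilon)-(w,r)|}{\epsilon\wedge r}\right)^p$ for all $z,w\in\mathbb R^2$ and all $\epsilon,r\in(0,1]$ with $\frac12\le\epsilon/r\le2$. An open domain $D\subset\mathbb R^2$ has harmonically non-trivial boundary if planar Brownian motion started in $D$ almost surely exits $D$. Let $G_D$ be the Dirichlet Green's function of $D$, normalized so that $G_D(x,y)=\log\frac1{|x-y|}+O(1)$ as $y\to x$, for each $x\in D$. The zero-boundary Gaussian free field $h^D$ on $D$ is the centered Gaussian random distribution with $\operatorname{Cov}[(h^D,f),(h^D,g)]=\iint_{D\times D}G_D(x,y)f(x)g(y)\,dx\,dy$ for $f,g\in C_c^\infty(D)$. For $z\in D$ and $0<\epsilon<\operatorname{dist}(z,\partial D)$, the measure $\rho_{z,\epsilon}$ is supported in $D$, and $h^{D,\rho}_\epsilon(z):=(h^D,\rho_{z,\epsilon})$, defined by the same $L^2(\mathbb P)$ approximation by smooth functions; a modification jointly continuous in $(z,\epsilon)$ is used. For $\alpha\in\mathbb R$ and $\star\in\{\liminf,\limsup,\lim\}$,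 $\mathcal T^{D,\rho}_{\alpha,\star}$ is the set of $z\in D$ such that, respectively, $\liminf_{\epsilon\to0}\frac{h^{D,\rho}_\epsilon(z)}{\log(1/\epsilon)}=\alpha$, $\limsup_{\epsilon\to0}\frac{h^{D,\rho}_\epsilon(z)}{\log(1/\epsilon)}=\alpha$, or $\lim_{\epsilon\to0}\frac{h^{D,\rho}_\epsilon(z)}{\log(1/\epsilon)}$ exists and equals $\alpha$ (with $\epsilon$ restricted to be small enough that the averaging region lies inside $D$). *)

theory Defs
  imports "HOL-Probability.Probability" "HOL-Library.Landau_Symbols"
begin

(* The plane R^2 is represented by the type complex: same Euclidean norm, same Lebesgue measure
   (lborel), and Basis = {1, ii} gives the two coordinate directions. *)

subsection \<open>Smooth functions, Schwartz functions, test functions, distributions\<close>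

definition dir_deriv :: "complex \<Rightarrow> (complex \<Rightarrow> real) \<Rightarrow> complex \<Rightarrow> real" where
  "dir_deriv v f = (\<lambda>x. frechet_derivative f (at x) v)"

definition iter_deriv :: "complex list \<Rightarrow> (complex \<Rightarrow> real) \<Rightarrow> complex \<Rightarrow> real" where
  "iter_deriv vs f = foldr dir_deriv vs f"

(* Class C^k on an open set S. *)
primrec Ck_on :: "nat \<Rightarrow> complex set \<Rightarrow> (complex \<Rightarrow> real) \<Rightarrow> bool" where
  "Ck_on 0 S f \<longleftrightarrow> continuous_on S f"
| "Ck_on (Suc k) S f \<longleftrightarrow>
     (\<forall>x\<in>S. f differentiable (at x)) \<and> (\<forall>v. Ck_on k S (dir_deriv v f))"

definition smooth :: "(complex \<Rightarrow> real) \<Rightarrow> bool" where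
  "smooth f \<longleftrightarrow> (\<forall>k. Ck_on k UNIV f)"

definition fun_support :: "(complex \<Rightarrow> real) \<Rightarrow> complex set" where
  "fun_support f = closure {x. f x \<noteq> 0}"

definition schwartz :: "(complex \<Rightarrow> real) set" where
  "schwartz = {f. smooth f \<and>
     (\<forall>j vs. set vs \<subseteq> Basis \<longrightarrow> bounded (range (\<lambda>x. (1 + norm x) ^ j * iter_deriv vs f x)))}"

definition schwartz0 :: "(complex \<Rightarrow> real) set" where
  "schwartz0 = {f \<in> schwartz. (LINT x|lborel. f x) = 0}"

definition test_functions :: "complex set \<Rightarrow> (complex \<Rightarrow> real) set" where
  "test_functions D = {f. smooth f \<and> compact (fun_support f) \<and> fun_support f \<subseteq> D}"

(* Polynomial weight of order j, partial derivatives up to order k.  The supremum is only used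
   for Schwartz functions, where the set of values is bounded. *)
definition weighted_seminorm :: "nat \<Rightarrow> nat \<Rightarrow> (complex \<Rightarrow> real) \<Rightarrow> real" where
  "weighted_seminorm j k f =
     (SUP q \<in> {vs. set vs \<subseteq> Basis \<and> length vs \<le> k} \<times> UNIV.
        (1 + norm (snd q)) ^ j * \<bar>iter_deriv (fst q) f (snd q)\<bar>)"

definition linear_functional_on ::
    "(complex \<Rightarrow> real) set \<Rightarrow> ((complex \<Rightarrow> real) \<Rightarrow> real) \<Rightarrow> bool" where
  "linear_functional_on F T \<longleftrightarrow>
     (\<forall>f\<in>F. \<forall>g\<in>F. \<forall>a b. T (\<lambda>x. a * f x + b * g x) = a * T f + b * T g)"

definition tempered_distribution :: "((complex \<Rightarrow> real) \<Rightarrow> real) \<Rightarrow> bool" where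
  "tempered_distribution T \<longleftrightarrow> linear_functional_on schwartz T \<and>
     (\<exists>C k. \<forall>f\<in>schwartz. \<bar>T f\<bar> \<le> C * weighted_seminorm k k f)"

definition distribution_on :: "complex set \<Rightarrow> ((complex \<Rightarrow> real) \<Rightarrow> real) \<Rightarrow> bool" where
  "distribution_on D T \<longleftrightarrow> linear_functional_on (test_functions D) T \<and>
     (\<forall>K. compact K \<and> K \<subseteq> D \<longrightarrow>
        (\<exists>C k. \<forall>f\<in>test_functions D. fun_support f \<subseteq> K \<longrightarrow> \<bar>T f\<bar> \<le> C * weighted_seminorm 0 k f))"

subsection \<open>Mollifiers and pairings with measures\<close>

definition measure_support :: "complex measure \<Rightarrow> complex set" where
  "measure_support \<mu> = {x. \<forall>U. open U \<and> x \<in> U \<longrightarrow> emeasure \<mu> U > 0}"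

(* The value on the diagonal has to be set to infinity explicitly, because ln 0 = 0 in HOL;
   in particular, a measure with atoms has infinite energy. *)
definition abs_log_kernel :: "complex \<Rightarrow> complex \<Rightarrow> ennreal" where
  "abs_log_kernel x y = (if x = y then \<infinity> else ennreal \<bar>ln (1 / dist x y)\<bar>)"

definition finite_log_energy :: "complex measure \<Rightarrow> bool" where
  "finite_log_energy \<mu> \<longleftrightarrow> (\<integral>\<^sup>+x. \<integral>\<^sup>+y. abs_log_kernel x y \<partial>\<mu> \<partial>\<mu>) < \<infinity>"

(* Finite Borel measures on the plane are automatically Radon. *)
definition admissible_mollifier :: "complex measure \<Rightarrow> bool" where
  "admissible_mollifier \<rho> \<longleftrightarrow> sets \<rho> = sets borel \<and> measure_support \<rho> \<subseteq> cball 0 1 \<and>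
     emeasure \<rho> UNIV = 1 \<and> finite_log_energy \<rho>"

definition scaled_measure :: "complex measure \<Rightarrow> complex \<Rightarrow> real \<Rightarrow> complex measure" where
  "scaled_measure \<rho> z \<epsilon> = distr \<rho> borel (\<lambda>y. z + \<epsilon> *\<^sub>R y)"

definition smooth_bumps :: "(complex \<Rightarrow> real) set" where
  "smooth_bumps = {\<psi>. smooth \<psi> \<and> (\<forall>x. \<psi> x \<ge> 0) \<and> (\<forall>x. \<psi> (- x) = \<psi> x) \<and>
     fun_support \<psi> \<subseteq> ball 0 1 \<and> (LINT x|lborel. \<psi> x) = 1}"

(* The convolution of \<mu> with \<psi>_n(x) = n^2 \<psi>(n x). *)
definition mollify :: "complex measure \<Rightarrow> (complex \<Rightarrow> real) \<Rightarrow> nat \<Rightarrow> complex \<Rightarrow> real" where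
  "mollify \<mu> \<psi> n = (\<lambda>x. LINT y|\<mu>. (real n)\<^sup>2 * \<psi> (real n *\<^sub>R (x - y)))"

(* X is (a version of) the random variable (h, \<mu>), the L^2 limit of (h, \<mu> * \<psi>_n).
   The squared L^2 distance is a nonnegative Lebesgue integral, so the limit being 0 implies
   that it is eventually finite. *)
definition field_pairing ::
    "'a measure \<Rightarrow> ('a \<Rightarrow> (complex \<Rightarrow> real) \<Rightarrow> real) \<Rightarrow> complex measure \<Rightarrow> ('a \<Rightarrow> real) \<Rightarrow> bool" where
  "field_pairing M h \<mu> X \<longleftrightarrow> X \<in> borel_measurable M \<and>
     (\<forall>\<psi>\<in>smooth_bumps.
        (\<lambda>n. \<integral>\<^sup>+\<omega>. ennreal ((h \<omega> (mollify \<mu> \<psi> n) - X \<omega>)\<^sup>2) \<partial>M) \<longlonglongrightarrow> 0)"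

subsection \<open>The log-correlated Gaussian field on the plane\<close>

definition centered_gaussian :: "'a measure \<Rightarrow> ('a \<Rightarrow> real) \<Rightarrow> bool" where
  "centered_gaussian M X \<longleftrightarrow> X \<in> borel_measurable M \<and>
     (\<exists>s\<ge>0. distr M borel X =
        (if s = 0 then return borel 0 else density lborel (\<lambda>x. ennreal (normal_density 0 s x))))"

definition circle_measure :: "complex measure" where
  "circle_measure = distr (uniform_measure lborel {0..<2 * pi}) borel cis"

(* Joint Gaussianity of the pairings follows from linearity and the Gaussianity of every single
   pairing.  A field modulo additive constants is determined on schwartz0; the additive constant,
   i.e. the extension to all of schwartz, is fixed by the last clause. *)
definition log_correlated_field ::
    "'a measure \<Rightarrow> ('a \<Rightarrow> (complex \<Rightarrow> real) \<Rightarrow> real) \<Rightarrow> bool" where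
  "log_correlated_field M h \<longleftrightarrow> prob_space M \<and>
     (\<forall>\<omega>\<in>space M. tempered_distribution (h \<omega>)) \<and>
     (\<forall>f\<in>schwartz. (\<lambda>\<omega>. h \<omega> f) \<in> borel_measurable M) \<and>
     (\<forall>f\<in>schwartz0. centered_gaussian M (\<lambda>\<omega>. h \<omega> f)) \<and>
     (\<forall>f\<in>schwartz0. \<forall>g\<in>schwartz0. (LINT \<omega>|M. h \<omega> f * h \<omega> g) =
        (LINT x|lborel. LINT y|lborel. ln (1 / dist x y) * f x * g y)) \<and>
     field_pairing M h circle_measure (\<lambda>\<omega>. 0)"

definition condition_A ::
    "'a measure \<Rightarrow> ('a \<Rightarrow> (complex \<Rightarrow> real) \<Rightarrow> real) \<Rightarrow> complex measure \<Rightarrow> real \<Rightarrow> bool" where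
  "condition_A M h \<rho> p \<longleftrightarrow>
     (\<exists>C. \<forall>z w. \<forall>\<epsilon>\<in>{0<..1}. \<forall>r\<in>{0<..1}. 1/2 \<le> \<epsilon> / r \<and> \<epsilon> / r \<le> 2 \<longrightarrow>
        (\<exists>X Y. field_pairing M h (scaled_measure \<rho> z \<epsilon>) X \<and>
               field_pairing M h (scaled_measure \<rho> w r) Y \<and>
               (LINT \<omega>|M. (X \<omega> - Y \<omega>)\<^sup>2) \<le> C * (norm ((z, \<epsilon>) - (w, r)) / min \<epsilon> r) powr p))"

subsection \<open>Planar Brownian motion and harmonically non-trivial boundary\<close>

definition planar_brownian_motion ::
    "'a measure \<Rightarrow> (real \<Rightarrow> 'a \<Rightarrow> complex) \<Rightarrow> complex \<Rightarrow> bool" where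
  "planar_brownian_motion M B x \<longleftrightarrow> prob_space M \<and>
     (\<forall>t\<ge>0. B t \<in> borel_measurable M) \<and>
     (\<forall>\<omega>\<in>space M. B 0 \<omega> = x \<and> continuous_on {0..} (\<lambda>t. B t \<omega>)) \<and>
     (\<forall>s t. 0 \<le> s \<and> s < t \<longrightarrow>
        distributed M lborel (\<lambda>\<omega>. B t \<omega> - B s \<omega>)
          (\<lambda>v. ennreal (exp (- (norm v)\<^sup>2 / (2 * (t - s))) / (2 * pi * (t - s))))) \<and>
     (\<forall>(n::nat) (\<tau>::nat \<Rightarrow> real). 0 \<le> \<tau> 0 \<and> (\<forall>i<n. \<tau> i < \<tau> (Suc i)) \<longrightarrow>
        prob_space.indep_vars M (\<lambda>_. borel) (\<lambda>i \<omega>. B (\<tau> (Suc i)) \<omega> - B (\<tau> i) \<omega>) {..<n})"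

(* Exiting D depends only on the law of the Brownian motion; the sample space type
   real => complex is large enough to carry one (the path space). *)
definition harmonically_nontrivial_boundary :: "complex set \<Rightarrow> bool" where
  "harmonically_nontrivial_boundary D \<longleftrightarrow>
     (\<forall>x\<in>D. \<forall>(M :: (real \<Rightarrow> complex) measure) B. planar_brownian_motion M B x \<longrightarrow>
        (AE \<omega> in M. \<exists>t\<ge>0. B t \<omega> \<notin> D))"

subsection \<open>The Dirichlet Green's function and the zero-boundary Gaussian free field\<close>

definition harmonic_on :: "complex set \<Rightarrow> (complex \<Rightarrow> real) \<Rightarrow> bool" where
  "harmonic_on S u \<longleftrightarrow> open S \<and> Ck_on 2 S u \<and>
     (\<forall>x\<in>S. (\<Sum>b\<in>Basis. dir_deriv b (dir_deriv b u) x) = 0)"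

definition polar :: "complex set \<Rightarrow> bool" where
  "polar E \<longleftrightarrow> (\<forall>\<mu>. sets \<mu> = sets borel \<and> prob_space \<mu> \<and>
     compact (measure_support \<mu>) \<and> measure_support \<mu> \<subseteq> E \<longrightarrow> \<not> finite_log_energy \<mu>)"

(* The usual potential-theoretic definition (Ransford, Potential Theory in the Complex Plane,
   Section 4.4).  Since irregular boundary points are allowed, the zero boundary values are attained
   up to a Borel polar set; by the extended maximum principle G x y is determined for all
   x, y in D with x \<noteq> y.  The values on the diagonal and off D play no role. *)
definition green_function :: "complex set \<Rightarrow> (complex \<Rightarrow> complex \<Rightarrow> real) \<Rightarrow> bool" where
  "green_function D G \<longleftrightarrow>
     (\<forall>x\<in>D. harmonic_on (D - {x}) (G x) \<and>
        (\<forall>\<delta>>0. bounded (G x ` (D - ball x \<delta>))) \<and>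
        (\<lambda>y. G x y - ln (1 / dist x y)) \<in> O[at x](\<lambda>_. 1) \<and>
        (\<exists>E. E \<in> sets borel \<and> polar E \<and>
           (\<forall>\<zeta>\<in>frontier D - E. (G x \<longlongrightarrow> 0) (at \<zeta> within D))))"

definition zero_boundary_GFF ::
    "'a measure \<Rightarrow> complex set \<Rightarrow> (complex \<Rightarrow> complex \<Rightarrow> real) \<Rightarrow>
     ('a \<Rightarrow> (complex \<Rightarrow> real) \<Rightarrow> real) \<Rightarrow> bool" where
  "zero_boundary_GFF M D G h \<longleftrightarrow> prob_space M \<and>
     (\<forall>\<omega>\<in>space M. distribution_on D (h \<omega>)) \<and>
     (\<forall>f\<in>test_functions D. centered_gaussian M (\<lambda>\<omega>. h \<omega> f)) \<and>
     (\<forall>f\<in>test_functions D. \<forall>g\<in>test_functions D. (LINT \<omega>|M. h \<omega> f * h \<omega> g) =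
        (LINT x:D|lborel. LINT y:D|lborel. G x y * f x * g y))"

(* H z \<epsilon> is the regularised field at (z, \<epsilon>), in an almost surely jointly continuous version. *)
definition continuous_regularisation ::
    "'a measure \<Rightarrow> complex set \<Rightarrow> ('a \<Rightarrow> (complex \<Rightarrow> real) \<Rightarrow> real) \<Rightarrow> complex measure \<Rightarrow>
     (complex \<Rightarrow> real \<Rightarrow> 'a \<Rightarrow> real) \<Rightarrow> bool" where
  "continuous_regularisation M D h \<rho> H \<longleftrightarrow>
     (\<forall>z\<in>D. \<forall>\<epsilon>. 0 < \<epsilon> \<and> \<epsilon> < infdist z (frontier D) \<longrightarrow>
        field_pairing M h (scaled_measure \<rho> z \<epsilon>) (H z \<epsilon>)) \<and>
     (AE \<omega> in M. continuous_on {(z, \<epsilon>). z \<in> D \<and> 0 < \<epsilon> \<and> \<epsilon> < infdist z (frontier D)}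
        (\<lambda>(z, \<epsilon>). H z \<epsilon> \<omega>))"

subsection \<open>Thick points\<close>

datatype limit_type = LimInf | LimSup | Lim

fun has_limit_of_type :: "limit_type \<Rightarrow> (real \<Rightarrow> real) \<Rightarrow> real \<Rightarrow> bool" where
  "has_limit_of_type LimInf f \<alpha> \<longleftrightarrow> Liminf (at_right 0) (\<lambda>\<epsilon>. ereal (f \<epsilon>)) = ereal \<alpha>"
| "has_limit_of_type LimSup f \<alpha> \<longleftrightarrow> Limsup (at_right 0) (\<lambda>\<epsilon>. ereal (f \<epsilon>)) = ereal \<alpha>"
| "has_limit_of_type Lim f \<alpha> \<longleftrightarrow> (f \<longlongrightarrow> \<alpha>) (at_right 0)"

definition thick_points ::
    "complex set \<Rightarrow> (complex \<Rightarrow> real \<Rightarrow> 'a \<Rightarrow> real) \<Rightarrow> 'a \<Rightarrow> real \<Rightarrow> limit_type \<Rightarrow> complex set" where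
  "thick_points D H \<omega> \<alpha> star =
     {z \<in> D. has_limit_of_type star (\<lambda>\<epsilon>. H z \<epsilon> \<omega> / ln (1 / \<epsilon>)) \<alpha>}"

end

theory Submission
  imports Defs
begin

text \<open>Let \<open>H\<rho>\<close> and \<open>H\<sigma>\<close> be the two regularisations of the field \<open>hD\<close> on \<open>D\<close>.  It suffices that almost
  surely \<open>(H\<rho> z \<epsilon> - H\<sigma> z \<epsilon>) / ln (1/\<epsilon>)\<close> tends to 0 at all points \<open>z\<close> of \<open>D\<close> simultaneously
  (\<open>regularisations_close\<close>), since then the lower limits, the upper limits and the limits in the
  definition of thick points agree.  The difference is a Gaussian variable whose variance is bounded
  at each point and each scale, and a Gaussian process with small enough increments has a supremum
  of smaller order than \<open>n\<close> over the scales between \<open>2^(-n-1)\<close> and \<open>2^(-n)\<close>.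

  The hypotheses on \<open>\<rho>\<close> and \<open>\<sigma>\<close> concern the whole-plane field \<open>h\<close>, so the first task is to transfer
  variances from \<open>h\<close> to \<open>hD\<close>.  This is done by comparing covariances, without a coupling of
  the two fields.  The Green's function \<open>G x y\<close> differs from the logarithmic kernel by a function that is
  harmonic in \<open>y\<close>, and a harmonic function integrates to zero against the Laplacian of a
  test function (\<open>harmonic_orthogonal_lap_removable\<close>).  Hence \<open>hD\<close> and \<open>h\<close> have the same covariances
  for two test functions of integral zero, one of which is the Laplacian of a test function
  (\<open>covariance_lap\<close>).  Now mollify at a small
  width \<open>s\<close> and at a fixed width \<open>\<delta>\<close>.  The difference of two radial bumps of widths \<open>s\<close> and \<open>\<delta>\<close> is a
  Laplacian of a test function (\<open>bump_diff_eq_lap\<close>), so if \<open>F\<^sub>s\<close> denotes the test function that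
  represents the difference of two regularisations, mollified at width \<open>s\<close>, then \<open>F\<^sub>s - F\<^sub>\<delta>\<close> is a
  Laplacian.  Expanding squares gives
  \<open>E (hD F\<^sub>s)\<^sup>2 \<le> E (h F\<^sub>s)\<^sup>2 + E (hD F\<^sub>\<delta>)\<^sup>2\<close> (\<open>variance_comparison\<close>), uniformly in \<open>s\<close>.

  The last term is harmless.  The functions \<open>F\<^sub>\<delta>\<close> form a bounded family of test functions on a compact
  subset of \<open>D\<close>; every sample of \<open>hD\<close> is a distribution, hence bounded on the family, and a family of
  centred Gaussian variables that is almost surely bounded has bounded variances
  (\<open>bounded_family_variance\<close>).  After division by the distance of the parameters, the same argument
  shows that the term is quadratic in that distance.

  The term with \<open>h\<close> is estimated in two cases.  For increments of one regularisation, condition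
  \<open>(A\<^sub>p)\<close> is the estimate that is needed (\<open>increment_tail\<close>).  For the two mollifiers at the same point
  and scale, the variance is the logarithmic energy of a charge of total mass zero, and is bounded by
  the energies of \<open>\<rho>\<close> and \<open>\<sigma>\<close> up to constants, independently of the scale (\<open>variance_same_point\<close>,
  \<open>same_point_tail\<close>).  Gaussian tails with these variances pass to the mean square limits that define
  the regularisations.  Chaining over the dyadic points of a cube, with two parameters for the position
  and one for the scale, and the Borel-Cantelli lemma give the supremum bound (\<open>chaining\<close>).

  The plane itself has no Green's function (\<open>not_green_function_UNIV\<close>), so \<open>D\<close> has a nonempty frontier
  and the regularisations are defined near every point for all small scales.\<close>

section \<open>Calculus of directional derivatives\<close>

lemma dir_deriv_eq:
  "(f has_derivative f') (at x) \<Longrightarrow> dir_deriv v f x = f' v"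
  unfolding dir_deriv_def using frechet_derivative_at by metis

lemma has_derivative_dir_deriv:
  "f differentiable (at x) \<Longrightarrow> (f has_derivative (\<lambda>v. dir_deriv v f x)) (at x)"
  unfolding dir_deriv_def using frechet_derivative_works by blast

lemma dir_deriv_cong_open:
  assumes "open S" "x \<in> S" "\<And>y. y \<in> S \<Longrightarrow> f y = g y"
  shows "dir_deriv v f x = dir_deriv v g x"
proof -
  have "((f has_derivative F) (at x)) = ((g has_derivative F) (at x))" for F
    using assms has_derivative_transform_within_open[of f F x UNIV S g]
      has_derivative_transform_within_open[of g F x UNIV S f] by auto
  then show ?thesis by (simp add: dir_deriv_def frechet_derivative_def)
qed

lemma differentiable_cong_open:
  fixes f g :: "'a::real_normed_vector \<Rightarrow> 'b::real_normed_vector"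
  assumes "open S" "x \<in> S" "\<And>y. y \<in> S \<Longrightarrow> f y = g y"
  shows "f differentiable (at x) \<longleftrightarrow> g differentiable (at x)"
  using assms has_derivative_transform_within_open[of f _ x UNIV S g]
      has_derivative_transform_within_open[of g _ x UNIV S f] unfolding differentiable_def by auto

lemma dir_deriv_add:
  assumes "f differentiable (at x)" "g differentiable (at x)"
  shows "dir_deriv v (\<lambda>x. f x + g x) x = dir_deriv v f x + dir_deriv v g x"
  by (intro dir_deriv_eq has_derivative_add has_derivative_dir_deriv assms)

lemma dir_deriv_diff:
  assumes "f differentiable (at x)" "g differentiable (at x)"
  shows "dir_deriv v (\<lambda>x. f x - g x) x = dir_deriv v f x - dir_deriv v g x"
  by (intro dir_deriv_eq has_derivative_diff has_derivative_dir_deriv assms)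

lemma dir_deriv_mult:
  assumes "f differentiable (at x)" "g differentiable (at x)"
  shows "dir_deriv v (\<lambda>x. f x * g x) x = f x * dir_deriv v g x + dir_deriv v f x * g x"
  by (intro dir_deriv_eq[where f' = "\<lambda>v. f x * dir_deriv v g x + dir_deriv v f x * g x"]
      has_derivative_mult has_derivative_dir_deriv assms)

lemma dir_deriv_const [simp]: "dir_deriv v (\<lambda>x. c) x = 0"
  by (rule dir_deriv_eq) simp

lemma dir_deriv_cmult:
  assumes "f differentiable (at x)"
  shows "dir_deriv v (\<lambda>x. c * f x) x = c * dir_deriv v f x"
  using dir_deriv_mult[OF _ assms, of "\<lambda>_. c"] by simp

lemma Ck_on_cong:
  assumes "open S" "\<And>x. x \<in> S \<Longrightarrow> f x = g x"
  shows "Ck_on k S f \<longleftrightarrow> Ck_on k S g"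
  using assms(2)
proof (induction k arbitrary: f g)
  case 0 then show ?case by (auto intro!: continuous_on_cong)
next
  case (Suc k)
  have "\<And>x v. x \<in> S \<Longrightarrow> dir_deriv v f x = dir_deriv v g x"
    using dir_deriv_cong_open[OF assms(1)] Suc.prems by blast
  then have "Ck_on k S (dir_deriv v f) = Ck_on k S (dir_deriv v g)" for v
    by (intro Suc.IH) auto
  moreover have "\<And>x. x \<in> S \<Longrightarrow> f differentiable (at x) \<longleftrightarrow> g differentiable (at x)"
    using differentiable_cong_open[OF assms(1)] Suc.prems by blast
  ultimately show ?case by simp
qed

lemma Ck_on_subset: "Ck_on k S f \<Longrightarrow> T \<subseteq> S \<Longrightarrow> Ck_on k T f"
  by (induction k arbitrary: f) (auto intro: continuous_on_subset)

lemma Ck_on_Un: "open S \<Longrightarrow> open T \<Longrightarrow> Ck_on k S f \<Longrightarrow> Ck_on k T f \<Longrightarrow> Ck_on k (S \<union> T) f"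
  by (induction k arbitrary: f) (auto intro: continuous_on_open_Un)

lemma Ck_on_SucD: "Ck_on (Suc k) S f \<Longrightarrow> Ck_on k S f"
proof (induction k arbitrary: f)
  case 0
  then show ?case
    by (auto intro!: continuous_at_imp_continuous_on differentiable_imp_continuous_within)
next
  case (Suc k)
  from Suc.prems have "\<forall>v. Ck_on k S (dir_deriv v f)" "\<forall>x\<in>S. f differentiable (at x)"
    using Suc.IH by auto
  then show ?case by simp
qed

lemma Ck_on_mono: "Ck_on k S f \<Longrightarrow> j \<le> k \<Longrightarrow> Ck_on j S f"
proof (induction k)
  case (Suc k)
  then show ?case using Ck_on_SucD by (cases "j = Suc k") auto
qed simp

lemma Ck_on_const [simp]: "Ck_on k S (\<lambda>x. c)"
proof (induction k arbitrary: c)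
  case (Suc k)
  have "dir_deriv v (\<lambda>x. c) = (\<lambda>x. 0)" for v by auto
  then show ?case using Suc by simp
qed simp

lemma Ck_on_add:
  assumes "open S"
  shows "Ck_on k S f \<Longrightarrow> Ck_on k S g \<Longrightarrow> Ck_on k S (\<lambda>x. f x + g x)"
proof (induction k arbitrary: f g)
  case 0 then show ?case by (auto intro: continuous_intros)
next
  case (Suc k)
  have "Ck_on k S (dir_deriv v (\<lambda>x. f x + g x))" for v
  proof -
    have "Ck_on k S (\<lambda>x. dir_deriv v f x + dir_deriv v g x)"
      using Suc by auto
    then show ?thesis
      using Suc.prems by (subst Ck_on_cong[OF assms]) (auto intro: dir_deriv_add)
  qed
  then show ?case using Suc.prems by (auto intro: differentiable_add)
qed

lemma Ck_on_mult:
  assumes "open S"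
  shows "Ck_on k S f \<Longrightarrow> Ck_on k S g \<Longrightarrow> Ck_on k S (\<lambda>x. f x * g x)"
proof (induction k arbitrary: f g)
  case 0 then show ?case by (auto intro: continuous_intros)
next
  case (Suc k)
  have "Ck_on k S (dir_deriv v (\<lambda>x. f x * g x))" for v
  proof -
    have "Ck_on k S f" "Ck_on k S g" using Suc.prems Ck_on_SucD by blast+
    then have "Ck_on k S (\<lambda>x. f x * dir_deriv v g x + dir_deriv v f x * g x)"
      using Suc by (intro Ck_on_add assms Suc.IH) auto
    then show ?thesis
      using Suc.prems by (subst Ck_on_cong[OF assms]) (auto intro: dir_deriv_mult)
  qed
  then show ?case using Suc.prems by (auto intro: differentiable_mult)
qed

lemma Ck_on_cmult: "open S \<Longrightarrow> Ck_on k S f \<Longrightarrow> Ck_on k S (\<lambda>x. c * f x)"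
  by (intro Ck_on_mult) auto

lemma Ck_on_diff:
  "open S \<Longrightarrow> Ck_on k S f \<Longrightarrow> Ck_on k S g \<Longrightarrow> Ck_on k S (\<lambda>x. f x - g x)"
  using Ck_on_add[of S k f "\<lambda>x. (-1) * g x"] Ck_on_cmult[of S k g "-1"] by simp

lemma Ck_on_linear:
  assumes "bounded_linear f" shows "Ck_on k S (\<lambda>x. f x + c)"
proof (cases k)
  case 0
  then show ?thesis using linear_continuous_on[OF assms] by (auto intro!: continuous_intros)
next
  case (Suc j)
  have *: "((\<lambda>x. f x + c) has_derivative f) (at x)" for x
    using bounded_linear_imp_has_derivative[OF assms, of "at x"]
    by (auto intro!: derivative_eq_intros)
  have "dir_deriv v (\<lambda>x. f x + c) = (\<lambda>x. f v)" for v
    using dir_deriv_eq[OF *] by auto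
  moreover have "(\<lambda>x. f x + c) differentiable (at x)" for x
    using * differentiable_def by blast
  ultimately show ?thesis using Suc by simp
qed

section \<open>Smooth functions of one variable, and radial functions\<close>

text \<open>Radial functions are composed from functions of one real variable.  The domain matters because
  logarithms and reciprocals of the squared radius enter.\<close>

primrec Dk_on :: "nat \<Rightarrow> real set \<Rightarrow> (real \<Rightarrow> real) \<Rightarrow> bool" where
  "Dk_on 0 S f \<longleftrightarrow> True"
| "Dk_on (Suc k) S f \<longleftrightarrow> (\<forall>t\<in>S. f differentiable (at t)) \<and> Dk_on k S (deriv f)"

lemma Dk_on_cong:
  assumes "open S" "\<And>x. x \<in> S \<Longrightarrow> f x = g x"
  shows "Dk_on k S f \<longleftrightarrow> Dk_on k S g"
  using assms(2)
proof (induction k arbitrary: f g)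
  case (Suc k)
  have "\<And>x. x \<in> S \<Longrightarrow> deriv f x = deriv g x"
    using Suc.prems assms(1) by (intro deriv_cong_ev) (auto simp: eventually_nhds)
  then have "Dk_on k S (deriv f) = Dk_on k S (deriv g)"
    by (intro Suc.IH) auto
  moreover have "\<And>x. x \<in> S \<Longrightarrow> f differentiable (at x) \<longleftrightarrow> g differentiable (at x)"
    using differentiable_cong_open[OF assms(1)] Suc.prems by blast
  ultimately show ?case by simp
qed simp

lemma Dk_on_Un: "Dk_on k S f \<Longrightarrow> Dk_on k T f \<Longrightarrow> Dk_on k (S \<union> T) f"
  by (induction k arbitrary: f) auto

lemma Dk_on_subset: "Dk_on k S f \<Longrightarrow> T \<subseteq> S \<Longrightarrow> Dk_on k T f"
  by (induction k arbitrary: f) auto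

lemma differentiable_deriv:
  fixes f :: "real \<Rightarrow> real"
  shows "f differentiable (at x) \<Longrightarrow> (f has_real_derivative deriv f x) (at x)"
  using DERIV_deriv_iff_real_differentiable by blast

lemma Dk_on_SucI:
  assumes "open S" "\<And>x. x \<in> S \<Longrightarrow> (f has_real_derivative f' x) (at x)" "Dk_on k S f'"
  shows "Dk_on (Suc k) S f"
proof -
  have "Dk_on k S (deriv f)"
    using assms by (subst Dk_on_cong[of S _ f']) (auto intro: DERIV_imp_deriv)
  then show ?thesis using assms(2) by (auto simp: real_differentiable_def)
qed

lemma Dk_on_SucD: "Dk_on (Suc k) S f \<Longrightarrow> Dk_on k S f"
  by (induction k arbitrary: f) auto

lemma Dk_on_const [simp]: "Dk_on k S (\<lambda>x. c)"
proof (induction k arbitrary: c)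
  case (Suc k)
  then show ?case by simp
qed simp

lemma Dk_on_add:
  assumes "open S"
  shows "Dk_on k S f \<Longrightarrow> Dk_on k S g \<Longrightarrow> Dk_on k S (\<lambda>x. f x + g x)"
proof (induction k arbitrary: f g)
  case (Suc k)
  then show ?case
    by (intro Dk_on_SucI[OF assms, where f' = "\<lambda>x. deriv f x + deriv g x"])
      (auto intro!: derivative_intros differentiable_deriv)
qed simp

lemma Dk_on_mult:
  assumes "open S"
  shows "Dk_on k S f \<Longrightarrow> Dk_on k S g \<Longrightarrow> Dk_on k S (\<lambda>x. f x * g x)"
proof (induction k arbitrary: f g)
  case (Suc k)
  have "Dk_on k S f" "Dk_on k S g" using Suc.prems Dk_on_SucD by blast+
  then have "Dk_on k S (\<lambda>x. deriv f x * g x + deriv g x * f x)"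
    using Suc.prems by (intro Dk_on_add assms Suc.IH) auto
  then show ?case using Suc.prems
    by (intro Dk_on_SucI[OF assms, where f' = "\<lambda>x. deriv f x * g x + deriv g x * f x"])
      (auto intro!: DERIV_mult differentiable_deriv)
qed simp

lemma Dk_on_affine:
  assumes "\<And>k. Dk_on k UNIV f"
  shows "Dk_on k S (\<lambda>x. f (a * x + b))"
proof -
  have "Dk_on k UNIV (\<lambda>x. f (a * x + b))" using assms
  proof (induction k arbitrary: f)
    case (Suc k)
    have D: "f differentiable (at x)" for x using Suc.prems[of 1] by simp
    have "Dk_on k UNIV (deriv f)" for k using Suc.prems[of "Suc k"] by simp
    then have "Dk_on k UNIV (\<lambda>x. deriv f (a * x + b))" using Suc.IH by blast
    then have "Dk_on k UNIV (\<lambda>x. deriv f (a * x + b) * a)" by (intro Dk_on_mult) auto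
    then show ?case
      by (intro Dk_on_SucI[where f' = "\<lambda>x. deriv f (a * x + b) * a"])
        (auto intro!: derivative_eq_intros DERIV_chain2[OF differentiable_deriv[OF D]])
  qed simp
  then show ?thesis using Dk_on_subset by blast
qed

lemma Dk_on_inverse: "Dk_on k {0<..} (\<lambda>t. 1 / t)"
proof (induction k)
  case (Suc k)
  have "Dk_on k {0<..} (\<lambda>t. (-1) * (1 / t * (1 / t)))"
    using Suc by (intro Dk_on_mult) auto
  then show ?case
    by (intro Dk_on_SucI[where f' = "\<lambda>t. (-1) * (1 / t * (1 / t))"])
      (auto intro!: derivative_eq_intros simp: power2_eq_square)
qed simp

lemma Dk_on_ln:
  assumes "\<And>k. Dk_on k UNIV f"
  shows "Dk_on k {0<..} (\<lambda>x. f (a * ln x + b))"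
  using assms
proof (induction k arbitrary: f)
  case (Suc k)
  have D: "f differentiable (at x)" for x using Suc.prems[of 1] by simp
  have "Dk_on k UNIV (deriv f)" for k using Suc.prems[of "Suc k"] by simp
  then have "Dk_on k {0<..} (\<lambda>x. deriv f (a * ln x + b))" using Suc.IH by blast
  then have "Dk_on k {0<..} (\<lambda>x. deriv f (a * ln x + b) * (a * (1 / x)))"
    by (intro Dk_on_mult Dk_on_inverse) auto
  then show ?case
    by (intro Dk_on_SucI[where f' = "\<lambda>x. deriv f (a * ln x + b) * (a * (1 / x))"] DERIV_chain2[OF differentiable_deriv[OF D]])
      (auto intro!: derivative_eq_intros)
qed simp

text \<open>Radial functions about \<open>a\<close> are written as functions of the squared distance, which is
  smooth also at the centre.\<close>

definition radial :: "(real \<Rightarrow> real) \<Rightarrow> complex \<Rightarrow> complex \<Rightarrow> real" where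
  "radial g a = (\<lambda>y. g ((norm (y - a))\<^sup>2))"

lemma radial_has_derivative:
  assumes "(g has_real_derivative g') (at ((norm (y - a))\<^sup>2))"
  shows "(radial g a has_derivative (\<lambda>v. g' * (2 * ((y - a) \<bullet> v)))) (at y)"
proof -
  have "((\<lambda>y. (norm (y - a))\<^sup>2) has_derivative (\<lambda>v. 2 * ((y - a) \<bullet> v))) (at y)"
    unfolding power2_norm_eq_inner
    by (auto intro!: derivative_eq_intros simp: inner_commute)
  from this assms show ?thesis unfolding radial_def
    by (auto dest: has_derivative_compose simp: has_field_derivative_def)
qed

lemma dir_deriv_radial:
  assumes "g differentiable (at ((norm (y - a))\<^sup>2))"
  shows "dir_deriv v (radial g a) y = 2 * ((y - a) \<bullet> v) * radial (deriv g) a y"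
  using dir_deriv_eq[OF radial_has_derivative[OF differentiable_deriv[OF assms]]]
  by (simp add: radial_def)

lemma Ck_on_shifted_inner: "Ck_on k S (\<lambda>y. 2 * ((y - a) \<bullet> v))"
proof -
  have "bounded_linear (\<lambda>y. 2 * (y \<bullet> v))"
    by (intro bounded_linear_const_mult bounded_linear_inner_left)
  from Ck_on_linear[OF this, of k S "- 2 * (a \<bullet> v)"] show ?thesis
    by (simp add: inner_diff_left algebra_simps)
qed

lemma Ck_on_radial:
  assumes "open S" "open T" "\<And>y. y \<in> S \<Longrightarrow> (norm (y - a))\<^sup>2 \<in> T" "Dk_on (Suc k) T g"
  shows "Ck_on k S (radial g a)"
  using assms(4)
proof (induction k arbitrary: g)
  case 0
  have "g differentiable (at ((norm (y - a))\<^sup>2))" if "y \<in> S" for y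
    using 0 assms(3)[OF that] by simp
  then have "radial g a differentiable (at y)" if "y \<in> S" for y
    using radial_has_derivative[OF differentiable_deriv] that differentiable_def by blast
  then show ?case
    by (auto intro!: continuous_at_imp_continuous_on differentiable_imp_continuous_within)
next
  case (Suc k)
  have d: "g differentiable (at ((norm (y - a))\<^sup>2))" if "y \<in> S" for y
    using Suc.prems assms(3)[OF that] by simp
  have d': "radial g a differentiable (at y)" if "y \<in> S" for y
    using radial_has_derivative[OF differentiable_deriv] d that differentiable_def by blast
  have "Ck_on k S (radial (deriv g) a)"
    using Suc.prems by (intro Suc.IH) auto
  then have "Ck_on k S (\<lambda>y. 2 * ((y - a) \<bullet> v) * radial (deriv g) a y)" for v
    by (intro Ck_on_mult assms Ck_on_shifted_inner)
  then have "Ck_on k S (dir_deriv v (radial g a))" for v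
    by (rule iffD2[OF Ck_on_cong[OF assms(1)], rotated]) (auto intro: dir_deriv_radial d)
  then show ?case using d' by auto
qed

definition lap :: "(complex \<Rightarrow> real) \<Rightarrow> complex \<Rightarrow> real" where
  "lap f x = (\<Sum>b\<in>Basis. dir_deriv b (dir_deriv b f) x)"

lemma lap_cong_open:
  assumes "open S" "x \<in> S" "\<And>y. y \<in> S \<Longrightarrow> f y = g y"
  shows "lap f x = lap g x"
  unfolding lap_def
  by (intro sum.cong refl dir_deriv_cong_open[OF assms(1,2)] dir_deriv_cong_open[OF assms(1)] assms(3))

lemma lap_Ck: "Ck_on (Suc (Suc k)) S f \<Longrightarrow> open S \<Longrightarrow> Ck_on k S (lap f)"
proof -
  assume f: "Ck_on (Suc (Suc k)) S f" and S: "open S"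
  have "Ck_on k S (\<lambda>x. dir_deriv 1 (dir_deriv 1 f) x + dir_deriv \<i> (dir_deriv \<i> f) x)"
    using f by (intro Ck_on_add S) auto
  then show ?thesis
    unfolding lap_def[abs_def] by (simp add: Basis_complex_def)
qed

lemma lap_add:
  assumes "Ck_on 2 S f" "Ck_on 2 S g" "open S" "x \<in> S"
  shows "lap (\<lambda>x. f x + g x) x = lap f x + lap g x"
proof -
  have "dir_deriv b (dir_deriv b (\<lambda>x. f x + g x)) x
      = dir_deriv b (dir_deriv b f) x + dir_deriv b (dir_deriv b g) x" for b
  proof -
    have "dir_deriv b (dir_deriv b (\<lambda>x. f x + g x)) x
        = dir_deriv b (\<lambda>x. dir_deriv b f x + dir_deriv b g x) x"
      using assms by (intro dir_deriv_cong_open[of S] dir_deriv_add) (auto simp: numeral_2_eq_2)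
    also have "\<dots> = dir_deriv b (dir_deriv b f) x + dir_deriv b (dir_deriv b g) x"
      using assms by (intro dir_deriv_add) (auto simp: numeral_2_eq_2)
    finally show ?thesis .
  qed
  then show ?thesis by (simp add: lap_def sum.distrib)
qed

lemma lap_cmult:
  assumes "Ck_on 2 S f" "open S" "x \<in> S"
  shows "lap (\<lambda>x. c * f x) x = c * lap f x"
proof -
  have "dir_deriv b (dir_deriv b (\<lambda>x. c * f x)) x = c * dir_deriv b (dir_deriv b f) x" for b
  proof -
    have "dir_deriv b (dir_deriv b (\<lambda>x. c * f x)) x = dir_deriv b (\<lambda>x. c * dir_deriv b f x) x"
      using assms by (intro dir_deriv_cong_open[of S] dir_deriv_cmult) (auto simp: numeral_2_eq_2)
    also have "\<dots> = c * dir_deriv b (dir_deriv b f) x"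
      using assms by (intro dir_deriv_cmult) (auto simp: numeral_2_eq_2)
    finally show ?thesis .
  qed
  then show ?thesis by (simp add: lap_def sum_distrib_left)
qed

lemma lap_mult:
  assumes "Ck_on 2 S f" "Ck_on 2 S g" "open S" "x \<in> S"
  shows "lap (\<lambda>x. f x * g x) x
    = f x * lap g x + 2 * (\<Sum>b\<in>Basis. dir_deriv b f x * dir_deriv b g x) + lap f x * g x"
proof -
  have "dir_deriv b (dir_deriv b (\<lambda>x. f x * g x)) x
      = f x * dir_deriv b (dir_deriv b g) x + 2 * (dir_deriv b f x * dir_deriv b g x)
        + dir_deriv b (dir_deriv b f) x * g x" for b
  proof -
    have "dir_deriv b (dir_deriv b (\<lambda>x. f x * g x)) x
        = dir_deriv b (\<lambda>x. f x * dir_deriv b g x + dir_deriv b f x * g x) x"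
      using assms by (intro dir_deriv_cong_open[of S] dir_deriv_mult) (auto simp: numeral_2_eq_2)
    also have "\<dots> = dir_deriv b (\<lambda>x. f x * dir_deriv b g x) x + dir_deriv b (\<lambda>x. dir_deriv b f x * g x) x"
      using assms by (intro dir_deriv_add differentiable_mult) (auto simp: numeral_2_eq_2)
    also have "dir_deriv b (\<lambda>x. f x * dir_deriv b g x) x
        = f x * dir_deriv b (dir_deriv b g) x + dir_deriv b f x * dir_deriv b g x"
      using assms by (intro dir_deriv_mult) (auto simp: numeral_2_eq_2)
    also have "dir_deriv b (\<lambda>x. dir_deriv b f x * g x) x
        = dir_deriv b f x * dir_deriv b g x + dir_deriv b (dir_deriv b f) x * g x"
      using assms by (intro dir_deriv_mult) (auto simp: numeral_2_eq_2)
    finally show ?thesis by simp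
  qed
  then show ?thesis by (simp add: lap_def sum.distrib sum_distrib_left sum_distrib_right)
qed

lemma lap_radial:
  assumes "open T" "Dk_on 2 T g" "(norm (y - a))\<^sup>2 \<in> T"
  shows "lap (radial g a) y
    = 4 * (radial (deriv g) a y + (norm (y - a))\<^sup>2 * radial (deriv (deriv g)) a y)"
proof -
  define S where "S = (\<lambda>y. (norm (y - a))\<^sup>2) -` T"
  have S: "open S" unfolding S_def by (intro open_vimage assms continuous_intros)
  have yS: "y \<in> S" using assms by (simp add: S_def)
  have d: "g differentiable (at t)" "deriv g differentiable (at t)" if "t \<in> T" for t
    using assms that by (auto simp: numeral_2_eq_2)
  have "dir_deriv b (dir_deriv b (radial g a)) y
      = 2 * ((y - a) \<bullet> b) * (2 * ((y - a) \<bullet> b) * radial (deriv (deriv g)) a y)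
        + 2 * (b \<bullet> b) * radial (deriv g) a y" for b
  proof -
    have D: "((\<lambda>y. 2 * ((y - a) \<bullet> b)) has_derivative (\<lambda>v. 2 * (v \<bullet> b))) (at y)"
      by (auto intro!: derivative_eq_intros)
    have "dir_deriv b (dir_deriv b (radial g a)) y
        = dir_deriv b (\<lambda>y. 2 * ((y - a) \<bullet> b) * radial (deriv g) a y) y"
      by (intro dir_deriv_cong_open[OF S yS] dir_deriv_radial d) (simp add: S_def)
    also have "\<dots> = 2 * ((y - a) \<bullet> b) * dir_deriv b (radial (deriv g) a) y
        + dir_deriv b (\<lambda>y. 2 * ((y - a) \<bullet> b)) y * radial (deriv g) a y"
      using radial_has_derivative[OF differentiable_deriv[OF d(2)[OF assms(3)]]] D
      by (intro dir_deriv_mult) (auto simp: differentiable_def)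
    finally show ?thesis
      using dir_deriv_radial[OF d(2)[OF assms(3)]] dir_deriv_eq[OF D] by simp
  qed
  note D = this
  define p q where "p = (y - a) \<bullet> 1" and "q = (y - a) \<bullet> \<i>"
  have N: "(norm (y - a))\<^sup>2 = p * p + q * q"
    unfolding cmod_power2 p_def q_def by (simp add: power2_eq_square inner_complex_def)
  show ?thesis
    using D[of 1, folded p_def] D[of \<i>, folded q_def]
    by (simp add: N lap_def Basis_complex_def algebra_simps)
qed

section \<open>A smooth step\<close>

text \<open>The functions \<open>p(1/t) exp (-1/t)\<close>, extended by zero to \<open>t \<le> 0\<close>, are closed under differentiation;
  so all of them are smooth.\<close>

definition flat :: "real poly \<Rightarrow> real \<Rightarrow> real" where
  "flat p t = (if t > 0 then poly p (1 / t) * exp (- (1 / t)) else 0)"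

lemma poly_exp_tendsto_0: "((\<lambda>u::real. poly p u * exp (- u)) \<longlongrightarrow> 0) at_top"
proof -
  have "((\<lambda>u::real. \<Sum>i\<le>degree p. coeff p i * (u ^ i / exp u)) \<longlongrightarrow> (\<Sum>i\<le>degree p. coeff p i * 0)) at_top"
    by (intro tendsto_sum tendsto_mult tendsto_const tendsto_power_div_exp_0)
  then show ?thesis
    by (simp add: poly_altdef exp_minus sum_distrib_right divide_inverse mult.assoc)
qed

lemma flat_has_derivative:
  "(flat p has_real_derivative flat ([:0, 0, 1:] * (p - pderiv p)) t) (at t)"
proof (cases t "0::real" rule: linorder_cases)
  case less
  have "((\<lambda>t. 0) has_real_derivative 0) (at t)" by simp
  then have "(flat p has_real_derivative 0) (at t)"
    by (rule has_field_derivative_transform_within_open[of _ _ _ "{..<0}"])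
      (use less in \<open>auto simp: flat_def\<close>)
  then show ?thesis using less by (simp add: flat_def)
next
  case greater
  have "((\<lambda>t. poly p (1 / t) * exp (- (1 / t))) has_real_derivative
      flat ([:0, 0, 1:] * (p - pderiv p)) t) (at t)"
    using greater
    by (auto intro!: derivative_eq_intros DERIV_chain2[OF poly_DERIV]
        simp: flat_def power2_eq_square field_simps)
  then show ?thesis
    by (rule has_field_derivative_transform_within_open[of _ _ _ "{0<..}"])
      (use greater in \<open>auto simp: flat_def\<close>)
next
  case equal
  have "((\<lambda>h. flat p h / h) \<longlongrightarrow> 0) (at_right 0)"
  proof -
    have "((\<lambda>u. flat p (inverse u) / inverse u) \<longlongrightarrow> 0) at_top"
      by (rule Lim_transform_eventually[OF poly_exp_tendsto_0[of "pCons 0 p"]])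
        (auto intro!: eventually_mono[OF eventually_gt_at_top[of 0]] simp: flat_def field_simps)
    then show ?thesis
      by (simp add: filterlim_at_right_to_top inverse_eq_divide)
  qed
  moreover have "((\<lambda>h. flat p h / h) \<longlongrightarrow> 0) (at_left 0)"
    by (rule tendsto_eventually) (auto simp: eventually_at_filter flat_def)
  ultimately have "((\<lambda>h. flat p h / h) \<longlongrightarrow> 0) (at 0)"
    by (simp add: filterlim_split_at)
  then show ?thesis using equal by (simp add: DERIV_def flat_def)
qed

lemma Dk_on_flat: "Dk_on k UNIV (flat p)"
proof (induction k arbitrary: p)
  case (Suc k)
  show ?case by (rule Dk_on_SucI[OF open_UNIV flat_has_derivative Suc])
qed simp

lemma ex_antiderivative:
  fixes f :: "real \<Rightarrow> real"
  assumes "continuous_on UNIV f" "\<And>t. t \<le> a \<Longrightarrow> f t = 0"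
  shows "\<exists>F. (\<forall>t. (F has_real_derivative f t) (at t)) \<and> (\<forall>t\<le>a. F t = 0)"
proof (intro exI conjI allI impI)
  define F where "F = (\<lambda>t. integral {a - 1..t} f)"
  show F0: "F t = 0" if "t \<le> a" for t
    unfolding F_def by (rule integral_unique, rule has_integral_is_0) (use assms that in auto)
  show "(F has_real_derivative f t) (at t)" for t
  proof (cases "t < a")
    case True
    have "((\<lambda>t. 0) has_real_derivative 0) (at t)" by simp
    then have "(F has_real_derivative 0) (at t)"
      by (rule has_field_derivative_transform_within_open[of _ _ _ "{..<a}"])
        (use True F0 in auto)
    then show ?thesis using assms True by simp
  next
    case False
    have "(F has_real_derivative f t) (at t within {a - 1..t + 1})"
      unfolding F_def using False
      by (intro integral_has_real_derivative continuous_on_subset[OF assms(1)]) auto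
    then show ?thesis
      using False by (subst (asm) at_within_interior) auto
  qed
qed

text \<open>The step is the normalised primitive of a product of two flat functions, one vanishing to the
  left of \<open>1/4\<close> and one to the right of \<open>1/2\<close>.\<close>

lemma ex_smooth_step:
  "\<exists>B. (\<forall>k. Dk_on k UNIV B) \<and> (\<forall>t. deriv B t \<ge> 0) \<and>
     (\<forall>t\<le>1/4. B t = 0) \<and> (\<forall>t\<ge>1/2. B t = (1::real))"
proof -
  define f where "f = (\<lambda>t. flat 1 (1 * t + (-1/4)) * flat 1 ((-1) * t + 1/2))"
  have f: "Dk_on k UNIV f" for k
    unfolding f_def by (intro Dk_on_mult Dk_on_affine Dk_on_flat) auto
  have "f differentiable (at t)" for t using f[of 1] by simp
  then have cont: "continuous_on UNIV f"
    by (simp add: continuous_at_imp_continuous_on differentiable_imp_continuous_within)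
  have f0: "f t = 0" if "t \<le> 1/4 \<or> t \<ge> 1/2" for t using that by (auto simp: f_def flat_def)
  have fp: "f t \<ge> 0" for t by (auto simp: f_def flat_def)
  obtain A where A: "\<And>t. (A has_real_derivative f t) (at t)" "\<And>t. t \<le> 1/4 \<Longrightarrow> A t = 0"
    using ex_antiderivative[OF cont, of "1/4"] f0 by meson
  have mono: "A s \<le> A t" if "s \<le> t" for s t
  proof (rule DERIV_nonneg_imp_nondecreasing[OF that])
    fix x show "\<exists>y. (A has_real_derivative y) (at x) \<and> 0 \<le> y"
      by (intro exI[of _ "f x"] conjI A fp)
  qed
  have "f (3/8) > 0" by (simp add: f_def flat_def)
  from DERIV_pos_inc_right[OF A(1) this] obtain d where
    d: "d > 0" "\<And>h. 0 < h \<Longrightarrow> h < d \<Longrightarrow> A (3/8) < A (3/8 + h)" by meson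
  have "A (3/8) < A (3/8 + min (d/2) (1/16))" by (rule d(2)) (use d(1) in auto)
  also have "\<dots> \<le> A (1/2)" by (intro mono) auto
  finally have "A (3/8) < A (1/2)" .
  moreover have "A (1/4) \<le> A (3/8)" "A (1/4) = 0" by (intro mono A; simp)+
  ultimately have pos: "A (1/2) > 0" by linarith
  have const: "A t = A (1/2)" if "t \<ge> 1/2" for t
  proof (cases "1/2 < t")
    case True
    then obtain z where z: "1/2 < z" "A t - A (1/2) = (t - 1/2) * f z"
      using MVT2[OF True, of A f] A(1) by blast
    then show ?thesis using f0[of z] by simp
  next
    case False
    then have "t = 1/2" using that by simp
    then show ?thesis by (simp only:)
  qed
  define B where "B = (\<lambda>t. 1 / A (1/2) * A t)"
  have B: "(B has_real_derivative 1 / A (1/2) * f t) (at t)" for t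
    unfolding B_def by (intro DERIV_cmult A)
  have "Dk_on k UNIV B" for k
  proof (cases k)
    case (Suc j)
    have "Dk_on j UNIV (\<lambda>t. 1 / A (1/2) * f t)" by (intro Dk_on_mult f) auto
    then show ?thesis unfolding Suc by (intro Dk_on_SucI[OF open_UNIV B])
  qed simp
  moreover have "deriv B t \<ge> 0" for t using DERIV_imp_deriv[OF B] fp pos by simp
  ultimately show ?thesis
  proof (intro exI[of _ B] conjI allI impI)
    show "B t = 0" if "t \<le> 1/4" for t using A(2)[OF that] by (simp add: B_def)
    show "B t = 1" if "t \<ge> 1/2" for t using const[OF that] pos by (simp add: B_def)
  qed auto
qed

definition step :: "real \<Rightarrow> real" where
  "step = (SOME B. (\<forall>k. Dk_on k UNIV B) \<and> (\<forall>t. deriv B t \<ge> 0) \<and>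
     (\<forall>t\<le>1/4. B t = 0) \<and> (\<forall>t\<ge>1/2. B t = 1))"

lemma step_props:
  shows Dk_on_step: "Dk_on k UNIV step" and deriv_step_nonneg: "deriv step t \<ge> 0"
    and step_0: "t \<le> 1/4 \<Longrightarrow> step t = 0" and step_1: "t \<ge> 1/2 \<Longrightarrow> step t = 1"
proof -
  have "(\<forall>k. Dk_on k UNIV step) \<and> (\<forall>t. deriv step t \<ge> 0) \<and>
     (\<forall>t\<le>1/4. step t = 0) \<and> (\<forall>t\<ge>1/2. step t = 1)"
    unfolding step_def by (rule someI_ex[OF ex_smooth_step])
  then show "Dk_on k UNIV step" "deriv step t \<ge> 0"
    "t \<le> 1/4 \<Longrightarrow> step t = 0" "t \<ge> 1/2 \<Longrightarrow> step t = 1" by auto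
qed

lemma Dk_on_deriv_step: "Dk_on k UNIV (deriv step)"
  using Dk_on_step[of "Suc k"] by simp

lemma step_differentiable: "step differentiable (at t)"
  using Dk_on_step[of 1] by simp

lemma deriv_step_eq_0: "t \<le> 1/4 \<or> t \<ge> 1/2 \<Longrightarrow> deriv step t = 0"
proof -
  have cont: "isCont (deriv step) t" for t
    using Dk_on_deriv_step[of 1] by (simp add: differentiable_imp_continuous_within)
  have l: "deriv step s = 0" if "s < 1/4" for s
  proof -
    have "deriv step s = deriv (\<lambda>_. 0) s"
      by (intro deriv_cong_ev eventually_mono[OF eventually_nhds_in_open[of "{..<1/4}"]])
        (use that step_0 in auto)
    then show ?thesis by simp
  qed
  have r: "deriv step s = 0" if "s > 1/2" for s
  proof -
    have "deriv step s = deriv (\<lambda>_. 1) s"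
      by (intro deriv_cong_ev eventually_mono[OF eventually_nhds_in_open[of "{1/2<..}"]])
        (use that step_1 in auto)
    then show ?thesis by simp
  qed
  have "(deriv step \<longlongrightarrow> 0) (at_left (1/4))"
    by (rule tendsto_eventually) (auto simp: eventually_at_filter l)
  then have l': "deriv step (1/4) = 0"
  proof -
    have "(deriv step \<longlongrightarrow> deriv step (1/4)) (at_left (1/4))"
      by (rule tendsto_mono[OF at_le]) (use cont[of "1/4"] in \<open>auto simp: isCont_def\<close>)
    then show ?thesis
      using \<open>(deriv step \<longlongrightarrow> 0) (at_left (1/4))\<close> tendsto_unique trivial_limit_at_left_real by blast
  qed
  have "(deriv step \<longlongrightarrow> 0) (at_right (1/2))"
    by (rule tendsto_eventually) (auto simp: eventually_at_filter r)
  then have "deriv step (1/2) = 0"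
  proof -
    have "(deriv step \<longlongrightarrow> deriv step (1/2)) (at_right (1/2))"
      by (rule tendsto_mono[OF at_le]) (use cont[of "1/2"] in \<open>auto simp: isCont_def\<close>)
    then show ?thesis
      using \<open>(deriv step \<longlongrightarrow> 0) (at_right (1/2))\<close> tendsto_unique trivial_limit_at_right_real by blast
  qed
  then show "t \<le> 1/4 \<or> t \<ge> 1/2 \<Longrightarrow> deriv step t = 0"
    using l[of t] r[of t] l' unfolding le_less by blast
qed

section \<open>Smooth functions of bounded support\<close>

lemma continuous_supp_bounded:
  fixes f :: "complex \<Rightarrow> real"
  assumes "continuous_on UNIV f" "\<And>x. norm x > R \<Longrightarrow> f x = 0"
  obtains L where "L \<ge> 0" "\<And>x. \<bar>f x\<bar> \<le> L"
proof -
  have "compact (f ` cball 0 R)"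
    using assms(1) by (intro compact_continuous_image continuous_on_subset[OF assms(1)]) auto
  then obtain L where L: "\<And>x. x \<in> cball 0 R \<Longrightarrow> \<bar>f x\<bar> \<le> L"
    using compact_imp_bounded[of "f ` cball 0 R"] unfolding bounded_iff by (metis imageI real_norm_def)
  have "\<bar>f x\<bar> \<le> max L 0" for x
    using L[of x] assms(2)[of x] by (cases "norm x > R") (auto simp: le_max_iff_disj)
  then show ?thesis by (intro that[of "max L 0"]) auto
qed

lemma dir_deriv_eq_0_outside:
  assumes "\<And>x. norm x > R \<Longrightarrow> f x = 0" "norm x > R"
  shows "dir_deriv v f x = 0"
proof -
  have "open {x::complex. norm x > R}" by (intro open_Collect_less continuous_intros)
  then have "dir_deriv v f x = dir_deriv v (\<lambda>_. 0) x"
    using assms by (intro dir_deriv_cong_open) auto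
  then show ?thesis by simp
qed

lemma dir_deriv_complex:
  assumes "f differentiable (at x)"
  shows "dir_deriv v f x = Re v * dir_deriv 1 f x + Im v * dir_deriv \<i> f x"
proof -
  interpret linear "\<lambda>v. dir_deriv v f x"
    using has_derivative_linear[OF has_derivative_dir_deriv[OF assms]] .
  have "v = Re v *\<^sub>R 1 + Im v *\<^sub>R \<i>" by (simp add: complex_eq_iff)
  then have "dir_deriv v f x = dir_deriv (Re v *\<^sub>R 1 + Im v *\<^sub>R \<i>) f x" by simp
  also have "\<dots> = Re v * dir_deriv 1 f x + Im v * dir_deriv \<i> f x"
    unfolding add scale by simp
  finally show ?thesis .
qed

lemma C1_supp_Lipschitz:
  assumes F: "Ck_on 1 UNIV F" "\<And>x. norm x > R \<Longrightarrow> F x = 0"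
  obtains L where "L \<ge> 0" "\<And>x y. \<bar>F x - F y\<bar> \<le> L * norm (x - y)"
proof -
  have diff: "F differentiable (at x)" and cont: "continuous_on UNIV (dir_deriv v F)" for x v
    using F(1) by auto
  have d0: "dir_deriv v F x = 0" if "norm x > R" for v x
    by (rule dir_deriv_eq_0_outside[OF F(2) that])
  obtain L1 where L1: "L1 \<ge> 0" "\<And>x. \<bar>dir_deriv 1 F x\<bar> \<le> L1"
    using continuous_supp_bounded[OF cont d0] by blast
  obtain L2 where L2: "L2 \<ge> 0" "\<And>x. \<bar>dir_deriv \<i> F x\<bar> \<le> L2"
    using continuous_supp_bounded[OF cont d0] by blast
  have "onorm (\<lambda>v. dir_deriv v F x) \<le> L1 + L2" for x
  proof (rule onorm_le)
    fix v
    have "\<bar>dir_deriv v F x\<bar> \<le> \<bar>Re v\<bar> * \<bar>dir_deriv 1 F x\<bar> + \<bar>Im v\<bar> * \<bar>dir_deriv \<i> F x\<bar>"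
      unfolding dir_deriv_complex[OF diff, of v] abs_mult[symmetric] by (rule abs_triangle_ineq)
    also have "\<dots> \<le> norm v * L1 + norm v * L2"
      by (intro add_mono mult_mono L1 L2 abs_Re_le_cmod abs_Im_le_cmod) auto
    finally show "norm (dir_deriv v F x) \<le> (L1 + L2) * norm v" by (simp add: algebra_simps)
  qed
  then have "\<bar>F x - F y\<bar> \<le> (L1 + L2) * norm (x - y)" for x y
    using differentiable_bound[OF convex_UNIV, of F "\<lambda>x v. dir_deriv v F x" "L1 + L2" y x]
      has_derivative_dir_deriv[OF diff] by (auto simp: norm_minus_commute abs_minus_commute)
  then show ?thesis using L1 L2 by (intro that[of "L1 + L2"]) auto
qed

text \<open>The radius is part of the notion because the supports of averages and of differences have to
  be located inside the domain.\<close>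

definition smooth_supp :: "real \<Rightarrow> (complex \<Rightarrow> real) \<Rightarrow> bool" where
  "smooth_supp R f \<longleftrightarrow> smooth f \<and> (\<forall>x. norm x > R \<longrightarrow> f x = 0)"

lemma smooth_supp_mono: "smooth_supp R f \<Longrightarrow> R \<le> R' \<Longrightarrow> smooth_supp R' f"
  by (auto simp: smooth_supp_def)

lemma smooth_dir_deriv: "smooth f \<Longrightarrow> smooth (dir_deriv v f)"
  unfolding smooth_def
proof
  fix k assume "\<forall>k. Ck_on k UNIV f"
  then have "Ck_on (Suc k) UNIV f" by blast
  then show "Ck_on k UNIV (dir_deriv v f)" by simp
qed

lemma smooth_supp_dir_deriv:
  assumes "smooth_supp R f" shows "smooth_supp R (dir_deriv v f)"
  using assms smooth_dir_deriv dir_deriv_eq_0_outside[of R f _ v] by (auto simp: smooth_supp_def)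

lemma smooth_supp_iter_deriv: "smooth_supp R f \<Longrightarrow> smooth_supp R (iter_deriv vs f)"
  unfolding iter_deriv_def by (induction vs) (auto intro: smooth_supp_dir_deriv)

lemma smooth_supp_diff: "smooth_supp R f \<Longrightarrow> smooth_supp R g \<Longrightarrow> smooth_supp R (\<lambda>x. f x - g x)"
  unfolding smooth_supp_def smooth_def by (auto intro: Ck_on_diff)

lemma smooth_continuous: "smooth f \<Longrightarrow> continuous_on S f"
  unfolding smooth_def using Ck_on.simps(1) continuous_on_subset by blast

lemma smooth_measurable: "smooth f \<Longrightarrow> f \<in> borel_measurable borel"
  by (intro borel_measurable_continuous_onI smooth_continuous)

lemma smooth_supp_bounded:
  assumes "smooth_supp R f" obtains L where "L \<ge> 0" "\<And>x. \<bar>f x\<bar> \<le> L"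
  using assms continuous_supp_bounded[OF smooth_continuous] unfolding smooth_supp_def by blast

lemma smooth_supp_Lipschitz:
  assumes "smooth_supp R f" obtains L where "L \<ge> 0" "\<And>x y. \<bar>f x - f y\<bar> \<le> L * norm (x - y)"
  using assms C1_supp_Lipschitz[of f R] unfolding smooth_supp_def smooth_def by blast

lemma smooth_supp_integrable:
  assumes "smooth_supp R f" shows "integrable lborel f"
proof -
  have "integrable lborel (\<lambda>x. indicator (cball 0 R) x *\<^sub>R f x)"
    using assms by (intro borel_integrable_compact) (auto simp: smooth_supp_def intro: smooth_continuous)
  moreover have "(\<lambda>x. indicator (cball 0 R) x *\<^sub>R f x) = f"
    using assms by (auto simp: smooth_supp_def indicator_def fun_eq_iff not_le)
  ultimately show ?thesis by simp
qed

section \<open>Radial bumps and their potentials\<close>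

lemma lborel_integral_rescale:
  assumes "s > 0"
  shows "(LINT y|lborel. f (y /\<^sub>R s)) = s\<^sup>2 * (LINT y|lborel. f (y::complex)::real)"
proof (cases "f \<in> borel_measurable borel")
  case True
  have "(LINT y|lborel. f (y /\<^sub>R s)) = (LINT y|density (distr lborel borel (\<lambda>x. 0 + s *\<^sub>R x)) (\<lambda>_. \<bar>s\<bar>^DIM(complex)). f (y /\<^sub>R s))"
    using assms lborel_affine[of s "0::complex"] by simp
  also have "\<dots> = s\<^sup>2 * (LINT y|lborel. f y)"
    using assms True by (subst integral_density) (auto simp: integral_distr)
  finally show ?thesis .
next
  case False
  have "(\<lambda>y. f (y /\<^sub>R s)) \<notin> borel_measurable borel"
  proof
    assume "(\<lambda>y. f (y /\<^sub>R s)) \<in> borel_measurable borel"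
    then have "(\<lambda>y. f ((s *\<^sub>R y) /\<^sub>R s)) \<in> borel_measurable borel"
      by (rule measurable_compose[rotated]) auto
    then show False using False assms by simp
  qed
  then have "\<not> integrable lborel f" "\<not> integrable lborel (\<lambda>y. f (y /\<^sub>R s))"
    using False borel_measurable_integrable by fastforce+
  then show ?thesis by (simp add: not_integrable_integral_eq)
qed

definition bump_const :: real where
  "bump_const = 1 / (LINT y|lborel. radial (deriv step) 0 y)"

text \<open>A radial probability density on an annulus of radius of order \<open>s\<close>.  Its profile is the derivative of
  a step, so that in \<open>bump_diff_eq_lap\<close> one integration in the squared radius can be carried out
  explicitly.\<close>

definition bump :: "real \<Rightarrow> complex \<Rightarrow> real" where
  "bump s y = bump_const / s\<^sup>2 * deriv step ((norm y)\<^sup>2 / s\<^sup>2)"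

lemma smooth_radial: "(\<And>k. Dk_on k UNIV g) \<Longrightarrow> smooth (radial g a)"
  unfolding smooth_def by (auto intro!: Ck_on_radial[of _ UNIV])

lemma bump_radial: "bump s = (\<lambda>y. bump_const / s\<^sup>2 * radial (\<lambda>t. deriv step (1 / s\<^sup>2 * t + 0)) 0 y)"
  by (simp add: bump_def[abs_def] radial_def)

lemma smooth_cmult: "smooth f \<Longrightarrow> smooth (\<lambda>x. c * f x)"
  unfolding smooth_def by (auto intro: Ck_on_cmult)

lemma bump_eq_0: "s > 0 \<Longrightarrow> norm y < s / 2 \<or> norm y \<ge> s * 3/4 \<Longrightarrow> bump s y = 0"
proof -
  assume s: "s > 0" and y: "norm y < s / 2 \<or> norm y \<ge> s * 3/4"
  have s2: "s\<^sup>2 > 0" using s by simp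
  have "(norm y)\<^sup>2 / s\<^sup>2 \<le> 1/4 \<or> (norm y)\<^sup>2 / s\<^sup>2 \<ge> 1/2"
  proof (cases "norm y < s / 2")
    case True
    then have "(norm y)\<^sup>2 \<le> (s/2)\<^sup>2" by (intro power_mono) auto
    then have "(norm y)\<^sup>2 \<le> 1/4 * s\<^sup>2" by (simp add: power_divide)
    then show ?thesis using s2 by (simp add: pos_divide_le_eq)
  next
    case False
    then have "(norm y)\<^sup>2 \<ge> (s * 3/4)\<^sup>2" using y s by (intro power_mono) auto
    then have "9/16 * s\<^sup>2 \<le> (norm y)\<^sup>2" by (simp add: power_divide power_mult_distrib)
    then have "1/2 * s\<^sup>2 \<le> (norm y)\<^sup>2" using s2 by linarith
    then show ?thesis using s2 by (simp add: pos_le_divide_eq)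
  qed
  then show ?thesis unfolding bump_def using deriv_step_eq_0 by simp
qed

lemma smooth_bump: "smooth (bump s)"
  unfolding bump_radial
  by (intro smooth_cmult smooth_radial Dk_on_affine Dk_on_deriv_step)

lemma smooth_supp_bump: "s > 0 \<Longrightarrow> smooth_supp s (bump s)"
  unfolding smooth_supp_def using smooth_bump bump_eq_0[of s] by auto

lemma integral_radial_deriv_step_pos: "(LINT y|lborel. radial (deriv step) 0 y) > 0"
proof -
  let ?f = "radial (deriv step) 0"
  have sm: "smooth ?f" by (intro smooth_radial Dk_on_deriv_step)
  have "?f x = 0" if "norm x > 1" for x
  proof -
    have "(norm x)\<^sup>2 \<ge> 1\<^sup>2" using that by (intro power_mono) auto
    then show ?thesis using deriv_step_eq_0[of "(norm x)\<^sup>2"] by (simp add: radial_def)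
  qed
  then have "smooth_supp 1 ?f" using sm by (auto simp: smooth_supp_def)
  then have int: "integrable lborel ?f" by (rule smooth_supp_integrable)
  obtain t where t: "1/4 < t" "t < 1/2" "step (1/2) - step (1/4) = (1/2 - 1/4) * deriv step t"
    using MVT2[of "1/4" "1/2" step "deriv step"] differentiable_deriv[OF step_differentiable] by auto
  then have "deriv step t \<noteq> 0" using step_0[of "1/4"] step_1[of "1/2"] by auto
  moreover have "(norm (of_real (sqrt t) :: complex))\<^sup>2 = t" using t by simp
  ultimately have ne: "of_real (sqrt t) \<in> {x. ?f x \<noteq> 0}" by (simp add: radial_def)
  have op: "open {x. ?f x \<noteq> 0}"
    using smooth_continuous[OF sm, of UNIV] by (intro open_Collect_neq) auto
  have nn: "?f x \<ge> 0" for x by (simp add: radial_def deriv_step_nonneg)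
  show ?thesis
  proof (rule ccontr)
    assume "\<not> ?thesis"
    then have "integral\<^sup>L lborel ?f = 0"
      using Bochner_Integration.integral_nonneg[of lborel ?f] nn by (simp add: order.antisym not_less)
    then have "AE x in lborel. ?f x = 0"
      using integral_nonneg_eq_0_iff_AE[OF int] nn by auto
    then have "emeasure lborel {x. ?f x \<noteq> 0} = 0"
      using op by (subst (asm) AE_iff_measurable[OF _ refl]) auto
    moreover have "emeasure lborel {x. ?f x \<noteq> 0} \<noteq> 0"
    proof -
      obtain e x where e: "e > 0" "ball x e \<subseteq> {x. ?f x \<noteq> 0}"
        using op ne unfolding open_contains_ball by blast
      have "emeasure lborel (ball x e) > 0"
        using e by (simp add: emeasure_ball)
      also have "\<dots> \<le> emeasure lborel {x. ?f x \<noteq> 0}"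
        using op e by (intro emeasure_mono) auto
      finally show ?thesis by simp
    qed
    ultimately show False by simp
  qed
qed

lemma bump_nonneg: "bump s y \<ge> 0"
  unfolding bump_def bump_const_def
  using integral_radial_deriv_step_pos deriv_step_nonneg by simp

lemma norm_rescale_power2: "s > 0 \<Longrightarrow> (norm ((y::complex) /\<^sub>R s))\<^sup>2 = (norm y)\<^sup>2 / s\<^sup>2"
  by (simp add: power_mult_distrib divide_inverse power_inverse)

lemma integral_bump: "s > 0 \<Longrightarrow> (LINT y|lborel. bump s y) = 1"
proof -
  assume s: "s > 0"
  have "bump s = (\<lambda>y. bump_const / s\<^sup>2 * radial (deriv step) 0 (y /\<^sub>R s))"
    by (simp add: bump_def[abs_def] radial_def norm_rescale_power2[OF s] del: norm_scaleR)
  then have "(LINT y|lborel. bump s y) = bump_const / s\<^sup>2 * (LINT y|lborel. radial (deriv step) 0 (y /\<^sub>R s))"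
    by simp
  also have "\<dots> = 1"
    using s integral_radial_deriv_step_pos unfolding lborel_integral_rescale[OF s] bump_const_def by simp
  finally show ?thesis .
qed

lemma bump_rescale: "s > 0 \<Longrightarrow> bump s y = bump 1 (y /\<^sub>R s) / s\<^sup>2"
  by (simp add: bump_def norm_rescale_power2 del: norm_scaleR)

lemma bump_in_smooth_bumps: "bump 1 \<in> smooth_bumps"
proof -
  have "{x. bump 1 x \<noteq> 0} \<subseteq> cball 0 (3/4)"
  proof
    fix x assume "x \<in> {x. bump 1 x \<noteq> 0}"
    then have "\<not> norm x \<ge> 3/4" using bump_eq_0[of 1 x] by auto
    then show "x \<in> cball 0 (3/4)" by simp
  qed
  then have "fun_support (bump 1) \<subseteq> cball 0 (3/4)"
    unfolding fun_support_def by (rule closure_minimal) auto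
  then have "fun_support (bump 1) \<subseteq> ball 0 1" by force
  moreover have "bump 1 (- x) = bump 1 x" for x by (simp add: bump_def)
  ultimately show ?thesis
    unfolding smooth_bumps_def using smooth_bump bump_nonneg integral_bump[of 1] by auto
qed

text \<open>Two bumps of different widths have the same logarithmic potential far away, so their
  difference is the Laplacian of a test function.  In the variable \<open>t = |y|\<^sup>2\<close>, the planar Laplacian
  is \<open>4 (t \<Omega>')'\<close>; the profile of the bump is a derivative, so \<open>t \<Omega>'\<close> can be written down and
  vanishes near zero and near infinity.\<close>

lemma bump_diff_eq_lap:
  assumes r: "r > 0" and s: "s > 0"
  obtains \<Phi> where "smooth_supp (max r s) \<Phi>" "\<And>y. lap \<Phi> y = bump r y - bump s y"
proof -
  define c where "c = (min r s)\<^sup>2 / 4"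
  define C where "C = (max r s)\<^sup>2 / 2"
  define d where "d = (\<lambda>t. step (1 / r\<^sup>2 * t + 0) - step (1 / s\<^sup>2 * t + 0))"
  define F where "F = (\<lambda>t. if t > 0 then d t * (1 / t) else 0)"
  have c: "c > 0" using r s by (simp add: c_def)
  have small: "t / r\<^sup>2 \<le> 1/4 \<and> t / s\<^sup>2 \<le> 1/4" if "t \<le> c" for t
  proof -
    have "(min r s)\<^sup>2 \<le> r\<^sup>2" "(min r s)\<^sup>2 \<le> s\<^sup>2"
      using power_mono[of "min r s" r 2] power_mono[of "min r s" s 2] r s by simp_all
    then have "t \<le> 1/4 * r\<^sup>2" "t \<le> 1/4 * s\<^sup>2" using that unfolding c_def by linarith+
    then show ?thesis using r s by (simp add: pos_divide_le_eq)
  qed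
  have large: "t / r\<^sup>2 \<ge> 1/2 \<and> t / s\<^sup>2 \<ge> 1/2" if "t \<ge> C" for t
  proof -
    have "r\<^sup>2 \<le> (max r s)\<^sup>2" "s\<^sup>2 \<le> (max r s)\<^sup>2"
      using power_mono[of r "max r s" 2] power_mono[of s "max r s" 2] r s by simp_all
    then have "t \<ge> 1/2 * r\<^sup>2" "t \<ge> 1/2 * s\<^sup>2" using that unfolding C_def by linarith+
    then show ?thesis using r s by (simp add: pos_le_divide_eq)
  qed
  have d0: "d t = 0" if "t \<le> c \<or> t \<ge> C" for t
    using that small[of t] large[of t] by (auto simp: d_def step_0 step_1)
  have tF: "t * F t = d t" for t
    using d0[of t] c by (auto simp: F_def)
  have F0: "F t = 0" if "t \<le> c \<or> t \<ge> C" for t using d0[OF that] by (simp add: F_def)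
  have d: "Dk_on k S d" for k S
  proof -
    have "Dk_on k UNIV (\<lambda>t. step (1 / r\<^sup>2 * t + 0) + (-1) * step (1 / s\<^sup>2 * t + 0))"
      by (rule Dk_on_add[OF open_UNIV Dk_on_affine[OF Dk_on_step]
          Dk_on_mult[OF open_UNIV Dk_on_const Dk_on_affine[OF Dk_on_step]]])
    moreover have "d = (\<lambda>t. step (1 / r\<^sup>2 * t + 0) + (-1) * step (1 / s\<^sup>2 * t + 0))"
      by (simp add: d_def fun_eq_iff)
    ultimately have "Dk_on k UNIV d" by (simp only:)
    then show ?thesis by (rule Dk_on_subset) simp
  qed
  have DkF: "Dk_on k UNIV F" for k
  proof -
    have "Dk_on k {0<..} (\<lambda>t. d t * (1 / t))"
      by (intro Dk_on_mult d Dk_on_inverse) auto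
    then have "Dk_on k {0<..} F" by (subst Dk_on_cong[of _ _ "\<lambda>t. d t * (1 / t)"]) (auto simp: F_def)
    moreover have "Dk_on k {..<c} F" by (subst Dk_on_cong[of _ _ "\<lambda>t. 0"]) (auto simp: F0)
    ultimately have "Dk_on k ({0<..} \<union> {..<c}) F" by (rule Dk_on_Un)
    moreover have "{0<..} \<union> {..<c} = UNIV" using c by force
    ultimately show ?thesis by simp
  qed
  have dF: "F differentiable (at t)" for t using DkF[of 1] by simp
  then have "continuous_on UNIV F"
    by (simp add: continuous_at_imp_continuous_on differentiable_imp_continuous_within)
  then obtain \<Omega>0 where \<Omega>0: "\<And>t. (\<Omega>0 has_real_derivative F t) (at t)"
    using ex_antiderivative[of F c] F0 by auto
  \<comment> \<open>The primitive that vanishes outside the larger disc, not the one that vanishes at the centre.\<close>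
  define \<Omega> where "\<Omega> = (\<lambda>t. \<Omega>0 t - \<Omega>0 C)"
  have \<Omega>: "(\<Omega> has_real_derivative F t) (at t)" for t
    unfolding \<Omega>_def using DERIV_diff[OF \<Omega>0 DERIV_const] by simp
  have \<Omega>C: "\<Omega> t = 0" if "t \<ge> C" for t
  proof (cases "C < t")
    case True
    then obtain z where "C < z" "\<Omega> t - \<Omega> C = (t - C) * F z"
      using MVT2[OF True, of \<Omega> F] \<Omega> by blast
    then show ?thesis using F0[of z] by (simp add: \<Omega>_def)
  next
    case False
    then have "t = C" using that by simp
    then show ?thesis by (simp add: \<Omega>_def)
  qed
  have Dk\<Omega>: "Dk_on k UNIV \<Omega>" for k
  proof (cases k)
    case (Suc j)
    show ?thesis unfolding Suc by (rule Dk_on_SucI[OF open_UNIV \<Omega> DkF])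
  qed simp
  have d\<Omega>: "deriv \<Omega> = F" using \<Omega> DERIV_imp_deriv by blast
  have key: "F t + t * deriv F t = deriv step (t / r\<^sup>2) / r\<^sup>2 - deriv step (t / s\<^sup>2) / s\<^sup>2" for t
  proof -
    have lin: "((\<lambda>t. a * t + 0) has_real_derivative a) (at t)" for a :: real
      by (auto intro!: derivative_eq_intros)
    have "((\<lambda>t. t * F t) has_real_derivative 1 * F t + deriv F t * t) (at t)"
      by (intro DERIV_mult DERIV_ident differentiable_deriv dF)
    moreover have "(d has_real_derivative
        deriv step (1 / r\<^sup>2 * t + 0) * (1 / r\<^sup>2) - deriv step (1 / s\<^sup>2 * t + 0) * (1 / s\<^sup>2)) (at t)"
      unfolding d_def
      by (intro DERIV_diff DERIV_chain2[OF differentiable_deriv[OF step_differentiable]])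
        (rule lin)+
    ultimately have "1 * F t + deriv F t * t
        = deriv step (1 / r\<^sup>2 * t + 0) * (1 / r\<^sup>2) - deriv step (1 / s\<^sup>2 * t + 0) * (1 / s\<^sup>2)"
      unfolding tF by (rule DERIV_unique)
    then show ?thesis by (simp add: mult.commute)
  qed
  define \<Phi> where "\<Phi> = (\<lambda>y. bump_const / 4 * radial \<Omega> 0 y)"
  have sm: "smooth (radial \<Omega> 0)" by (intro smooth_radial Dk\<Omega>)
  have "lap \<Phi> y = bump r y - bump s y" for y
  proof -
    have "lap \<Phi> y = bump_const / 4 * lap (radial \<Omega> 0) y"
      unfolding \<Phi>_def using sm by (intro lap_cmult[of UNIV]) (auto simp: smooth_def)
    also have "lap (radial \<Omega> 0) y = 4 * (F ((norm y)\<^sup>2) + (norm y)\<^sup>2 * deriv F ((norm y)\<^sup>2))"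
      using lap_radial[OF open_UNIV Dk\<Omega>, of y 0] by (simp add: d\<Omega> radial_def)
    finally show ?thesis unfolding key by (simp add: bump_def algebra_simps)
  qed
  moreover have "smooth_supp (max r s) \<Phi>"
  proof -
    have "\<Phi> x = 0" if "norm x > max r s" for x
    proof -
      have "(max r s)\<^sup>2 \<le> (norm x)\<^sup>2" using that r s by (intro power_mono) auto
      then have "C \<le> (norm x)\<^sup>2" using zero_le_power2[of "max r s"] unfolding C_def by linarith
      then show ?thesis using \<Omega>C by (simp add: \<Phi>_def radial_def)
    qed
    then show ?thesis
      using smooth_cmult[OF sm, of "bump_const / 4", folded \<Phi>_def] by (auto simp: smooth_supp_def)
  qed
  ultimately show ?thesis using that by blast
qed

section \<open>Averages of smooth functions against a measure\<close>

lemma integrable_bounded_supp: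
  fixes f :: "complex \<Rightarrow> real"
  assumes "f \<in> borel_measurable borel" "\<And>x. \<bar>f x\<bar> \<le> C" "\<And>x. norm x > R \<Longrightarrow> f x = 0"
  shows "integrable lborel f"
proof (rule integrableI_bounded_set[where A = "cball 0 R" and B = C])
  show "emeasure lborel (cball 0 R :: complex set) < \<infinity>" by (rule emeasure_lborel_cball_finite)
  show "AE x in lborel. x \<notin> cball 0 R \<longrightarrow> f x = 0" using assms(3) by (auto simp: not_le)
qed (use assms in auto)

lemma lborel_integral_shift:
  fixes f :: "complex \<Rightarrow> real"
  shows "(LINT x|lborel. f (x - a)) = (LINT x|lborel. f x)"
proof (cases "f \<in> borel_measurable borel")
  case True
  have "(LINT x|lborel. f x) = (LINT x|distr lborel borel ((+) (- a)). f x)"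
    by (simp add: lborel_distr_plus)
  also have "\<dots> = (LINT x|lborel. f (- a + x))"
    using True by (subst integral_distr) auto
  finally show ?thesis by simp
next
  case False
  have "(\<lambda>x. f (x - a)) \<notin> borel_measurable borel"
  proof
    assume "(\<lambda>x. f (x - a)) \<in> borel_measurable borel"
    then have "(\<lambda>x. f ((x + a) - a)) \<in> borel_measurable borel"
      by (rule measurable_compose[rotated]) auto
    then show False using False by simp
  qed
  then have "\<not> integrable lborel f" "\<not> integrable lborel (\<lambda>x. f (x - a))"
    using False borel_measurable_integrable by fastforce+
  then show ?thesis by (simp add: not_integrable_integral_eq)
qed

text \<open>What is used of an admissible mollifier besides its energy.\<close>

definition disc_prob :: "complex measure \<Rightarrow> bool" where
  "disc_prob \<rho> \<longleftrightarrow> sets \<rho> = sets borel \<and> prob_space \<rho> \<and> (AE y in \<rho>. norm y \<le> 1)"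

text \<open>The complement of the support is a union of open null sets, of which countably many suffice by
  the Lindelof property.\<close>

lemma AE_measure_support:
  assumes "sets \<mu> = sets borel" shows "AE x in \<mu>. x \<in> measure_support \<mu>"
proof -
  define \<U> where "\<U> = {U. open U \<and> emeasure \<mu> U = 0}"
  obtain \<V> where \<V>: "\<V> \<subseteq> \<U>" "countable \<V>" "\<Union>\<V> = \<Union>\<U>"
    using Lindelof[of \<U>] by (auto simp: \<U>_def)
  have eq: "\<Union>\<U> = - measure_support \<mu>"
    by (auto simp: \<U>_def measure_support_def zero_less_iff_neq_zero)
  have "(\<Union>V\<in>\<V>. V) \<in> null_sets \<mu>"
    using \<V> assms by (intro null_sets_UN') (auto simp: \<U>_def null_sets_def subset_iff)
  then have "- measure_support \<mu> \<in> null_sets \<mu>" using \<V>(3) eq by simp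
  then show ?thesis by (rule AE_I') (use assms in \<open>auto simp: sets_eq_imp_space_eq[OF assms]\<close>)
qed

lemma disc_prob_admissible:
  assumes "admissible_mollifier \<rho>" shows "disc_prob \<rho>"
proof -
  have s: "sets \<rho> = sets borel" and sub: "measure_support \<rho> \<subseteq> cball 0 1" and e: "emeasure \<rho> UNIV = 1"
    using assms by (auto simp: admissible_mollifier_def)
  have "space \<rho> = UNIV" using sets_eq_imp_space_eq[OF s] by simp
  then have "prob_space \<rho>" using e by (intro prob_spaceI) simp
  moreover have "AE y in \<rho>. norm y \<le> 1"
    using AE_measure_support[OF s] by (rule AE_mp) (use sub in \<open>auto simp: subset_iff\<close>)
  ultimately show ?thesis using s by (simp add: disc_prob_def)
qed

text \<open>The convolution of \<open>\<phi>\<close> with the image of \<open>\<rho>\<close> under \<open>y \<mapsto> z + \<epsilon> y\<close>.\<close>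

definition avg :: "complex measure \<Rightarrow> (complex \<Rightarrow> real) \<Rightarrow> complex \<Rightarrow> real \<Rightarrow> complex \<Rightarrow> real" where
  "avg \<rho> \<phi> z \<epsilon> x = (LINT y|\<rho>. \<phi> (x - z - \<epsilon> *\<^sub>R y))"

lemma disc_prob_measurable:
  "disc_prob \<rho> \<Longrightarrow> f \<in> borel_measurable borel \<Longrightarrow> f \<in> borel_measurable \<rho>"
  by (auto simp: disc_prob_def cong: measurable_cong_sets)

lemma mollify_scaled_measure:
  assumes \<rho>: "disc_prob \<rho>" and "n > 0"
  shows "mollify (scaled_measure \<rho> z \<epsilon>) (bump 1) n = avg \<rho> (bump (1 / n)) z \<epsilon>"
proof
  fix x
  have m: "(\<lambda>y. z + \<epsilon> *\<^sub>R y) \<in> measurable \<rho> borel"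
    using \<rho> by (auto simp: disc_prob_def cong: measurable_cong_sets)
  have "mollify (scaled_measure \<rho> z \<epsilon>) (bump 1) n x
      = (LINT y|\<rho>. (real n)\<^sup>2 * bump 1 (real n *\<^sub>R (x - (z + \<epsilon> *\<^sub>R y))))"
    unfolding mollify_def scaled_measure_def
    by (intro integral_distr m borel_measurable_times borel_measurable_const
        measurable_compose[OF _ smooth_measurable[OF smooth_bump]]) auto
  also have "(\<lambda>y. (real n)\<^sup>2 * bump 1 (real n *\<^sub>R (x - (z + \<epsilon> *\<^sub>R y)))) = (\<lambda>y. bump (1 / n) (x - z - \<epsilon> *\<^sub>R y))"
    using assms(2) by (auto simp: bump_rescale[of "1 / n"] power_divide diff_diff_eq)
  finally show "mollify (scaled_measure \<rho> z \<epsilon>) (bump 1) n x = avg \<rho> (bump (1 / n)) z \<epsilon> x"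
    by (simp add: avg_def)
qed

context
  fixes \<rho> assumes \<rho>: "disc_prob \<rho>"
begin

interpretation prob_space \<rho> using \<rho> by (simp add: disc_prob_def)

lemma abs_integral_le_AE:
  fixes f :: "complex \<Rightarrow> real"
  assumes "integrable \<rho> f" "AE y in \<rho>. \<bar>f y\<bar> \<le> c"
  shows "\<bar>LINT y|\<rho>. f y\<bar> \<le> c"
proof -
  have "\<bar>LINT y|\<rho>. f y\<bar> \<le> (LINT y|\<rho>. \<bar>f y\<bar>)" using integral_abs_bound by blast
  also have "\<dots> \<le> (LINT y|\<rho>. c)" using assms by (intro integral_mono_AE) auto
  finally show ?thesis by (simp add: prob_space)
qed

lemma smooth_supp_shift_integrable:
  assumes "smooth_supp R \<phi>" shows "integrable \<rho> (\<lambda>y. \<phi> (x - \<epsilon> *\<^sub>R y))"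
proof -
  obtain L where "\<And>x. \<bar>\<phi> x\<bar> \<le> L" using smooth_supp_bounded[OF assms] by blast
  moreover have "(\<lambda>y. \<phi> (x - \<epsilon> *\<^sub>R y)) \<in> borel_measurable \<rho>"
    by (intro disc_prob_measurable[OF \<rho>] measurable_compose[OF _ smooth_measurable])
      (use assms in \<open>auto simp: smooth_supp_def\<close>)
  ultimately show ?thesis by (intro integrable_const_bound[where B = L]) auto
qed

text \<open>The remainder is uniform in the base point, so it survives averaging and gives the derivative of
  an average.\<close>

lemma smooth_supp_taylor:
  assumes "smooth_supp R \<phi>"
  obtains L where "L \<ge> 0" "\<And>u h. \<bar>\<phi> (u + h) - \<phi> u - dir_deriv h \<phi> u\<bar> \<le> L * (norm h)\<^sup>2"
proof -
  have diff: "\<phi> differentiable (at x)" for x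
  proof -
    have "Ck_on (Suc 0) UNIV \<phi>" using assms unfolding smooth_supp_def smooth_def by blast
    then show ?thesis by simp
  qed
  obtain L1 where L1: "L1 \<ge> 0" "\<And>x y. \<bar>dir_deriv 1 \<phi> x - dir_deriv 1 \<phi> y\<bar> \<le> L1 * norm (x - y)"
    using smooth_supp_Lipschitz[OF smooth_supp_dir_deriv[OF assms]] by blast
  obtain L2 where L2: "L2 \<ge> 0" "\<And>x y. \<bar>dir_deriv \<i> \<phi> x - dir_deriv \<i> \<phi> y\<bar> \<le> L2 * norm (x - y)"
    using smooth_supp_Lipschitz[OF smooth_supp_dir_deriv[OF assms]] by blast
  have "\<bar>\<phi> (u + h) - \<phi> u - dir_deriv h \<phi> u\<bar> \<le> (L1 + L2) * (norm h)\<^sup>2" for u h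
  proof -
    have "((\<lambda>t. \<phi> (u + t *\<^sub>R h)) has_real_derivative dir_deriv h \<phi> (u + t *\<^sub>R h)) (at t)" for t
    proof -
      have lin: "linear (\<lambda>v. dir_deriv v \<phi> (u + t *\<^sub>R h))"
        using has_derivative_linear[OF has_derivative_dir_deriv[OF diff]] .
      have "((\<lambda>t. u + t *\<^sub>R h) has_derivative (\<lambda>s. s *\<^sub>R h)) (at t)"
        by (auto intro!: derivative_eq_intros)
      note D = has_derivative_compose[OF this has_derivative_dir_deriv[OF diff]]
      have "(\<lambda>s. dir_deriv (s *\<^sub>R h) \<phi> (u + t *\<^sub>R h)) = (*) (dir_deriv h \<phi> (u + t *\<^sub>R h))"
        by (simp add: fun_eq_iff linear_cmul[OF lin])
      with D show ?thesis by (simp only: has_field_derivative_def)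
    qed
    from MVT2[of 0 1 "\<lambda>t. \<phi> (u + t *\<^sub>R h)", OF _ this]
    obtain t where t: "0 < t" "t < 1" "\<phi> (u + h) - \<phi> u = dir_deriv h \<phi> (u + t *\<^sub>R h)" by auto
    have th: "norm (t *\<^sub>R h) \<le> norm h" using t by (simp add: mult_left_le_one_le)
    have "\<phi> (u + h) - \<phi> u - dir_deriv h \<phi> u
        = Re h * (dir_deriv 1 \<phi> (u + t *\<^sub>R h) - dir_deriv 1 \<phi> u)
        + Im h * (dir_deriv \<i> \<phi> (u + t *\<^sub>R h) - dir_deriv \<i> \<phi> u)"
      unfolding t(3) dir_deriv_complex[OF diff, of h] by (simp add: algebra_simps)
    also have "\<bar>\<dots>\<bar> \<le> \<bar>Re h\<bar> * \<bar>dir_deriv 1 \<phi> (u + t *\<^sub>R h) - dir_deriv 1 \<phi> u\<bar>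
        + \<bar>Im h\<bar> * \<bar>dir_deriv \<i> \<phi> (u + t *\<^sub>R h) - dir_deriv \<i> \<phi> u\<bar>"
      unfolding abs_mult[symmetric] by (rule abs_triangle_ineq)
    also have "\<dots> \<le> norm h * (L1 * norm h) + norm h * (L2 * norm h)"
      using L1(2)[of "u + t *\<^sub>R h" u] L2(2)[of "u + t *\<^sub>R h" u] mult_left_mono[OF th L1(1)]
        mult_left_mono[OF th L2(1)]
      by (intro add_mono mult_mono abs_Re_le_cmod abs_Im_le_cmod) auto
    finally show ?thesis by (simp add: power2_eq_square algebra_simps)
  qed
  then show ?thesis using L1 L2 by (intro that[of "L1 + L2"]) auto
qed

lemma avg_has_derivative:
  assumes "smooth_supp R \<phi>"
  shows "(avg \<rho> \<phi> z \<epsilon> has_derivative (\<lambda>v. avg \<rho> (dir_deriv v \<phi>) z \<epsilon> x)) (at x)"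
proof -
  have diff: "\<phi> differentiable (at x)" for x
  proof -
    have "Ck_on (Suc 0) UNIV \<phi>" using assms unfolding smooth_supp_def smooth_def by blast
    then show ?thesis by simp
  qed
  note int = smooth_supp_shift_integrable[OF smooth_supp_dir_deriv[OF assms]]
  obtain L where L: "L \<ge> 0" "\<And>u h. \<bar>\<phi> (u + h) - \<phi> u - dir_deriv h \<phi> u\<bar> \<le> L * (norm h)\<^sup>2"
    using smooth_supp_taylor[OF assms] by blast
  have eq: "(\<lambda>v. avg \<rho> (dir_deriv v \<phi>) z \<epsilon> x)
      = (\<lambda>v. Re v * avg \<rho> (dir_deriv 1 \<phi>) z \<epsilon> x + Im v * avg \<rho> (dir_deriv \<i> \<phi>) z \<epsilon> x)"
  proof
    fix v
    show "avg \<rho> (dir_deriv v \<phi>) z \<epsilon> x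
      = Re v * avg \<rho> (dir_deriv 1 \<phi>) z \<epsilon> x + Im v * avg \<rho> (dir_deriv \<i> \<phi>) z \<epsilon> x"
      unfolding avg_def dir_deriv_complex[OF diff, of v] using int by simp
  qed
  have bl: "bounded_linear (\<lambda>v. avg \<rho> (dir_deriv v \<phi>) z \<epsilon> x)"
    unfolding eq by (intro bounded_linear_add bounded_linear_mult_const bounded_linear_Re bounded_linear_Im)
  have "norm (avg \<rho> \<phi> z \<epsilon> y - avg \<rho> \<phi> z \<epsilon> x - avg \<rho> (dir_deriv (y - x) \<phi>) z \<epsilon> x)
      \<le> L * (norm (y - x))\<^sup>2" for y
  proof -
    let ?e = "\<lambda>w. \<phi> (y - z - \<epsilon> *\<^sub>R w) - \<phi> (x - z - \<epsilon> *\<^sub>R w) - dir_deriv (y - x) \<phi> (x - z - \<epsilon> *\<^sub>R w)"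
    have ie: "integrable \<rho> ?e"
      by (intro Bochner_Integration.integrable_diff smooth_supp_shift_integrable[OF assms] int)
    have "avg \<rho> \<phi> z \<epsilon> y - avg \<rho> \<phi> z \<epsilon> x - avg \<rho> (dir_deriv (y - x) \<phi>) z \<epsilon> x = (LINT w|\<rho>. ?e w)"
      unfolding avg_def using int smooth_supp_shift_integrable[OF assms] by simp
    also have "norm \<dots> \<le> (LINT w|\<rho>. L * (norm (y - x))\<^sup>2)"
    proof (rule Bochner_Integration.integral_norm_bound_integral[OF ie])
      show "norm (?e w) \<le> L * (norm (y - x))\<^sup>2" for w
        using L(2)[of "x - z - \<epsilon> *\<^sub>R w" "y - x"] by (simp add: algebra_simps)
    qed simp
    finally show ?thesis by (simp add: prob_space)
  qed
  note bound = this
  show ?thesis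
    unfolding has_derivative_at_within
  proof (intro conjI bl)
    have "((\<lambda>y. L * norm (y - x)) \<longlongrightarrow> L * norm (x - x)) (at x)" by (intro tendsto_intros)
    then have lim: "((\<lambda>y. L * norm (y - x)) \<longlongrightarrow> 0) (at x)" by simp
    show "((\<lambda>y. (avg \<rho> \<phi> z \<epsilon> y - avg \<rho> \<phi> z \<epsilon> x - avg \<rho> (dir_deriv (y - x) \<phi>) z \<epsilon> x) /\<^sub>R norm (y - x)) \<longlongrightarrow> 0) (at x)"
    proof (rule Lim_null_comparison[OF _ lim])
      have "norm ((avg \<rho> \<phi> z \<epsilon> y - avg \<rho> \<phi> z \<epsilon> x - avg \<rho> (dir_deriv (y - x) \<phi>) z \<epsilon> x) /\<^sub>R norm (y - x))
          \<le> L * norm (y - x)" if "y \<noteq> x" for y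
        using bound[of y] that by (simp add: field_simps power2_eq_square)
      then show "\<forall>\<^sub>F y in at x. norm ((avg \<rho> \<phi> z \<epsilon> y - avg \<rho> \<phi> z \<epsilon> x - avg \<rho> (dir_deriv (y - x) \<phi>) z \<epsilon> x) /\<^sub>R norm (y - x))
          \<le> L * norm (y - x)"
        by (auto simp: eventually_at_filter)
    qed
  qed
qed

lemma dir_deriv_avg:
  assumes "smooth_supp R \<phi>"
  shows "dir_deriv v (avg \<rho> \<phi> z \<epsilon>) = avg \<rho> (dir_deriv v \<phi>) z \<epsilon>"
  using dir_deriv_eq[OF avg_has_derivative[OF assms]] by auto

lemma smooth_avg:
  assumes "smooth_supp R \<phi>" shows "smooth (avg \<rho> \<phi> z \<epsilon>)"
proof -
  have diff: "avg \<rho> \<phi> z \<epsilon> differentiable (at x)" if "smooth_supp R \<phi>" for \<phi> x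
    using avg_has_derivative[OF that] differentiable_def by blast
  have "Ck_on k UNIV (avg \<rho> \<phi> z \<epsilon>)" for k using assms
  proof (induction k arbitrary: \<phi>)
    case 0
    then show ?case using diff
      by (auto intro!: continuous_at_imp_continuous_on differentiable_imp_continuous_within)
  next
    case (Suc k)
    then show ?case using diff by (auto simp: dir_deriv_avg intro: smooth_supp_dir_deriv)
  qed
  then show ?thesis by (simp add: smooth_def)
qed

lemma lap_avg:
  assumes "smooth_supp R \<phi>" shows "lap (avg \<rho> \<phi> z \<epsilon>) x = avg \<rho> (lap \<phi>) z \<epsilon> x"
proof -
  note i = smooth_supp_shift_integrable[OF smooth_supp_dir_deriv[OF smooth_supp_dir_deriv[OF assms]]]
  show ?thesis
    unfolding lap_def Basis_complex_def dir_deriv_avg[OF assms] dir_deriv_avg[OF smooth_supp_dir_deriv[OF assms]]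
    using i by (simp add: avg_def)
qed

lemma iter_deriv_avg:
  assumes "smooth_supp R \<phi>"
  shows "iter_deriv vs (avg \<rho> \<phi> z \<epsilon>) = avg \<rho> (iter_deriv vs \<phi>) z \<epsilon>"
proof (induction vs)
  case (Cons v vs)
  show ?case
    using Cons dir_deriv_avg[OF smooth_supp_iter_deriv[OF assms]] by (simp add: iter_deriv_def)
qed (simp add: iter_deriv_def)

lemma avg_eq_0:
  assumes "smooth_supp R \<phi>" "\<epsilon> \<ge> 0" "norm (x - z) > R + \<epsilon>"
  shows "avg \<rho> \<phi> z \<epsilon> x = 0"
proof -
  have "AE y in \<rho>. norm y \<le> 1" using \<rho> by (simp add: disc_prob_def)
  then have "AE y in \<rho>. \<phi> (x - z - \<epsilon> *\<^sub>R y) = 0"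
  proof (rule AE_mp, intro AE_I2 impI)
    fix y :: complex assume "norm y \<le> 1"
    then have "norm (\<epsilon> *\<^sub>R y) \<le> \<epsilon>" using assms(2) by (simp add: mult_left_le)
    then have "norm (x - z - \<epsilon> *\<^sub>R y) > R"
      using norm_triangle_ineq2[of "x - z" "\<epsilon> *\<^sub>R y"] assms(3) by linarith
    then show "\<phi> (x - z - \<epsilon> *\<^sub>R y) = 0" using assms(1) by (simp add: smooth_supp_def)
  qed
  then show ?thesis unfolding avg_def by (rule integral_eq_zero_AE)
qed

lemma smooth_supp_avg:
  assumes "smooth_supp R \<phi>" "\<epsilon> \<ge> 0" shows "smooth_supp (norm z + R + \<epsilon>) (avg \<rho> \<phi> z \<epsilon>)"
proof -
  have "avg \<rho> \<phi> z \<epsilon> x = 0" if "norm x > norm z + R + \<epsilon>" for x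
    by (rule avg_eq_0[OF assms]) (use that norm_triangle_ineq2[of x z] in linarith)
  then show ?thesis using smooth_avg[OF assms(1)] by (simp add: smooth_supp_def)
qed

lemma avg_diff_le:
  assumes "smooth_supp R \<phi>" "\<And>x y. \<bar>\<phi> x - \<phi> y\<bar> \<le> L * norm (x - y)" "L \<ge> 0"
  shows "\<bar>avg \<rho> \<phi> z \<epsilon> x - avg \<rho> \<phi> w r x\<bar> \<le> L * (norm (z - w) + \<bar>\<epsilon> - r\<bar>)"
proof -
  note i = smooth_supp_shift_integrable[OF assms(1)]
  have "avg \<rho> \<phi> z \<epsilon> x - avg \<rho> \<phi> w r x = (LINT y|\<rho>. \<phi> (x - z - \<epsilon> *\<^sub>R y) - \<phi> (x - w - r *\<^sub>R y))"
    unfolding avg_def using i by simp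
  also have "\<bar>\<dots>\<bar> \<le> L * (norm (z - w) + \<bar>\<epsilon> - r\<bar>)"
  proof (rule abs_integral_le_AE)
    have "AE y in \<rho>. norm y \<le> 1" using \<rho> by (simp add: disc_prob_def)
    then show "AE y in \<rho>. \<bar>\<phi> (x - z - \<epsilon> *\<^sub>R y) - \<phi> (x - w - r *\<^sub>R y)\<bar> \<le> L * (norm (z - w) + \<bar>\<epsilon> - r\<bar>)"
    proof (rule AE_mp, intro AE_I2 impI)
      fix y :: complex assume y: "norm y \<le> 1"
      have "(x - z - \<epsilon> *\<^sub>R y) - (x - w - r *\<^sub>R y) = - ((z - w) + (\<epsilon> - r) *\<^sub>R y)"
        by (simp add: algebra_simps)
      then have "norm ((x - z - \<epsilon> *\<^sub>R y) - (x - w - r *\<^sub>R y)) \<le> norm (z - w) + norm ((\<epsilon> - r) *\<^sub>R y)"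
        using norm_triangle_ineq[of "z - w" "(\<epsilon> - r) *\<^sub>R y"] by (simp only: norm_minus_cancel)
      also have "\<dots> \<le> norm (z - w) + \<bar>\<epsilon> - r\<bar>"
        using y mult_left_mono[OF y, of "\<bar>\<epsilon> - r\<bar>"] by simp
      finally have "L * norm ((x - z - \<epsilon> *\<^sub>R y) - (x - w - r *\<^sub>R y)) \<le> L * (norm (z - w) + \<bar>\<epsilon> - r\<bar>)"
        using assms(3) by (rule mult_left_mono)
      then show "\<bar>\<phi> (x - z - \<epsilon> *\<^sub>R y) - \<phi> (x - w - r *\<^sub>R y)\<bar> \<le> L * (norm (z - w) + \<bar>\<epsilon> - r\<bar>)"
        using assms(2)[of "x - z - \<epsilon> *\<^sub>R y" "x - w - r *\<^sub>R y"] by linarith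
    qed
  qed (use i in auto)
  finally show ?thesis .
qed

lemma integrable_lborel_prod:
  assumes "smooth_supp R \<phi>"
  shows "integrable (lborel \<Otimes>\<^sub>M \<rho>) (\<lambda>(x, y). \<phi> (x - z - \<epsilon> *\<^sub>R y))"
proof -
  interpret pair_sigma_finite lborel \<rho> ..
  have [measurable_cong]: "sets \<rho> = sets borel" using \<rho> by (simp add: disc_prob_def)
  have [measurable]: "\<phi> \<in> borel_measurable borel"
    using assms smooth_measurable by (auto simp: smooth_supp_def)
  have *: "integrable (\<rho> \<Otimes>\<^sub>M lborel) (\<lambda>(y, x). \<phi> (x - z - \<epsilon> *\<^sub>R y))"
  proof (rule pair_sigma_finite.Fubini_integrable)
    show "pair_sigma_finite \<rho> lborel" ..
    have "(LINT x|lborel. norm (\<phi> (x - z - \<epsilon> *\<^sub>R y))) = (LINT x|lborel. norm (\<phi> x))" for y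
      using lborel_integral_shift[of "\<lambda>x. norm (\<phi> x)" "z + \<epsilon> *\<^sub>R y"] by (simp add: diff_diff_eq)
    then show "integrable \<rho> (\<lambda>y. LINT x|lborel. norm (case (y, x) of (y, x) \<Rightarrow> \<phi> (x - z - \<epsilon> *\<^sub>R y)))"
      by simp
    show "AE y in \<rho>. integrable lborel (\<lambda>x. case (y, x) of (y, x) \<Rightarrow> \<phi> (x - z - \<epsilon> *\<^sub>R y))"
    proof (intro AE_I2)
      fix y
      have "integrable (distr lborel borel ((+) (- (z + \<epsilon> *\<^sub>R y)))) \<phi>"
        using smooth_supp_integrable[OF assms] by (simp add: lborel_distr_plus)
      then have "integrable lborel (\<lambda>x. \<phi> (- (z + \<epsilon> *\<^sub>R y) + x))" by (subst (asm) integrable_distr_eq) auto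
      then show "integrable lborel (\<lambda>x. case (y, x) of (y, x) \<Rightarrow> \<phi> (x - z - \<epsilon> *\<^sub>R y))"
        by (simp add: algebra_simps)
    qed
  qed measurable
  interpret swap: pair_sigma_finite \<rho> lborel ..
  show ?thesis using swap.integrable_product_swap[OF *] by (simp add: case_prod_beta')
qed

lemma integral_avg:
  assumes "smooth_supp R \<phi>"
  shows "(LINT x|lborel. avg \<rho> \<phi> z \<epsilon> x) = (LINT x|lborel. \<phi> x)"
proof -
  interpret pair_sigma_finite lborel \<rho> ..
  have "(LINT x|lborel. avg \<rho> \<phi> z \<epsilon> x) = (LINT y|\<rho>. LINT x|lborel. \<phi> (x - z - \<epsilon> *\<^sub>R y))"
    unfolding avg_def using Fubini_integral[OF integrable_lborel_prod[OF assms]] by simp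
  also have "\<dots> = (LINT y|\<rho>. LINT x|lborel. \<phi> x)"
    using lborel_integral_shift[of \<phi> "z + \<epsilon> *\<^sub>R _"] by (simp add: diff_diff_eq)
  finally show ?thesis by (simp add: prob_space)
qed

lemma avg_nonneg: "(\<And>x. \<phi> x \<ge> 0) \<Longrightarrow> avg \<rho> \<phi> z \<epsilon> x \<ge> 0"
  unfolding avg_def by simp

end

section \<open>Integrability of the logarithmic kernel\<close>

definition disc_area :: real where "disc_area = measure lborel (cball (0::complex) 1)"

lemma emeasure_cball_complex:
  "r \<ge> 0 \<Longrightarrow> emeasure lborel (cball (x::complex) r) = ennreal (disc_area * r\<^sup>2)"
  unfolding disc_area_def by (simp add: emeasure_cball content_cball)

lemma disc_area_nonneg: "disc_area \<ge> 0" by (simp add: disc_area_def)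

text \<open>Counting the radii \<open>s exp (-k)\<close> above \<open>d\<close> turns the logarithm into a sum of indicators of
  concentric discs, whose areas form a geometric series.\<close>

lemma ln_le_count:
  assumes "0 < d" "d < s"
  shows "ennreal (ln (s / d)) \<le> (\<Sum>k. indicator {y. d \<le> s * exp (- real k)} d)"
proof -
  define m where "m = nat \<lfloor>ln (s / d)\<rfloor>"
  have l: "ln (s / d) > 0" using assms by simp
  then have m: "real m \<le> ln (s / d)" "ln (s / d) \<le> real m + 1" unfolding m_def by linarith+
  have "d \<le> s * exp (- real k)" if "k \<in> {..<Suc m}" for k
  proof -
    have "real k \<le> ln (s / d)" using that m by (auto simp: less_Suc_eq_le)
    then have "exp (real k) \<le> s / d" using assms by (subst (asm) ln_ge_iff) auto
    then show ?thesis using assms by (simp add: exp_minus field_simps)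
  qed
  then have "(\<Sum>k\<in>{..<Suc m}. indicator {y. d \<le> s * exp (- real k)} d) = (\<Sum>k\<in>{..<Suc m}. 1 :: ennreal)"
    by (intro sum.cong) auto
  then have "ennreal (ln (s / d)) \<le> (\<Sum>k\<in>{..<Suc m}. indicator {y. d \<le> s * exp (- real k)} d)"
    using m by (simp add: ennreal_of_nat_eq_real_of_nat[symmetric] ennreal_leI flip: of_nat_Suc)
  also have "\<dots> \<le> (\<Sum>k. indicator {y. d \<le> s * exp (- real k)} d)"
    by (rule sum_le_suminf) auto
  finally show ?thesis .
qed

definition log_const :: real where "log_const = disc_area * (\<Sum>k. exp (-2) ^ k)"

lemma nn_integral_log_ball:
  fixes x :: complex
  assumes "s > 0"
  shows "(\<integral>\<^sup>+y. indicator (ball x s) y * ennreal (ln (s / dist x y)) \<partial>lborel) \<le> ennreal (log_const * s\<^sup>2)"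
proof -
  have pw: "indicator (ball x s) y * ennreal (ln (s / dist x y))
      \<le> (\<Sum>k. indicator (cball x (s * exp (- real k))) y)" for y
  proof (cases "y \<in> ball x s \<and> y \<noteq> x")
    case True
    then have "ennreal (ln (s / dist x y)) \<le> (\<Sum>k. indicator {z. dist x y \<le> s * exp (- real k)} (dist x y))"
      by (intro ln_le_count) auto
    also have "\<dots> = (\<Sum>k. indicator (cball x (s * exp (- real k))) y)"
      by (intro suminf_cong) (auto simp: indicator_def)
    finally show ?thesis using True by simp
  qed auto
  have "(\<integral>\<^sup>+y. indicator (ball x s) y * ennreal (ln (s / dist x y)) \<partial>lborel)
      \<le> (\<integral>\<^sup>+y. (\<Sum>k. indicator (cball x (s * exp (- real k))) y) \<partial>lborel)"
    by (rule nn_integral_mono) (rule pw)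
  also have "\<dots> = (\<Sum>k. \<integral>\<^sup>+y. indicator (cball x (s * exp (- real k))) y \<partial>lborel)"
    by (intro nn_integral_suminf) (auto intro!: borel_measurable_indicator borel_closed)
  also have "\<dots> = (\<Sum>k. ennreal ((disc_area * s\<^sup>2) * exp (-2) ^ k))"
  proof (intro suminf_cong)
    fix k
    have "(exp (- real k))\<^sup>2 = exp (-2) ^ k"
      by (simp add: exp_of_nat_mult[symmetric] power2_eq_square exp_add[symmetric])
    then show "(\<integral>\<^sup>+y. indicator (cball x (s * exp (- real k))) y \<partial>lborel) = ennreal ((disc_area * s\<^sup>2) * exp (-2) ^ k)"
      using assms emeasure_cball_complex[of "s * exp (- real k)" x]
      by (subst nn_integral_indicator) (auto simp: power_mult_distrib mult.assoc intro!: borel_closed)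
  qed
  also have "\<dots> = ennreal (\<Sum>k. (disc_area * s\<^sup>2) * exp (-2) ^ k)"
    by (intro suminf_ennreal2 summable_mult summable_geometric mult_nonneg_nonneg disc_area_nonneg) auto
  also have "(\<Sum>k. (disc_area * s\<^sup>2) * exp (-2::real) ^ k) = log_const * s\<^sup>2"
    by (subst suminf_mult) (auto simp: log_const_def intro!: summable_geometric)
  finally show ?thesis .
qed

lemma log_const_nonneg: "log_const \<ge> 0"
  unfolding log_const_def
  by (intro mult_nonneg_nonneg disc_area_nonneg suminf_nonneg summable_geometric) auto

lemma integrable_log_bounded_supp:
  fixes f :: "complex \<Rightarrow> real"
  assumes f: "f \<in> borel_measurable borel" "\<And>x. \<bar>f x\<bar> \<le> C" "\<And>x. norm x > R \<Longrightarrow> f x = 0"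
  shows "integrable lborel (\<lambda>y. ln (1 / dist x y) * f y)"
proof -
  define S where "S = norm x + \<bar>R\<bar> + 1"
  have S: "S > 0" unfolding S_def using norm_ge_zero[of x] by linarith
  have sub: "y \<in> ball x S" if "norm y \<le> R" for y
    using norm_triangle_ineq4[of x y] that by (simp add: S_def dist_norm)
  have iln: "integrable lborel (\<lambda>y. indicator (ball x S) y * ln (S / dist x y))"
  proof (rule integrableI_nonneg)
    have "(\<integral>\<^sup>+y. ennreal (indicator (ball x S) y * ln (S / dist x y)) \<partial>lborel)
        = (\<integral>\<^sup>+y. indicator (ball x S) y * ennreal (ln (S / dist x y)) \<partial>lborel)"
      by (intro nn_integral_cong) (auto simp: indicator_def)
    also have "\<dots> \<le> ennreal (log_const * S\<^sup>2)" by (rule nn_integral_log_ball[OF S])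
    also have "\<dots> < \<infinity>" by simp
    finally show "(\<integral>\<^sup>+y. ennreal (indicator (ball x S) y * ln (S / dist x y)) \<partial>lborel) < \<infinity>" .
    have "0 \<le> indicator (ball x S) y * ln (S / dist x y)" for y
      by (cases "y \<in> ball x S \<and> y \<noteq> x") (auto simp: indicator_def)
    then show "AE y in lborel. 0 \<le> indicator (ball x S) y * ln (S / dist x y)" by simp
  qed (intro borel_measurable_times borel_measurable_indicator borel_open; simp)
  have "integrable lborel (\<lambda>y. C * (indicator (ball x S) y * ln (S / dist x y)) + C * \<bar>ln S\<bar> * indicator (ball x S) y)"
    by (intro Bochner_Integration.integrable_add integrable_mult_right iln integrable_real_indicator)
      (auto simp: emeasure_lborel_ball_finite[unfolded infinity_ennreal_def])
  then show ?thesis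
  proof (rule Bochner_Integration.integrable_bound)
    show "(\<lambda>y. ln (1 / dist x y) * f y) \<in> borel_measurable lborel" using f(1) by simp
    have C: "C \<ge> 0" using f(2)[of 0] abs_ge_zero[of "f 0"] by linarith
    have "norm (ln (1 / dist x y) * f y)
        \<le> C * (indicator (ball x S) y * ln (S / dist x y)) + C * \<bar>ln S\<bar> * indicator (ball x S) y" for y
    proof (cases "y \<in> ball x S \<and> y \<noteq> x")
      case True
      then have d: "dist x y > 0" "dist x y < S" by auto
      then have "ln (1 / dist x y) = ln (S / dist x y) - ln S" "ln (S / dist x y) \<ge> 0" using S
        by (auto simp: ln_div)
      then have "\<bar>ln (1 / dist x y)\<bar> \<le> ln (S / dist x y) + \<bar>ln S\<bar>" by linarith
      then have "\<bar>ln (1 / dist x y)\<bar> * \<bar>f y\<bar> \<le> (ln (S / dist x y) + \<bar>ln S\<bar>) * C"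
        using f(2)[of y] by (intro mult_mono) auto
      then show ?thesis using True by (simp add: abs_mult algebra_simps)
    next
      case False
      then show ?thesis
        using sub[of y] f(3)[of y] C by (cases "y = x"; cases "norm y \<le> R") auto
    qed
    then show "AE y in lborel. norm (ln (1 / dist x y) * f y)
        \<le> norm (C * (indicator (ball x S) y * ln (S / dist x y)) + C * \<bar>ln S\<bar> * indicator (ball x S) y)"
      by (intro AE_I2) (rule order_trans, assumption, simp only: real_norm_def abs_ge_self)
  qed
qed

section \<open>Integration by parts\<close>

text \<open>The integral of a shifted function does not depend on the shift; differentiate.\<close>

lemma integral_dir_deriv_eq_0:
  assumes F: "Ck_on 1 UNIV F" "\<And>x. norm x > R \<Longrightarrow> F x = 0"
  shows "(LINT x|lborel. dir_deriv v F x) = 0"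
proof -
  have diff: "F differentiable (at x)" and cont: "continuous_on UNIV (dir_deriv v F)" for x
    using F(1) by auto
  have contF: "continuous_on UNIV F"
    using diff by (simp add: continuous_at_imp_continuous_on differentiable_imp_continuous_within)
  obtain B where B: "B \<ge> 0" "\<And>x. \<bar>F x\<bar> \<le> B"
    using continuous_supp_bounded[OF contF F(2)] by blast
  have intF: "integrable lborel F"
    using F(2) B(2) contF by (intro integrable_bounded_supp) (auto intro: borel_measurable_continuous_onI)
  have intFs: "integrable lborel (\<lambda>x. F (x + a))" for a
  proof -
    have "integrable (distr lborel borel ((+) a)) F" using intF by (simp add: lborel_distr_plus)
    then have "integrable lborel (\<lambda>x. F (a + x))"
      using contF by (subst (asm) integrable_distr_eq) (auto intro: borel_measurable_continuous_onI)
    then show ?thesis by (simp add: add.commute)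
  qed
  obtain L where L: "L \<ge> 0" "\<And>x y. \<bar>F x - F y\<bar> \<le> L * norm (x - y)"
    using C1_supp_Lipschitz[OF F] by blast
  define s where "s = (\<lambda>n x. real (Suc n) * (F (x + (1 / real (Suc n)) *\<^sub>R v) - F x))"
  have "(\<lambda>n. LINT x|lborel. s n x) \<longlonglongrightarrow> (LINT x|lborel. dir_deriv v F x)"
  proof (rule integral_dominated_convergence[where w = "\<lambda>x. (L * norm v) * indicator (cball 0 (\<bar>R\<bar> + norm v)) x"])
    show "dir_deriv v F \<in> borel_measurable lborel"
      using borel_measurable_continuous_onI[OF cont] by simp
    have "F \<in> borel_measurable borel" by (rule borel_measurable_continuous_onI[OF contF])
    then show "s n \<in> borel_measurable lborel" for n unfolding s_def by measurable
    show "integrable lborel (\<lambda>x::complex. (L * norm v) * indicator (cball 0 (\<bar>R\<bar> + norm v)) x)"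
      by (intro integrable_mult_right integrable_real_indicator) (auto simp: emeasure_lborel_cball_finite[unfolded infinity_ennreal_def])
    show "AE x in lborel. (\<lambda>n. s n x) \<longlonglongrightarrow> dir_deriv v F x"
    proof (intro AE_I2)
      fix x
      have lin: "linear (\<lambda>v. dir_deriv v F x)"
        using has_derivative_linear[OF has_derivative_dir_deriv[OF diff]] .
      have "((\<lambda>t. x + t *\<^sub>R v) has_derivative (\<lambda>s. s *\<^sub>R v)) (at 0)"
        by (auto intro!: derivative_eq_intros)
      note D = has_derivative_compose[OF this has_derivative_dir_deriv[OF diff]]
      have "(\<lambda>s. dir_deriv (s *\<^sub>R v) F (x + 0 *\<^sub>R v)) = (*) (dir_deriv v F x)"
        by (simp add: fun_eq_iff linear_cmul[OF lin])
      with D have "((\<lambda>t. F (x + t *\<^sub>R v)) has_real_derivative dir_deriv v F x) (at 0)"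
        by (simp only: has_field_derivative_def)
      then have lim: "((\<lambda>h. (F (x + h *\<^sub>R v) - F x) / h) \<longlongrightarrow> dir_deriv v F x) (at 0)"
        by (simp add: DERIV_def)
      have "filterlim (\<lambda>n. 1 / real (Suc n)) (at 0) sequentially"
        using LIMSEQ_inverse_real_of_nat by (auto simp: filterlim_at inverse_eq_divide)
      from filterlim_compose[OF lim this] show "(\<lambda>n. s n x) \<longlonglongrightarrow> dir_deriv v F x"
        by (simp add: s_def mult.commute)
    qed
    show "AE x in lborel. norm (s n x) \<le> (L * norm v) * indicator (cball 0 (\<bar>R\<bar> + norm v)) x" for n
    proof (intro AE_I2)
      fix x
      let ?h = "(1 / real (Suc n)) *\<^sub>R v"
      have h: "norm ?h \<le> norm v" by (simp add: divide_le_eq mult_le_cancel_left1)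
      show "norm (s n x) \<le> (L * norm v) * indicator (cball 0 (\<bar>R\<bar> + norm v)) x"
      proof (cases "norm x \<le> \<bar>R\<bar> + norm v")
        case True
        have "norm (s n x) = real (Suc n) * \<bar>F (x + ?h) - F x\<bar>" by (simp add: s_def abs_mult)
        also have "\<dots> \<le> real (Suc n) * (L * norm ?h)"
          using L(2)[of "x + ?h" x] by (intro mult_left_mono) simp_all
        also have "\<dots> = L * norm v" by simp
        finally show ?thesis using True by simp
      next
        case False
        then have "norm x > R" "norm (x + ?h) > R"
          using h norm_triangle_ineq2[of x "- ?h"] norm_ge_zero[of v]
          unfolding norm_minus_cancel diff_minus_eq_add by linarith+
        then show ?thesis using F(2) False by (simp add: s_def)
      qed
    qed
  qed
  moreover have "(LINT x|lborel. s n x) = 0" for n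
    using intF intFs[of "(1 / real (Suc n)) *\<^sub>R v"] lborel_integral_shift[of F "- ((1 / real (Suc n)) *\<^sub>R v)"]
    unfolding s_def by simp
  ultimately have "(\<lambda>n::nat. 0) \<longlonglongrightarrow> (LINT x|lborel. dir_deriv v F x)" by simp
  then show ?thesis using LIMSEQ_unique[OF tendsto_const] by metis
qed

lemma lap_eq_0_outside:
  assumes "\<And>x. x \<notin> K \<Longrightarrow> \<phi> x = 0" "closed K" "x \<notin> K"
  shows "dir_deriv v \<phi> x = 0" "lap \<phi> x = 0"
proof -
  have d: "dir_deriv v \<phi> x = 0" if "x \<notin> K" for v x
    using dir_deriv_cong_open[of "- K" x \<phi> "\<lambda>_. 0" v] assms that by (auto simp: open_Compl)
  show "dir_deriv v \<phi> x = 0" by (rule d[OF assms(3)])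
  have "dir_deriv v (dir_deriv v \<phi>) x = 0" for v
    using dir_deriv_cong_open[of "- K" x "dir_deriv v \<phi>" "\<lambda>_. 0" v] assms d by (auto simp: open_Compl)
  then show "lap \<phi> x = 0" by (simp add: lap_def)
qed

text \<open>Green's second identity: \<open>u \<Delta>\<phi>\<close> is the divergence of the field \<open>u \<nabla>\<phi> - \<phi> \<nabla>u\<close>, which
  extends by zero to the whole plane.\<close>

lemma harmonic_orthogonal_lap:
  assumes u: "harmonic_on S u" and \<phi>: "Ck_on 2 UNIV \<phi>" and K: "compact K" "K \<subseteq> S"
    and zero: "\<And>x. x \<notin> K \<Longrightarrow> \<phi> x = 0"
  shows "(LINT y|lborel. u y * lap \<phi> y) = 0"
proof -
  have S: "open S" and u2: "Ck_on 2 S u" and lu: "\<And>x. x \<in> S \<Longrightarrow> lap u x = 0"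
    using u by (auto simp: harmonic_on_def lap_def)
  have clK: "closed K" using K compact_imp_closed by blast
  obtain R where R: "\<And>x. x \<in> K \<Longrightarrow> norm x \<le> R"
    using compact_imp_bounded[OF K(1)] by (auto simp: bounded_iff)
  define E where "E = (\<lambda>b x. u x * dir_deriv b \<phi> x - \<phi> x * dir_deriv b u x)"
  have E0: "E b x = 0" if "x \<notin> K" for b x
    using zero[OF that] lap_eq_0_outside(1)[OF zero clK that] by (simp add: E_def)
  have E0': "E b x = 0" if "norm x > R" for b x using R[of x] that E0[of x b] by force
  have E1: "Ck_on 1 UNIV (E b)" for b
  proof -
    have "Ck_on 1 S u" "Ck_on 1 S \<phi>" "Ck_on 1 S (dir_deriv b \<phi>)" "Ck_on 1 S (dir_deriv b u)"
      using u2 Ck_on_subset[OF \<phi>, of S] Ck_on_mono[OF u2, of 1] Ck_on_mono[OF Ck_on_subset[OF \<phi>, of S], of 1]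
      by (simp_all add: numeral_2_eq_2)
    then have "Ck_on 1 S (E b)" unfolding E_def by (rule_tac Ck_on_diff[OF S Ck_on_mult[OF S] Ck_on_mult[OF S]])
    moreover have "Ck_on 1 (- K) (E b)"
      using Ck_on_cong[of "- K" "E b" "\<lambda>_. 0" 1] clK E0 Ck_on_const[of 1 "- K" 0] by (auto simp: open_Compl)
    ultimately have "Ck_on 1 (S \<union> - K) (E b)" using clK S by (intro Ck_on_Un) (auto simp: open_Compl)
    moreover have "S \<union> - K = UNIV" using K by auto
    ultimately show ?thesis by simp
  qed
  have dE: "dir_deriv b (E b) x = u x * dir_deriv b (dir_deriv b \<phi>) x - \<phi> x * dir_deriv b (dir_deriv b u) x" for b x
  proof (cases "x \<in> K")
    case True
    then have x: "x \<in> S" using K by auto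
    have d: "u differentiable (at x)" "\<phi> differentiable (at x)" "dir_deriv b \<phi> differentiable (at x)"
      "dir_deriv b u differentiable (at x)"
      using u2 \<phi> x by (auto simp: numeral_2_eq_2)
    show ?thesis unfolding E_def
      using d by (subst dir_deriv_diff) (auto simp: dir_deriv_mult intro: differentiable_mult)
  next
    case False
    have "dir_deriv b (E b) x = 0" by (rule lap_eq_0_outside(1)[OF E0 clK False])
    moreover have "dir_deriv b (dir_deriv b \<phi>) x = 0"
      by (rule lap_eq_0_outside(1)[OF lap_eq_0_outside(1)[OF zero clK] clK False])
    ultimately show ?thesis using zero[OF False] by simp
  qed
  have "u x * lap \<phi> x = dir_deriv 1 (E 1) x + dir_deriv \<i> (E \<i>) x" for x
  proof (cases "x \<in> K")
    case True
    then have "lap u x = 0" using K lu by auto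
    then have "\<phi> x * dir_deriv 1 (dir_deriv 1 u) x + \<phi> x * dir_deriv \<i> (dir_deriv \<i> u) x = 0"
      by (simp add: lap_def Basis_complex_def flip: distrib_left)
    then show ?thesis unfolding dE by (simp add: lap_def Basis_complex_def algebra_simps)
  next
    case False
    then show ?thesis unfolding dE using zero[OF False] by (simp add: lap_def Basis_complex_def algebra_simps)
  qed
  moreover have "integrable lborel (dir_deriv b (E b))" for b
  proof -
    have c: "continuous_on UNIV (dir_deriv b (E b))" using E1[of b] by simp
    have z: "dir_deriv b (E b) x = 0" if "norm x > R" for x
      by (rule dir_deriv_eq_0_outside[OF E0' that])
    obtain B where "\<And>x. \<bar>dir_deriv b (E b) x\<bar> \<le> B"
      using continuous_supp_bounded[OF c z] by blast
    then show ?thesis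
      using z borel_measurable_continuous_onI[OF c] by (intro integrable_bounded_supp)
  qed
  ultimately show ?thesis
    using integral_dir_deriv_eq_0[OF E1 E0'] by simp
qed

section \<open>The regular part of the Green's function\<close>

lemma harmonic_on_log: "harmonic_on (- {x}) (\<lambda>y. ln (dist x y))"
proof -
  define g where "g = (\<lambda>t::real. 1/2 * ln t)"
  have Dg: "Dk_on k {0<..} g" for k
  proof (cases k)
    case (Suc j)
    have "Dk_on j {0<..} (\<lambda>t::real. 1/2 * (1 / t))" by (rule Dk_on_mult[OF _ Dk_on_const Dk_on_inverse]) simp
    then show ?thesis unfolding Suc g_def
      by (rule Dk_on_SucI[rotated 2]) (auto intro!: derivative_eq_intros)
  qed simp
  have eq: "ln (dist x y) = radial g x y" if "y \<in> - {x}" for y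
    using that by (simp add: radial_def g_def ln_realpow dist_norm norm_minus_commute)
  have d1: "deriv g t = 1 / (2 * t)" if "t > 0" for t
    unfolding g_def by (rule DERIV_imp_deriv) (use that in \<open>auto intro!: derivative_eq_intros\<close>)
  have d2: "deriv (deriv g) t = - 1 / (2 * t\<^sup>2)" if "t > 0" for t
  proof -
    have "((\<lambda>t. 1 / (2 * t)) has_real_derivative - 1 / (2 * t\<^sup>2)) (at t)"
      using that by (auto intro!: derivative_eq_intros simp: power2_eq_square field_simps)
    then have "(deriv g has_real_derivative - 1 / (2 * t\<^sup>2)) (at t)"
      by (rule has_field_derivative_transform_within_open[of _ _ _ "{0<..}"]) (use that d1 in auto)
    then show ?thesis by (rule DERIV_imp_deriv)
  qed
  have op: "open (- {x})" by auto
  have "Ck_on 2 (- {x}) (radial g x)"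
    by (rule Ck_on_radial[OF op _ _ Dg]) auto
  then have "Ck_on 2 (- {x}) (\<lambda>y. ln (dist x y))"
    using Ck_on_cong[OF op, of "\<lambda>y. ln (dist x y)" "radial g x" 2] eq by blast
  moreover have "lap (\<lambda>y. ln (dist x y)) y = 0" if "y \<in> - {x}" for y
  proof -
    have t: "(norm (y - x))\<^sup>2 > 0" using that by simp
    have "lap (\<lambda>y. ln (dist x y)) y = lap (radial g x) y" by (rule lap_cong_open[OF op that eq])
    also have "\<dots> = 4 * (deriv g ((norm (y - x))\<^sup>2) + (norm (y - x))\<^sup>2 * deriv (deriv g) ((norm (y - x))\<^sup>2))"
      by (subst lap_radial[OF _ Dg]) (use t in \<open>auto simp: radial_def\<close>)
    also have "\<dots> = 0" unfolding d1[OF t] d2[OF t] using t by (simp add: power2_eq_square field_simps)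
    finally show ?thesis .
  qed
  ultimately show ?thesis by (auto simp: harmonic_on_def lap_def)
qed

lemma harmonic_on_add:
  assumes "harmonic_on S u" "harmonic_on S w" shows "harmonic_on S (\<lambda>x. u x + w x)"
  using assms lap_add[of S u w] unfolding harmonic_on_def lap_def[symmetric]
  by (auto intro: Ck_on_add)

lemma harmonic_on_subset: "harmonic_on S u \<Longrightarrow> open T \<Longrightarrow> T \<subseteq> S \<Longrightarrow> harmonic_on T u"
  unfolding harmonic_on_def by (auto intro: Ck_on_subset)

text \<open>The annulus is covered by \<open>n + 1\<close> shells of ratio \<open>e\<close>, each of which contributes a bounded
  amount.\<close>

lemma integral_inverse_square_annulus:
  fixes x :: complex
  defines "J \<equiv> \<lambda>n y. if exp (- real n) \<le> norm (y - x) \<and> norm (y - x) \<le> 1 then 1 / (norm (y - x))\<^sup>2 else 0"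
  shows "integrable lborel (J n)" "(LINT y|lborel. J n y) \<le> disc_area * exp 2 * (real n + 1)"
proof -
  define U where "U = (\<lambda>y. \<Sum>k\<le>n. exp (2 * (real k + 1)) * indicat_real (cball x (exp (- real k))) y)"
  have le: "J n y \<le> U y" for y
  proof (cases "exp (- real n) \<le> norm (y - x) \<and> norm (y - x) \<le> 1")
    case True
    define r where "r = norm (y - x)"
    have r: "exp (- real n) \<le> r" "r \<le> 1" using True by (auto simp: r_def)
    then have r0: "r > 0" using exp_gt_zero[of "- real n"] by linarith
    define k where "k = nat \<lfloor>- ln r\<rfloor>"
    have "- real n \<le> ln r" "ln r \<le> 0" using r r0 by (auto simp: ln_ge_iff)
    then have k: "real k \<le> - ln r" "- ln r \<le> real k + 1" "k \<le> n" unfolding k_def by linarith+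
    have "1 / r\<^sup>2 = exp (2 * (- ln r))"
      using r0 by (simp add: exp_minus exp_double inverse_eq_divide power_divide)
    also have "\<dots> \<le> exp (2 * (real k + 1))" using k by simp
    finally have "J n y \<le> exp (2 * (real k + 1))" using True by (simp add: J_def r_def)
    also have "\<dots> = exp (2 * (real k + 1)) * indicat_real (cball x (exp (- real k))) y"
    proof -
      have "ln r \<le> - real k" using k by simp
      then have "r \<le> exp (- real k)" using r0 by (metis exp_le_cancel_iff exp_ln)
      then show ?thesis by (simp add: r_def dist_norm norm_minus_commute)
    qed
    also have "\<dots> \<le> U y"
      unfolding U_def by (rule member_le_sum[of k "{..n}"]) (use k in auto)
    finally show ?thesis .
  next
    case False
    then show ?thesis unfolding J_def U_def by (auto intro!: sum_nonneg)
  qed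
  have J0: "J n y \<ge> 0" for y by (simp add: J_def)
  have intind: "integrable lborel (indicat_real (cball x r))" for r
    by (intro integrable_real_indicator) (auto simp: emeasure_lborel_cball_finite[unfolded infinity_ennreal_def])
  have U: "integrable lborel U" unfolding U_def
    by (intro Bochner_Integration.integrable_sum integrable_mult_right intind)
  have meas: "J n \<in> borel_measurable lborel" unfolding J_def by measurable
  show int: "integrable lborel (J n)"
    by (rule Bochner_Integration.integrable_bound[OF U meas])
      (use le J0 in \<open>auto intro!: AE_I2 order_trans[OF le abs_ge_self] simp: abs_of_nonneg\<close>)
  have "(LINT y|lborel. J n y) \<le> (LINT y|lborel. U y)" by (rule integral_mono[OF int U le])
  also have "\<dots> = (\<Sum>k\<le>n. exp (2 * (real k + 1)) * measure lborel (cball x (exp (- real k))))"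
    unfolding U_def by (subst Bochner_Integration.integral_sum) (auto intro!: intind)
  also have "\<dots> = (\<Sum>k\<le>n. disc_area * exp 2)"
  proof (intro sum.cong refl)
    fix k
    have "measure lborel (cball x (exp (- real k))) = disc_area * (exp (- real k))\<^sup>2"
      using emeasure_cball_complex[of "exp (- real k)" x] disc_area_nonneg by (simp add: measure_def)
    moreover have "exp (2 * (real k + 1)) * (exp (- real k))\<^sup>2 = exp 2"
      by (simp add: exp_double[symmetric] exp_add[symmetric])
    ultimately show "exp (2 * (real k + 1)) * measure lborel (cball x (exp (- real k))) = disc_area * exp 2"
      by (simp add: mult.left_commute)
  qed
  also have "\<dots> = disc_area * exp 2 * (real n + 1)" by simp
  finally show "(LINT y|lborel. J n y) \<le> disc_area * exp 2 * (real n + 1)" .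
qed

text \<open>A cutoff that is constant outside the annulus \<open>exp (-3n/4) \<le> |y - x| \<le> exp (-n/2)\<close> and varies
  there on a logarithmic scale, so that the integral of its absolute Laplacian is of order \<open>1/n\<close>.\<close>

definition log_cutoff :: "complex \<Rightarrow> nat \<Rightarrow> complex \<Rightarrow> real" where
  "log_cutoff x n = radial (\<lambda>t. if t > 0 then step (1 / (2 * real n) * ln t + 1) else 0) x"

lemma deriv_step_bounded: obtains S where "S \<ge> 0" "\<And>t. \<bar>deriv step t\<bar> \<le> S" "\<And>t. \<bar>deriv (deriv step) t\<bar> \<le> S"
proof -
  have b: "\<exists>L\<ge>0. \<forall>t. \<bar>f t\<bar> \<le> L" if "\<And>t. isCont f t" "\<And>t. t < 1/4 \<or> t > 1/2 \<Longrightarrow> f t = 0" for f :: "real \<Rightarrow> real"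
  proof -
    have "compact (f ` {1/4..1/2})"
      using that(1) by (intro compact_continuous_image continuous_at_imp_continuous_on) auto
    then obtain L where L: "\<And>t. t \<in> {1/4..1/2} \<Longrightarrow> \<bar>f t\<bar> \<le> L"
      using compact_imp_bounded[of "f ` {1/4..1/2}"] unfolding bounded_iff by (metis imageI real_norm_def)
    have "\<bar>f t\<bar> \<le> max L 0" for t
      using L[of t] that(2)[of t] by (cases "1/4 \<le> t \<and> t \<le> 1/2") (auto simp: le_max_iff_disj)
    then show ?thesis by (intro exI[of _ "max L 0"]) auto
  qed
  have c1: "isCont (deriv step) t" for t
    using Dk_on_deriv_step[of 1] by (simp add: differentiable_imp_continuous_within)
  have c2: "isCont (deriv (deriv step)) t" for t
    using Dk_on_deriv_step[of "Suc (Suc 0)"] by (simp add: differentiable_imp_continuous_within)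
  have z2: "deriv (deriv step) t = 0" if "t < 1/4 \<or> t > 1/2" for t
  proof -
    have "deriv (deriv step) t = deriv (\<lambda>_. 0) t"
      by (intro deriv_cong_ev eventually_mono[OF eventually_nhds_in_open[of "{..<1/4} \<union> {1/2<..}"]])
        (use that in \<open>auto intro!: deriv_step_eq_0\<close>)
    then show ?thesis by simp
  qed
  obtain S1 where S1: "S1 \<ge> 0" "\<And>t. \<bar>deriv step t\<bar> \<le> S1" using b[OF c1] deriv_step_eq_0 by force
  obtain S2 where S2: "S2 \<ge> 0" "\<And>t. \<bar>deriv (deriv step) t\<bar> \<le> S2" using b[OF c2 z2] by blast
  show ?thesis
    by (rule that[of "max S1 S2"]) (use S1 S2 in \<open>auto simp: le_max_iff_disj\<close>)
qed

lemma log_cutoff_props: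
  fixes x y :: complex
  assumes n: "n > 0"
  defines "a \<equiv> 1 / (2 * real n)"
  defines "\<tau> \<equiv> \<lambda>y. a * ln ((norm (y - x))\<^sup>2) + 1"
  shows "Ck_on k UNIV (log_cutoff x n)"
    and "norm (y - x) \<le> exp (- 3/4 * real n) \<Longrightarrow> log_cutoff x n y = 0"
    and "norm (y - x) \<ge> exp (- 1/2 * real n) \<Longrightarrow> log_cutoff x n y = 1"
    and "y \<noteq> x \<Longrightarrow> dir_deriv v (log_cutoff x n) y
      = 2 * ((y - x) \<bullet> v) * (deriv step (\<tau> y) * a / (norm (y - x))\<^sup>2)"
    and "y \<noteq> x \<Longrightarrow> lap (log_cutoff x n) y = 4 * (deriv (deriv step) (\<tau> y) * a\<^sup>2 / (norm (y - x))\<^sup>2)"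
    and "y \<noteq> x \<Longrightarrow> norm (y - x) < exp (- 3/4 * real n) \<or> norm (y - x) > exp (- 1/2 * real n) \<Longrightarrow>
      deriv step (\<tau> y) = 0 \<and> deriv (deriv step) (\<tau> y) = 0"
    and "0 \<le> log_cutoff x n y \<and> log_cutoff x n y \<le> 1"
proof -
  define g where "g = (\<lambda>t. if t > 0 then step (a * ln t + 1) else 0)"
  have q: "log_cutoff x n = radial g x" unfolding log_cutoff_def g_def a_def by (rule refl)
  have a0: "a > 0" using n by (simp add: a_def)
  have ln2: "ln ((norm (y - x))\<^sup>2) = 2 * ln (norm (y - x))" if "y \<noteq> x" for y
    using that by (simp add: ln_realpow)
  have \<tau>: "\<tau> y = ln (norm (y - x)) / real n + 1" if "y \<noteq> x" for y
    using n by (simp add: \<tau>_def ln2[OF that] a_def)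
  have g0: "g t = 0" if "t < exp (- 3/2 * real n)" for t
  proof (cases "t > 0")
    case True
    then have "ln t < - 3/2 * real n" using that by (metis exp_less_cancel_iff exp_ln)
    then have "a * ln t \<le> a * (- 3/2 * real n)" using a0 by (intro mult_left_mono) auto
    also have "\<dots> = - 3/4" using n by (simp add: a_def)
    finally have "a * ln t + 1 \<le> 1/4" by simp
    then show ?thesis by (simp add: g_def step_0)
  qed (simp add: g_def)
  have Dg: "Dk_on k UNIV g" for k
  proof -
    have "Dk_on k {0<..} (\<lambda>t. step (a * ln t + 1))" by (rule Dk_on_ln[OF Dk_on_step])
    then have "Dk_on k {0<..} g"
      using Dk_on_cong[of "{0<..}" g "\<lambda>t. step (a * ln t + 1)" k] by (auto simp: g_def)
    moreover have "Dk_on k {..<exp (- 3/2 * real n)} g"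
      using Dk_on_cong[of "{..<exp (- 3/2 * real n)}" g "\<lambda>t. 0" k] g0 by auto
    ultimately have "Dk_on k ({0<..} \<union> {..<exp (- 3/2 * real n)}) g" by (rule Dk_on_Un)
    moreover have "{0<..} \<union> {..<exp (- 3/2 * real n)} = UNIV"
    proof -
      have "s > 0 \<or> s < exp (- 3/2 * real n)" for s :: real
        using exp_gt_zero[of "- 3/2 * real n"] by linarith
      then show ?thesis by auto
    qed
    ultimately show ?thesis by simp
  qed
  show "Ck_on k UNIV (log_cutoff x n)" unfolding q by (rule Ck_on_radial[OF _ open_UNIV _ Dg]) auto
  show "log_cutoff x n y = 0" if "norm (y - x) \<le> exp (- 3/4 * real n)"
  proof (cases "y = x")
    case False
    then have p: "norm (y - x) > 0" by simp
    have "ln (norm (y - x)) \<le> - 3/4 * real n" using p that by (metis exp_le_cancel_iff exp_ln)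
    then have "\<tau> y \<le> 1/4" unfolding \<tau>[OF False] using n by (simp add: field_simps)
    then show ?thesis using p by (simp add: q radial_def g_def step_0 \<tau>_def)
  qed (simp add: q radial_def g_def)
  show "log_cutoff x n y = 1" if "norm (y - x) \<ge> exp (- 1/2 * real n)"
  proof -
    have p: "norm (y - x) > 0" using that exp_gt_zero[of "- 1/2 * real n"] by linarith
    then have ne: "y \<noteq> x" by auto
    have "ln (norm (y - x)) \<ge> - 1/2 * real n" using p that by (metis exp_le_cancel_iff exp_ln)
    then have "\<tau> y \<ge> 1/2" unfolding \<tau>[OF ne] using n by (simp add: field_simps)
    then show ?thesis using p by (simp add: q radial_def g_def step_1 \<tau>_def)
  qed
  have lin: "((\<lambda>t. a * ln t + 1) has_real_derivative a / t) (at t)" if "t > 0" for t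
    using that by (auto intro!: derivative_eq_intros)
  have dd: "deriv step differentiable (at t)" for t using Dk_on_deriv_step[of 1] by simp
  have d1: "deriv g t = deriv step (a * ln t + 1) * (a / t)" if "t > 0" for t
  proof -
    have "((\<lambda>t. step (a * ln t + 1)) has_real_derivative deriv step (a * ln t + 1) * (a / t)) (at t)"
      by (rule DERIV_chain2[OF differentiable_deriv[OF step_differentiable] lin[OF that]])
    then have "(g has_real_derivative deriv step (a * ln t + 1) * (a / t)) (at t)"
      by (rule has_field_derivative_transform_within_open[of _ _ _ "{0<..}"]) (use that in \<open>auto simp: g_def\<close>)
    then show ?thesis by (rule DERIV_imp_deriv)
  qed
  have d2: "deriv g t + t * deriv (deriv g) t = deriv (deriv step) (a * ln t + 1) * (a\<^sup>2 / t)" if "t > 0" for t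
  proof -
    have "(deriv g has_real_derivative deriv (deriv g) t) (at t)"
      using Dg[of "Suc (Suc 0)"] by (intro differentiable_deriv) simp
    then have "((\<lambda>t. t * deriv g t) has_real_derivative 1 * deriv g t + deriv (deriv g) t * t) (at t)"
      by (rule DERIV_mult[OF DERIV_ident])
    then have A: "((\<lambda>t. deriv step (a * ln t + 1) * a) has_real_derivative 1 * deriv g t + deriv (deriv g) t * t) (at t)"
      by (rule has_field_derivative_transform_within_open[of _ _ _ "{0<..}"]) (use that in \<open>auto simp: d1\<close>)
    have "((\<lambda>t. deriv step (a * ln t + 1) * a) has_real_derivative
        deriv (deriv step) (a * ln t + 1) * (a / t) * a) (at t)"
      by (rule DERIV_cmult_right[OF DERIV_chain2[OF differentiable_deriv[OF dd] lin[OF that]]])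
    from DERIV_unique[OF A this] show ?thesis by (simp add: power2_eq_square mult.commute)
  qed
  show "dir_deriv v (log_cutoff x n) y = 2 * ((y - x) \<bullet> v) * (deriv step (\<tau> y) * a / (norm (y - x))\<^sup>2)"
    if "y \<noteq> x"
  proof -
    have "g differentiable (at ((norm (y - x))\<^sup>2))" using Dg[of 1] by simp
    from dir_deriv_radial[OF this] show ?thesis
      using that by (simp add: q radial_def d1 \<tau>_def)
  qed
  show "lap (log_cutoff x n) y = 4 * (deriv (deriv step) (\<tau> y) * a\<^sup>2 / (norm (y - x))\<^sup>2)" if "y \<noteq> x"
  proof -
    have "(norm (y - x))\<^sup>2 > 0" using that by simp
    from d2[OF this] show ?thesis
      using lap_radial[OF open_UNIV Dg, of y x] by (simp add: q radial_def \<tau>_def)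
  qed
  show "deriv step (\<tau> y) = 0 \<and> deriv (deriv step) (\<tau> y) = 0"
    if "y \<noteq> x" "norm (y - x) < exp (- 3/4 * real n) \<or> norm (y - x) > exp (- 1/2 * real n)"
  proof -
    have p: "norm (y - x) > 0" using that by simp
    have "ln (norm (y - x)) < - 3/4 * real n \<or> ln (norm (y - x)) > - 1/2 * real n"
      using p that(2) by (metis exp_less_cancel_iff exp_ln)
    then have t: "\<tau> y < 1/4 \<or> \<tau> y > 1/2" unfolding \<tau>[OF that(1)] using n by (auto simp: field_simps)
    then have "deriv step (\<tau> y) = 0" using deriv_step_eq_0 by auto
    moreover have "deriv (deriv step) (\<tau> y) = deriv (\<lambda>_. 0) (\<tau> y)"
      by (intro deriv_cong_ev eventually_mono[OF eventually_nhds_in_open[of "{..<1/4} \<union> {1/2<..}"]])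
        (use t in \<open>auto intro!: deriv_step_eq_0\<close>)
    ultimately show ?thesis by simp
  qed
  have mono: "step s \<le> step t" if "s \<le> t" for s t
  proof (rule DERIV_nonneg_imp_nondecreasing[OF that])
    fix x show "\<exists>y. (step has_real_derivative y) (at x) \<and> 0 \<le> y"
      by (intro exI[of _ "deriv step x"] conjI differentiable_deriv step_differentiable deriv_step_nonneg)
  qed
  have "0 \<le> step t \<and> step t \<le> 1" for t
    using mono[of "min t 0" t] mono[of t "max t 1"] step_0[of "min t 0"] step_1[of "max t 1"] by simp
  then show "0 \<le> log_cutoff x n y \<and> log_cutoff x n y \<le> 1" by (simp add: q radial_def g_def)
qed

lemma singular_mult_measurable:
  fixes w f :: "complex \<Rightarrow> real"
  assumes D: "open D" and w: "continuous_on (D - {x}) w" and f: "f \<in> borel_measurable borel"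
    and f0: "\<And>y. y \<notin> D \<Longrightarrow> f y = 0"
  shows "(\<lambda>y. w y * f y) \<in> borel_measurable borel"
proof -
  have "open (D - {x})" using D by (simp add: open_Diff)
  then have "(\<lambda>y. indicator (D - {x}) y *\<^sub>R w y) \<in> borel_measurable borel"
    using w by (intro borel_measurable_continuous_on_indicator) auto
  then have "(\<lambda>y. (indicator (D - {x}) y *\<^sub>R w y) * f y + indicator {x} y * (w x * f x)) \<in> borel_measurable borel"
    using f by measurable
  moreover have "(\<lambda>y. (indicator (D - {x}) y *\<^sub>R w y) * f y + indicator {x} y * (w x * f x)) = (\<lambda>y. w y * f y)"
    using f0 by (auto simp: indicator_def fun_eq_iff)
  ultimately show ?thesis by simp
qed

text \<open>A bounded harmonic function does not see an isolated point.  The product of \<open>\<phi>\<close> with the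
  logarithmic cutoff vanishes near \<open>x\<close>, so the previous identity applies to it; the terms in which
  the cutoff is differentiated are of order \<open>1/(n r)\<^sup>2\<close> on an annulus of logarithmic width
  proportional to \<open>n\<close>, so their integral is of order \<open>1/n\<close>.\<close>

lemma harmonic_orthogonal_lap_removable:
  assumes D: "open D" and w: "harmonic_on (D - {x}) w"
    and K: "compact K" "K \<subseteq> D" and wC: "\<And>y. y \<in> K - {x} \<Longrightarrow> \<bar>w y\<bar> \<le> C"
    and sm: "smooth \<phi>" and zero: "\<And>y. y \<notin> K \<Longrightarrow> \<phi> y = 0"
  shows "integrable lborel (\<lambda>y. w y * lap \<phi> y)" "(LINT y|lborel. w y * lap \<phi> y) = 0"
proof -
  have \<phi>k: "Ck_on k UNIV \<phi>" for k using sm by (simp add: smooth_def)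
  have clK: "closed K" using K compact_imp_closed by blast
  obtain R where R: "\<And>x. x \<in> K \<Longrightarrow> norm x \<le> R"
    using compact_imp_bounded[OF K(1)] by (auto simp: bounded_iff)
  have zR: "\<phi> y = 0" if "norm y > R" for y using R[of y] that zero[of y] by force
  have contw: "continuous_on (D - {x}) w"
    using w Ck_on_mono[of 2 "D - {x}" w 0] by (simp add: harmonic_on_def)
  have ss: "smooth_supp R \<phi>" using sm zR by (simp add: smooth_supp_def)
  obtain B0 where B0: "B0 \<ge> 0" "\<And>y. \<bar>\<phi> y\<bar> \<le> B0" using smooth_supp_bounded[OF ss] by blast
  obtain B1 where B1: "B1 \<ge> 0" "\<And>y. \<bar>dir_deriv 1 \<phi> y\<bar> \<le> B1"
    using smooth_supp_bounded[OF smooth_supp_dir_deriv[OF ss]] by blast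
  obtain B2 where B2: "B2 \<ge> 0" "\<And>y. \<bar>dir_deriv \<i> \<phi> y\<bar> \<le> B2"
    using smooth_supp_bounded[OF smooth_supp_dir_deriv[OF ss]] by blast
  obtain S where S: "S \<ge> 0" "\<And>t. \<bar>deriv step t\<bar> \<le> S" "\<And>t. \<bar>deriv (deriv step) t\<bar> \<le> S"
    using deriv_step_bounded by blast
  have out1: "dir_deriv v \<phi> y = 0" if "y \<notin> K" for v y using lap_eq_0_outside(1)[OF zero clK that] .
  have out2: "lap \<phi> y = 0" if "y \<notin> K" for y using lap_eq_0_outside(2)[OF zero clK that] .
  have lapc: "continuous_on UNIV (lap \<phi>)" using lap_Ck[of 0 UNIV \<phi>] \<phi>k by simp
  have lap0: "lap \<phi> y = 0" if "norm y > R" for y using R[of y] that out2[of y] by force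
  obtain BL where BL: "BL \<ge> 0" "\<And>y. \<bar>lap \<phi> y\<bar> \<le> BL" using continuous_supp_bounded[OF lapc lap0] by blast
  \<comment> \<open>The value of \<open>w\<close> at \<open>x\<close> itself is arbitrary.\<close>
  define C' where "C' = \<bar>C\<bar> + \<bar>w x\<bar>"
  have wC': "\<bar>w y\<bar> \<le> C'" if "y \<in> K" for y using wC[of y] that by (cases "y = x") (auto simp: C'_def)
  have C'0: "C' \<ge> 0" by (simp add: C'_def)
  show int: "integrable lborel (\<lambda>y. w y * lap \<phi> y)"
  proof (rule integrable_bounded_supp)
    show "(\<lambda>y. w y * lap \<phi> y) \<in> borel_measurable borel"
      by (rule singular_mult_measurable[OF D contw borel_measurable_continuous_onI[OF lapc] out2])
        (use K in auto)
    show "\<bar>w y * lap \<phi> y\<bar> \<le> C' * BL" for y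
    proof (cases "y \<in> K")
      case True
      then show ?thesis unfolding abs_mult using wC' BL C'0 by (intro mult_mono) auto
    next
      case False then show ?thesis using out2[OF False] C'0 BL by simp
    qed
    show "w y * lap \<phi> y = 0" if "norm y > R" for y using lap0[OF that] by simp
  qed
  define m where "m = Suc"
  have m0: "m n > 0" and m1: "real (m n) \<ge> 1" for n by (simp_all add: m_def)
  define q where "q = (\<lambda>n. log_cutoff x (m n))"
  note cut = log_cutoff_props[OF m0]
  define err where "err = (\<lambda>n y. \<phi> y * lap (q n) y + 2 * (\<Sum>b\<in>Basis. dir_deriv b \<phi> y * dir_deriv b (q n) y))"
  have qk: "Ck_on k UNIV (q n)" for k n unfolding q_def by (rule cut(1))
  have prod: "lap (\<lambda>y. \<phi> y * q n y) y = err n y + lap \<phi> y * q n y" for n y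
    using lap_mult[OF \<phi>k qk open_UNIV, of y] by (simp add: err_def)
  have key: "(LINT y|lborel. w y * lap (\<lambda>y. \<phi> y * q n y) y) = 0" for n
  proof (rule harmonic_orthogonal_lap[OF w])
    show "Ck_on 2 UNIV (\<lambda>y. \<phi> y * q n y)" by (rule Ck_on_mult[OF open_UNIV \<phi>k qk])
    let ?K = "K \<inter> {y. norm (y - x) \<ge> exp (- 3/4 * real (m n))}"
    have "closed {y. norm (y - x) \<ge> exp (- 3/4 * real (m n))}"
      by (intro closed_Collect_le continuous_intros)
    then show "compact ?K" using K(1) by (rule compact_Int_closed[rotated])
    show "?K \<subseteq> D - {x}" using K(2) by auto
    show "\<phi> y * q n y = 0" if "y \<notin> ?K" for y
      using that zero[of y] cut(2)[where x = x and y = y] unfolding q_def by (cases "y \<in> K") auto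
  qed
  define J where "J = (\<lambda>n y. if exp (- real (n::nat)) \<le> norm (y - x) \<and> norm (y - x) \<le> 1 then 1 / (norm (y - x))\<^sup>2 else 0)"
  define Q where "Q = C' * (B0 * S + 4 * (B1 + B2) * S)"
  have Q0: "Q \<ge> 0" unfolding Q_def using C'0 B0 B1 B2 S by simp
  have err_le: "\<bar>w y * err n y\<bar> \<le> Q / (real (m n))\<^sup>2 * J (m n) y" for n y
  proof (cases "y \<in> K \<and> y \<noteq> x")
    case True
    let ?m = "real (m n)"
    define a where "a = 1 / (2 * ?m)"
    define \<tau> where "\<tau> = a * ln ((norm (y - x))\<^sup>2) + 1"
    define r where "r = norm (y - x)"
    have ne: "y \<noteq> x" and r0: "r > 0" using True by (auto simp: r_def)
    have m: "?m \<ge> 1" by (rule m1)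
    have a0: "a > 0" using m by (simp add: a_def)
    have am: "a * ?m = 1/2" using m by (simp add: a_def)
    have dq: "dir_deriv v (q n) y = 2 * ((y - x) \<bullet> v) * (deriv step \<tau> * a * (1 / r\<^sup>2))" for v
      unfolding q_def \<tau>_def a_def r_def using cut(4)[OF ne] by simp
    have lq: "lap (q n) y = 4 * (deriv (deriv step) \<tau> * a\<^sup>2 * (1 / r\<^sup>2))"
      unfolding q_def \<tau>_def a_def r_def using cut(5)[OF ne] by simp
    show ?thesis
    proof (cases "exp (- 3/4 * ?m) \<le> r \<and> r \<le> exp (- 1/2 * ?m)")
      case A: True
      have "exp (- ?m) \<le> exp (- 3/4 * ?m)" using m by (subst exp_le_cancel_iff) linarith
      moreover have "exp (- 1/2 * ?m) \<le> 1" by simp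
      ultimately have "exp (- ?m) \<le> r" "r \<le> 1" using A by linarith+
      then have J: "J (m n) y = 1 / r\<^sup>2" by (simp add: J_def r_def)
      \<comment> \<open>The gradient of the cutoff is only of order \<open>1/(m r)\<close>; the annulus lies so close to \<open>x\<close> that
        the missing factor \<open>1/(m r)\<close> can be inserted.\<close>
      have r2: "r \<le> 2 / ?m"
      proof -
        have "1 + ?m / 2 \<le> exp (?m / 2)" by (rule exp_ge_add_one_self)
        then have e: "?m / 2 \<le> exp (?m / 2)" by linarith
        have "exp (- 1/2 * ?m) = 1 / exp (?m / 2)" by (simp add: exp_minus inverse_eq_divide)
        also have "\<dots> \<le> 1 / (?m / 2)" using e m by (intro divide_left_mono) auto
        finally show ?thesis using A by simp
      qed
      have lq': "\<bar>lap (q n) y\<bar> \<le> S / ?m\<^sup>2 * (1 / r\<^sup>2)"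
      proof -
        have "\<bar>lap (q n) y\<bar> = 4 * \<bar>deriv (deriv step) \<tau>\<bar> * a\<^sup>2 * (1 / r\<^sup>2)"
          unfolding lq by (simp add: abs_mult)
        also have "\<dots> \<le> 4 * S * a\<^sup>2 * (1 / r\<^sup>2)" using S by (intro mult_right_mono mult_left_mono) auto
        also have "4 * S * a\<^sup>2 = S / ?m\<^sup>2" by (simp add: a_def power_mult_distrib power_divide)
        finally show ?thesis .
      qed
      have dq': "\<bar>dir_deriv b (q n) y\<bar> \<le> 2 * S / ?m\<^sup>2 * (1 / r\<^sup>2)" if "norm b = 1" for b
      proof -
        have "\<bar>dir_deriv b (q n) y\<bar> = 2 * \<bar>(y - x) \<bullet> b\<bar> * (\<bar>deriv step \<tau>\<bar> * a * (1 / r\<^sup>2))"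
          unfolding dq using a0 by (simp add: abs_mult)
        also have "\<dots> \<le> 2 * (2 / ?m) * (S * a * (1 / r\<^sup>2))"
          using S a0 r2 Cauchy_Schwarz_ineq2[of "y - x" b] that m
          by (intro mult_mono) (auto simp: r_def[symmetric])
        also have "\<dots> = 2 * S / ?m\<^sup>2 * (1 / r\<^sup>2)" by (simp add: a_def power2_eq_square)
        finally show ?thesis .
      qed
      let ?X = "1 / r\<^sup>2 / ?m\<^sup>2"
      have "\<bar>err n y\<bar> \<le> \<bar>\<phi> y\<bar> * \<bar>lap (q n) y\<bar> + 2 * (\<bar>dir_deriv 1 \<phi> y\<bar> * \<bar>dir_deriv 1 (q n) y\<bar> + \<bar>dir_deriv \<i> \<phi> y\<bar> * \<bar>dir_deriv \<i> (q n) y\<bar>)"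
        unfolding err_def Basis_complex_def abs_mult[symmetric] by simp
      also have "\<dots> \<le> B0 * (S / ?m\<^sup>2 * (1 / r\<^sup>2)) + 2 * (B1 * (2 * S / ?m\<^sup>2 * (1 / r\<^sup>2)) + B2 * (2 * S / ?m\<^sup>2 * (1 / r\<^sup>2)))"
        using B0 B1 B2 lq' dq'[of 1] dq'[of \<i>] by (intro add_mono mult_mono mult_left_mono) auto
      also have "\<dots> = (B0 * S + 4 * (B1 + B2) * S) * ?X" by (simp add: algebra_simps add_divide_distrib)
      finally have "\<bar>err n y\<bar> \<le> (B0 * S + 4 * (B1 + B2) * S) * ?X" .
      then have "\<bar>w y\<bar> * \<bar>err n y\<bar> \<le> C' * ((B0 * S + 4 * (B1 + B2) * S) * ?X)"
        using wC'[of y] True C'0 by (intro mult_mono) auto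
      moreover have "Q / ?m\<^sup>2 * (1 / r\<^sup>2) = C' * ((B0 * S + 4 * (B1 + B2) * S) * ?X)"
        unfolding Q_def by (simp only: divide_inverse mult_ac mult_1_left)
      ultimately show ?thesis unfolding J abs_mult by simp
    next
      case False
      then have "deriv step \<tau> = 0 \<and> deriv (deriv step) \<tau> = 0"
        using log_cutoff_props(6)[OF m0[of n], where y = y and x = x] ne unfolding \<tau>_def a_def r_def by linarith
      then have "err n y = 0" using dq lq by (simp add: err_def)
      then show ?thesis using Q0 by (simp add: J_def)
    qed
  next
    case False
    then consider "y \<notin> K" | "y = x" by blast
    then show ?thesis
    proof cases
      case 1
      then have "err n y = 0" using zero[OF 1] out1[OF 1] by (simp add: err_def Basis_complex_def)
      then show ?thesis using Q0 by (simp add: J_def)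
    next
      case 2
      have op: "open (ball x (exp (- 3/4 * real (m n))))" and xin: "x \<in> ball x (exp (- 3/4 * real (m n)))" by auto
      have q0: "q n y = 0" if "y \<in> ball x (exp (- 3/4 * real (m n)))" for y
        unfolding q_def by (rule cut(2)) (use that in \<open>simp add: dist_norm norm_minus_commute\<close>)
      have "lap (q n) x = lap (\<lambda>_. 0) x" by (rule lap_cong_open[OF op xin q0])
      moreover have "lap (\<lambda>_. 0) x = 0"
      proof -
        have "dir_deriv b (\<lambda>_. 0) = (\<lambda>_. 0)" for b by auto
        then show ?thesis by (simp add: lap_def)
      qed
      moreover have "dir_deriv b (q n) x = 0" for b
      proof -
        have "dir_deriv b (q n) x = dir_deriv b (\<lambda>_. 0) x" by (rule dir_deriv_cong_open[OF op xin q0])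
        then show ?thesis by simp
      qed
      ultimately have "err n y = 0" using 2 by (simp add: err_def)
      then show ?thesis using Q0 by (simp add: J_def)
    qed
  qed
  have Jint: "integrable lborel (J n)" "(LINT y|lborel. J n y) \<le> disc_area * exp 2 * (real n + 1)" for n
    unfolding J_def by (rule integral_inverse_square_annulus)+
  have J_int: "integrable lborel (\<lambda>y. Q / (real (m n))\<^sup>2 * J (m n) y)" for n
    by (rule integrable_mult_right[OF Jint(1)])
  have qle: "norm (w y * (lap \<phi> y * q n y)) \<le> norm (w y * lap \<phi> y)" for n y
  proof -
    have "\<bar>q n y\<bar> \<le> 1" using log_cutoff_props(7)[OF m0[of n], where y = y and x = x] unfolding q_def by linarith
    then have "\<bar>w y * lap \<phi> y\<bar> * \<bar>q n y\<bar> \<le> \<bar>w y * lap \<phi> y\<bar>" by (rule mult_left_le) simp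
    then show ?thesis by (simp add: abs_mult mult.assoc)
  qed
  have hint: "integrable lborel (\<lambda>y. w y * (lap \<phi> y * q n y))" for n
  proof (rule Bochner_Integration.integrable_bound[OF int])
    have "continuous_on UNIV (q n)" using qk[of 0 n] by simp
    then have "q n \<in> borel_measurable borel" by (rule borel_measurable_continuous_onI)
    then have "(\<lambda>y. (w y * lap \<phi> y) * q n y) \<in> borel_measurable lborel"
      using borel_measurable_integrable[OF int] by (intro borel_measurable_times[of "\<lambda>y. w y * lap \<phi> y"]) simp_all
    then show "(\<lambda>y. w y * (lap \<phi> y * q n y)) \<in> borel_measurable lborel" by (simp add: mult.assoc)
    show "AE y in lborel. norm (w y * (lap \<phi> y * q n y)) \<le> norm (w y * lap \<phi> y)" by (intro AE_I2 qle)
  qed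
  have wq: "w y * lap (\<lambda>y. \<phi> y * q n y) y = w y * err n y + w y * (lap \<phi> y * q n y)" for n y
    unfolding prod by (simp add: algebra_simps)
  have eint: "integrable lborel (\<lambda>y. w y * err n y)" for n
  proof (rule Bochner_Integration.integrable_bound[OF J_int[of n]])
    have c: "continuous_on UNIV (err n)"
    proof -
      have "continuous_on UNIV (lap (q n))" using lap_Ck[of 0 UNIV "q n"] qk by simp
      moreover have "continuous_on UNIV \<phi>" using \<phi>k[of 0] by simp
      moreover have "continuous_on UNIV (dir_deriv b \<phi>)" "continuous_on UNIV (dir_deriv b (q n))" for b
        using \<phi>k[of "Suc 0"] qk[of "Suc 0" n] by simp_all
      ultimately show ?thesis unfolding err_def by (intro continuous_intros)
    qed
    have "err n y = 0" if "y \<notin> D" for y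
    proof -
      have "y \<notin> K" using that K(2) by auto
      then show ?thesis using zero out1 by (simp add: err_def Basis_complex_def)
    qed
    then show "(\<lambda>y. w y * err n y) \<in> borel_measurable lborel"
      using singular_mult_measurable[OF D contw borel_measurable_continuous_onI[OF c]] by simp
    show "AE y in lborel. norm (w y * err n y) \<le> norm (Q / (real (m n))\<^sup>2 * J (m n) y)"
      unfolding real_norm_def by (intro AE_I2 order_trans[OF err_le abs_ge_self])
  qed
  have sum0: "(LINT y|lborel. w y * (lap \<phi> y * q n y)) = - (LINT y|lborel. w y * err n y)" for n
    using key[of n] eint[of n] hint[of n] unfolding wq by simp
  have e_small: "\<bar>LINT y|lborel. w y * err n y\<bar> \<le> Q * disc_area * exp 2 * 2 / real (m n)" for n
  proof -
    have "\<bar>LINT y|lborel. w y * err n y\<bar> \<le> (LINT y|lborel. Q / (real (m n))\<^sup>2 * J (m n) y)"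
      using Bochner_Integration.integral_norm_bound_integral[OF eint J_int] err_le by simp
    also have "\<dots> = Q / (real (m n))\<^sup>2 * (LINT y|lborel. J (m n) y)" by simp
    also have "\<dots> \<le> Q / (real (m n))\<^sup>2 * (disc_area * exp 2 * (real (m n) + 1))"
      using Q0 by (intro mult_left_mono Jint(2)) auto
    also have "\<dots> \<le> Q / (real (m n))\<^sup>2 * (disc_area * exp 2 * (2 * real (m n)))"
      using Q0 disc_area_nonneg m1[of n] by (intro mult_left_mono) auto
    also have "\<dots> = Q * disc_area * exp 2 * 2 / real (m n)" using m0[of n] by (simp add: power2_eq_square)
    finally show ?thesis .
  qed
  have "(\<lambda>n. LINT y|lborel. w y * (lap \<phi> y * q n y)) \<longlonglongrightarrow> 0"
  proof (rule Lim_null_comparison)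
    show "\<forall>\<^sub>F n in sequentially. norm (LINT y|lborel. w y * (lap \<phi> y * q n y)) \<le> Q * disc_area * exp 2 * 2 / real (m n)"
      using e_small by (simp add: sum0)
    have "(\<lambda>n. (Q * disc_area * exp 2 * 2) * inverse (real (Suc n))) \<longlonglongrightarrow> (Q * disc_area * exp 2 * 2) * 0"
      by (intro tendsto_mult tendsto_const LIMSEQ_inverse_real_of_nat)
    then show "(\<lambda>n. Q * disc_area * exp 2 * 2 / real (m n)) \<longlonglongrightarrow> 0" unfolding m_def by (simp add: divide_inverse)
  qed
  moreover have "(\<lambda>n. LINT y|lborel. w y * (lap \<phi> y * q n y)) \<longlonglongrightarrow> (LINT y|lborel. w y * lap \<phi> y)"
  proof (rule integral_dominated_convergence[where w = "\<lambda>y. norm (w y * lap \<phi> y)"])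
    show "(\<lambda>y. w y * lap \<phi> y) \<in> borel_measurable lborel" using int by auto
    show "(\<lambda>y. w y * (lap \<phi> y * q n y)) \<in> borel_measurable lborel" for n using hint by auto
    show "integrable lborel (\<lambda>y. norm (w y * lap \<phi> y))" using int by (rule integrable_norm)
    show "AE y in lborel. norm (w y * (lap \<phi> y * q n y)) \<le> norm (w y * lap \<phi> y)" for n
      by (intro AE_I2 qle)
    have "AE y in lborel. y \<noteq> x" by (rule AE_lborel_singleton)
    then show "AE y in lborel. (\<lambda>n. w y * (lap \<phi> y * q n y)) \<longlonglongrightarrow> w y * lap \<phi> y"
    proof (rule AE_mp, intro AE_I2 impI)
      fix y assume "y \<noteq> x"
      then have p: "norm (y - x) > 0" by simp
      have "\<forall>\<^sub>F n in sequentially. real n \<ge> - 2 * ln (norm (y - x))"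
        using filterlim_real_sequentially unfolding filterlim_at_top by blast
      then have "\<forall>\<^sub>F n in sequentially. w y * (lap \<phi> y * q n y) = w y * lap \<phi> y"
      proof (rule eventually_mono)
        fix n assume "real n \<ge> - 2 * ln (norm (y - x))"
        then have "- 1/2 * real (m n) \<le> ln (norm (y - x))" unfolding m_def by (auto simp: field_simps)
        then have "exp (- 1/2 * real (m n)) \<le> norm (y - x)" using p by (metis exp_le_cancel_iff exp_ln)
        then show "w y * (lap \<phi> y * q n y) = w y * lap \<phi> y"
          using log_cutoff_props(3)[OF m0[of n], where y = y and x = x] by (simp add: q_def)
      qed
      then show "(\<lambda>n. w y * (lap \<phi> y * q n y)) \<longlonglongrightarrow> w y * lap \<phi> y" by (rule tendsto_eventually)
    qed
  qed
  ultimately show "(LINT y|lborel. w y * lap \<phi> y) = 0" using LIMSEQ_unique by blast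
qed

text \<open>The regular part \<open>G x y + ln |x - y|\<close> is harmonic off \<open>x\<close> and bounded on compact sets, hence
  orthogonal to Laplacians.\<close>

lemma green_function_lap:
  assumes D: "open D" and G: "green_function D G" and x: "x \<in> D"
    and K: "compact K" "K \<subseteq> D" and sm: "smooth \<phi>" and zero: "\<And>y. y \<notin> K \<Longrightarrow> \<phi> y = 0"
  shows "integrable lborel (\<lambda>y. G x y * lap \<phi> y)"
    and "(LINT y|lborel. G x y * lap \<phi> y) = (LINT y|lborel. ln (1 / dist x y) * lap \<phi> y)"
proof -
  define w where "w = (\<lambda>y. G x y + ln (dist x y))"
  have h1: "harmonic_on (D - {x}) (G x)"
    and bd: "\<And>\<delta>. \<delta> > 0 \<Longrightarrow> bounded (G x ` (D - ball x \<delta>))"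
    and O: "(\<lambda>y. G x y - ln (1 / dist x y)) \<in> O[at x](\<lambda>_. 1)"
    using G x by (auto simp: green_function_def)
  have h2: "harmonic_on (D - {x}) (\<lambda>y. ln (dist x y))"
    by (rule harmonic_on_subset[OF harmonic_on_log]) (use D in \<open>auto simp: open_Diff\<close>)
  have w: "harmonic_on (D - {x}) w" unfolding w_def by (rule harmonic_on_add[OF h1 h2])
  from O obtain c where "eventually (\<lambda>y. norm (G x y - ln (1 / dist x y)) \<le> c * norm (1::real)) (at x)"
    by (elim landau_o.bigE)
  then obtain \<delta> where \<delta>: "\<delta> > 0" "\<And>y. y \<noteq> x \<Longrightarrow> dist y x < \<delta> \<Longrightarrow> \<bar>G x y - ln (1 / dist x y)\<bar> \<le> c"
    unfolding eventually_at by auto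
  obtain B where B: "\<And>y. y \<in> D - ball x \<delta> \<Longrightarrow> \<bar>G x y\<bar> \<le> B"
    using bd[OF \<delta>(1)] unfolding bounded_iff by (metis imageI real_norm_def)
  obtain R where R: "\<And>y. y \<in> K \<Longrightarrow> norm y \<le> R"
    using compact_imp_bounded[OF K(1)] by (auto simp: bounded_iff)
  define m where "m = norm x + R"
  define C where "C = \<bar>c\<bar> + (\<bar>B\<bar> + (\<bar>ln \<delta>\<bar> + \<bar>ln m\<bar>))"
  have wC: "\<bar>w y\<bar> \<le> C" if y: "y \<in> K - {x}" for y
  proof (cases "dist y x < \<delta>")
    case True
    have "dist x y > 0" using y by auto
    then have "w y = G x y - ln (1 / dist x y)" by (simp add: w_def ln_div)
    then show ?thesis using \<delta>(2)[of y] True y unfolding C_def by auto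
  next
    case False
    then have "\<bar>G x y\<bar> \<le> B" using y K by (intro B) (auto simp: dist_commute)
    moreover have "ln \<delta> \<le> ln (dist x y)" using False \<delta>(1) by (subst ln_le_cancel_iff) (auto simp: dist_commute)
    moreover have "ln (dist x y) \<le> ln m"
    proof -
      have "dist x y \<le> m" using R[of y] y norm_triangle_ineq4[of x y] by (simp add: m_def dist_norm)
      moreover have "0 < dist x y" using y by auto
      ultimately show ?thesis by (intro ln_mono) auto
    qed
    ultimately show ?thesis unfolding C_def w_def by linarith
  qed
  note rem = harmonic_orthogonal_lap_removable[OF D w K wC sm zero]
  have \<phi>k: "Ck_on k UNIV \<phi>" for k using sm by (simp add: smooth_def)
  have clK: "closed K" using K compact_imp_closed by blast
  have lapc: "continuous_on UNIV (lap \<phi>)" using lap_Ck[of 0 UNIV \<phi>] \<phi>k by simp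
  have out2: "lap \<phi> y = 0" if "y \<notin> K" for y
    by (rule lap_eq_0_outside(2)[where K = K]) (use zero clK that in auto)
  have lap0: "lap \<phi> y = 0" if "norm y > R" for y using R[of y] that out2[of y] by force
  obtain BL where BL: "BL \<ge> 0" "\<And>y. \<bar>lap \<phi> y\<bar> \<le> BL" using continuous_supp_bounded[OF lapc lap0] by blast
  have il: "integrable lborel (\<lambda>y. ln (1 / dist x y) * lap \<phi> y)"
    using integrable_log_bounded_supp[OF borel_measurable_continuous_onI[OF lapc] BL(2) lap0] .
  have eq: "G x y * lap \<phi> y = w y * lap \<phi> y + ln (1 / dist x y) * lap \<phi> y" if "y \<noteq> x" for y
    using that by (simp add: w_def ln_div algebra_simps)
  have AEeq: "AE y in lborel. w y * lap \<phi> y + ln (1 / dist x y) * lap \<phi> y = G x y * lap \<phi> y"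
    using AE_lborel_singleton[of x] by (rule AE_mp) (use eq in auto)
  have int: "integrable lborel (\<lambda>y. w y * lap \<phi> y + ln (1 / dist x y) * lap \<phi> y)"
    by (intro Bochner_Integration.integrable_add rem(1) il)
  have "(\<lambda>y. G x y * lap \<phi> y) \<in> borel_measurable borel"
  proof (rule singular_mult_measurable[OF D _ borel_measurable_continuous_onI[OF lapc]])
    show "continuous_on (D - {x}) (G x)"
      using h1 Ck_on_mono[of 2 "D - {x}" "G x" 0] by (simp add: harmonic_on_def)
  qed (use out2 K in auto)
  then have m: "(\<lambda>y. G x y * lap \<phi> y) \<in> borel_measurable lborel" by simp
  show "integrable lborel (\<lambda>y. G x y * lap \<phi> y)"
    using integrable_cong_AE[OF borel_measurable_integrable[OF int] m AEeq] int by simp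
  have "(LINT y|lborel. G x y * lap \<phi> y) = (LINT y|lborel. w y * lap \<phi> y + ln (1 / dist x y) * lap \<phi> y)"
    using integral_cong_AE[OF borel_measurable_integrable[OF int] m AEeq] by simp
  also have "\<dots> = (LINT y|lborel. ln (1 / dist x y) * lap \<phi> y)"
    using rem il by simp
  finally show "(LINT y|lborel. G x y * lap \<phi> y) = (LINT y|lborel. ln (1 / dist x y) * lap \<phi> y)" .
qed

text \<open>Tested against the Laplacian \<open>bump 1 - bump s\<close>, the logarithm gives a quantity that grows like
  \<open>ln s\<close>, but a function that is bounded outside the unit disc gives a bounded one, since for
  \<open>s \<ge> 2\<close> the wide bump lives there.\<close>

lemma not_green_function_UNIV: "\<not> green_function UNIV G"
proof
  assume G: "green_function UNIV G"
  have "bounded (G 0 ` (UNIV - ball 0 1))" using G by (auto simp: green_function_def)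
  then obtain A where A: "\<And>y. y \<in> UNIV - ball 0 1 \<Longrightarrow> \<bar>G 0 y\<bar> \<le> A"
    unfolding bounded_iff by (metis imageI real_norm_def)
  have cG: "continuous_on (UNIV - {0}) (G 0)"
    using G Ck_on_mono[of 2 "UNIV - {0}" "G 0" 0] by (auto simp: green_function_def harmonic_on_def)
  have A0: "A \<ge> 0" using A[of 2] abs_ge_zero[of "G 0 2"] by (auto intro: order_trans)
  define I1 where "I1 = (LINT y|lborel. G 0 y * bump 1 y)"
  define c1 where "c1 = (LINT y|lborel. ln (1 / dist 0 y) * bump 1 y)"
  have main: "ln (s / 2) \<le> I1 + A - c1" if s: "s \<ge> 2" for s
  proof -
    have sp: "s > 0" using s by simp
    obtain \<Phi> where \<Phi>: "smooth_supp (max 1 s) \<Phi>" "\<And>y. lap \<Phi> y = bump 1 y - bump s y"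
      using bump_diff_eq_lap[of 1 s] sp by auto
    have zero: "\<Phi> y = 0" if "y \<notin> cball 0 (max 1 s)" for y using that \<Phi>(1) by (simp add: smooth_supp_def not_le)
    have sm: "smooth \<Phi>" using \<Phi> by (simp add: smooth_supp_def)
    note g = green_function_lap[where K = "cball 0 (max 1 s)", OF open_UNIV G UNIV_I[of 0] compact_cball subset_UNIV sm zero, unfolded \<Phi>(2)]
    obtain B where B: "\<And>y. \<bar>bump s y\<bar> \<le> B" using smooth_supp_bounded[OF smooth_supp_bump[OF sp]] by blast
    have b0: "bump s y = 0" if "norm y < 1" for y by (rule bump_eq_0[OF sp]) (use that s in auto)
    have Gs: "\<bar>G 0 y * bump s y\<bar> \<le> A * bump s y" for y
      using A[of y] b0[of y] bump_nonneg[of s y] by (cases "norm y < 1") (auto simp: abs_mult intro!: mult_right_mono)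
    have m: "(\<lambda>y. G 0 y * bump s y) \<in> borel_measurable borel"
      by (rule singular_mult_measurable[OF open_UNIV cG smooth_measurable[OF smooth_bump]]) auto
    have ib: "integrable lborel (bump s)" "integrable lborel (bump 1)"
      using smooth_supp_integrable[OF smooth_supp_bump] sp by auto
    have igs: "integrable lborel (\<lambda>y. G 0 y * bump s y)"
    proof (rule Bochner_Integration.integrable_bound[of lborel "\<lambda>y. A * bump s y"])
      show "AE y in lborel. norm (G 0 y * bump s y) \<le> norm (A * bump s y)"
        using Gs by (intro AE_I2) (auto intro: order_trans[OF Gs abs_ge_self])
    qed (use ib m in auto)
    have ig1: "integrable lborel (\<lambda>y. G 0 y * bump 1 y)"
      using Bochner_Integration.integrable_add[OF g(1) igs] by (simp add: algebra_simps)
    have il: "integrable lborel (\<lambda>y. ln (1 / dist 0 y) * bump r y)" if r: "r > 0" for r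
    proof -
      obtain B where "\<And>y. \<bar>bump r y\<bar> \<le> B" using smooth_supp_bounded[OF smooth_supp_bump[OF r]] by blast
      then show ?thesis
        using smooth_supp_bump[OF r] by (intro integrable_log_bounded_supp[of _ _ r] smooth_measurable) (auto simp: smooth_supp_def)
    qed
    have "I1 - (LINT y|lborel. G 0 y * bump s y) = c1 - (LINT y|lborel. ln (1 / dist 0 y) * bump s y)"
      using g(2) ig1 igs il[of 1] il[OF sp] by (simp add: I1_def c1_def right_diff_distrib)
    moreover have "(LINT y|lborel. G 0 y * bump s y) \<ge> - A"
    proof -
      have "(LINT y|lborel. - (A * bump s y)) \<le> (LINT y|lborel. G 0 y * bump s y)"
        using Gs by (intro integral_mono igs) (use ib in \<open>auto simp: abs_le_iff minus_le_iff\<close>)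
      then show ?thesis using integral_bump[OF sp] by simp
    qed
    moreover have "(LINT y|lborel. ln (1 / dist 0 y) * bump s y) \<le> - ln (s / 2)"
    proof -
      have "ln (1 / dist 0 y) * bump s y \<le> - ln (s / 2) * bump s y" for y
      proof (cases "norm y < s / 2")
        case True
        then show ?thesis using bump_eq_0[OF sp] by simp
      next
        case False
        then have "ln (s / 2) \<le> ln (norm y)" using sp by (subst ln_le_cancel_iff) auto
        moreover have "ln (1 / dist 0 y) = - ln (norm y)" using False sp by (subst ln_div) auto
        ultimately show ?thesis using bump_nonneg[of s y] by (intro mult_right_mono) auto
      qed
      then have "(LINT y|lborel. ln (1 / dist 0 y) * bump s y) \<le> (LINT y|lborel. - ln (s / 2) * bump s y)"
        by (intro integral_mono il sp integrable_mult_right ib)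
      then show ?thesis using integral_bump[OF sp] by simp
    qed
    ultimately show ?thesis by linarith
  qed
  have "ln (2 * exp (\<bar>I1 + A - c1\<bar> + 1) / 2) \<le> I1 + A - c1" by (rule main) simp
  then show False by simp
qed

section \<open>Test functions and their Laplacians\<close>

lemma test_functionsI:
  assumes "smooth f" "compact K" "K \<subseteq> D" "\<And>y. y \<notin> K \<Longrightarrow> f y = 0"
  shows "f \<in> test_functions D"
proof -
  have "fun_support f \<subseteq> K"
    unfolding fun_support_def using assms by (intro closure_minimal compact_imp_closed) auto
  moreover have "closed (fun_support f)" by (simp add: fun_support_def)
  ultimately have "compact (fun_support f)"
    using compact_Int_closed[OF assms(2), of "fun_support f"] by (simp add: Int_absorb1)
  then show ?thesis using assms \<open>fun_support f \<subseteq> K\<close> by (auto simp: test_functions_def)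
qed

lemma smooth_supp_schwartz:
  assumes "smooth_supp R f" shows "f \<in> schwartz"
proof -
  have "bounded (range (\<lambda>x. (1 + norm x) ^ j * iter_deriv vs f x))" for j vs
  proof -
    obtain L where L: "L \<ge> 0" "\<And>x. \<bar>iter_deriv vs f x\<bar> \<le> L"
      using smooth_supp_bounded[OF smooth_supp_iter_deriv[OF assms]] by blast
    have "\<bar>(1 + norm x) ^ j * iter_deriv vs f x\<bar> \<le> (1 + \<bar>R\<bar>) ^ j * L" for x
    proof (cases "norm x > R")
      case True
      then have "iter_deriv vs f x = 0" using smooth_supp_iter_deriv[OF assms] by (simp add: smooth_supp_def)
      then show ?thesis using L by simp
    next
      case False
      then have "(1 + norm x) ^ j \<le> (1 + \<bar>R\<bar>) ^ j" by (intro power_mono) auto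
      then have "(1 + norm x) ^ j * \<bar>iter_deriv vs f x\<bar> \<le> (1 + \<bar>R\<bar>) ^ j * L"
        using L by (intro mult_mono) auto
      then show ?thesis by (simp add: abs_mult)
    qed
    then show ?thesis unfolding bounded_iff by auto
  qed
  then show ?thesis using assms by (simp add: schwartz_def smooth_supp_def)
qed

lemma smooth_lap: "smooth f \<Longrightarrow> smooth (lap f)"
  unfolding smooth_def by (auto intro!: lap_Ck)

lemma smooth_supp_lap: "smooth_supp R f \<Longrightarrow> smooth_supp R (lap f)"
proof -
  assume f: "smooth_supp R f"
  have "lap f x = 0" if "norm x > R" for x
    using smooth_supp_dir_deriv[OF smooth_supp_dir_deriv[OF f]] that by (simp add: lap_def smooth_supp_def)
  then show ?thesis using f smooth_lap by (auto simp: smooth_supp_def)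
qed

lemma integral_lap: assumes "smooth_supp R f" shows "(LINT x|lborel. lap f x) = 0"
proof -
  have d: "(LINT x|lborel. dir_deriv b (dir_deriv b f) x) = 0" for b
    using smooth_supp_dir_deriv[OF assms, of b]
    by (intro integral_dir_deriv_eq_0[of _ R]) (auto simp: smooth_supp_def smooth_def)
  have i: "integrable lborel (dir_deriv b (dir_deriv b f))" for b
    by (rule smooth_supp_integrable[OF smooth_supp_dir_deriv[OF smooth_supp_dir_deriv[OF assms]]])
  show ?thesis unfolding lap_def Basis_complex_def using d i by simp
qed

section \<open>Centred Gaussian variables\<close>

text \<open>Completing the square.\<close>

lemma normal_density_exp_shift:
  assumes "s > 0"
  shows "exp (l * x) * normal_density 0 s x = exp (l\<^sup>2 * s\<^sup>2 / 2) * normal_density (l * s\<^sup>2) s x"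
proof -
  have "l * x + - (x - 0)\<^sup>2 / (2 * s\<^sup>2) = l\<^sup>2 * s\<^sup>2 / 2 + - (x - l * s\<^sup>2)\<^sup>2 / (2 * s\<^sup>2)"
  proof -
    have q: "s\<^sup>2 > 0" using assms by simp
    have "(x - l * s\<^sup>2)\<^sup>2 = x\<^sup>2 + s\<^sup>2 * (l\<^sup>2 * s\<^sup>2 - 2 * l * x)"
      by (simp add: power2_eq_square algebra_simps)
    then have "(x - l * s\<^sup>2)\<^sup>2 / (2 * s\<^sup>2) = x\<^sup>2 / (2 * s\<^sup>2) + (l\<^sup>2 * s\<^sup>2 - 2 * l * x) / 2"
      using q by (simp add: add_divide_distrib)
    then show ?thesis by (simp add: diff_divide_distrib)
  qed
  then have "exp (l * x) * exp (- (x - 0)\<^sup>2 / (2 * s\<^sup>2)) = exp (l\<^sup>2 * s\<^sup>2 / 2) * exp (- (x - l * s\<^sup>2)\<^sup>2 / (2 * s\<^sup>2))"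
    by (simp only: exp_add[symmetric])
  then show ?thesis by (simp add: normal_density_def mult.left_commute)
qed

locale gaussian_variable = prob_space +
  fixes X :: "'a \<Rightarrow> real" assumes gaussian: "centered_gaussian M X"
begin

lemma measurable_X [measurable]: "X \<in> borel_measurable M"
  using gaussian by (simp add: centered_gaussian_def)

lemma cases_gaussian:
  obtains (zero) "distr M borel X = return borel 0"
  | (normal) s where "s > 0" "distr M borel X = density lborel (\<lambda>x. ennreal (normal_density 0 s x))"
proof -
  obtain s where s: "s \<ge> 0" and d: "distr M borel X =
      (if s = 0 then return borel 0 else density lborel (\<lambda>x. ennreal (normal_density 0 s x)))"
    using gaussian unfolding centered_gaussian_def by blast
  show ?thesis
  proof (cases "s = 0")
    case True
    then show ?thesis using d zero by simp
  next
    case False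
    then show ?thesis using d s normal[of s] by simp
  qed
qed

lemma square_integrable: "integrable M (\<lambda>\<omega>. (X \<omega>)\<^sup>2)"
proof (cases rule: cases_gaussian)
  case zero
  have "AE x in return borel (0::real). x = 0" by (subst AE_return) auto
  then have "AE x in distr M borel X. x = 0" by (simp only: zero)
  then have "AE \<omega> in M. X \<omega> = 0" by (rule AE_distrD[OF measurable_X])
  then have "integrable M (\<lambda>\<omega>. (X \<omega>)\<^sup>2) = integrable M (\<lambda>\<omega>. 0 :: real)"
    by (intro integrable_cong_AE) auto
  then show ?thesis by simp
next
  case (normal s)
  have "integrable (distr M borel X) (\<lambda>x. x\<^sup>2)"
    unfolding normal(2) using integrable_normal_moment[OF normal(1), of 0 2]
    by (subst integrable_density) auto
  then show ?thesis by (subst (asm) integrable_distr_eq) auto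
qed

lemma second_moment_normal:
  assumes s: "s > 0" and d: "distr M borel X = density lborel (\<lambda>x. ennreal (normal_density 0 s x))"
  shows "(LINT \<omega>|M. (X \<omega>)\<^sup>2) = s\<^sup>2"
proof -
  have "(LINT \<omega>|M. (X \<omega>)\<^sup>2) = (LINT x|distr M borel X. x\<^sup>2)" by (subst integral_distr) auto
  also have "\<dots> = (LINT x|lborel. normal_density 0 s x * x\<^sup>2)"
    unfolding d by (subst integral_density) auto
  also have "\<dots> = s\<^sup>2" using integral_normal_moment_even[OF s, of 0 1] by simp
  finally show ?thesis .
qed

lemma second_moment_zero:
  assumes d: "distr M borel X = return borel 0"
  shows "(LINT \<omega>|M. (X \<omega>)\<^sup>2) = 0"
proof -
  have "(LINT \<omega>|M. (X \<omega>)\<^sup>2) = (LINT x|distr M borel X. x\<^sup>2)" by (subst integral_distr) auto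
  also have "\<dots> = 0" unfolding d by (subst integral_return) auto
  finally show ?thesis .
qed

text \<open>The Chernoff bound, in a form that is monotone in the variance.\<close>

lemma tail_bound:
  assumes "t > 0" "V > 0" "(LINT \<omega>|M. (X \<omega>)\<^sup>2) \<le> V"
  shows "measure M {\<omega> \<in> space M. \<bar>X \<omega>\<bar> \<ge> t} \<le> 2 * exp (- t\<^sup>2 / (2 * V))"
proof (cases rule: cases_gaussian)
  case zero
  have "measure M {\<omega> \<in> space M. \<bar>X \<omega>\<bar> \<ge> t} = measure (distr M borel X) {x. \<bar>x\<bar> \<ge> t}"
    by (subst measure_distr) (auto intro!: arg_cong[where f = "measure M"])
  also have "\<dots> = 0" unfolding zero using assms(1) by (subst measure_return) auto
  finally show ?thesis by simp
next
  case (normal s)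
  have one: "measure M {\<omega> \<in> space M. \<sigma> * X \<omega> \<ge> t} \<le> exp (- t\<^sup>2 / (2 * s\<^sup>2))" if \<sigma>: "\<sigma> = 1 \<or> \<sigma> = -1" for \<sigma> :: real
  proof -
    define l where "l = \<sigma> * t / s\<^sup>2"
    have \<sigma>2: "\<sigma> * \<sigma> = 1" using \<sigma> by auto
    have "measure M {\<omega> \<in> space M. \<sigma> * X \<omega> \<ge> t} = measure (distr M borel X) {x. \<sigma> * x \<ge> t}"
      by (subst measure_distr) (auto intro!: arg_cong[where f = "measure M"])
    also have "\<dots> = (LINT x|distr M borel X. indicator {x. \<sigma> * x \<ge> t} x)"
    proof -
      have "{x. \<sigma> * x \<ge> t} \<in> sets borel" by measurable
      then show ?thesis by simp
    qed
    also have "\<dots> = (LINT x|lborel. normal_density 0 s x * indicator {x. \<sigma> * x \<ge> t} x)"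
      unfolding normal(2) by (subst integral_density) (auto)
    also have "\<dots> \<le> (LINT x|lborel. exp (- t\<^sup>2 / (2 * s\<^sup>2)) * normal_density (l * s\<^sup>2) s x)"
    proof (rule integral_mono)
      show "integrable lborel (\<lambda>x. normal_density 0 s x * indicator {x. \<sigma> * x \<ge> t} x)"
        by (rule Bochner_Integration.integrable_bound[OF integrable_normal_density[OF normal(1), of 0]])
          (auto simp: indicator_def)
      show "integrable lborel (\<lambda>x. exp (- t\<^sup>2 / (2 * s\<^sup>2)) * normal_density (l * s\<^sup>2) s x)"
        using integrable_normal_density[OF normal(1)] by auto
      fix x
      have e: "- t\<^sup>2 / (2 * s\<^sup>2) = l\<^sup>2 * s\<^sup>2 / 2 - t\<^sup>2 / s\<^sup>2"
      proof -
        have "l\<^sup>2 * s\<^sup>2 = (\<sigma> * \<sigma>) * (t\<^sup>2 / s\<^sup>2)" using normal(1) by (simp add: l_def power2_eq_square)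
        then show ?thesis unfolding \<sigma>2 by simp
      qed
      have "normal_density 0 s x * indicator {x. \<sigma> * x \<ge> t} x \<le> exp (l * x - t\<^sup>2 / s\<^sup>2) * normal_density 0 s x"
      proof (cases "\<sigma> * x \<ge> t")
        case True
        have "t * t \<le> t * (\<sigma> * x)" using True assms(1) by (intro mult_left_mono) auto
        then have "t\<^sup>2 / s\<^sup>2 \<le> t * (\<sigma> * x) / s\<^sup>2" unfolding power2_eq_square[of t]
          by (intro divide_right_mono) auto
        then have "t\<^sup>2 / s\<^sup>2 \<le> l * x" by (simp add: l_def mult.assoc mult.left_commute)
        then have "1 \<le> exp (l * x - t\<^sup>2 / s\<^sup>2)" by simp
        from mult_right_mono[OF this normal_density_nonneg[of 0 s x]] show ?thesis using True by simp
      qed simp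
      also have "\<dots> = exp (- (t\<^sup>2 / s\<^sup>2)) * (exp (l * x) * normal_density 0 s x)"
        unfolding mult.assoc[symmetric] mult_exp_exp by (simp only: diff_conv_add_uminus add.commute)
      also have "\<dots> = exp (- t\<^sup>2 / (2 * s\<^sup>2)) * normal_density (l * s\<^sup>2) s x"
      proof -
        have "exp (- (t\<^sup>2 / s\<^sup>2)) * exp (l\<^sup>2 * s\<^sup>2 / 2) = exp (- t\<^sup>2 / (2 * s\<^sup>2))"
          unfolding e mult_exp_exp by simp
        then show ?thesis
          unfolding normal_density_exp_shift[OF normal(1)] by (simp only: mult.assoc[symmetric])
      qed
      finally show "normal_density 0 s x * indicator {x. \<sigma> * x \<ge> t} x
        \<le> exp (- t\<^sup>2 / (2 * s\<^sup>2)) * normal_density (l * s\<^sup>2) s x" .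
    qed
    also have "\<dots> = exp (- t\<^sup>2 / (2 * s\<^sup>2))" using integral_normal_density[OF normal(1)] by simp
    finally show ?thesis .
  qed
  have "measure M {\<omega> \<in> space M. \<bar>X \<omega>\<bar> \<ge> t}
      \<le> measure M ({\<omega> \<in> space M. 1 * X \<omega> \<ge> t} \<union> {\<omega> \<in> space M. (-1) * X \<omega> \<ge> t})"
    by (intro finite_measure_mono) auto
  also have "\<dots> \<le> measure M {\<omega> \<in> space M. 1 * X \<omega> \<ge> t} + measure M {\<omega> \<in> space M. (-1) * X \<omega> \<ge> t}"
    by (intro measure_Un_le) measurable
  also have "\<dots> \<le> 2 * exp (- t\<^sup>2 / (2 * s\<^sup>2))" using one[of 1] one[of "-1"] by simp
  also have "\<dots> \<le> 2 * exp (- t\<^sup>2 / (2 * V))"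
  proof -
    have "t\<^sup>2 / (2 * V) \<le> t\<^sup>2 / (2 * s\<^sup>2)"
      using assms(3) second_moment_normal[OF normal] normal(1) assms(2) by (intro divide_left_mono) auto
    then show ?thesis by simp
  qed
  finally show ?thesis .
qed

text \<open>The normal density of standard deviation \<open>s\<close> is at most \<open>1/s\<close>.\<close>

lemma small_ball_bound:
  assumes "T \<ge> 0" "v > 0" "v\<^sup>2 \<le> (LINT \<omega>|M. (X \<omega>)\<^sup>2)"
  shows "measure M {\<omega> \<in> space M. \<bar>X \<omega>\<bar> \<le> T} \<le> 2 * T / v"
proof (cases rule: cases_gaussian)
  case zero
  then show ?thesis using second_moment_zero[OF zero] assms by simp
next
  case (normal s)
  have "v\<^sup>2 \<le> s\<^sup>2" using assms(3) second_moment_normal[OF normal] by simp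
  then have "v \<le> s" using normal(1) by (rule power2_le_imp_le[OF _ less_imp_le])
  have dens: "normal_density 0 s x \<le> 1 / s" for x
  proof -
    have "sqrt (2 * pi * s\<^sup>2) \<ge> sqrt (s\<^sup>2)"
    proof (rule real_sqrt_le_mono)
      have "1 * s\<^sup>2 \<le> (2 * pi) * s\<^sup>2" using pi_gt3 by (intro mult_right_mono) auto
      then show "s\<^sup>2 \<le> 2 * pi * s\<^sup>2" by simp
    qed
    then have "sqrt (2 * pi * s\<^sup>2) \<ge> s" using normal(1) by simp
    then have "1 / sqrt (2 * pi * s\<^sup>2) * exp (- (x - 0)\<^sup>2 / (2 * s\<^sup>2)) \<le> 1 / s * 1"
      using normal(1) by (intro mult_mono divide_left_mono) (auto simp: mult_pos_pos)
    then show ?thesis by (simp add: normal_density_def)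
  qed
  have "measure M {\<omega> \<in> space M. \<bar>X \<omega>\<bar> \<le> T} = measure (distr M borel X) {-T..T}"
    by (subst measure_distr) (auto intro!: arg_cong[where f = "measure M"])
  also have "\<dots> = (LINT x|distr M borel X. indicator {-T..T} x)" by simp
  also have "\<dots> = (LINT x|lborel. normal_density 0 s x * indicator {-T..T} x)"
    unfolding normal(2) by (subst integral_density) auto
  also have "\<dots> \<le> (LINT x|lborel. 1 / s * indicator {-T..T} x)"
  proof (rule integral_mono)
    show "integrable lborel (\<lambda>x. normal_density 0 s x * indicator {-T..T} x)"
      by (rule Bochner_Integration.integrable_bound[OF integrable_normal_density[OF normal(1), of 0]])
        (auto simp: indicator_def)
    show "integrable lborel (\<lambda>x. 1 / s * indicator {-T..T} x)"
      by (intro integrable_mult_right integrable_real_indicator) (auto simp: emeasure_lborel_Icc_eq)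
    show "normal_density 0 s x * indicator {-T..T} x \<le> 1 / s * indicator {-T..T} x" for x
      using dens[of x] by (intro mult_right_mono) auto
  qed
  also have "\<dots> = 2 * T / s" using assms(1) by simp
  also have "\<dots> \<le> 2 * T / v" using \<open>v \<le> s\<close> assms by (intro divide_left_mono) auto
  finally show ?thesis .
qed

end

lemma integrable_mult_square:
  fixes X Y :: "'a \<Rightarrow> real"
  assumes "X \<in> borel_measurable M" "Y \<in> borel_measurable M"
    "integrable M (\<lambda>\<omega>. (X \<omega>)\<^sup>2)" "integrable M (\<lambda>\<omega>. (Y \<omega>)\<^sup>2)"
  shows "integrable M (\<lambda>\<omega>. X \<omega> * Y \<omega>)"
proof (rule Bochner_Integration.integrable_bound)
  show "integrable M (\<lambda>\<omega>. (X \<omega>)\<^sup>2 + (Y \<omega>)\<^sup>2)" using assms by auto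
  show "(\<lambda>\<omega>. X \<omega> * Y \<omega>) \<in> borel_measurable M" using assms by measurable
  have "\<bar>a * b\<bar> \<le> a\<^sup>2 + b\<^sup>2" for a b :: real
  proof -
    have "2 * \<bar>a\<bar> * \<bar>b\<bar> \<le> \<bar>a\<bar>\<^sup>2 + \<bar>b\<bar>\<^sup>2" by (rule sum_squares_bound)
    then have "2 * (\<bar>a\<bar> * \<bar>b\<bar>) \<le> a\<^sup>2 + b\<^sup>2" by (simp only: power2_abs mult.assoc)
    moreover have "0 \<le> \<bar>a\<bar> * \<bar>b\<bar>" by simp
    ultimately show ?thesis unfolding abs_mult by linarith
  qed
  then show "AE \<omega> in M. norm (X \<omega> * Y \<omega>) \<le> norm ((X \<omega>)\<^sup>2 + (Y \<omega>)\<^sup>2)" by auto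
qed

section \<open>Comparison of the two fields\<close>

lemma integral_test_product:
  fixes G :: "complex \<Rightarrow> complex \<Rightarrow> real" and f g' u :: "complex \<Rightarrow> real"
  assumes "\<And>x. x \<in> D \<Longrightarrow> (LINT y:D|lborel. G x y * f x * g' y) = f x * u x" "\<And>x. x \<notin> D \<Longrightarrow> f x = 0"
  shows "(LINT x:D|lborel. LINT y:D|lborel. G x y * f x * g' y) = (LINT x|lborel. f x * u x)"
  unfolding set_lebesgue_integral_def[of _ D "\<lambda>x. LINT y:D|lborel. G x y * f x * g' y"]
  by (intro Bochner_Integration.integral_cong refl) (use assms in \<open>auto simp: indicator_def\<close>)

lemma linear_functional_diff:
  assumes "linear_functional_on S T" "f \<in> S" "g \<in> S"
  shows "T (\<lambda>x. f x - g x) = T f - T g" "T (\<lambda>x. f x + g x) = T f + T g"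
proof -
  have "T (\<lambda>x. a * f x + b * g x) = a * T f + b * T g" for a b
    using assms by (simp add: linear_functional_on_def)
  from this[of 1 "-1"] this[of 1 1]
  show "T (\<lambda>x. f x - g x) = T f - T g" "T (\<lambda>x. f x + g x) = T f + T g" by simp_all
qed

locale gff_comparison =
  fixes M :: "'a measure" and h :: "'a \<Rightarrow> (complex \<Rightarrow> real) \<Rightarrow> real"
    and N :: "'b measure" and hD :: "'b \<Rightarrow> (complex \<Rightarrow> real) \<Rightarrow> real"
    and D :: "complex set" and G :: "complex \<Rightarrow> complex \<Rightarrow> real"
  assumes field: "log_correlated_field M h" and openD: "open D"
    and green: "green_function D G" and gff: "zero_boundary_GFF N D G hD"
begin

sublocale M: prob_space M using field by (simp add: log_correlated_field_def)
sublocale N: prob_space N using gff by (simp add: zero_boundary_GFF_def)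

lemma gaussian_h: "f \<in> schwartz0 \<Longrightarrow> gaussian_variable M (\<lambda>\<omega>. h \<omega> f)"
  using field by unfold_locales (simp add: log_correlated_field_def)

lemma gaussian_hD: "f \<in> test_functions D \<Longrightarrow> gaussian_variable N (\<lambda>\<omega>. hD \<omega> f)"
  using gff by unfold_locales (simp add: zero_boundary_GFF_def)

lemma h_measurable: "f \<in> schwartz \<Longrightarrow> (\<lambda>\<omega>. h \<omega> f) \<in> borel_measurable M"
  using field by (simp add: log_correlated_field_def)

lemma hD_measurable: "f \<in> test_functions D \<Longrightarrow> (\<lambda>\<omega>. hD \<omega> f) \<in> borel_measurable N"
  using gaussian_variable.measurable_X[OF gaussian_hD] .

lemma h_linear: "\<omega> \<in> space M \<Longrightarrow> linear_functional_on schwartz (h \<omega>)"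
  using field by (simp add: log_correlated_field_def tempered_distribution_def)

lemma hD_linear: "\<omega> \<in> space N \<Longrightarrow> linear_functional_on (test_functions D) (hD \<omega>)"
  using gff by (simp add: zero_boundary_GFF_def distribution_on_def)

lemma schwartz0I: "smooth_supp R f \<Longrightarrow> (LINT x|lborel. f x) = 0 \<Longrightarrow> f \<in> schwartz0"
  by (simp add: schwartz0_def smooth_supp_schwartz)

lemma schwartz0D: "f \<in> schwartz0 \<Longrightarrow> f \<in> schwartz" by (simp add: schwartz0_def)

text \<open>Against the Laplacian of a test function, the Green's function acts like the logarithm.\<close>

lemma covariance_lap:
  assumes K: "compact K" "K \<subseteq> D" and f: "f \<in> test_functions D" "f \<in> schwartz0"
    and \<phi>: "smooth_supp R \<phi>" "\<And>y. y \<notin> K \<Longrightarrow> \<phi> y = 0"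
  shows "(LINT \<omega>|N. hD \<omega> f * hD \<omega> (lap \<phi>)) = (LINT \<omega>|M. h \<omega> f * h \<omega> (lap \<phi>))"
proof -
  have clK: "closed K" using K compact_imp_closed by blast
  have sm: "smooth \<phi>" using \<phi> by (simp add: smooth_supp_def)
  have out2: "lap \<phi> y = 0" if "y \<notin> K" for y
    by (rule lap_eq_0_outside(2)[where K = K]) (use \<phi>(2) clK that in auto)
  have lt: "lap \<phi> \<in> test_functions D" by (rule test_functionsI[OF smooth_lap[OF sm] K out2])
  have ls: "lap \<phi> \<in> schwartz0" by (rule schwartz0I[OF smooth_supp_lap[OF \<phi>(1)] integral_lap[OF \<phi>(1)]])
  have f0: "f x = 0" if "x \<notin> D" for x
  proof -
    have "{x. f x \<noteq> 0} \<subseteq> D" using f(1) closure_subset by (fastforce simp: test_functions_def fun_support_def)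
    then show ?thesis using that by auto
  qed
  let ?u = "\<lambda>x. LINT y|lborel. ln (1 / dist x y) * lap \<phi> y"
  have "(LINT \<omega>|N. hD \<omega> f * hD \<omega> (lap \<phi>)) = (LINT x:D|lborel. LINT y:D|lborel. G x y * f x * lap \<phi> y)"
    using gff f(1) lt by (simp add: zero_boundary_GFF_def)
  also have "\<dots> = (LINT x|lborel. f x * ?u x)"
  proof (rule integral_test_product[OF _ f0])
    fix x assume x: "x \<in> D"
    have "(LINT y:D|lborel. G x y * f x * lap \<phi> y) = (LINT y|lborel. f x * (G x y * lap \<phi> y))"
      unfolding set_lebesgue_integral_def
    proof (intro Bochner_Integration.integral_cong refl)
      fix y
      show "indicator D y *\<^sub>R (G x y * f x * lap \<phi> y) = f x * (G x y * lap \<phi> y)"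
        using out2[of y] K(2) by (cases "y \<in> D") (auto simp: mult_ac)
    qed
    also have "\<dots> = f x * ?u x"
      using green_function_lap(2)[OF openD green x K sm \<phi>(2)] by simp
    finally show "(LINT y:D|lborel. G x y * f x * lap \<phi> y) = f x * ?u x" .
  qed
  also have "\<dots> = (LINT x|lborel. LINT y|lborel. ln (1 / dist x y) * f x * lap \<phi> y)"
    by (intro Bochner_Integration.integral_cong refl) (simp add: mult_ac flip: integral_mult_right_zero)
  also have "\<dots> = (LINT \<omega>|M. h \<omega> f * h \<omega> (lap \<phi>))"
    using field f(2) ls by (simp add: log_correlated_field_def)
  finally show ?thesis .
qed

text \<open>Split \<open>F\<close> into a Laplacian and \<open>T\<close>, and expand the second moment of \<open>hD F\<close>.  The terms that
  involve the Laplacian can be computed with \<open>h\<close> instead, where they add up to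
  \<open>E (h F)\<^sup>2 - E (h T)\<^sup>2\<close>.\<close>

lemma variance_comparison:
  assumes K: "compact K" "K \<subseteq> D"
    and F: "smooth_supp R F" "\<And>y. y \<notin> K \<Longrightarrow> F y = 0" "(LINT x|lborel. F x) = 0"
    and T: "smooth_supp R T" "\<And>y. y \<notin> K \<Longrightarrow> T y = 0"
    and \<phi>: "smooth_supp R \<phi>" "\<And>y. y \<notin> K \<Longrightarrow> \<phi> y = 0"
    and dec: "\<And>x. F x = lap \<phi> x + T x"
  shows "(LINT \<omega>|N. (hD \<omega> F)\<^sup>2) \<le> (LINT \<omega>|M. (h \<omega> F)\<^sup>2) + (LINT \<omega>|N. (hD \<omega> T)\<^sup>2)"
proof -
  have clK: "closed K" using K compact_imp_closed by blast
  let ?L = "lap \<phi>"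
  have out2: "?L y = 0" if "y \<notin> K" for y
    by (rule lap_eq_0_outside(2)[where K = K]) (use \<phi>(2) clK that in auto)
  have sL: "smooth_supp R ?L" by (rule smooth_supp_lap[OF \<phi>(1)])
  have "(LINT x|lborel. F x) = (LINT x|lborel. ?L x) + (LINT x|lborel. T x)"
    unfolding dec using smooth_supp_integrable[OF sL] smooth_supp_integrable[OF T(1)] by simp
  then have T0: "(LINT x|lborel. T x) = 0" using F(3) integral_lap[OF \<phi>(1)] by simp
  have Ft: "F \<in> test_functions D" and Tt: "T \<in> test_functions D" and Lt: "?L \<in> test_functions D"
    using test_functionsI[OF _ K] F T out2 sL by (auto simp: smooth_supp_def)
  have Fs: "F \<in> schwartz0" and Ts: "T \<in> schwartz0" and Ls: "?L \<in> schwartz0"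
    using schwartz0I F T T0 sL integral_lap[OF \<phi>(1)] by blast+
  note Fs' = schwartz0D[OF Fs] and Ts' = schwartz0D[OF Ts] and Ls' = schwartz0D[OF Ls]
  have FF: "F = (\<lambda>x. ?L x + T x)" using dec by auto
  have LL: "?L = (\<lambda>x. F x - T x)" using dec by auto
  have linN: "hD \<omega> F = hD \<omega> ?L + hD \<omega> T" if "\<omega> \<in> space N" for \<omega>
    using linear_functional_diff(2)[OF hD_linear[OF that] Lt Tt] FF by simp
  have linM: "h \<omega> ?L = h \<omega> F - h \<omega> T" if "\<omega> \<in> space M" for \<omega>
    using linear_functional_diff(1)[OF h_linear[OF that] Fs' Ts'] LL by simp
  note sqN = gaussian_variable.square_integrable[OF gaussian_hD]
  note sqM = gaussian_variable.square_integrable[OF gaussian_h]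
  note iN = integrable_mult_square[OF hD_measurable hD_measurable sqN sqN]
  note iM = integrable_mult_square[OF h_measurable h_measurable sqM sqM]
  have "(LINT \<omega>|N. (hD \<omega> F)\<^sup>2) = (LINT \<omega>|N. hD \<omega> F * hD \<omega> ?L + hD \<omega> T * hD \<omega> ?L + (hD \<omega> T)\<^sup>2)"
    by (intro Bochner_Integration.integral_cong refl) (simp add: linN power2_eq_square algebra_simps)
  also have "\<dots> = (LINT \<omega>|N. hD \<omega> F * hD \<omega> ?L) + (LINT \<omega>|N. hD \<omega> T * hD \<omega> ?L) + (LINT \<omega>|N. (hD \<omega> T)\<^sup>2)"
    using iN[OF Ft Lt Ft Lt] iN[OF Tt Lt Tt Lt] sqN[OF Tt] by simp
  also have "(LINT \<omega>|N. hD \<omega> F * hD \<omega> ?L) = (LINT \<omega>|M. h \<omega> F * h \<omega> ?L)"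
    by (rule covariance_lap[OF K Ft Fs \<phi>])
  also have "(LINT \<omega>|N. hD \<omega> T * hD \<omega> ?L) = (LINT \<omega>|M. h \<omega> T * h \<omega> ?L)"
    by (rule covariance_lap[OF K Tt Ts \<phi>])
  also have "(LINT \<omega>|M. h \<omega> F * h \<omega> ?L) + (LINT \<omega>|M. h \<omega> T * h \<omega> ?L)
      = (LINT \<omega>|M. h \<omega> F * h \<omega> ?L + h \<omega> T * h \<omega> ?L)"
    using iM[OF Fs' Ls' Fs Ls] iM[OF Ts' Ls' Ts Ls] by simp
  also have "\<dots> = (LINT \<omega>|M. (h \<omega> F)\<^sup>2 - (h \<omega> T)\<^sup>2)"
    by (intro Bochner_Integration.integral_cong refl) (simp add: linM power2_eq_square algebra_simps)
  also have "\<dots> = (LINT \<omega>|M. (h \<omega> F)\<^sup>2) - (LINT \<omega>|M. (h \<omega> T)\<^sup>2)"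
    using sqM[OF Fs] sqM[OF Ts] by simp
  also have "\<dots> \<le> (LINT \<omega>|M. (h \<omega> F)\<^sup>2)" by simp
  finally show ?thesis by simp
qed

end

section \<open>Limits in mean square\<close>

lemma square_integrableI:
  fixes f :: "'a \<Rightarrow> real"
  assumes "f \<in> borel_measurable M" "(\<integral>\<^sup>+\<omega>. ennreal ((f \<omega>)\<^sup>2) \<partial>M) < \<infinity>"
  shows "integrable M (\<lambda>\<omega>. (f \<omega>)\<^sup>2)"
  using assms by (intro integrableI_nonneg) auto

lemma square_sum_le:
  fixes f g k :: "'a \<Rightarrow> real"
  assumes m: "f \<in> borel_measurable M" "g \<in> borel_measurable M" "k \<in> borel_measurable M"
    and i: "integrable M (\<lambda>\<omega>. (f \<omega>)\<^sup>2)" "integrable M (\<lambda>\<omega>. (g \<omega>)\<^sup>2)" "integrable M (\<lambda>\<omega>. (k \<omega>)\<^sup>2)"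
  shows "integrable M (\<lambda>\<omega>. (f \<omega> + g \<omega> + k \<omega>)\<^sup>2)"
    and "(LINT \<omega>|M. (f \<omega> + g \<omega> + k \<omega>)\<^sup>2)
      \<le> 3 * (LINT \<omega>|M. (f \<omega>)\<^sup>2) + 3 * (LINT \<omega>|M. (g \<omega>)\<^sup>2) + 3 * (LINT \<omega>|M. (k \<omega>)\<^sup>2)"
proof -
  have le: "(a + b + c)\<^sup>2 \<le> 3 * a\<^sup>2 + 3 * b\<^sup>2 + 3 * c\<^sup>2" for a b c :: real
  proof -
    have "0 \<le> (a - b)\<^sup>2 + (b - c)\<^sup>2 + (a - c)\<^sup>2" by simp
    then show ?thesis by (simp add: power2_eq_square algebra_simps)
  qed
  have int: "integrable M (\<lambda>\<omega>. 3 * (f \<omega>)\<^sup>2 + 3 * (g \<omega>)\<^sup>2 + 3 * (k \<omega>)\<^sup>2)" using i by simp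
  show i': "integrable M (\<lambda>\<omega>. (f \<omega> + g \<omega> + k \<omega>)\<^sup>2)"
  proof (rule Bochner_Integration.integrable_bound[OF int])
    show "(\<lambda>\<omega>. (f \<omega> + g \<omega> + k \<omega>)\<^sup>2) \<in> borel_measurable M" using m by measurable
    have "norm ((f \<omega> + g \<omega> + k \<omega>)\<^sup>2) \<le> norm (3 * (f \<omega>)\<^sup>2 + 3 * (g \<omega>)\<^sup>2 + 3 * (k \<omega>)\<^sup>2)" for \<omega>
      using le[of "f \<omega>" "g \<omega>" "k \<omega>"] by simp
    then show "AE \<omega> in M. norm ((f \<omega> + g \<omega> + k \<omega>)\<^sup>2) \<le> norm (3 * (f \<omega>)\<^sup>2 + 3 * (g \<omega>)\<^sup>2 + 3 * (k \<omega>)\<^sup>2)" by simp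
  qed
  have "(LINT \<omega>|M. (f \<omega> + g \<omega> + k \<omega>)\<^sup>2) \<le> (LINT \<omega>|M. 3 * (f \<omega>)\<^sup>2 + 3 * (g \<omega>)\<^sup>2 + 3 * (k \<omega>)\<^sup>2)"
    by (intro integral_mono i' int le)
  then show "(LINT \<omega>|M. (f \<omega> + g \<omega> + k \<omega>)\<^sup>2)
      \<le> 3 * (LINT \<omega>|M. (f \<omega>)\<^sup>2) + 3 * (LINT \<omega>|M. (g \<omega>)\<^sup>2) + 3 * (LINT \<omega>|M. (k \<omega>)\<^sup>2)"
    using i by simp
qed

text \<open>The second moment of the limit controls those of the approximations, with a factor that comes
  from \<open>(a + b + c)\<^sup>2 \<le> 3 (a\<^sup>2 + b\<^sup>2 + c\<^sup>2)\<close>.\<close>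

lemma L2_limit_variance:
  fixes a b :: "nat \<Rightarrow> 'a \<Rightarrow> real"
  assumes a: "\<And>n. a n \<in> borel_measurable M" "X \<in> borel_measurable M"
      "(\<lambda>n. \<integral>\<^sup>+\<omega>. ennreal ((a n \<omega> - X \<omega>)\<^sup>2) \<partial>M) \<longlonglongrightarrow> 0"
    and b: "\<And>n. b n \<in> borel_measurable M" "Y \<in> borel_measurable M"
      "(\<lambda>n. \<integral>\<^sup>+\<omega>. ennreal ((b n \<omega> - Y \<omega>)\<^sup>2) \<partial>M) \<longlonglongrightarrow> 0"
    and sq: "\<And>n. integrable M (\<lambda>\<omega>. (a n \<omega> - b n \<omega>)\<^sup>2)"
    and v: "(LINT \<omega>|M. (X \<omega> - Y \<omega>)\<^sup>2) \<le> v" and \<delta>: "\<delta> > 0"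
  shows "\<forall>\<^sub>F n in sequentially. (LINT \<omega>|M. (a n \<omega> - b n \<omega>)\<^sup>2) \<le> 3 * v + \<delta>"
proof -
  have "\<forall>\<^sub>F n in sequentially. (\<integral>\<^sup>+\<omega>. ennreal ((a n \<omega> - X \<omega>)\<^sup>2) \<partial>M) < ennreal (\<delta> / 6)"
    "\<forall>\<^sub>F n in sequentially. (\<integral>\<^sup>+\<omega>. ennreal ((b n \<omega> - Y \<omega>)\<^sup>2) \<partial>M) < ennreal (\<delta> / 6)"
    using order_tendstoD(2)[OF a(3)] order_tendstoD(2)[OF b(3)] \<delta> by simp_all
  then show ?thesis
  proof eventually_elim
    case (elim n)
    have ia: "integrable M (\<lambda>\<omega>. (a n \<omega> - X \<omega>)\<^sup>2)" and ib: "integrable M (\<lambda>\<omega>. (b n \<omega> - Y \<omega>)\<^sup>2)"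
      using elim a b by (auto intro!: square_integrableI elim: order.strict_trans)
    have ib': "integrable M (\<lambda>\<omega>. (Y \<omega> - b n \<omega>)\<^sup>2)" using ib by (simp add: power2_commute)
    have "integrable M (\<lambda>\<omega>. (X \<omega> - a n \<omega>)\<^sup>2)" using ia by (simp add: power2_commute)
    then have "integrable M (\<lambda>\<omega>. ((X \<omega> - a n \<omega>) + (a n \<omega> - b n \<omega>) + (b n \<omega> - Y \<omega>))\<^sup>2)"
      using a b by (intro square_sum_le(1) sq ib) auto
    then have iXY: "integrable M (\<lambda>\<omega>. (X \<omega> - Y \<omega>)\<^sup>2)" by simp
    have "(LINT \<omega>|M. ((a n \<omega> - X \<omega>) + (X \<omega> - Y \<omega>) + (Y \<omega> - b n \<omega>))\<^sup>2)
        \<le> 3 * (LINT \<omega>|M. (a n \<omega> - X \<omega>)\<^sup>2) + 3 * (LINT \<omega>|M. (X \<omega> - Y \<omega>)\<^sup>2) + 3 * (LINT \<omega>|M. (Y \<omega> - b n \<omega>)\<^sup>2)"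
      using a b by (intro square_sum_le(2) ia iXY ib') auto
    moreover have "(LINT \<omega>|M. (a n \<omega> - X \<omega>)\<^sup>2) \<le> \<delta> / 6"
      using elim(1) nn_integral_eq_integral[OF ia] \<delta> by (simp add: ennreal_less_iff)
    moreover have "(LINT \<omega>|M. (Y \<omega> - b n \<omega>)\<^sup>2) \<le> \<delta> / 6"
      using elim(2) nn_integral_eq_integral[OF ib] \<delta> by (simp add: ennreal_less_iff power2_commute)
    ultimately show ?case using v by simp
  qed
qed

text \<open>The Gaussian tail is used at height \<open>t/2\<close>, which turns \<open>2 V\<close> into \<open>8 V\<close>; the errors of approximation
  are left with height \<open>t/4\<close> each, where Markov's inequality makes them negligible.\<close>

lemma (in prob_space) L2_limit_tail:
  fixes a b :: "nat \<Rightarrow> 'a \<Rightarrow> real"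
  assumes a: "\<And>n. n \<ge> n0 \<Longrightarrow> a n \<in> borel_measurable M" "X \<in> borel_measurable M"
      "(\<lambda>n. \<integral>\<^sup>+\<omega>. ennreal ((a n \<omega> - X \<omega>)\<^sup>2) \<partial>M) \<longlonglongrightarrow> 0"
    and b: "\<And>n. n \<ge> n0 \<Longrightarrow> b n \<in> borel_measurable M" "Y \<in> borel_measurable M"
      "(\<lambda>n. \<integral>\<^sup>+\<omega>. ennreal ((b n \<omega> - Y \<omega>)\<^sup>2) \<partial>M) \<longlonglongrightarrow> 0"
    and g: "\<And>n. n \<ge> n0 \<Longrightarrow> gaussian_variable M (\<lambda>\<omega>. a n \<omega> - b n \<omega>)"
    and v: "\<forall>\<^sub>F n in sequentially. (LINT \<omega>|M. (a n \<omega> - b n \<omega>)\<^sup>2) \<le> V" and V: "V > 0" and t: "t > 0"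
  shows "measure M {\<omega> \<in> space M. \<bar>X \<omega> - Y \<omega>\<bar> \<ge> t} \<le> 2 * exp (- t\<^sup>2 / (8 * V))"
proof -
  have markov: "ennreal (measure M {\<omega> \<in> space M. \<bar>f \<omega>\<bar> \<ge> t / 4})
      \<le> ennreal (16 / t\<^sup>2) * (\<integral>\<^sup>+\<omega>. ennreal ((f \<omega>)\<^sup>2) \<partial>M)" if [measurable]: "f \<in> borel_measurable M" for f :: "'a \<Rightarrow> real"
  proof -
    have "ennreal (measure M {\<omega> \<in> space M. \<bar>f \<omega>\<bar> \<ge> t / 4}) = emeasure M {\<omega> \<in> space M. \<bar>f \<omega>\<bar> \<ge> t / 4}"
      by (simp add: emeasure_eq_measure)
    also have "\<dots> \<le> emeasure M ({\<omega> \<in> space M. 1 \<le> ennreal (16 / t\<^sup>2) * ennreal ((f \<omega>)\<^sup>2)})"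
    proof (rule emeasure_mono)
      show "{\<omega> \<in> space M. \<bar>f \<omega>\<bar> \<ge> t / 4} \<subseteq> {\<omega> \<in> space M. 1 \<le> ennreal (16 / t\<^sup>2) * ennreal ((f \<omega>)\<^sup>2)}"
      proof safe
        fix \<omega> assume "t / 4 \<le> \<bar>f \<omega>\<bar>"
        then have "(t / 4)\<^sup>2 \<le> \<bar>f \<omega>\<bar>\<^sup>2" using t by (intro power_mono) auto
        then have "1 \<le> 16 / t\<^sup>2 * (f \<omega>)\<^sup>2" using t by (simp add: power_divide field_simps)
        then show "1 \<le> ennreal (16 / t\<^sup>2) * ennreal ((f \<omega>)\<^sup>2)"
          using t by (simp add: ennreal_mult[symmetric])
      qed
    qed measurable
    also have "\<dots> \<le> ennreal (16 / t\<^sup>2) * (\<integral>\<^sup>+\<omega>. ennreal ((f \<omega>)\<^sup>2) * indicator (space M) \<omega> \<partial>M)"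
      by (rule nn_integral_Markov_inequality) auto
    also have "(\<integral>\<^sup>+\<omega>. ennreal ((f \<omega>)\<^sup>2) * indicator (space M) \<omega> \<partial>M) = (\<integral>\<^sup>+\<omega>. ennreal ((f \<omega>)\<^sup>2) \<partial>M)"
      by (intro nn_integral_cong) simp
    finally show ?thesis .
  qed
  let ?P = "\<lambda>f c. measure M {\<omega> \<in> space M. \<bar>f \<omega>\<bar> \<ge> c}"
  let ?e = "\<lambda>n. ennreal (16 / t\<^sup>2) * (\<integral>\<^sup>+\<omega>. ennreal ((a n \<omega> - X \<omega>)\<^sup>2) \<partial>M) + ennreal (16 / t\<^sup>2) * (\<integral>\<^sup>+\<omega>. ennreal ((b n \<omega> - Y \<omega>)\<^sup>2) \<partial>M)"
  have ev: "\<forall>\<^sub>F n in sequentially. ennreal (?P (\<lambda>\<omega>. X \<omega> - Y \<omega>) t) \<le> ennreal (2 * exp (- t\<^sup>2 / (8 * V))) + ?e n"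
    using v eventually_ge_at_top[of n0]
  proof eventually_elim
    case (elim n)
    have [measurable]: "a n \<in> borel_measurable M" "b n \<in> borel_measurable M" "X \<in> borel_measurable M" "Y \<in> borel_measurable M"
      using a b elim by auto
    interpret g: gaussian_variable M "\<lambda>\<omega>. a n \<omega> - b n \<omega>" using g elim by blast
    let ?A = "{\<omega> \<in> space M. \<bar>a n \<omega> - b n \<omega>\<bar> \<ge> t / 2}"
    let ?B = "{\<omega> \<in> space M. \<bar>a n \<omega> - X \<omega>\<bar> \<ge> t / 4}"
    let ?C = "{\<omega> \<in> space M. \<bar>b n \<omega> - Y \<omega>\<bar> \<ge> t / 4}"
    have meas: "?A \<in> sets M" "?B \<in> sets M" "?C \<in> sets M" by measurable
    have "?P (\<lambda>\<omega>. X \<omega> - Y \<omega>) t \<le> measure M (?A \<union> (?B \<union> ?C))"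
    proof (rule finite_measure_mono)
      show "{\<omega> \<in> space M. t \<le> \<bar>X \<omega> - Y \<omega>\<bar>} \<subseteq> ?A \<union> (?B \<union> ?C)"
      proof (rule subsetI)
        fix \<omega> assume w: "\<omega> \<in> {\<omega> \<in> space M. t \<le> \<bar>X \<omega> - Y \<omega>\<bar>}"
        have "\<bar>X \<omega> - Y \<omega>\<bar> \<le> \<bar>a n \<omega> - b n \<omega>\<bar> + (\<bar>a n \<omega> - X \<omega>\<bar> + \<bar>b n \<omega> - Y \<omega>\<bar>)" by linarith
        then have "t / 2 \<le> \<bar>a n \<omega> - b n \<omega>\<bar> \<or> t / 4 \<le> \<bar>a n \<omega> - X \<omega>\<bar> \<or> t / 4 \<le> \<bar>b n \<omega> - Y \<omega>\<bar>"
          using w by auto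
        then show "\<omega> \<in> ?A \<union> (?B \<union> ?C)" using w by blast
      qed
    qed (use meas in auto)
    also have "\<dots> \<le> measure M ?A + measure M (?B \<union> ?C)" using meas by (intro measure_Un_le) auto
    also have "measure M (?B \<union> ?C) \<le> measure M ?B + measure M ?C" using meas by (intro measure_Un_le) auto
    also have "measure M ?A \<le> 2 * exp (- t\<^sup>2 / (8 * V))"
      using g.tail_bound[of "t / 2" V] t V elim by (simp add: power_divide)
    finally have "?P (\<lambda>\<omega>. X \<omega> - Y \<omega>) t \<le> 2 * exp (- t\<^sup>2 / (8 * V)) + (measure M ?B + measure M ?C)" by simp
    then have "ennreal (?P (\<lambda>\<omega>. X \<omega> - Y \<omega>) t) \<le> ennreal (2 * exp (- t\<^sup>2 / (8 * V))) + (ennreal (measure M ?B) + ennreal (measure M ?C))"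
      by (simp add: ennreal_plus[symmetric] del: ennreal_plus)
    also have "\<dots> \<le> ennreal (2 * exp (- t\<^sup>2 / (8 * V))) + ?e n"
      by (intro add_mono order_refl markov) measurable
    finally show ?case .
  qed
  have "(\<lambda>n. ennreal (2 * exp (- t\<^sup>2 / (8 * V))) + ?e n) \<longlonglongrightarrow> ennreal (2 * exp (- t\<^sup>2 / (8 * V))) + (ennreal (16 / t\<^sup>2) * 0 + ennreal (16 / t\<^sup>2) * 0)"
    by (intro tendsto_add tendsto_const ennreal_tendsto_cmult a(3) b(3)) auto
  then have "ennreal (?P (\<lambda>\<omega>. X \<omega> - Y \<omega>) t) \<le> ennreal (2 * exp (- t\<^sup>2 / (8 * V))) + (ennreal (16 / t\<^sup>2) * 0 + ennreal (16 / t\<^sup>2) * 0)"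
    by (rule tendsto_lowerbound[OF _ ev]) simp
  then show ?thesis by simp
qed

section \<open>Energy of mollified measures\<close>

lemma nn_integral_bump: "s > 0 \<Longrightarrow> (\<integral>\<^sup>+y. ennreal (bump s (y - c)) \<partial>lborel) = 1"
proof -
  assume s: "s > 0"
  have "integrable (distr lborel borel ((+) (- c))) (bump s)"
    using smooth_supp_integrable[OF smooth_supp_bump[OF s]] by (simp add: lborel_distr_plus)
  then have "integrable lborel (\<lambda>y. bump s (- c + y))"
    by (subst (asm) integrable_distr_eq) (auto intro: smooth_measurable smooth_bump)
  then have i: "integrable lborel (\<lambda>y. bump s (y - c))" by (simp add: add.commute)
  show ?thesis
    using nn_integral_eq_integral[OF i] lborel_integral_shift[of "bump s" c] integral_bump[OF s] bump_nonneg by simp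
qed

definition bump_max :: real where "bump_max = (SOME L. L \<ge> 0 \<and> (\<forall>y. bump 1 y \<le> L))"

lemma bump_shift_measurable: "(\<lambda>y. ennreal (bump s (y - c))) \<in> borel_measurable lborel"
proof -
  have [measurable]: "bump s \<in> borel_measurable borel" by (rule smooth_measurable[OF smooth_bump])
  show ?thesis by measurable
qed

lemma bump_max: "bump_max \<ge> 0" "s > 0 \<Longrightarrow> bump s y \<le> bump_max / s\<^sup>2"
proof -
  obtain L where "L \<ge> 0" "\<And>y. \<bar>bump 1 y\<bar> \<le> L"
    using smooth_supp_bounded[OF smooth_supp_bump[of 1]] by auto
  then have "\<exists>L. L \<ge> 0 \<and> (\<forall>y. bump 1 y \<le> L)" by (auto simp: abs_le_iff)
  from someI_ex[OF this] have *: "bump_max \<ge> 0" "\<And>y. bump 1 y \<le> bump_max" by (auto simp: bump_max_def)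
  then show "bump_max \<ge> 0" by blast
  show "bump s y \<le> bump_max / s\<^sup>2" if "s > 0"
    unfolding bump_rescale[OF that] by (intro divide_right_mono *) simp
qed

text \<open>The additive constant in the next estimate: \<open>ln 2\<close> from comparing distances, and the
  contribution of the logarithmic singularity.\<close>

definition pot_const :: real where "pot_const = ln 2 + bump_max * log_const"

lemma pot_const_nonneg: "pot_const \<ge> 0"
  unfolding pot_const_def using bump_max(1) log_const_nonneg by simp

text \<open>The logarithmic potential of a bump of width \<open>s\<close> is at most that of a unit charge truncated at
  distance \<open>s\<close>, up to an additive constant.  Far from the centre the distances are comparable; near
  it, the density is at most of order \<open>1/s\<^sup>2\<close>.\<close>

lemma bump_potential_le:
  assumes s: "0 < s" "s \<le> R" and x: "norm (x - c) \<le> R"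
  shows "(\<integral>\<^sup>+y. ennreal (ln (R / dist x y)) * ennreal (bump s (y - c)) \<partial>lborel)
    \<le> ennreal (pot_const + ln (R / max (norm (x - c)) s))"
proof -
 note mb = bump_shift_measurable[of s c]
 show ?thesis
 proof (cases "norm (x - c) \<ge> 2 * s")
  case True
  have le: "ennreal (ln (R / dist x y)) * ennreal (bump s (y - c))
      \<le> ennreal (ln (2 * R / norm (x - c))) * ennreal (bump s (y - c))" for y
  proof (cases "norm (y - c) \<le> s")
    case y: True
    have "dist x y \<ge> norm (x - c) - norm (y - c)"
      using norm_triangle_ineq2[of "x - c" "y - c"] by (simp add: dist_norm)
    then have d: "dist x y \<ge> norm (x - c) / 2" using True y by simp
    have p: "norm (x - c) > 0" "dist x y > 0" using d s True by linarith+
    have "R / dist x y \<le> R / (norm (x - c) / 2)" using d s p by (intro divide_left_mono mult_pos_pos) auto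
    moreover have "0 < R / dist x y" using d s True by (intro divide_pos_pos) linarith+
    ultimately have "ln (R / dist x y) \<le> ln (2 * R / norm (x - c))"
      by (simp add: mult.commute)
    then show ?thesis by (intro mult_right_mono ennreal_leI) auto
  next
    case False
    then show ?thesis using bump_eq_0[OF s(1), of "y - c"] s by simp
  qed
  have "(\<integral>\<^sup>+y. ennreal (ln (R / dist x y)) * ennreal (bump s (y - c)) \<partial>lborel)
      \<le> (\<integral>\<^sup>+y. ennreal (ln (2 * R / norm (x - c))) * ennreal (bump s (y - c)) \<partial>lborel)"
    by (rule nn_integral_mono) (rule le)
  also have "\<dots> = ennreal (ln (2 * R / norm (x - c))) * (\<integral>\<^sup>+y. ennreal (bump s (y - c)) \<partial>lborel)"
    by (rule nn_integral_cmult[OF mb])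
  also have "\<dots> = ennreal (ln (2 * R / norm (x - c)))" using nn_integral_bump[OF s(1)] by simp
  also have "\<dots> \<le> ennreal (pot_const + ln (R / max (norm (x - c)) s))"
  proof (rule ennreal_leI)
    have "max (norm (x - c)) s = norm (x - c)" using True s by auto
    moreover have "ln (2 * R / norm (x - c)) = ln 2 + ln (R / norm (x - c))"
    proof -
      have "norm (x - c) > 0" using True s by linarith
      then have "R / norm (x - c) > 0" using s by simp
      from ln_mult_pos[OF _ this, of 2] show ?thesis by simp
    qed
    ultimately show "ln (2 * R / norm (x - c)) \<le> pot_const + ln (R / max (norm (x - c)) s)"
      unfolding pot_const_def using bump_max(1) log_const_nonneg by simp
  qed
  finally show ?thesis .
next
  case False
  have le: "ennreal (ln (R / dist x y)) * ennreal (bump s (y - c))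
      \<le> ennreal (ln (R / s)) * ennreal (bump s (y - c))
        + ennreal (bump_max / s\<^sup>2) * (indicator (ball x s) y * ennreal (ln (s / dist x y)))" for y
  proof (cases "y \<in> ball x s \<and> y \<noteq> x")
    case True
    then have d: "0 < dist x y" "dist x y < s" by auto
    have "R / s \<ge> 1" using s by simp
    moreover have "s / dist x y \<ge> 1" using d by simp
    ultimately have nn: "0 \<le> ln (R / s)" "0 \<le> ln (s / dist x y)" by (simp_all only: ln_ge_zero)
    have "ln (R / dist x y) = ln (R / s) + ln (s / dist x y)"
      using d s by (simp add: ln_div)
    then have "ennreal (ln (R / dist x y)) = ennreal (ln (R / s)) + ennreal (ln (s / dist x y))"
      using nn by simp
    moreover have "ennreal (ln (s / dist x y)) * ennreal (bump s (y - c)) \<le> ennreal (ln (s / dist x y)) * ennreal (bump_max / s\<^sup>2)"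
      by (intro mult_left_mono ennreal_leI bump_max(2) s(1)) simp
    ultimately show ?thesis using True by (simp add: distrib_right mult.commute[of "ennreal (bump_max / s\<^sup>2)"] add_left_mono)
  next
    case F: False
    have "ln (R / dist x y) \<le> ln (R / s)"
    proof (cases "y = x")
      case True then show ?thesis using s by simp
    next
      case False
      then have "s \<le> dist x y" using F by auto
      then have "R / dist x y \<le> R / s" "0 < R / dist x y" using s False by (auto intro!: divide_left_mono divide_pos_pos mult_pos_pos)
      then show ?thesis by simp
    qed
    then have "ennreal (ln (R / dist x y)) * ennreal (bump s (y - c)) \<le> ennreal (ln (R / s)) * ennreal (bump s (y - c))"
      by (intro mult_right_mono ennreal_leI) auto
    then show ?thesis by (rule order_trans) simp
  qed
  have ml: "(\<lambda>y. indicator (ball x s) y * ennreal (ln (s / dist x y))) \<in> borel_measurable lborel"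
    by (intro borel_measurable_times_ennreal borel_measurable_indicator) (auto intro: borel_open)
  have "(\<integral>\<^sup>+y. ennreal (ln (R / dist x y)) * ennreal (bump s (y - c)) \<partial>lborel)
      \<le> (\<integral>\<^sup>+y. ennreal (ln (R / s)) * ennreal (bump s (y - c))
        + ennreal (bump_max / s\<^sup>2) * (indicator (ball x s) y * ennreal (ln (s / dist x y))) \<partial>lborel)"
    by (rule nn_integral_mono) (rule le)
  also have "\<dots> = ennreal (ln (R / s)) * (\<integral>\<^sup>+y. ennreal (bump s (y - c)) \<partial>lborel)
      + ennreal (bump_max / s\<^sup>2) * (\<integral>\<^sup>+y. indicator (ball x s) y * ennreal (ln (s / dist x y)) \<partial>lborel)"
    using mb ml by (subst nn_integral_add) (auto simp: nn_integral_cmult)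
  also have "\<dots> \<le> ennreal (ln (R / s)) * 1 + ennreal (bump_max / s\<^sup>2) * ennreal (log_const * s\<^sup>2)"
    using nn_integral_bump[OF s(1), of c] nn_integral_log_ball[OF s(1), of x]
    by (intro add_mono mult_left_mono) auto
  also have "\<dots> = ennreal (ln (R / s) + bump_max * log_const)"
    using s bump_max(1) log_const_nonneg by (simp add: ennreal_mult[symmetric] flip: ennreal_plus)
  also have "\<dots> \<le> ennreal (pot_const + ln (R / max (norm (x - c)) s))"
  proof (rule ennreal_leI)
    define m where "m = max (norm (x - c)) s"
    have m: "0 < m" "m \<le> 2 * s" using False s by (auto simp: m_def)
    have "R / (2 * s) \<le> R / m" using m s by (intro divide_left_mono) auto
    then have "ln (R / (2 * s)) \<le> ln (R / m)" using s m by (intro ln_mono) auto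
    moreover have "ln (R / (2 * s)) = ln (R / s) - ln 2" using s by (simp add: ln_div ln_mult)
    ultimately show "ln (R / s) + bump_max * log_const \<le> pot_const + ln (R / max (norm (x - c)) s)"
      unfolding pot_const_def m_def[symmetric] by simp
  qed
  finally show ?thesis .
 qed
qed

lemma abs_log_kernel_measurable:
  "(\<lambda>(x, y). abs_log_kernel x y) \<in> borel_measurable (borel \<Otimes>\<^sub>M borel)"
proof -
  have "(\<lambda>p. if dist (fst p) (snd p) = (0::real) then \<infinity> else ennreal \<bar>ln (1 / dist (fst p) (snd p :: complex))\<bar>)
      \<in> borel_measurable (borel \<Otimes>\<^sub>M borel)" by measurable
  moreover have "(\<lambda>p. if dist (fst p) (snd p) = (0::real) then \<infinity> else ennreal \<bar>ln (1 / dist (fst p) (snd p :: complex))\<bar>)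
      = (\<lambda>(x, y). abs_log_kernel x y)" by (auto simp: abs_log_kernel_def fun_eq_iff)
  ultimately show ?thesis by (simp only:)
qed

text \<open>By Tonelli, the energy is an average over pairs \<open>a\<close>, \<open>b\<close> of the potential of the bump at
  \<open>z + \<epsilon> b\<close>, evaluated at a point \<open>x\<close> within \<open>s\<close> of \<open>z + \<epsilon> a\<close>.  The truncated distance is
  at least half of \<open>\<epsilon> |a - b|\<close>, so the scale \<open>\<epsilon>\<close> cancels and the energy of \<open>\<rho>\<close> remains.\<close>

lemma mollified_energy_le:
  fixes z :: complex
  assumes \<rho>: "disc_prob \<rho>" and s: "0 < s" "s \<le> \<epsilon>"
  defines "f \<equiv> avg \<rho> (bump s) z \<epsilon>"
  shows "(\<integral>\<^sup>+x. ennreal (f x) * (\<integral>\<^sup>+y. ennreal (ln (4 * \<epsilon> / dist x y)) * ennreal (f y) \<partial>lborel) \<partial>lborel)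
    \<le> ennreal (pot_const + ln 8) + (\<integral>\<^sup>+a. \<integral>\<^sup>+b. abs_log_kernel a b \<partial>\<rho> \<partial>\<rho>)"
proof -
  define R where "R = 4 * \<epsilon>"
  have sR: "s \<le> R" "R > 0" "\<epsilon> > 0" using s by (auto simp: R_def)
  interpret \<rho>: prob_space \<rho> using \<rho> by (simp add: disc_prob_def)
  interpret P: pair_sigma_finite lborel \<rho> ..
  have [measurable_cong]: "sets \<rho> = sets borel" using \<rho> by (simp add: disc_prob_def)
  have [measurable]: "bump s \<in> borel_measurable borel" by (rule smooth_measurable[OF smooth_bump])
  have small: "AE a in \<rho>. norm a \<le> 1" using \<rho> by (simp add: disc_prob_def)
  let ?b = "\<lambda>x a. ennreal (bump s (x - (z + \<epsilon> *\<^sub>R a)))"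
  have fe: "ennreal (f x) = (\<integral>\<^sup>+a. ?b x a \<partial>\<rho>)" for x
    using nn_integral_eq_integral[OF smooth_supp_shift_integrable[OF \<rho> smooth_supp_bump[OF s(1)], of "x - z" \<epsilon>]]
      bump_nonneg by (simp add: f_def avg_def diff_diff_eq)
  define k where "k = (\<lambda>x b. ennreal (pot_const + ln (R / max (norm (x - (z + \<epsilon> *\<^sub>R b))) s)))"
  have [measurable]: "(\<lambda>(x, b). k x b) \<in> borel_measurable (lborel \<Otimes>\<^sub>M \<rho>)" unfolding k_def by measurable
  have inner: "(\<integral>\<^sup>+y. ennreal (ln (R / dist x y)) * ennreal (f y) \<partial>lborel) \<le> (\<integral>\<^sup>+b. k x b \<partial>\<rho>)"
    if x: "norm (x - z) \<le> 2 * \<epsilon>" for x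
  proof -
    have "(\<integral>\<^sup>+y. ennreal (ln (R / dist x y)) * ennreal (f y) \<partial>lborel)
        = (\<integral>\<^sup>+y. \<integral>\<^sup>+b. ennreal (ln (R / dist x y)) * ?b y b \<partial>\<rho> \<partial>lborel)"
      unfolding fe by (intro nn_integral_cong nn_integral_cmult[symmetric]) measurable
    also have "\<dots> = (\<integral>\<^sup>+b. \<integral>\<^sup>+y. ennreal (ln (R / dist x y)) * ?b y b \<partial>lborel \<partial>\<rho>)"
      by (rule P.Fubini'[symmetric]) measurable
    also have "\<dots> \<le> (\<integral>\<^sup>+b. k x b \<partial>\<rho>)"
    proof (rule nn_integral_mono_AE)
      show "AE b in \<rho>. (\<integral>\<^sup>+y. ennreal (ln (R / dist x y)) * ?b y b \<partial>lborel) \<le> k x b"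
        using small
      proof (rule AE_mp, intro AE_I2 impI)
        fix b :: complex assume "norm b \<le> 1"
        then have "norm (\<epsilon> *\<^sub>R b) \<le> \<epsilon>" using sR by (simp add: mult_left_le)
        moreover have "norm (x - (z + \<epsilon> *\<^sub>R b)) \<le> norm (x - z) + norm (\<epsilon> *\<^sub>R b)"
          using norm_triangle_ineq4[of "x - z" "\<epsilon> *\<^sub>R b"] by (simp add: diff_diff_eq)
        ultimately have "norm (x - (z + \<epsilon> *\<^sub>R b)) \<le> R" unfolding R_def using x sR by linarith
        then show "(\<integral>\<^sup>+y. ennreal (ln (R / dist x y)) * ?b y b \<partial>lborel) \<le> k x b"
          unfolding k_def by (rule bump_potential_le[OF s(1) sR(1)])
      qed
    qed
    finally show ?thesis .
  qed
  have kle: "k x b \<le> ennreal (pot_const + ln 8) + abs_log_kernel a b"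
    if x: "norm (x - (z + \<epsilon> *\<^sub>R a)) \<le> s" for x a b
  proof (cases "a = b")
    case False
    define m where "m = max (norm (x - (z + \<epsilon> *\<^sub>R b))) s"
    have "norm (\<epsilon> *\<^sub>R (a - b)) \<le> norm (x - (z + \<epsilon> *\<^sub>R b)) + norm (x - (z + \<epsilon> *\<^sub>R a))"
      using norm_triangle_ineq4[of "x - (z + \<epsilon> *\<^sub>R b)" "x - (z + \<epsilon> *\<^sub>R a)"] by (simp add: algebra_simps)
    also have "\<dots> \<le> 2 * m" using x by (simp add: m_def)
    finally have m: "\<epsilon> * norm (a - b) / 2 \<le> m" using sR by simp
    have p: "0 < \<epsilon> * norm (a - b) / 2" using False sR by simp
    have "R / m \<le> R / (\<epsilon> * norm (a - b) / 2)" using m p sR by (intro divide_left_mono mult_pos_pos) auto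
    also have "\<dots> = 8 * (1 / norm (a - b))" using sR by (simp add: R_def)
    finally have "ln (R / m) \<le> ln (8 * (1 / norm (a - b)))" using m p sR by (intro ln_mono) auto
    also have "\<dots> = ln 8 + ln (1 / norm (a - b))" using False by (intro ln_mult_pos) auto
    also have "\<dots> \<le> ln 8 + \<bar>ln (1 / dist a b)\<bar>" by (simp add: dist_norm)
    finally have "pot_const + ln (R / m) \<le> (pot_const + ln 8) + \<bar>ln (1 / dist a b)\<bar>" by simp
    then have "k x b \<le> ennreal ((pot_const + ln 8) + \<bar>ln (1 / dist a b)\<bar>)"
      unfolding k_def m_def by (rule ennreal_leI)
    also have "\<dots> = ennreal (pot_const + ln 8) + abs_log_kernel a b"
      using False pot_const_nonneg by (simp add: abs_log_kernel_def)
    finally show ?thesis .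
  qed (simp add: abs_log_kernel_def)
  have f0: "f x = 0" if "norm (x - z) > 2 * \<epsilon>" for x
    unfolding f_def by (rule avg_eq_0[OF \<rho> smooth_supp_bump[OF s(1)]]) (use that s in auto)
  have [measurable]: "(\<lambda>(a, b). abs_log_kernel a b) \<in> borel_measurable (\<rho> \<Otimes>\<^sub>M \<rho>)"
    using abs_log_kernel_measurable by measurable
  have [measurable]: "abs_log_kernel a \<in> borel_measurable \<rho>" for a
    using measurable_compose[OF measurable_Pair1' abs_log_kernel_measurable, of a] by simp
  have "(\<integral>\<^sup>+x. ennreal (f x) * (\<integral>\<^sup>+y. ennreal (ln (R / dist x y)) * ennreal (f y) \<partial>lborel) \<partial>lborel)
      \<le> (\<integral>\<^sup>+x. ennreal (f x) * (\<integral>\<^sup>+b. k x b \<partial>\<rho>) \<partial>lborel)"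
  proof (rule nn_integral_mono)
    fix x
    show "ennreal (f x) * (\<integral>\<^sup>+y. ennreal (ln (R / dist x y)) * ennreal (f y) \<partial>lborel) \<le> ennreal (f x) * (\<integral>\<^sup>+b. k x b \<partial>\<rho>)"
      using inner[of x] f0[of x] by (cases "norm (x - z) \<le> 2 * \<epsilon>") (auto intro!: mult_left_mono)
  qed
  also have "\<dots> = (\<integral>\<^sup>+x. \<integral>\<^sup>+a. ?b x a * (\<integral>\<^sup>+b. k x b \<partial>\<rho>) \<partial>\<rho> \<partial>lborel)"
    unfolding fe by (intro nn_integral_cong nn_integral_multc[symmetric]) measurable
  also have "\<dots> = (\<integral>\<^sup>+a. \<integral>\<^sup>+x. ?b x a * (\<integral>\<^sup>+b. k x b \<partial>\<rho>) \<partial>lborel \<partial>\<rho>)"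
    by (rule P.Fubini'[symmetric]) measurable
  also have "\<dots> \<le> (\<integral>\<^sup>+a. \<integral>\<^sup>+x. ?b x a * (\<integral>\<^sup>+b. ennreal (pot_const + ln 8) + abs_log_kernel a b \<partial>\<rho>) \<partial>lborel \<partial>\<rho>)"
  proof (intro nn_integral_mono)
    fix a x
    show "?b x a * (\<integral>\<^sup>+b. k x b \<partial>\<rho>) \<le> ?b x a * (\<integral>\<^sup>+b. ennreal (pot_const + ln 8) + abs_log_kernel a b \<partial>\<rho>)"
    proof (cases "norm (x - (z + \<epsilon> *\<^sub>R a)) \<le> s")
      case True
      show ?thesis by (intro mult_left_mono nn_integral_mono kle[OF True]) simp
    next
      case False
      then have "bump s (x - (z + \<epsilon> *\<^sub>R a)) = 0" by (intro bump_eq_0[OF s(1)]) (use s in linarith)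
      then show ?thesis by simp
    qed
  qed
  also have "\<dots> = (\<integral>\<^sup>+a. (\<integral>\<^sup>+b. ennreal (pot_const + ln 8) + abs_log_kernel a b \<partial>\<rho>) \<partial>\<rho>)"
  proof (intro nn_integral_cong)
    fix a
    have "(\<integral>\<^sup>+x. ?b x a * (\<integral>\<^sup>+b. ennreal (pot_const + ln 8) + abs_log_kernel a b \<partial>\<rho>) \<partial>lborel)
      = (\<integral>\<^sup>+x. ?b x a \<partial>lborel) * (\<integral>\<^sup>+b. ennreal (pot_const + ln 8) + abs_log_kernel a b \<partial>\<rho>)"
      by (rule nn_integral_multc) measurable
    then show "(\<integral>\<^sup>+x. ?b x a * (\<integral>\<^sup>+b. ennreal (pot_const + ln 8) + abs_log_kernel a b \<partial>\<rho>) \<partial>lborel)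
      = (\<integral>\<^sup>+b. ennreal (pot_const + ln 8) + abs_log_kernel a b \<partial>\<rho>)"
      using nn_integral_bump[OF s(1)] by simp
  qed
  also have "\<dots> = (\<integral>\<^sup>+a. ennreal (pot_const + ln 8) + (\<integral>\<^sup>+b. abs_log_kernel a b \<partial>\<rho>) \<partial>\<rho>)"
    by (intro nn_integral_cong, subst nn_integral_add) (auto simp: \<rho>.emeasure_space_1)
  also have "\<dots> = ennreal (pot_const + ln 8) + (\<integral>\<^sup>+a. \<integral>\<^sup>+b. abs_log_kernel a b \<partial>\<rho> \<partial>\<rho>)"
    by (subst nn_integral_add) (auto simp: \<rho>.emeasure_space_1)
  finally show ?thesis by (simp add: R_def)
qed

context gff_comparison
begin

text \<open>A charge of total mass zero may be paired with \<open>ln (4\<epsilon> / |x - y|)\<close> instead of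
  \<open>ln (1 / |x - y|)\<close>.  On the support of two mollified measures of scale \<open>\<epsilon>\<close> this kernel is
  nonnegative, so the cross terms have a sign and only the self-energies remain.\<close>

lemma variance_same_point:
  assumes \<rho>: "disc_prob \<rho>" "finite_log_energy \<rho>" and \<sigma>: "disc_prob \<sigma>" "finite_log_energy \<sigma>"
  obtains C where "C \<ge> 0" "\<And>z \<epsilon> s. 0 < s \<Longrightarrow> s \<le> \<epsilon> \<Longrightarrow>
    (LINT \<omega>|M. (h \<omega> (\<lambda>x. avg \<rho> (bump s) z \<epsilon> x - avg \<sigma> (bump s) z \<epsilon> x))\<^sup>2) \<le> C"
proof -
  define E where "E = (\<lambda>\<mu>. pot_const + ln 8 + enn2real (\<integral>\<^sup>+a. \<integral>\<^sup>+b. abs_log_kernel a b \<partial>\<mu> \<partial>\<mu>))"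
  have E0: "E \<mu> \<ge> 0" for \<mu> unfolding E_def using pot_const_nonneg by simp
  have self: "integrable lborel (\<lambda>x. f x * V x) \<and> (LINT x|lborel. f x * V x) \<le> E \<mu>
      \<and> (\<forall>x. norm (x - z) \<le> 2 * \<epsilon> \<longrightarrow> 0 \<le> V x)
      \<and> (\<forall>x. norm (x - z) > 2 * \<epsilon> \<longrightarrow> f x = 0) \<and> (\<forall>x. f x \<ge> 0)
      \<and> (\<forall>x. integrable lborel (\<lambda>y. ln (1 / dist x y) * f y)
           \<and> (LINT y|lborel. ln (1 / dist x y) * f y) = V x - ln (4 * \<epsilon>))"
    if \<mu>: "disc_prob \<mu>" "finite_log_energy \<mu>" and s: "0 < s" "s \<le> \<epsilon>"
      and fd: "f = avg \<mu> (bump s) z \<epsilon>" and Vd: "V = (\<lambda>x. LINT y|lborel. ln (4 * \<epsilon> / dist x y) * f y)"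
    for \<mu> s \<epsilon> z f V
  proof -
    note ss = smooth_supp_avg[OF \<mu>(1) smooth_supp_bump[OF s(1)], of \<epsilon> z, folded fd]
    have e0: "\<epsilon> > 0" using s by simp
    have ssf: "smooth_supp (norm z + s + \<epsilon>) f" using ss e0 by simp
    have fm: "f \<in> borel_measurable borel" using ssf smooth_measurable by (simp add: smooth_supp_def)
    have f0: "f x = 0" if "norm (x - z) > 2 * \<epsilon>" for x
      unfolding fd by (rule avg_eq_0[OF \<mu>(1) smooth_supp_bump[OF s(1)]]) (use that s in auto)
    have fn: "f x \<ge> 0" for x unfolding fd by (rule avg_nonneg[OF \<mu>(1) bump_nonneg])
    have fi: "integrable lborel f" by (rule smooth_supp_integrable[OF ssf])
    have f1: "(LINT x|lborel. f x) = 1"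
      unfolding fd integral_avg[OF \<mu>(1) smooth_supp_bump[OF s(1)]] by (rule integral_bump[OF s(1)])
    obtain B where B: "\<And>x. \<bar>f x\<bar> \<le> B" using smooth_supp_bounded[OF ssf] by blast
    have il: "integrable lborel (\<lambda>y. ln (1 / dist x y) * f y)" for x
      by (rule integrable_log_bounded_supp[OF fm B, where R = "norm z + s + \<epsilon>"]) (use ssf in \<open>simp add: smooth_supp_def\<close>)
    have AEeq: "AE y in lborel. ln (1 / dist x y) * f y + ln (4 * \<epsilon>) * f y = ln (4 * \<epsilon> / dist x y) * f y" for x
      using AE_lborel_singleton[of x]
      by (rule AE_mp) (use e0 in \<open>auto simp: ln_div ln_mult algebra_simps\<close>)
    have mL: "(\<lambda>y. ln (4 * \<epsilon> / dist x y) * f y) \<in> borel_measurable lborel" for x using fm by measurable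
    have isum: "integrable lborel (\<lambda>y. ln (1 / dist x y) * f y + ln (4 * \<epsilon>) * f y)" for x
      using il fi by simp
    have iL: "integrable lborel (\<lambda>y. ln (4 * \<epsilon> / dist x y) * f y)" for x
      using integrable_cong_AE[OF borel_measurable_integrable[OF isum] mL AEeq] isum by simp
    have VV: "V x = (LINT y|lborel. ln (1 / dist x y) * f y) + ln (4 * \<epsilon>)" for x
    proof -
      have "V x = (LINT y|lborel. ln (1 / dist x y) * f y + ln (4 * \<epsilon>) * f y)"
        unfolding Vd using integral_cong_AE[OF borel_measurable_integrable[OF isum] mL AEeq] by simp
      then show ?thesis using il fi f1 by simp
    qed
    have nn: "AE y in lborel. 0 \<le> ln (4 * \<epsilon> / dist x y) * f y" if x: "norm (x - z) \<le> 2 * \<epsilon>" for x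
      using AE_lborel_singleton[of x]
    proof (rule AE_mp, intro AE_I2 impI)
      fix y assume "y \<noteq> x"
      show "0 \<le> ln (4 * \<epsilon> / dist x y) * f y"
      proof (cases "norm (y - z) \<le> 2 * \<epsilon>")
        case True
        have "dist x y \<le> norm (x - z) + norm (y - z)"
          using norm_triangle_ineq4[of "x - z" "y - z"] by (simp add: dist_norm)
        then have "dist x y \<le> 4 * \<epsilon>" using x True by simp
        then have "1 \<le> 4 * \<epsilon> / dist x y" using \<open>y \<noteq> x\<close> by (simp add: le_divide_eq)
        then show ?thesis using fn[of y] by simp
      next
        case False then show ?thesis using f0[of y] by simp
      qed
    qed
    have V0: "0 \<le> V x" if "norm (x - z) \<le> 2 * \<epsilon>" for x
      unfolding Vd by (rule integral_nonneg_AE[OF nn[OF that]])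
    have fV0: "0 \<le> f x * V x" for x using V0[of x] f0[of x] fn[of x] by (cases "norm (x - z) \<le> 2 * \<epsilon>") auto
    have Vm: "V \<in> borel_measurable lborel"
    proof -
      have "(\<lambda>(x, y). ln (4 * \<epsilon> / dist x y) * f y) \<in> borel_measurable (lborel \<Otimes>\<^sub>M lborel)"
        using fm by measurable
      then show ?thesis unfolding Vd by (rule lborel.borel_measurable_lebesgue_integral)
    qed
    have fVm: "(\<lambda>x. f x * V x) \<in> borel_measurable lborel" using fm Vm by simp
    have eq: "ennreal (f x * V x) = ennreal (f x) * (\<integral>\<^sup>+y. ennreal (ln (4 * \<epsilon> / dist x y)) * ennreal (f y) \<partial>lborel)" for x
    proof (cases "norm (x - z) \<le> 2 * \<epsilon>")
      case True
      have "(\<integral>\<^sup>+y. ennreal (ln (4 * \<epsilon> / dist x y)) * ennreal (f y) \<partial>lborel) = (\<integral>\<^sup>+y. ennreal (ln (4 * \<epsilon> / dist x y) * f y) \<partial>lborel)"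
        by (intro nn_integral_cong) (simp add: ennreal_mult'' fn)
      also have "\<dots> = ennreal (V x)" unfolding Vd by (rule nn_integral_eq_integral[OF iL nn[OF True]])
      finally show ?thesis using fn V0[OF True] by (simp add: ennreal_mult)
    next
      case False then show ?thesis using f0[of x] by simp
    qed
    have "(\<integral>\<^sup>+x. ennreal (f x * V x) \<partial>lborel) \<le> ennreal (pot_const + ln 8) + (\<integral>\<^sup>+a. \<integral>\<^sup>+b. abs_log_kernel a b \<partial>\<mu> \<partial>\<mu>)"
      unfolding eq unfolding fd by (rule mollified_energy_le[OF \<mu>(1) s])
    also have "\<dots> = ennreal (E \<mu>)"
      unfolding E_def using \<mu>(2) pot_const_nonneg by (simp add: finite_log_energy_def ennreal_enn2real_if less_top[symmetric])
    finally have nb: "(\<integral>\<^sup>+x. ennreal (f x * V x) \<partial>lborel) \<le> ennreal (E \<mu>)" .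
    have "integrable lborel (\<lambda>x. f x * V x)"
      using fV0 nb by (intro integrableI_nonneg[OF fVm]) (auto intro: le_less_trans[OF nb])
    moreover have "(LINT x|lborel. f x * V x) \<le> E \<mu>" by (rule integral_real_bounded[OF E0 nb])
    ultimately show ?thesis using V0 f0 fn il VV by simp
  qed
  show ?thesis
  proof (rule that[of "E \<rho> + E \<sigma>"])
    show "E \<rho> + E \<sigma> \<ge> 0" using E0 by simp
    fix z :: complex and \<epsilon> s :: real
    assume s: "0 < s" "s \<le> \<epsilon>"
    define f where "f = avg \<rho> (bump s) z \<epsilon>"
    define g where "g = avg \<sigma> (bump s) z \<epsilon>"
    define V where "V = (\<lambda>x. LINT y|lborel. ln (4 * \<epsilon> / dist x y) * f y)"
    define W where "W = (\<lambda>x. LINT y|lborel. ln (4 * \<epsilon> / dist x y) * g y)"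
    note A = self[OF \<rho> s f_def V_def] and B = self[OF \<sigma> s g_def W_def]
    define F where "F = (\<lambda>x. f x - g x)"
    have e0: "\<epsilon> \<ge> 0" using s by simp
    have ssf: "smooth_supp (norm z + s + \<epsilon>) f" "smooth_supp (norm z + s + \<epsilon>) g"
      unfolding f_def g_def using smooth_supp_avg[OF _ smooth_supp_bump[OF s(1)] e0] \<rho> \<sigma> by auto
    have F0: "(LINT x|lborel. F x) = 0"
      unfolding F_def using smooth_supp_integrable[OF ssf(1)] smooth_supp_integrable[OF ssf(2)]
        integral_avg[OF \<rho>(1) smooth_supp_bump[OF s(1)]] integral_avg[OF \<sigma>(1) smooth_supp_bump[OF s(1)]]
      by (simp add: f_def g_def)
    have Fs: "F \<in> schwartz0" using schwartz0I[OF _ F0] smooth_supp_diff[OF ssf] unfolding F_def by blast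
    have inner: "(LINT y|lborel. ln (1 / dist x y) * F x * F y) = F x * (V x - W x)" for x
    proof -
      have "(LINT y|lborel. ln (1 / dist x y) * F x * F y) = (LINT y|lborel. F x * (ln (1 / dist x y) * f y - ln (1 / dist x y) * g y))"
        by (intro Bochner_Integration.integral_cong refl) (simp add: F_def algebra_simps)
      also have "\<dots> = F x * ((LINT y|lborel. ln (1 / dist x y) * f y) - (LINT y|lborel. ln (1 / dist x y) * g y))"
        using A B by simp
      finally show ?thesis using A B by simp
    qed
    have "(LINT \<omega>|M. (h \<omega> F)\<^sup>2) = (LINT \<omega>|M. h \<omega> F * h \<omega> F)" by (simp add: power2_eq_square)
    also have "\<dots> = (LINT x|lborel. LINT y|lborel. ln (1 / dist x y) * F x * F y)"
      using field Fs by (simp add: log_correlated_field_def)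
    also have "\<dots> = (LINT x|lborel. F x * (V x - W x))" by (simp only: inner)
    also have "\<dots> \<le> (LINT x|lborel. f x * V x + g x * W x)"
    proof (rule integral_mono_AE')
      show "integrable lborel (\<lambda>x. f x * V x + g x * W x)" using A B by simp
      have le: "F x * (V x - W x) \<le> f x * V x + g x * W x \<and> 0 \<le> f x * V x + g x * W x" for x
      proof (cases "norm (x - z) \<le> 2 * \<epsilon>")
        case True
        then have nn: "f x \<ge> 0" "g x \<ge> 0" "V x \<ge> 0" "W x \<ge> 0" using A B by auto
        have "F x * (V x - W x) = f x * V x + g x * W x - (f x * W x + g x * V x)" by (simp add: F_def algebra_simps)
        moreover have "0 \<le> f x * W x + g x * V x" "0 \<le> f x * V x + g x * W x" using nn by simp_all
        ultimately show ?thesis by linarith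
      next
        case False
        then have "f x = 0" "g x = 0" using A B by auto
        then show ?thesis by (simp add: F_def)
      qed
      show "AE x in lborel. F x * (V x - W x) \<le> f x * V x + g x * W x" using le by simp
      show "AE x in lborel. 0 \<le> f x * V x + g x * W x" using le by simp
    qed
    also have "\<dots> = (LINT x|lborel. f x * V x) + (LINT x|lborel. g x * W x)" using A B by simp
    also have "\<dots> \<le> E \<rho> + E \<sigma>" using A B by (intro add_mono) auto
    finally show "(LINT \<omega>|M. (h \<omega> (\<lambda>x. avg \<rho> (bump s) z \<epsilon> x - avg \<sigma> (bump s) z \<epsilon> x))\<^sup>2) \<le> E \<rho> + E \<sigma>"
      by (simp add: F_def f_def g_def)
  qed
qed

end

section \<open>Variances of bounded families of test functions\<close>

lemma iter_deriv_cmult_diff: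
  assumes "smooth f" "smooth g"
  shows "iter_deriv vs (\<lambda>x. c * (f x - g x)) = (\<lambda>x. c * (iter_deriv vs f x - iter_deriv vs g x))"
proof -
  have diff: "f differentiable (at x)" if "smooth f" for f x
  proof -
    have "Ck_on (Suc 0) UNIV f" using that unfolding smooth_def by blast
    then show ?thesis by simp
  qed
  have sm: "smooth (iter_deriv vs f)" if "smooth f" for f vs
    using that unfolding iter_deriv_def by (induction vs) (auto intro: smooth_dir_deriv)
  show ?thesis
  proof (induction vs)
    case (Cons v vs)
    have "iter_deriv (v # vs) (\<lambda>x. c * (f x - g x)) = dir_deriv v (\<lambda>x. c * (iter_deriv vs f x - iter_deriv vs g x))"
      using Cons by (simp add: iter_deriv_def)
    also have "\<dots> = (\<lambda>x. c * (dir_deriv v (iter_deriv vs f) x - dir_deriv v (iter_deriv vs g) x))"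
    proof
      fix x
      have df: "iter_deriv vs f differentiable (at x)" and dg: "iter_deriv vs g differentiable (at x)"
        by (intro diff sm assms)+
      show "dir_deriv v (\<lambda>x. c * (iter_deriv vs f x - iter_deriv vs g x)) x
          = c * (dir_deriv v (iter_deriv vs f) x - dir_deriv v (iter_deriv vs g) x)"
        using dir_deriv_cmult[OF differentiable_diff[OF df dg]] dir_deriv_diff[OF df dg] by simp
    qed
    finally show ?case by (simp add: iter_deriv_def)
  qed (simp add: iter_deriv_def)
qed

lemma weighted_seminorm_le:
  assumes "\<And>vs x. set vs \<subseteq> Basis \<Longrightarrow> length vs \<le> k \<Longrightarrow> \<bar>iter_deriv vs f x\<bar> \<le> B"
  shows "0 \<le> weighted_seminorm 0 k f" "weighted_seminorm 0 k f \<le> B"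
proof -
  let ?Q = "{vs. set vs \<subseteq> (Basis :: complex set) \<and> length vs \<le> k} \<times> (UNIV :: complex set)"
  let ?F = "\<lambda>q. (1 + norm (snd q)) ^ 0 * \<bar>iter_deriv (fst q) f (snd q)\<bar>"
  have le: "?F q \<le> B" if "q \<in> ?Q" for q 
  proof -
    have "\<bar>iter_deriv (fst q) f (snd q)\<bar> \<le> B" by (rule assms) (use that in auto)
    then show ?thesis by simp
  qed
  have mem: "([], 0) \<in> ?Q" by simp
  have eq: "weighted_seminorm 0 k f = (SUP q\<in>?Q. ?F q)" by (simp add: weighted_seminorm_def)
  show "weighted_seminorm 0 k f \<le> B" unfolding eq
  proof (rule cSUP_least)
    show "?Q \<noteq> {}"
    proof
      assume e: "?Q = {}"
      show False by (rule emptyE[OF mem[unfolded e]])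
    qed
  qed (rule le)
  have "bdd_above (?F ` ?Q)" using le by (intro bdd_aboveI2)
  from cSUP_upper[OF mem this] show "0 \<le> weighted_seminorm 0 k f" unfolding eq
    by (rule order_trans[rotated]) simp
qed

context gff_comparison
begin

text \<open>Every sample of the field is a distribution, so it is bounded on a bounded set of test
  functions.  A family of centred Gaussians that is almost surely bounded has bounded variances,
  since a Gaussian of large variance is rarely small.\<close>

lemma bounded_family_variance:
  assumes K: "compact K" "K \<subseteq> D"
    and \<F>: "\<And>f. f \<in> \<F> \<Longrightarrow> smooth f" "\<And>f y. f \<in> \<F> \<Longrightarrow> y \<notin> K \<Longrightarrow> f y = 0"
    and bound: "\<And>k. \<exists>B. \<forall>f\<in>\<F>. \<forall>vs x. set vs \<subseteq> Basis \<and> length vs \<le> k \<longrightarrow> \<bar>iter_deriv vs f x\<bar> \<le> B"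
  shows "\<exists>C\<ge>0. \<forall>f\<in>\<F>. (LINT \<omega>|N. (hD \<omega> f)\<^sup>2) \<le> C"
proof (rule ccontr)
  assume neg: "\<not> ?thesis"
  have "\<forall>m. \<exists>f. f \<in> \<F> \<and> (real m)\<^sup>2 < (LINT \<omega>|N. (hD \<omega> f)\<^sup>2)"
  proof (rule allI, rule ccontr)
    fix m assume no: "\<not> (\<exists>f. f \<in> \<F> \<and> (real m)\<^sup>2 < (LINT \<omega>|N. (hD \<omega> f)\<^sup>2))"
    have "(LINT \<omega>|N. (hD \<omega> f)\<^sup>2) \<le> (real m)\<^sup>2" if "f \<in> \<F>" for f
    proof (rule ccontr)
      assume "\<not> (LINT \<omega>|N. (hD \<omega> f)\<^sup>2) \<le> (real m)\<^sup>2"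
      then have "f \<in> \<F> \<and> (real m)\<^sup>2 < (LINT \<omega>|N. (hD \<omega> f)\<^sup>2)" using that by (intro conjI) (simp_all only: not_le)
      then have "\<exists>f. f \<in> \<F> \<and> (real m)\<^sup>2 < (LINT \<omega>|N. (hD \<omega> f)\<^sup>2)" by (rule exI[of _ f])
      with no show False by (rule notE)
    qed
    then have "\<forall>f\<in>\<F>. (LINT \<omega>|N. (hD \<omega> f)\<^sup>2) \<le> (real m)\<^sup>2" by (rule ballI)
    note conjI[OF zero_le_power2[of "real m"] this]
    then have "\<exists>C\<ge>0. \<forall>f\<in>\<F>. (LINT \<omega>|N. (hD \<omega> f)\<^sup>2) \<le> C" by (rule exI[of _ "(real m)\<^sup>2"])
    with neg show False by (rule notE)
  qed
  from choice[OF this] obtain f where f0: "\<forall>m. f m \<in> \<F> \<and> (real m)\<^sup>2 < (LINT \<omega>|N. (hD \<omega> (f m))\<^sup>2)"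
    by (rule exE)
  note f = f0[THEN spec, THEN conjunct1] f0[THEN spec, THEN conjunct2]
  have ft: "f m \<in> test_functions D" for m using test_functionsI[OF \<F>(1)[OF f(1)] K \<F>(2)[OF f(1)]] .
  have clK: "closed K" using K compact_imp_closed by blast
  have supp: "fun_support (f m) \<subseteq> K" for m
    unfolding fun_support_def using \<F>(2)[OF f(1)] clK by (intro closure_minimal) auto
  define A where "A = (\<lambda>T::nat. {\<omega> \<in> space N. \<forall>m. \<bar>hD \<omega> (f m)\<bar> \<le> real T})"
  have mb: "(\<lambda>\<omega>. hD \<omega> (f m)) \<in> borel_measurable N" for m by (rule hD_measurable[OF ft])
  have mA: "A T \<in> sets N" for T
    unfolding A_def using mb by measurable
  have small: "measure N (A T) \<le> 2 * real T / real (Suc m)" for T m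
  proof -
    interpret g: gaussian_variable N "\<lambda>\<omega>. hD \<omega> (f (Suc m))" by (rule gaussian_hD[OF ft])
    have "measure N (A T) \<le> measure N {\<omega> \<in> space N. \<bar>hD \<omega> (f (Suc m))\<bar> \<le> real T}"
    proof (rule N.finite_measure_mono)
      show "A T \<subseteq> {\<omega> \<in> space N. \<bar>hD \<omega> (f (Suc m))\<bar> \<le> real T}" unfolding A_def by blast
      show "{\<omega> \<in> space N. \<bar>hD \<omega> (f (Suc m))\<bar> \<le> real T} \<in> sets N" using mb[of "Suc m"] by measurable
    qed
    also have "\<dots> \<le> 2 * real T / real (Suc m)"
      by (rule g.small_ball_bound) (use f(2)[of "Suc m"] in auto)
    finally show ?thesis .
  qed
  have "measure N (A T) \<le> 0" for T
  proof (rule LIMSEQ_le_const)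
    have "(\<lambda>m. (2 * real T) * inverse (real (Suc m))) \<longlonglongrightarrow> (2 * real T) * 0"
      by (intro tendsto_mult tendsto_const LIMSEQ_inverse_real_of_nat)
    then show "(\<lambda>m. 2 * real T / real (Suc m)) \<longlonglongrightarrow> 0" by (simp add: divide_inverse)
    show "\<exists>n0. \<forall>n\<ge>n0. measure N (A T) \<le> 2 * real T / real (Suc n)" using small by blast
  qed
  then have "A T \<in> null_sets N" for T
  proof (intro null_setsI mA)
    have "measure N (A T) = 0"
      using \<open>\<And>T. measure N (A T) \<le> 0\<close>[of T] measure_nonneg[of N "A T"] by (rule order.antisym)
    then show "emeasure N (A T) = 0" by (simp add: N.emeasure_eq_measure)
  qed
  then have "(\<Union>T. A T) \<in> null_sets N" by (rule null_sets_UN)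
  moreover have "(\<Union>T. A T) = space N"
  proof -
    have "\<exists>T::nat. \<omega> \<in> A T" if \<omega>: "\<omega> \<in> space N" for \<omega>
    proof -
      have "distribution_on D (hD \<omega>)" using gff \<omega> by (simp add: zero_boundary_GFF_def)
      from this[unfolded distribution_on_def, THEN conjunct2, THEN spec, THEN mp, OF conjI[OF K]]
      obtain C k where Ck: "\<forall>f\<in>test_functions D. fun_support f \<subseteq> K \<longrightarrow> \<bar>hD \<omega> f\<bar> \<le> C * weighted_seminorm 0 k f"
        by (elim exE) (rule that)
      obtain B where B: "\<forall>f\<in>\<F>. \<forall>vs x. set vs \<subseteq> Basis \<and> length vs \<le> k \<longrightarrow> \<bar>iter_deriv vs f x\<bar> \<le> B"
        using bound by blast
      have "\<bar>hD \<omega> (f m)\<bar> \<le> \<bar>C\<bar> * \<bar>B\<bar>" for m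
      proof -
        have sn: "0 \<le> weighted_seminorm 0 k (f m)" "weighted_seminorm 0 k (f m) \<le> B"
          using weighted_seminorm_le[of k "f m" B] B f(1)[of m] by auto
        have "\<bar>hD \<omega> (f m)\<bar> \<le> C * weighted_seminorm 0 k (f m)" by (rule Ck[rule_format, OF ft supp])
        also have "\<dots> \<le> \<bar>C\<bar> * weighted_seminorm 0 k (f m)" using sn by (intro mult_right_mono) auto
        also have "\<dots> \<le> \<bar>C\<bar> * \<bar>B\<bar>" using sn by (intro mult_left_mono) auto
        finally show ?thesis .
      qed
      moreover obtain T :: nat where "\<bar>C\<bar> * \<bar>B\<bar> \<le> real T" using real_arch_simple by blast
      ultimately show ?thesis using \<omega> unfolding A_def by (intro exI[of _ T]) (auto intro: order_trans)
    qed
    then show ?thesis by (auto simp: A_def)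
  qed
  ultimately show False using N.emeasure_space_1 by (simp add: null_sets_def)
qed

lemma smooth_supp_iter_deriv_bounds:
  assumes \<eta>: "smooth_supp R \<eta>"
  shows "\<exists>L\<ge>0. \<forall>vs x y. set vs \<subseteq> Basis \<and> length vs \<le> k \<longrightarrow>
    \<bar>iter_deriv vs \<eta> x\<bar> \<le> L \<and> \<bar>iter_deriv vs \<eta> x - iter_deriv vs \<eta> y\<bar> \<le> L * norm (x - y)"
proof -
  let ?V = "{vs. set vs \<subseteq> (Basis :: complex set) \<and> length vs \<le> k}"
  have fin: "finite ?V" by (rule finite_lists_length_le) simp
  have "\<exists>L\<ge>0. \<forall>x y. \<bar>iter_deriv vs \<eta> x\<bar> \<le> L \<and> \<bar>iter_deriv vs \<eta> x - iter_deriv vs \<eta> y\<bar> \<le> L * norm (x - y)" for vs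
  proof -
    obtain L1 where L1: "L1 \<ge> 0" "\<And>x. \<bar>iter_deriv vs \<eta> x\<bar> \<le> L1"
      using smooth_supp_bounded[OF smooth_supp_iter_deriv[OF \<eta>]] by blast
    obtain L2 where L2: "L2 \<ge> 0" "\<And>x y. \<bar>iter_deriv vs \<eta> x - iter_deriv vs \<eta> y\<bar> \<le> L2 * norm (x - y)"
      using smooth_supp_Lipschitz[OF smooth_supp_iter_deriv[OF \<eta>]] by blast
    have "\<bar>iter_deriv vs \<eta> x\<bar> \<le> L1 + L2 \<and> \<bar>iter_deriv vs \<eta> x - iter_deriv vs \<eta> y\<bar> \<le> (L1 + L2) * norm (x - y)" for x y
    proof
      show "\<bar>iter_deriv vs \<eta> x\<bar> \<le> L1 + L2" using L1(2)[of x] L2(1) by linarith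
      have "L2 * norm (x - y) \<le> (L1 + L2) * norm (x - y)" using L1(1) by (intro mult_right_mono) auto
      then show "\<bar>iter_deriv vs \<eta> x - iter_deriv vs \<eta> y\<bar> \<le> (L1 + L2) * norm (x - y)"
        using L2(2)[of x y] by linarith
    qed
    then show ?thesis using L1 L2 by (intro exI[of _ "L1 + L2"]) auto
  qed
  then have "\<forall>vs. \<exists>L\<ge>0. \<forall>x y. \<bar>iter_deriv vs \<eta> x\<bar> \<le> L
      \<and> \<bar>iter_deriv vs \<eta> x - iter_deriv vs \<eta> y\<bar> \<le> L * norm (x - y)" by (rule allI)
  from choice[OF this] obtain L where L0: "\<forall>vs. L vs \<ge> 0 \<and> (\<forall>x y. \<bar>iter_deriv vs \<eta> x\<bar> \<le> L vs
      \<and> \<bar>iter_deriv vs \<eta> x - iter_deriv vs \<eta> y\<bar> \<le> L vs * norm (x - y))" by (rule exE)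
  note L = L0[THEN spec, THEN conjunct1] L0[THEN spec, THEN conjunct2, THEN spec, THEN spec]
  have le: "L vs \<le> sum L ?V" if "vs \<in> ?V" for vs by (rule member_le_sum[OF that _ fin]) (rule L(1))
  show ?thesis
  proof (intro exI[of _ "sum L ?V"] conjI allI impI)
    show "0 \<le> sum L ?V" by (intro sum_nonneg L(1))
    fix vs :: "complex list" and x y :: complex assume vs: "set vs \<subseteq> Basis \<and> length vs \<le> k"
    then have l: "L vs \<le> sum L ?V" by (intro le) simp
    show "\<bar>iter_deriv vs \<eta> x\<bar> \<le> sum L ?V" using L(2)[of vs x y] l by linarith
    have "L vs * norm (x - y) \<le> sum L ?V * norm (x - y)" using l by (intro mult_right_mono) auto
    then show "\<bar>iter_deriv vs \<eta> x - iter_deriv vs \<eta> y\<bar> \<le> sum L ?V * norm (x - y)"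
      using L(2)[of vs x y] by linarith
  qed
qed

lemma avg_outside:
  assumes \<rho>: "disc_prob \<rho>" and \<eta>: "smooth_supp s \<eta>" and e: "\<epsilon> \<ge> 0" and K: "cball z (\<epsilon> + s) \<subseteq> K" and y: "y \<notin> K"
  shows "avg \<rho> \<eta> z \<epsilon> y = 0"
proof (rule avg_eq_0[OF \<rho> \<eta> e])
  have "y \<notin> cball z (\<epsilon> + s)" using K y by blast
  then show "norm (y - z) > s + \<epsilon>" by (simp add: dist_norm norm_minus_commute)
qed

lemma avg_bounded:
  assumes \<rho>: "disc_prob \<rho>" and \<eta>: "smooth_supp R \<eta>" and L: "\<And>x. \<bar>\<eta> x\<bar> \<le> L"
  shows "\<bar>avg \<rho> \<eta> z \<epsilon> x\<bar> \<le> L"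
  unfolding avg_def by (rule abs_integral_le_AE[OF \<rho> smooth_supp_shift_integrable[OF \<rho> \<eta>]]) (simp add: L)

text \<open>Averaging does not increase the supremum norms of the derivatives.\<close>

lemma hD_variance_same_point:
  assumes K: "compact K" "K \<subseteq> D" and \<rho>: "disc_prob \<rho>" and \<sigma>: "disc_prob \<sigma>" and \<eta>: "smooth_supp s \<eta>"
  shows "\<exists>C\<ge>0. \<forall>z \<epsilon>. \<epsilon> > 0 \<and> cball z (\<epsilon> + s) \<subseteq> K \<longrightarrow>
    (LINT \<omega>|N. (hD \<omega> (\<lambda>x. avg \<rho> \<eta> z \<epsilon> x - avg \<sigma> \<eta> z \<epsilon> x))\<^sup>2) \<le> C"
proof -
  define \<F> where "\<F> = {(\<lambda>x. 1 * (avg \<rho> \<eta> z \<epsilon> x - avg \<sigma> \<eta> z \<epsilon> x)) | z \<epsilon>. \<epsilon> > 0 \<and> cball z (\<epsilon> + s) \<subseteq> K}"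
  have sm: "smooth (avg \<rho> \<eta> z \<epsilon>)" "smooth (avg \<sigma> \<eta> z \<epsilon>)" for z \<epsilon>
    by (rule smooth_avg[OF \<rho> \<eta>], rule smooth_avg[OF \<sigma> \<eta>])
  have "\<exists>C\<ge>0. \<forall>f\<in>\<F>. (LINT \<omega>|N. (hD \<omega> f)\<^sup>2) \<le> C"
  proof (rule bounded_family_variance[OF K])
    fix f assume "f \<in> \<F>"
    then obtain z \<epsilon> where f: "f = (\<lambda>x. 1 * (avg \<rho> \<eta> z \<epsilon> x - avg \<sigma> \<eta> z \<epsilon> x))" "\<epsilon> > 0" "cball z (\<epsilon> + s) \<subseteq> K"
      unfolding \<F>_def mem_Collect_eq by (elim exE conjE) (rule that; assumption)
    show "smooth f" using sm[of z \<epsilon>] unfolding f(1) smooth_def by (auto intro!: Ck_on_diff)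
    show "f y = 0" if "y \<notin> K" for y
      unfolding f(1) using avg_outside[OF \<rho> \<eta> _ f(3) that] avg_outside[OF \<sigma> \<eta> _ f(3) that] f(2) by simp
  next
    fix k
    obtain L where L: "L \<ge> 0" and L': "\<forall>vs x y. set vs \<subseteq> Basis \<and> length vs \<le> k \<longrightarrow>
    \<bar>iter_deriv vs \<eta> x\<bar> \<le> L \<and> \<bar>iter_deriv vs \<eta> x - iter_deriv vs \<eta> y\<bar> \<le> L * norm (x - y)"
      using smooth_supp_iter_deriv_bounds[OF \<eta>, of k] by (elim exE conjE) (rule that)
    have "\<bar>iter_deriv vs f x\<bar> \<le> 2 * L" if fF: "f \<in> \<F>" and vs: "set vs \<subseteq> Basis \<and> length vs \<le> k" for f vs x
    proof -
      obtain z \<epsilon> where f: "f = (\<lambda>x. 1 * (avg \<rho> \<eta> z \<epsilon> x - avg \<sigma> \<eta> z \<epsilon> x))"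
        using fF unfolding \<F>_def mem_Collect_eq by (elim exE conjE) (rule that)
      have "iter_deriv vs f x = avg \<rho> (iter_deriv vs \<eta>) z \<epsilon> x - avg \<sigma> (iter_deriv vs \<eta>) z \<epsilon> x"
        unfolding f iter_deriv_cmult_diff[OF sm] iter_deriv_avg[OF \<rho> \<eta>] iter_deriv_avg[OF \<sigma> \<eta>] by simp
      moreover have "\<bar>avg \<rho> (iter_deriv vs \<eta>) z \<epsilon> x\<bar> \<le> L" "\<bar>avg \<sigma> (iter_deriv vs \<eta>) z \<epsilon> x\<bar> \<le> L"
        by (rule avg_bounded[OF \<rho> smooth_supp_iter_deriv[OF \<eta>] L'[rule_format, OF vs, THEN conjunct1]],
            rule avg_bounded[OF \<sigma> smooth_supp_iter_deriv[OF \<eta>] L'[rule_format, OF vs, THEN conjunct1]])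
      ultimately show ?thesis by linarith
    qed
    then show "\<exists>B. \<forall>f\<in>\<F>. \<forall>vs x. set vs \<subseteq> Basis \<and> length vs \<le> k \<longrightarrow> \<bar>iter_deriv vs f x\<bar> \<le> B" by blast
  qed
  then obtain C where C: "C \<ge> 0" "\<And>f. f \<in> \<F> \<Longrightarrow> (LINT \<omega>|N. (hD \<omega> f)\<^sup>2) \<le> C" by blast
  have "(LINT \<omega>|N. (hD \<omega> (\<lambda>x. avg \<rho> \<eta> z \<epsilon> x - avg \<sigma> \<eta> z \<epsilon> x))\<^sup>2) \<le> C" if "\<epsilon> > 0 \<and> cball z (\<epsilon> + s) \<subseteq> K" for z \<epsilon>
  proof -
    have "(\<lambda>x. 1 * (avg \<rho> \<eta> z \<epsilon> x - avg \<sigma> \<eta> z \<epsilon> x)) \<in> \<F>"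
      unfolding \<F>_def mem_Collect_eq by (rule exI[of _ z], rule exI[of _ \<epsilon>], rule conjI[OF refl that])
    from C(2)[OF this] show ?thesis by simp
  qed
  then show ?thesis using C(1) by blast
qed

text \<open>Divided by the distance of the parameters, the differences of averages form a bounded family,
  because the derivatives of \<open>\<eta>\<close> are Lipschitz.\<close>

lemma hD_variance_increment:
  assumes K: "compact K" "K \<subseteq> D" and \<rho>: "disc_prob \<rho>" and \<eta>: "smooth_supp s \<eta>"
  shows "\<exists>C\<ge>0. \<forall>z \<epsilon> w r. \<epsilon> > 0 \<and> cball z (\<epsilon> + s) \<subseteq> K \<and> r > 0 \<and> cball w (r + s) \<subseteq> K \<longrightarrow>
    (LINT \<omega>|N. (hD \<omega> (\<lambda>x. avg \<rho> \<eta> z \<epsilon> x - avg \<rho> \<eta> w r x))\<^sup>2) \<le> C * (norm (z - w) + \<bar>\<epsilon> - r\<bar>)\<^sup>2"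
proof -
  let ?\<Delta> = "\<lambda>z \<epsilon> w r. norm (z - w) + \<bar>\<epsilon> - r\<bar>"
  let ?ok = "\<lambda>z \<epsilon> w r. \<epsilon> > 0 \<and> cball z (\<epsilon> + s) \<subseteq> K \<and> r > 0 \<and> cball w (r + s) \<subseteq> K"
  define \<F> where "\<F> = {(\<lambda>x. (1 / ?\<Delta> z \<epsilon> w r) * (avg \<rho> \<eta> z \<epsilon> x - avg \<rho> \<eta> w r x)) | z \<epsilon> w r. ?ok z \<epsilon> w r}"
  have sm: "smooth (avg \<rho> \<eta> z \<epsilon>)" for z \<epsilon> by (rule smooth_avg[OF \<rho> \<eta>])
  have sm': "smooth (\<lambda>x. c * (avg \<rho> \<eta> z \<epsilon> x - avg \<rho> \<eta> w r x))" for c z \<epsilon> w r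
    using sm unfolding smooth_def by (auto intro!: Ck_on_diff Ck_on_cmult)
  have out: "avg \<rho> \<eta> z \<epsilon> y = 0 \<and> avg \<rho> \<eta> w r y = 0" if "?ok z \<epsilon> w r" "y \<notin> K" for z \<epsilon> w r y
    using avg_outside[OF \<rho> \<eta> _ _ that(2), of \<epsilon> z] avg_outside[OF \<rho> \<eta> _ _ that(2), of r w] that(1) by simp
  have "\<exists>C\<ge>0. \<forall>f\<in>\<F>. (LINT \<omega>|N. (hD \<omega> f)\<^sup>2) \<le> C"
  proof (rule bounded_family_variance[OF K])
    fix f assume "f \<in> \<F>"
    then obtain z \<epsilon> w r where f: "f = (\<lambda>x. (1 / ?\<Delta> z \<epsilon> w r) * (avg \<rho> \<eta> z \<epsilon> x - avg \<rho> \<eta> w r x))" "?ok z \<epsilon> w r"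
      unfolding \<F>_def mem_Collect_eq by (elim exE conjE) (rule that, assumption, (intro conjI; assumption))
    show "smooth f" unfolding f(1) by (rule sm')
    show "f y = 0" if "y \<notin> K" for y unfolding f(1) using out[OF f(2) that] by simp
  next
    fix k
    obtain L where L: "L \<ge> 0" and L': "\<forall>vs x y. set vs \<subseteq> Basis \<and> length vs \<le> k \<longrightarrow>
    \<bar>iter_deriv vs \<eta> x\<bar> \<le> L \<and> \<bar>iter_deriv vs \<eta> x - iter_deriv vs \<eta> y\<bar> \<le> L * norm (x - y)"
      using smooth_supp_iter_deriv_bounds[OF \<eta>, of k] by (elim exE conjE) (rule that)
    have "\<bar>iter_deriv vs f x\<bar> \<le> L" if fF: "f \<in> \<F>" and vs: "set vs \<subseteq> Basis \<and> length vs \<le> k" for f vs x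
    proof -
      obtain z \<epsilon> w r where f: "f = (\<lambda>x. (1 / ?\<Delta> z \<epsilon> w r) * (avg \<rho> \<eta> z \<epsilon> x - avg \<rho> \<eta> w r x))"
        using fF unfolding \<F>_def mem_Collect_eq by (elim exE conjE) (rule that)
      have "iter_deriv vs f x = (1 / ?\<Delta> z \<epsilon> w r) * (avg \<rho> (iter_deriv vs \<eta>) z \<epsilon> x - avg \<rho> (iter_deriv vs \<eta>) w r x)"
        unfolding f iter_deriv_cmult_diff[OF sm sm] iter_deriv_avg[OF \<rho> \<eta>] ..
      moreover have "\<bar>avg \<rho> (iter_deriv vs \<eta>) z \<epsilon> x - avg \<rho> (iter_deriv vs \<eta>) w r x\<bar> \<le> L * ?\<Delta> z \<epsilon> w r"
        by (rule avg_diff_le[OF \<rho> smooth_supp_iter_deriv[OF \<eta>] L'[rule_format, OF vs, THEN conjunct2] L(1)])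
      moreover have "?\<Delta> z \<epsilon> w r = 0 \<or> ?\<Delta> z \<epsilon> w r > 0"
        using norm_ge_zero[of "z - w"] abs_ge_zero[of "\<epsilon> - r"] by linarith
      ultimately show ?thesis
        using L(1) by (elim disjE) (simp_all add: abs_mult pos_divide_le_eq)
    qed
    then show "\<exists>B. \<forall>f\<in>\<F>. \<forall>vs x. set vs \<subseteq> Basis \<and> length vs \<le> k \<longrightarrow> \<bar>iter_deriv vs f x\<bar> \<le> B" by blast
  qed
  then obtain C where C: "C \<ge> 0" "\<And>f. f \<in> \<F> \<Longrightarrow> (LINT \<omega>|N. (hD \<omega> f)\<^sup>2) \<le> C" by blast
  have "(LINT \<omega>|N. (hD \<omega> (\<lambda>x. avg \<rho> \<eta> z \<epsilon> x - avg \<rho> \<eta> w r x))\<^sup>2) \<le> C * (?\<Delta> z \<epsilon> w r)\<^sup>2" if ok: "?ok z \<epsilon> w r" for z \<epsilon> w r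
  proof -
    define d where "d = ?\<Delta> z \<epsilon> w r"
    let ?g = "\<lambda>x. avg \<rho> \<eta> z \<epsilon> x - avg \<rho> \<eta> w r x"
    let ?f = "\<lambda>x. (1 / d) * ?g x"
    have fF: "?f \<in> \<F>" unfolding \<F>_def d_def mem_Collect_eq
      by (rule exI[of _ z], rule exI[of _ \<epsilon>], rule exI[of _ w], rule exI[of _ r], rule conjI[OF refl ok])
    have ft: "?f \<in> test_functions D"
      by (rule test_functionsI[OF sm' K]) (use out[OF ok] in simp)
    \<comment> \<open>If \<open>d = 0\<close>, then \<open>?f\<close> is zero because of \<open>1 / 0 = 0\<close>, and so is \<open>?g\<close>.\<close>
    have gd: "?g = (\<lambda>x. d * ?f x + 0 * ?f x)"
    proof (cases "d = 0")
      case True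
      then have "norm (z - w) = 0" "\<bar>\<epsilon> - r\<bar> = 0"
        using norm_ge_zero[of "z - w"] abs_ge_zero[of "\<epsilon> - r"] unfolding d_def by linarith+
      then have "z = w" "\<epsilon> = r" by simp_all
      then show ?thesis using True by simp
    qed (simp add: fun_eq_iff)
    have "(LINT \<omega>|N. (hD \<omega> ?g)\<^sup>2) = (LINT \<omega>|N. d\<^sup>2 * (hD \<omega> ?f)\<^sup>2)"
    proof (intro Bochner_Integration.integral_cong refl)
      fix \<omega> assume \<omega>: "\<omega> \<in> space N"
      note lin = bspec[OF bspec[OF hD_linear[OF \<omega>, unfolded linear_functional_on_def] ft] ft]
      have "hD \<omega> (\<lambda>x. d * ?f x + 0 * ?f x) = d * hD \<omega> ?f + 0 * hD \<omega> ?f"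
        by (rule spec[OF spec[OF lin]])
      then have "hD \<omega> ?g = d * hD \<omega> ?f" using gd by (simp only: mult_zero_left add_0_right)
      then show "(hD \<omega> ?g)\<^sup>2 = d\<^sup>2 * (hD \<omega> ?f)\<^sup>2" by (simp only: power_mult_distrib)
    qed
    also have "\<dots> = d\<^sup>2 * (LINT \<omega>|N. (hD \<omega> ?f)\<^sup>2)" by simp
    also have "\<dots> \<le> d\<^sup>2 * C" by (intro mult_left_mono C(2)[OF fF]) simp
    finally show ?thesis by (simp only: d_def mult.commute)
  qed
  then show ?thesis using C(1) by blast
qed

end

section \<open>Gaussian tails for the regularised field\<close>

lemma centered_gaussian_cong:
  assumes "centered_gaussian M X" "\<And>\<omega>. \<omega> \<in> space M \<Longrightarrow> X \<omega> = Y \<omega>"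
  shows "centered_gaussian M Y"
proof -
  have d: "distr M borel X = distr M borel Y" by (rule distr_cong) (use assms(2) in auto)
  have m: "X \<in> borel_measurable M \<longleftrightarrow> Y \<in> borel_measurable M" by (rule measurable_cong[OF assms(2)])
  show ?thesis using assms(1) unfolding centered_gaussian_def d m .
qed

lemma field_pairing_avg:
  assumes p: "field_pairing M h (scaled_measure \<rho> z \<epsilon>) X" and \<rho>: "disc_prob \<rho>"
  shows "X \<in> borel_measurable M"
    and "(\<lambda>n. \<integral>\<^sup>+\<omega>. ennreal ((h \<omega> (avg \<rho> (bump (1 / real (Suc n))) z \<epsilon>) - X \<omega>)\<^sup>2) \<partial>M) \<longlonglongrightarrow> 0"
proof -
  show "X \<in> borel_measurable M" using p by (simp add: field_pairing_def)
  have "(\<lambda>n. \<integral>\<^sup>+\<omega>. ennreal ((h \<omega> (mollify (scaled_measure \<rho> z \<epsilon>) (bump 1) n) - X \<omega>)\<^sup>2) \<partial>M) \<longlonglongrightarrow> 0"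
    using p bump_in_smooth_bumps by (simp add: field_pairing_def)
  from LIMSEQ_Suc[OF this] show "(\<lambda>n. \<integral>\<^sup>+\<omega>. ennreal ((h \<omega> (avg \<rho> (bump (1 / real (Suc n))) z \<epsilon>) - X \<omega>)\<^sup>2) \<partial>M) \<longlonglongrightarrow> 0"
    unfolding mollify_scaled_measure[OF \<rho> zero_less_Suc] .
qed

lemma lap_diff:
  assumes "smooth f" "smooth g"
  shows "lap (\<lambda>x. f x - g x) x = lap f x - lap g x"
proof -
  have g': "smooth (\<lambda>x. (-1) * g x)" by (rule smooth_cmult[OF assms(2)])
  have "lap (\<lambda>x. f x + (-1) * g x) x = lap f x + lap (\<lambda>x. (-1) * g x) x"
    using assms g' by (intro lap_add[of UNIV]) (simp_all add: smooth_def)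
  also have "lap (\<lambda>x. (-1) * g x) x = (-1) * lap g x"
    using assms by (intro lap_cmult[of UNIV]) (simp_all add: smooth_def)
  finally show ?thesis by simp
qed

context gff_comparison
begin

abbreviation moll :: "nat \<Rightarrow> complex \<Rightarrow> real" where "moll n \<equiv> bump (1 / real (Suc n))"

lemma avg_diff_props:
  assumes \<rho>1: "disc_prob \<rho>1" and \<rho>2: "disc_prob \<rho>2" and \<eta>: "smooth_supp s \<eta>"
    and e: "\<epsilon> > 0" "r > 0"
  shows "smooth_supp (norm z + norm w + s + \<bar>s\<bar> + \<epsilon> + r) (\<lambda>x. avg \<rho>1 \<eta> z \<epsilon> x - avg \<rho>2 \<eta> w r x)"
    and "(LINT x|lborel. avg \<rho>1 \<eta> z \<epsilon> x - avg \<rho>2 \<eta> w r x) = 0"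
proof -
  have s1: "smooth_supp (norm z + s + \<epsilon>) (avg \<rho>1 \<eta> z \<epsilon>)" and s2: "smooth_supp (norm w + s + r) (avg \<rho>2 \<eta> w r)"
    using smooth_supp_avg[OF \<rho>1 \<eta>, of \<epsilon> z] smooth_supp_avg[OF \<rho>2 \<eta>, of r w] e by simp_all
  show "smooth_supp (norm z + norm w + s + \<bar>s\<bar> + \<epsilon> + r) (\<lambda>x. avg \<rho>1 \<eta> z \<epsilon> x - avg \<rho>2 \<eta> w r x)"
    by (rule smooth_supp_diff[OF smooth_supp_mono[OF s1] smooth_supp_mono[OF s2]])
      (use e norm_ge_zero[of z] norm_ge_zero[of w] abs_ge_zero[of s] in linarith)+
  show "(LINT x|lborel. avg \<rho>1 \<eta> z \<epsilon> x - avg \<rho>2 \<eta> w r x) = 0"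
    using smooth_supp_integrable[OF s1] smooth_supp_integrable[OF s2] integral_avg[OF \<rho>1 \<eta>] integral_avg[OF \<rho>2 \<eta>] by simp
qed

text \<open>A Gaussian tail for the difference of two regularisations of the field in \<open>D\<close>.  The variance
  proxy has a part from the whole-plane field and a part from the smooth correction at the fixed
  scale \<open>\<delta>\<close>: the difference of two bumps of width \<open>1/n\<close> and \<open>\<delta>\<close> is a Laplacian, averaging commutes
  with the Laplacian, and so \<open>variance_comparison\<close> applies.\<close>

lemma regularisation_tail:
  assumes K: "compact K" "K \<subseteq> D" and \<delta>: "\<delta> > 0"
    and \<rho>1: "disc_prob \<rho>1" and \<rho>2: "disc_prob \<rho>2"
    and e: "\<epsilon> > 0" "r > 0" and zK: "cball z (\<epsilon> + \<delta>) \<subseteq> K" and wK: "cball w (r + \<delta>) \<subseteq> K"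
    and H1: "field_pairing N hD (scaled_measure \<rho>1 z \<epsilon>) H1"
    and H2: "field_pairing N hD (scaled_measure \<rho>2 w r) H2"
    and V1: "\<forall>\<^sub>F n in sequentially. (LINT \<omega>|M. (h \<omega> (\<lambda>x. avg \<rho>1 (moll n) z \<epsilon> x - avg \<rho>2 (moll n) w r x))\<^sup>2) \<le> V1"
    and V2: "(LINT \<omega>|N. (hD \<omega> (\<lambda>x. avg \<rho>1 (bump \<delta>) z \<epsilon> x - avg \<rho>2 (bump \<delta>) w r x))\<^sup>2) \<le> V2"
    and V: "V1 + V2 > 0" and t: "t > 0"
  shows "measure N {\<omega> \<in> space N. \<bar>H1 \<omega> - H2 \<omega>\<bar> \<ge> t} \<le> 2 * exp (- t\<^sup>2 / (8 * (V1 + V2)))"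
proof -
  obtain n0 where n0: "1 / real (Suc n0) < \<delta>" using nat_approx_posE[OF \<delta>] by blast
  have small: "1 / real (Suc n) \<le> \<delta>" if "n \<ge> n0" for n
  proof -
    have "1 / real (Suc n) \<le> 1 / real (Suc n0)" using that by (intro divide_left_mono) auto
    then show ?thesis using n0 by linarith
  qed
  have mpos: "1 / real (Suc n) > 0" for n by simp
  have sm: "smooth_supp \<delta> (moll n)" if "n \<ge> n0" for n
    by (rule smooth_supp_mono[OF smooth_supp_bump[OF mpos] small[OF that]])
  have out1: "avg \<rho>1 \<eta> z \<epsilon> y = 0" if "smooth_supp \<delta> \<eta>" "y \<notin> K" for \<eta> y
    by (rule avg_outside[OF \<rho>1 that(1) _ zK that(2)]) (use e in simp)
  have out2: "avg \<rho>2 \<eta> w r y = 0" if "smooth_supp \<delta> \<eta>" "y \<notin> K" for \<eta> y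
    by (rule avg_outside[OF \<rho>2 that(1) _ wK that(2)]) (use e in simp)
  have t1: "avg \<rho>1 (moll n) z \<epsilon> \<in> test_functions D" if n: "n \<ge> n0" for n
    by (rule test_functionsI[OF smooth_avg[OF \<rho>1 sm[OF n]] K out1[OF sm[OF n]]])
  have t2: "avg \<rho>2 (moll n) w r \<in> test_functions D" if n: "n \<ge> n0" for n
    by (rule test_functionsI[OF smooth_avg[OF \<rho>2 sm[OF n]] K out2[OF sm[OF n]]])
  define F where "F = (\<lambda>\<eta> x. avg \<rho>1 \<eta> z \<epsilon> x - avg \<rho>2 \<eta> w r x)"
  have FK: "F \<eta> y = 0" if "smooth_supp \<delta> \<eta>" "y \<notin> K" for \<eta> y
    unfolding F_def using out1[OF that] out2[OF that] by simp
  define R where "R = norm z + norm w + \<delta> + \<bar>\<delta>\<bar> + \<epsilon> + r"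
  have F1: "smooth_supp R (F \<eta>)" if "smooth_supp \<delta> \<eta>" for \<eta>
    unfolding F_def R_def by (rule avg_diff_props(1)[OF \<rho>1 \<rho>2 that e])
  have F2: "(LINT x|lborel. F \<eta> x) = 0" if "smooth_supp \<delta> \<eta>" for \<eta>
    unfolding F_def by (rule avg_diff_props(2)[OF \<rho>1 \<rho>2 that e])
  have sF: "smooth (F \<eta>)" if "smooth_supp \<delta> \<eta>" for \<eta> using F1[OF that] unfolding smooth_supp_def by blast
  have tF: "F \<eta> \<in> test_functions D" if "smooth_supp \<delta> \<eta>" for \<eta>
    by (rule test_functionsI[OF sF[OF that] K FK[OF that]])
  have lin: "hD \<omega> (F (moll n)) = hD \<omega> (avg \<rho>1 (moll n) z \<epsilon>) - hD \<omega> (avg \<rho>2 (moll n) w r)"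
    if "\<omega> \<in> space N" "n \<ge> n0" for \<omega> n
    unfolding F_def using linear_functional_diff(1)[OF hD_linear[OF that(1)] t1[OF that(2)] t2[OF that(2)]] by simp
  have comp: "(LINT \<omega>|N. (hD \<omega> (F (moll n)))\<^sup>2) \<le> (LINT \<omega>|M. (h \<omega> (F (moll n)))\<^sup>2) + (LINT \<omega>|N. (hD \<omega> (F (bump \<delta>)))\<^sup>2)"
    if n: "n \<ge> n0" for n
  proof -
    obtain \<Phi> where \<Phi>: "smooth_supp (max (1 / real (Suc n)) \<delta>) \<Phi>" "\<And>y. lap \<Phi> y = bump (1 / real (Suc n)) y - bump \<delta> y"
      by (rule bump_diff_eq_lap[OF mpos[of n] \<delta>]) (rule that)
    have s\<Phi>: "smooth_supp \<delta> \<Phi>" using smooth_supp_mono[OF \<Phi>(1)] small[OF n] by simp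
    have dec: "F (moll n) x = lap (F \<Phi>) x + F (bump \<delta>) x" for x
    proof -
      have lap\<Phi>: "lap \<Phi> = (\<lambda>y. moll n y - bump \<delta> y)" using \<Phi>(2) by (simp add: fun_eq_iff)
      have "lap (F \<Phi>) x = avg \<rho>1 (lap \<Phi>) z \<epsilon> x - avg \<rho>2 (lap \<Phi>) w r x"
        unfolding F_def lap_diff[OF smooth_avg[OF \<rho>1 s\<Phi>] smooth_avg[OF \<rho>2 s\<Phi>]]
          lap_avg[OF \<rho>1 s\<Phi>] lap_avg[OF \<rho>2 s\<Phi>] ..
      moreover have "avg \<rho>' (lap \<Phi>) z' \<epsilon>' x = avg \<rho>' (moll n) z' \<epsilon>' x - avg \<rho>' (bump \<delta>) z' \<epsilon>' x"
        if \<rho>': "disc_prob \<rho>'" for \<rho>' z' \<epsilon>'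
        unfolding lap\<Phi> avg_def
        by (rule Bochner_Integration.integral_diff[OF smooth_supp_shift_integrable[OF \<rho>' sm[OF n]]
              smooth_supp_shift_integrable[OF \<rho>' smooth_supp_bump[OF \<delta>]]])
      ultimately show ?thesis unfolding F_def using \<rho>1 \<rho>2 by simp
    qed
    show ?thesis
      by (rule variance_comparison[OF K F1[OF sm[OF n]] FK[OF sm[OF n]] F2[OF sm[OF n]]
            F1[OF smooth_supp_bump[OF \<delta>]] FK[OF smooth_supp_bump[OF \<delta>]] F1[OF s\<Phi>] FK[OF s\<Phi>] dec])
  qed
  show ?thesis
  proof (rule N.L2_limit_tail[where ?n0.0 = n0 and a = "\<lambda>n \<omega>. hD \<omega> (avg \<rho>1 (moll n) z \<epsilon>)" and b = "\<lambda>n \<omega>. hD \<omega> (avg \<rho>2 (moll n) w r)"])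
    show "(\<lambda>\<omega>. hD \<omega> (avg \<rho>1 (moll n) z \<epsilon>)) \<in> borel_measurable N" if "n \<ge> n0" for n by (rule hD_measurable[OF t1[OF that]])
    show "(\<lambda>\<omega>. hD \<omega> (avg \<rho>2 (moll n) w r)) \<in> borel_measurable N" if "n \<ge> n0" for n by (rule hD_measurable[OF t2[OF that]])
    show "H1 \<in> borel_measurable N" "H2 \<in> borel_measurable N"
      by (rule field_pairing_avg(1)[OF H1 \<rho>1], rule field_pairing_avg(1)[OF H2 \<rho>2])
    show "(\<lambda>n. \<integral>\<^sup>+\<omega>. ennreal ((hD \<omega> (avg \<rho>1 (moll n) z \<epsilon>) - H1 \<omega>)\<^sup>2) \<partial>N) \<longlonglongrightarrow> 0"
      by (rule field_pairing_avg(2)[OF H1 \<rho>1])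
    show "(\<lambda>n. \<integral>\<^sup>+\<omega>. ennreal ((hD \<omega> (avg \<rho>2 (moll n) w r) - H2 \<omega>)\<^sup>2) \<partial>N) \<longlonglongrightarrow> 0"
      by (rule field_pairing_avg(2)[OF H2 \<rho>2])
    show "gaussian_variable N (\<lambda>\<omega>. hD \<omega> (avg \<rho>1 (moll n) z \<epsilon>) - hD \<omega> (avg \<rho>2 (moll n) w r))" if n: "n \<ge> n0" for n
    proof
      have "centered_gaussian N (\<lambda>\<omega>. hD \<omega> (F (moll n)))"
        using gaussian_variable.gaussian[OF gaussian_hD[OF tF[OF sm[OF n]]]] .
      then show "centered_gaussian N (\<lambda>\<omega>. hD \<omega> (avg \<rho>1 (moll n) z \<epsilon>) - hD \<omega> (avg \<rho>2 (moll n) w r))"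
        by (rule centered_gaussian_cong) (rule lin[OF _ n])
    qed
    show "\<forall>\<^sub>F n in sequentially. (LINT \<omega>|N. (hD \<omega> (avg \<rho>1 (moll n) z \<epsilon>) - hD \<omega> (avg \<rho>2 (moll n) w r))\<^sup>2) \<le> V1 + V2"
      using V1 eventually_ge_at_top[of n0]
    proof eventually_elim
      case (elim n)
      have "(LINT \<omega>|N. (hD \<omega> (avg \<rho>1 (moll n) z \<epsilon>) - hD \<omega> (avg \<rho>2 (moll n) w r))\<^sup>2) = (LINT \<omega>|N. (hD \<omega> (F (moll n)))\<^sup>2)"
        by (rule Bochner_Integration.integral_cong[OF refl]) (simp only: lin[OF _ elim(2)])
      also have "\<dots> \<le> V1 + V2"
        using comp[OF elim(2)] elim(1) V2 unfolding F_def by linarith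
      finally show ?case .
    qed
  qed (use V t in auto)
qed

text \<open>Both parts of the variance proxy are bounded uniformly in the point and the scale: the first by
  the energies, the second because averages of a fixed bump are bounded test functions.\<close>

lemma same_point_tail:
  assumes K: "compact K" "K \<subseteq> D" and \<delta>: "\<delta> > 0"
    and \<rho>: "disc_prob \<rho>" "finite_log_energy \<rho>" and \<sigma>: "disc_prob \<sigma>" "finite_log_energy \<sigma>"
  obtains C where "C > 0" "\<And>z \<epsilon> H1 H2 t. \<epsilon> > 0 \<Longrightarrow> cball z (\<epsilon> + \<delta>) \<subseteq> K \<Longrightarrow> t > 0 \<Longrightarrow>
    field_pairing N hD (scaled_measure \<rho> z \<epsilon>) H1 \<Longrightarrow> field_pairing N hD (scaled_measure \<sigma> z \<epsilon>) H2 \<Longrightarrow>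
    measure N {\<omega> \<in> space N. \<bar>H1 \<omega> - H2 \<omega>\<bar> \<ge> t} \<le> 2 * exp (- t\<^sup>2 / C)"
proof -
  obtain C1 where C1: "C1 \<ge> 0" "\<And>z \<epsilon> s. 0 < s \<Longrightarrow> s \<le> \<epsilon> \<Longrightarrow>
    (LINT \<omega>|M. (h \<omega> (\<lambda>x. avg \<rho> (bump s) z \<epsilon> x - avg \<sigma> (bump s) z \<epsilon> x))\<^sup>2) \<le> C1"
    by (rule variance_same_point[OF \<rho> \<sigma>]) (rule that)
  obtain C2 where C2: "C2 \<ge> 0" and C2': "\<forall>z \<epsilon>. \<epsilon> > 0 \<and> cball z (\<epsilon> + \<delta>) \<subseteq> K \<longrightarrow>
    (LINT \<omega>|N. (hD \<omega> (\<lambda>x. avg \<rho> (bump \<delta>) z \<epsilon> x - avg \<sigma> (bump \<delta>) z \<epsilon> x))\<^sup>2) \<le> C2"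
    using hD_variance_same_point[OF K \<rho>(1) \<sigma>(1) smooth_supp_bump[OF \<delta>]] by (elim exE conjE) (rule that)
  show ?thesis
  proof (rule that[of "8 * (C1 + 1 + C2)"])
    show "8 * (C1 + 1 + C2) > 0" using C1(1) C2 by simp
    fix z :: complex and \<epsilon> t :: real and H1 H2
    assume A: "\<epsilon> > 0" "cball z (\<epsilon> + \<delta>) \<subseteq> K" "t > 0"
      and H: "field_pairing N hD (scaled_measure \<rho> z \<epsilon>) H1" "field_pairing N hD (scaled_measure \<sigma> z \<epsilon>) H2"
    show "measure N {\<omega> \<in> space N. \<bar>H1 \<omega> - H2 \<omega>\<bar> \<ge> t} \<le> 2 * exp (- t\<^sup>2 / (8 * (C1 + 1 + C2)))"
    proof (rule regularisation_tail[OF K \<delta> \<rho>(1) \<sigma>(1) A(1) A(1) A(2) A(2) H _ C2'[rule_format, OF conjI[OF A(1,2)]] _ A(3)])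
      obtain n0 where n0: "1 / real (Suc n0) < \<epsilon>" using nat_approx_posE[OF A(1)] by blast
      show "\<forall>\<^sub>F n in sequentially. (LINT \<omega>|M. (h \<omega> (\<lambda>x. avg \<rho> (moll n) z \<epsilon> x - avg \<sigma> (moll n) z \<epsilon> x))\<^sup>2) \<le> C1 + 1"
        using eventually_ge_at_top[of n0]
      proof eventually_elim
        case (elim n)
        have "1 / real (Suc n) \<le> 1 / real (Suc n0)" using elim by (intro divide_left_mono) auto
        then have "1 / real (Suc n) \<le> \<epsilon>" using n0 by linarith
        then have "(LINT \<omega>|M. (h \<omega> (\<lambda>x. avg \<rho> (moll n) z \<epsilon> x - avg \<sigma> (moll n) z \<epsilon> x))\<^sup>2) \<le> C1"
          by (intro C1(2)) auto
        then show ?case by linarith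
      qed
      show "C1 + 1 + C2 > 0" using C1(1) C2 by simp
    qed
  qed
qed

text \<open>Condition \<open>(A\<^sub>p)\<close> bounds the part of the whole-plane field.  The smooth correction is of order
  \<open>d\<^sup>2\<close>, which is at most \<open>(d / min \<epsilon> r) powr p\<close> because \<open>d \<le> min \<epsilon> r \<le> 1\<close> and \<open>p \<le> 1\<close>.\<close>

lemma increment_tail:
  assumes K: "compact K" "K \<subseteq> D" and \<delta>: "\<delta> > 0"
    and \<rho>: "disc_prob \<rho>" and A: "condition_A M h \<rho> p" and p: "0 < p" "p \<le> 1"
  obtains C where "C > 0" "\<And>z \<epsilon> w r H1 H2 t d. \<epsilon> \<in> {0<..1} \<Longrightarrow> r \<in> {0<..1} \<Longrightarrow> 1/2 \<le> \<epsilon> / r \<Longrightarrow> \<epsilon> / r \<le> 2 \<Longrightarrow>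
    cball z (\<epsilon> + \<delta>) \<subseteq> K \<Longrightarrow> cball w (r + \<delta>) \<subseteq> K \<Longrightarrow>
    norm (z - w) + \<bar>\<epsilon> - r\<bar> \<le> d \<Longrightarrow> 0 < d \<Longrightarrow> d \<le> min \<epsilon> r \<Longrightarrow> t > 0 \<Longrightarrow>
    field_pairing N hD (scaled_measure \<rho> z \<epsilon>) H1 \<Longrightarrow> field_pairing N hD (scaled_measure \<rho> w r) H2 \<Longrightarrow>
    measure N {\<omega> \<in> space N. \<bar>H1 \<omega> - H2 \<omega>\<bar> \<ge> t} \<le> 2 * exp (- t\<^sup>2 / (C * (d / min \<epsilon> r) powr p))"
proof -
  obtain C0 where C0: "\<forall>z w. \<forall>\<epsilon>\<in>{0<..1}. \<forall>r\<in>{0<..1}. 1/2 \<le> \<epsilon> / r \<and> \<epsilon> / r \<le> 2 \<longrightarrow>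
        (\<exists>X Y. field_pairing M h (scaled_measure \<rho> z \<epsilon>) X \<and>
               field_pairing M h (scaled_measure \<rho> w r) Y \<and>
               (LINT \<omega>|M. (X \<omega> - Y \<omega>)\<^sup>2) \<le> C0 * (norm ((z, \<epsilon>) - (w, r)) / min \<epsilon> r) powr p)"
    using A unfolding condition_A_def by (elim exE) (rule that)
  obtain C2 where C2: "C2 \<ge> 0" and C2': "\<forall>z \<epsilon> w r. \<epsilon> > 0 \<and> cball z (\<epsilon> + \<delta>) \<subseteq> K \<and> r > 0 \<and> cball w (r + \<delta>) \<subseteq> K \<longrightarrow>
    (LINT \<omega>|N. (hD \<omega> (\<lambda>x. avg \<rho> (bump \<delta>) z \<epsilon> x - avg \<rho> (bump \<delta>) w r x))\<^sup>2) \<le> C2 * (norm (z - w) + \<bar>\<epsilon> - r\<bar>)\<^sup>2"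
    using hD_variance_increment[OF K \<rho> smooth_supp_bump[OF \<delta>]] by (elim exE conjE) (rule that)
  define V where "V = 3 * \<bar>C0\<bar> + 1 + C2"
  have V0: "V > 0" using C2 by (simp add: V_def)
  show ?thesis
  proof (rule that[of "8 * V"])
    show "8 * V > 0" using V0 by simp
    fix z w :: complex and \<epsilon> r t d :: real and H1 H2
    assume e: "\<epsilon> \<in> {0<..1}" "r \<in> {0<..1}" and ratio: "1/2 \<le> \<epsilon> / r" "\<epsilon> / r \<le> 2"
      and zK: "cball z (\<epsilon> + \<delta>) \<subseteq> K" and wK: "cball w (r + \<delta>) \<subseteq> K"
      and d: "norm (z - w) + \<bar>\<epsilon> - r\<bar> \<le> d" "0 < d" "d \<le> min \<epsilon> r" and t: "t > 0"
      and H: "field_pairing N hD (scaled_measure \<rho> z \<epsilon>) H1" "field_pairing N hD (scaled_measure \<rho> w r) H2"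
    define m where "m = min \<epsilon> r"
    have m: "0 < m" "m \<le> 1" using e by (auto simp: m_def)
    define q where "q = (d / m) powr p"
    have dm: "0 < d / m" "d / m \<le> 1" using d m by (auto simp: m_def)
    have q0: "q > 0" unfolding q_def by (rule iffD2[OF powr_gt_zero]) (use dm in linarith)
    obtain X Y where XY: "field_pairing M h (scaled_measure \<rho> z \<epsilon>) X" "field_pairing M h (scaled_measure \<rho> w r) Y"
      "(LINT \<omega>|M. (X \<omega> - Y \<omega>)\<^sup>2) \<le> C0 * (norm ((z, \<epsilon>) - (w, r)) / min \<epsilon> r) powr p"
      using C0[rule_format, OF e conjI[OF ratio], of z w] by (elim exE conjE) (rule that)
    have "norm ((z, \<epsilon>) - (w, r)) \<le> norm (z - w) + norm (\<epsilon> - r)"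
      unfolding diff_Pair by (rule norm_Pair_le)
    then have "norm ((z, \<epsilon>) - (w, r)) \<le> d" using d(1) by simp
    then have "(norm ((z, \<epsilon>) - (w, r)) / m) powr p \<le> q"
      unfolding q_def using m p by (intro powr_mono2 divide_right_mono) auto
    then have "\<bar>C0\<bar> * (norm ((z, \<epsilon>) - (w, r)) / m) powr p \<le> \<bar>C0\<bar> * q" by (intro mult_left_mono) auto
    moreover have "C0 * (norm ((z, \<epsilon>) - (w, r)) / m) powr p \<le> \<bar>C0\<bar> * (norm ((z, \<epsilon>) - (w, r)) / m) powr p"
      by (intro mult_right_mono) auto
    ultimately have v: "(LINT \<omega>|M. (X \<omega> - Y \<omega>)\<^sup>2) \<le> \<bar>C0\<bar> * q" using XY(3) unfolding m_def[symmetric] by linarith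
    have e0: "\<epsilon> > 0" "r > 0" using e by auto
    have mpos: "1 / real (Suc n) > 0" for n by simp
    have s1: "avg \<rho> (moll n) z \<epsilon> \<in> schwartz" for n
      by (rule smooth_supp_schwartz[OF smooth_supp_avg[OF \<rho> smooth_supp_bump[OF mpos]]]) (use e0 in simp)
    have s2: "avg \<rho> (moll n) w r \<in> schwartz" for n
      by (rule smooth_supp_schwartz[OF smooth_supp_avg[OF \<rho> smooth_supp_bump[OF mpos]]]) (use e0 in simp)
    define F where "F = (\<lambda>n x. avg \<rho> (moll n) z \<epsilon> x - avg \<rho> (moll n) w r x)"
    have Fs: "F n \<in> schwartz0" for n
      unfolding F_def by (rule schwartz0I[OF avg_diff_props[OF \<rho> \<rho> smooth_supp_bump[OF mpos] e0]])
    have lin: "h \<omega> (avg \<rho> (moll n) z \<epsilon>) - h \<omega> (avg \<rho> (moll n) w r) = h \<omega> (F n)" if "\<omega> \<in> space M" for \<omega> n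
      unfolding F_def using linear_functional_diff(1)[OF h_linear[OF that] s1 s2] by simp
    have "\<forall>\<^sub>F n in sequentially. (LINT \<omega>|M. (h \<omega> (avg \<rho> (moll n) z \<epsilon>) - h \<omega> (avg \<rho> (moll n) w r))\<^sup>2) \<le> 3 * (\<bar>C0\<bar> * q) + q"
    proof (rule L2_limit_variance[OF _ _ _ _ _ _ _ v q0])
      show "(\<lambda>\<omega>. h \<omega> (avg \<rho> (moll n) z \<epsilon>)) \<in> borel_measurable M" for n by (rule h_measurable[OF s1])
      show "(\<lambda>\<omega>. h \<omega> (avg \<rho> (moll n) w r)) \<in> borel_measurable M" for n by (rule h_measurable[OF s2])
      show "X \<in> borel_measurable M" "Y \<in> borel_measurable M"
        by (rule field_pairing_avg(1)[OF XY(1) \<rho>], rule field_pairing_avg(1)[OF XY(2) \<rho>])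
      show "(\<lambda>n. \<integral>\<^sup>+\<omega>. ennreal ((h \<omega> (avg \<rho> (moll n) z \<epsilon>) - X \<omega>)\<^sup>2) \<partial>M) \<longlonglongrightarrow> 0"
        by (rule field_pairing_avg(2)[OF XY(1) \<rho>])
      show "(\<lambda>n. \<integral>\<^sup>+\<omega>. ennreal ((h \<omega> (avg \<rho> (moll n) w r) - Y \<omega>)\<^sup>2) \<partial>M) \<longlonglongrightarrow> 0"
        by (rule field_pairing_avg(2)[OF XY(2) \<rho>])
      show "integrable M (\<lambda>\<omega>. (h \<omega> (avg \<rho> (moll n) z \<epsilon>) - h \<omega> (avg \<rho> (moll n) w r))\<^sup>2)" for n
        using gaussian_variable.square_integrable[OF gaussian_h[OF Fs[of n]]]
        by (subst Bochner_Integration.integrable_cong[OF refl]) (simp_all only: lin)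
    qed
    moreover have "(LINT \<omega>|M. (h \<omega> (avg \<rho> (moll n) z \<epsilon>) - h \<omega> (avg \<rho> (moll n) w r))\<^sup>2) = (LINT \<omega>|M. (h \<omega> (F n))\<^sup>2)" for n
      by (rule Bochner_Integration.integral_cong[OF refl]) (simp only: lin)
    ultimately have V1: "\<forall>\<^sub>F n in sequentially. (LINT \<omega>|M. (h \<omega> (\<lambda>x. avg \<rho> (moll n) z \<epsilon> x - avg \<rho> (moll n) w r x))\<^sup>2) \<le> 3 * (\<bar>C0\<bar> * q) + q"
      by (simp only: F_def)
    have dq: "(norm (z - w) + \<bar>\<epsilon> - r\<bar>)\<^sup>2 \<le> q"
    proof -
      have "(norm (z - w) + \<bar>\<epsilon> - r\<bar>)\<^sup>2 \<le> d\<^sup>2" using d by (intro power_mono) auto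
      also have "d\<^sup>2 \<le> d" using d m unfolding power2_eq_square by (intro mult_left_le) (use m_def in linarith)+
      also have "d \<le> d / m" using m d by (simp add: le_divide_eq mult_left_le)
      also have "\<dots> = (d / m) powr 1" by (rule powr_one[symmetric]) (use dm in linarith)
      also have "\<dots> \<le> q" unfolding q_def using dm p by (intro powr_mono') auto
      finally show ?thesis .
    qed
    have V2: "(LINT \<omega>|N. (hD \<omega> (\<lambda>x. avg \<rho> (bump \<delta>) z \<epsilon> x - avg \<rho> (bump \<delta>) w r x))\<^sup>2) \<le> C2 * q"
      using C2'[rule_format, of \<epsilon> z r w] e0 zK wK mult_left_mono[OF dq C2] by linarith
    have sum: "3 * (\<bar>C0\<bar> * q) + q + C2 * q = V * q" by (simp add: V_def algebra_simps)
    have "measure N {\<omega> \<in> space N. \<bar>H1 \<omega> - H2 \<omega>\<bar> \<ge> t} \<le> 2 * exp (- t\<^sup>2 / (8 * (3 * (\<bar>C0\<bar> * q) + q + C2 * q)))"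
      by (rule regularisation_tail[OF K \<delta> \<rho> \<rho> e0 zK wK H V1 V2 _ t]) (simp add: sum V0 q0)
    then show "measure N {\<omega> \<in> space N. \<bar>H1 \<omega> - H2 \<omega>\<bar> \<ge> t} \<le> 2 * exp (- t\<^sup>2 / (8 * V * (d / min \<epsilon> r) powr p))"
      unfolding sum by (simp add: q_def m_def mult.assoc)
  qed
qed

end

section \<open>Chaining\<close>

type_synonym point3 = "real \<times> real \<times> real"

definition unit_cube :: "point3 set" where "unit_cube = {0..1} \<times> {0..1} \<times> {0..1}"

definition grid :: "nat \<Rightarrow> (nat \<times> nat \<times> nat) set" where
  "grid k = {0..2 ^ k} \<times> {0..2 ^ k} \<times> {0..2 ^ k}"

definition grid_point :: "nat \<Rightarrow> nat \<times> nat \<times> nat \<Rightarrow> point3" where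
  "grid_point k = (\<lambda>(i, j, l). (real i / 2 ^ k, real j / 2 ^ k, real l / 2 ^ k))"

text \<open>Halving the indices matches passing from one dyadic approximation of a number, rounded down, to
  the previous one.\<close>

definition grid_parent :: "nat \<times> nat \<times> nat \<Rightarrow> nat \<times> nat \<times> nat" where
  "grid_parent = (\<lambda>(i, j, l). (i div 2, j div 2, l div 2))"

definition grid_index :: "nat \<Rightarrow> point3 \<Rightarrow> nat \<times> nat \<times> nat" where
  "grid_index k = (\<lambda>(x, y, s). (nat \<lfloor>2 ^ k * x\<rfloor>, nat \<lfloor>2 ^ k * y\<rfloor>, nat \<lfloor>2 ^ k * s\<rfloor>))"

definition close3 :: "real \<Rightarrow> point3 \<Rightarrow> point3 \<Rightarrow> bool" where
  "close3 d = (\<lambda>(x, y, s) (x', y', s'). \<bar>x - x'\<bar> \<le> d \<and> \<bar>y - y'\<bar> \<le> d \<and> \<bar>s - s'\<bar> \<le> d)"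

lemma finite_grid: "finite (grid k)" by (simp add: grid_def)

lemma card_grid: "real (card (grid k)) \<le> 8 ^ Suc k"
proof -
  have "real (card (grid k)) = (2 ^ k + 1) ^ 3"
    by (simp add: grid_def card_cartesian_product power3_eq_cube algebra_simps)
  also have "\<dots> \<le> (2 * 2 ^ k) ^ 3" by (intro power_mono) auto
  also have "(2 * 2 ^ k :: real) ^ 3 = 8 ^ Suc k"
  proof -
    have "(2 ^ k) ^ 3 = ((2 :: real) ^ 3) ^ k" unfolding power_mult[symmetric] by (simp only: mult.commute)
    then show ?thesis by (simp add: power_mult_distrib)
  qed
  finally show ?thesis .
qed

lemma div2_close: "\<bar>real i / 2 ^ Suc k - real (i div 2) / 2 ^ k\<bar> \<le> 1 / 2 ^ Suc k"
proof -
  have "2 * (i div 2) + i mod 2 = i" by simp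
  then have "real i = real (2 * (i div 2) + i mod 2)" by (rule arg_cong[OF sym])
  also have "\<dots> = 2 * real (i div 2) + real (i mod 2)" by (simp only: of_nat_add of_nat_mult of_nat_numeral)
  finally have "real i = 2 * real (i div 2) + real (i mod 2)" .
  then have "real i / 2 ^ Suc k - real (i div 2) / 2 ^ k = real (i mod 2) / 2 ^ Suc k"
    by (simp add: add_divide_distrib)
  moreover have "real (i mod 2) \<le> 1" by simp
  ultimately show ?thesis by (simp add: divide_right_mono)
qed

lemma grid_parent_props:
  assumes "g \<in> grid (Suc k)"
  shows "grid_parent g \<in> grid k" "close3 (1 / 2 ^ Suc k) (grid_point (Suc k) g) (grid_point k (grid_parent g))"
proof -
  obtain i j l where g: "g = (i, j, l)" by (cases g)
  show "grid_parent g \<in> grid k" using assms unfolding g grid_def grid_parent_def by auto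
  show "close3 (1 / 2 ^ Suc k) (grid_point (Suc k) g) (grid_point k (grid_parent g))"
    unfolding g grid_point_def grid_parent_def close3_def by (simp only: prod.case div2_close)
qed

lemma grid_point_in_cube: "g \<in> grid k \<Longrightarrow> grid_point k g \<in> unit_cube"
proof -
  assume a: "g \<in> grid k"
  obtain i j l where g: "g = (i, j, l)" by (cases g)
  have "real m / 2 ^ k \<le> 1" if "m \<le> 2 ^ k" for m :: nat
  proof -
    have "real m \<le> real (2 ^ k)" using that by (rule of_nat_mono)
    then show ?thesis by simp
  qed
  then show ?thesis using a unfolding g grid_def grid_point_def unit_cube_def by auto
qed

lemma floor_props:
  assumes "0 \<le> x" "x \<le> (1::real)"
  shows "nat \<lfloor>2 ^ k * x\<rfloor> \<le> 2 ^ k" "nat \<lfloor>2 ^ Suc k * x\<rfloor> div 2 = nat \<lfloor>2 ^ k * x\<rfloor>"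
    "(\<lambda>k. real (nat \<lfloor>2 ^ k * x\<rfloor>) / 2 ^ k) \<longlonglongrightarrow> x"
proof -
  have nn: "0 \<le> \<lfloor>2 ^ k * x\<rfloor>" for k using assms by simp
  have "2 ^ k * x \<le> 2 ^ k" using assms by (simp add: mult_left_le)
  then have "real_of_int \<lfloor>2 ^ k * x\<rfloor> \<le> 2 ^ k" by (rule order_trans[OF of_int_floor_le])
  then have "real_of_int \<lfloor>2 ^ k * x\<rfloor> \<le> real_of_int (2 ^ k)" by simp
  then have "\<lfloor>2 ^ k * x\<rfloor> \<le> 2 ^ k" by (simp only: of_int_le_iff)
  then show "nat \<lfloor>2 ^ k * x\<rfloor> \<le> 2 ^ k" by (simp add: nat_le_iff)
  have "\<lfloor>2 ^ Suc k * x\<rfloor> div 2 = \<lfloor>2 ^ k * x\<rfloor>"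
  proof -
    have "\<lfloor>2 ^ Suc k * x / real_of_int 2\<rfloor> = \<lfloor>2 ^ Suc k * x\<rfloor> div 2" by (rule floor_divide_real_eq_div) simp
    moreover have "2 ^ Suc k * x / real_of_int 2 = 2 ^ k * x" by simp
    ultimately show ?thesis by (simp only:)
  qed
  then show "nat \<lfloor>2 ^ Suc k * x\<rfloor> div 2 = nat \<lfloor>2 ^ k * x\<rfloor>"
    using nat_div_distrib'[of 2 "\<lfloor>2 ^ Suc k * x\<rfloor>"] by (simp del: power_Suc)
  have b: "x - (1/2) ^ k \<le> real (nat \<lfloor>2 ^ k * x\<rfloor>) / 2 ^ k \<and> real (nat \<lfloor>2 ^ k * x\<rfloor>) / 2 ^ k \<le> x" for k
  proof -
    have e: "real (nat \<lfloor>2 ^ k * x\<rfloor>) = real_of_int \<lfloor>2 ^ k * x\<rfloor>" using nn[of k] by simp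
    have l: "real_of_int \<lfloor>2 ^ k * x\<rfloor> \<le> 2 ^ k * x" "2 ^ k * x - 1 \<le> real_of_int \<lfloor>2 ^ k * x\<rfloor>" by linarith+
    have "real_of_int \<lfloor>2 ^ k * x\<rfloor> / 2 ^ k \<le> x" using l(1) by (simp add: pos_divide_le_eq mult.commute)
    moreover have "(2 ^ k * x - 1) / 2 ^ k \<le> real_of_int \<lfloor>2 ^ k * x\<rfloor> / 2 ^ k" using l(2) by (intro divide_right_mono) auto
    moreover have "(2 ^ k * x - 1) / 2 ^ k = x - (1/2) ^ k" by (simp add: diff_divide_distrib power_divide)
    ultimately show ?thesis unfolding e by (intro conjI) linarith+
  qed
  have "(\<lambda>k. x - (1/2) ^ k) \<longlonglongrightarrow> x - 0" by (intro tendsto_diff tendsto_const LIMSEQ_realpow_zero) auto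
  then have lim: "(\<lambda>k. x - (1/2) ^ k) \<longlonglongrightarrow> x" by (simp only: diff_0_right)
  show "(\<lambda>k. real (nat \<lfloor>2 ^ k * x\<rfloor>) / 2 ^ k) \<longlonglongrightarrow> x"
    by (rule tendsto_sandwich[OF always_eventually[OF allI[OF b[THEN conjunct1]]]
          always_eventually[OF allI[OF b[THEN conjunct2]]] lim tendsto_const])
qed

lemma grid_index_props:
  assumes "u \<in> unit_cube"
  shows "grid_index k u \<in> grid k" "grid_parent (grid_index (Suc k) u) = grid_index k u"
    "(\<lambda>k. grid_point k (grid_index k u)) \<longlonglongrightarrow> u"
proof -
  obtain x y s where u: "u = (x, y, s)" by (cases u)
  have b: "0 \<le> x" "x \<le> 1" "0 \<le> y" "y \<le> 1" "0 \<le> s" "s \<le> 1" using assms unfolding u unit_cube_def by auto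
  note fx = floor_props[OF b(1,2)] and fy = floor_props[OF b(3,4)] and fs = floor_props[OF b(5,6)]
  show "grid_index k u \<in> grid k" using fx(1) fy(1) fs(1) unfolding u grid_index_def grid_def by simp
  show "grid_parent (grid_index (Suc k) u) = grid_index k u"
    using fx(2) fy(2) fs(2) unfolding u grid_index_def grid_parent_def by (simp only: prod.case)
  show "(\<lambda>k. grid_point k (grid_index k u)) \<longlonglongrightarrow> u"
    unfolding u grid_index_def grid_point_def prod.case by (intro tendsto_Pair fx fy fs)
qed

text \<open>Telescope along the dyadic approximations of \<open>u\<close>, each of which is the parent of the next; they
  tend to \<open>u\<close>, so continuity finishes the proof.\<close>

lemma chaining_bound:
  fixes W :: "point3 \<Rightarrow> real"
  assumes cont: "continuous_on unit_cube W" and a: "0 < a" "a < 1" and c: "c \<ge> 0"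
    and base: "\<And>g. g \<in> grid n \<Longrightarrow> \<bar>W (grid_point n g)\<bar> < c"
    and step: "\<And>j g. g \<in> grid (Suc (n + j)) \<Longrightarrow>
      \<bar>W (grid_point (Suc (n + j)) g) - W (grid_point (n + j) (grid_parent g))\<bar> < c * a ^ j"
    and u: "u \<in> unit_cube"
  shows "\<bar>W u\<bar> \<le> c * (1 + 1 / (1 - a))"
proof -
  define v where "v = (\<lambda>k. grid_point k (grid_index k u))"
  have vI: "v k \<in> unit_cube" for k unfolding v_def by (intro grid_point_in_cube grid_index_props u)
  have sum: "\<bar>W (v (n + J))\<bar> \<le> c + (\<Sum>j<J. c * a ^ j)" for J
  proof (induction J)
    case 0
    show ?case using base[OF grid_index_props(1)[OF u]] by (simp add: v_def less_imp_le)
  next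
    case (Suc J)
    have "\<bar>W (v (Suc (n + J))) - W (v (n + J))\<bar> < c * a ^ J"
      using step[OF grid_index_props(1)[OF u]] unfolding v_def grid_index_props(2)[OF u] .
    then have "\<bar>W (v (Suc (n + J)))\<bar> \<le> c + (\<Sum>j<J. c * a ^ j) + c * a ^ J" using Suc by linarith
    then show ?case by simp
  qed
  have geo: "(\<Sum>j<J. a ^ j) \<le> 1 / (1 - a)" for J
  proof -
    have "(\<Sum>j<J. a ^ j) = (1 - a ^ J) / (1 - a)" using a by (subst sum_gp_strict) auto
    also have "\<dots> \<le> 1 / (1 - a)" using a by (intro divide_right_mono) auto
    finally show ?thesis .
  qed
  have bound: "\<bar>W (v (n + J))\<bar> \<le> c * (1 + 1 / (1 - a))" for J
  proof -
    have "c * (\<Sum>j<J. a ^ j) \<le> c * (1 / (1 - a))" by (intro mult_left_mono geo c)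
    then show ?thesis using sum[of J] by (simp add: sum_distrib_left algebra_simps)
  qed
  have "v \<longlonglongrightarrow> u" unfolding v_def by (rule grid_index_props(3)[OF u])
  then have "(\<lambda>J. v (J + n)) \<longlonglongrightarrow> u" by (rule LIMSEQ_ignore_initial_segment)
  then have "(\<lambda>J. W (v (J + n))) \<longlonglongrightarrow> W u"
    by (rule continuous_on_tendsto_compose[OF cont _ u]) (simp add: vI)
  then have "(\<lambda>J. \<bar>W (v (J + n))\<bar>) \<longlonglongrightarrow> \<bar>W u\<bar>" by (rule tendsto_rabs)
  then show ?thesis by (rule LIMSEQ_le_const2) (use bound in \<open>auto simp: add.commute\<close>)
qed

lemma eventually_exp_square_small:
  assumes "D > (0::real)" "\<epsilon> > 0"
  shows "\<forall>\<^sub>F n in sequentially. exp (- D * real n) \<le> \<epsilon>"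
proof -
  have "\<forall>\<^sub>F n in sequentially. real n \<ge> - ln \<epsilon> / D"
    using filterlim_real_sequentially unfolding filterlim_at_top by (rule spec)
  then show ?thesis
  proof (rule eventually_mono)
    fix n assume "real n \<ge> - ln \<epsilon> / D"
    from iffD1[OF pos_divide_le_eq[OF assms(1)] this] have "- D * real n \<le> ln \<epsilon>" by (simp add: mult.commute)
    then have "exp (- D * real n) \<le> exp (ln \<epsilon>)" by (rule exp_le_cancel_iff[THEN iffD2])
    then show "exp (- D * real n) \<le> \<epsilon>" using assms(2) by simp
  qed
qed

text \<open>At scale \<open>n\<close> the process has bounded variance, increments between dyadic neighbours of level
  \<open>n + j\<close> have variance of order \<open>a^(4 j)\<close>, and there are about \<open>8^(n + j)\<close> of them.  Allow them the
  height \<open>\<delta> n a^j\<close>: these heights are summable, and the exponent of the Gaussian tail is still of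
  order \<open>n\<^sup>2 a^(-2 j)\<close>, which beats the number of increments.  By the Borel-Cantelli lemma, the
  supremum is \<open>o(n)\<close>.\<close>

lemma (in prob_space) chaining:
  fixes W :: "nat \<Rightarrow> point3 \<Rightarrow> 'a \<Rightarrow> real"
  assumes meas: "\<And>n u. n \<ge> N0 \<Longrightarrow> u \<in> unit_cube \<Longrightarrow> W n u \<in> borel_measurable M"
    and a: "0 < a" "a < 1" and C: "C > 0"
    and t0: "\<And>n u t. n \<ge> N0 \<Longrightarrow> u \<in> unit_cube \<Longrightarrow> t > 0 \<Longrightarrow>
      measure M {\<omega> \<in> space M. \<bar>W n u \<omega>\<bar> \<ge> t} \<le> A * exp (- t\<^sup>2 / C)"
    and t1: "\<And>n j u v t. n \<ge> N0 \<Longrightarrow> u \<in> unit_cube \<Longrightarrow> v \<in> unit_cube \<Longrightarrow> close3 (1 / 2 ^ Suc (n + j)) u v \<Longrightarrow> t > 0 \<Longrightarrow>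
      measure M {\<omega> \<in> space M. \<bar>W n u \<omega> - W n v \<omega>\<bar> \<ge> t} \<le> A * exp (- t\<^sup>2 / (C * (a ^ 4) ^ j))"
    and cont: "AE \<omega> in M. \<forall>n\<ge>N0. continuous_on unit_cube (\<lambda>u. W n u \<omega>)"
    and \<delta>: "\<delta> > 0"
  shows "AE \<omega> in M. \<forall>\<^sub>F n in sequentially. \<forall>u\<in>unit_cube. \<bar>W n u \<omega>\<bar> \<le> (\<delta> * real n) * (1 + 1 / (1 - a))"
proof -
  define N1 where "N1 = max N0 1"
  define B0 where "B0 = (\<lambda>n. \<Union>g\<in>grid n. {\<omega> \<in> space M. \<bar>W n (grid_point n g) \<omega>\<bar> \<ge> \<delta> * real n})"
  define B1 where "B1 = (\<lambda>n j. \<Union>g\<in>grid (Suc (n + j)).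
    {\<omega> \<in> space M. \<bar>W n (grid_point (Suc (n + j)) g) \<omega> - W n (grid_point (n + j) (grid_parent g)) \<omega>\<bar> \<ge> \<delta> * real n * a ^ j})"
  define Bad where "Bad = (\<lambda>n. if n \<ge> N1 then B0 n \<union> (\<Union>j. B1 n j) else {})"
  have A0: "A \<ge> 0"
  proof -
    have "(0, 0, 0) \<in> unit_cube" by (simp add: unit_cube_def)
    note order_trans[OF measure_nonneg t0[OF order_refl this zero_less_one]]
    then show ?thesis by (simp add: zero_le_mult_iff)
  qed
  define D where "D = \<delta>\<^sup>2 / C"
  have D: "D > 0" using \<delta> C by (simp add: D_def)
  define \<eta> where "\<eta> = 1 / a\<^sup>2 - 1"
  have "a\<^sup>2 < 1" using a by (simp add: power_less_one_iff abs_square_less_1)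
  then have \<eta>: "\<eta> > 0" using a by (simp add: \<eta>_def)
  have s0: "{\<omega> \<in> space M. \<bar>W n (grid_point n g) \<omega>\<bar> \<ge> \<delta> * real n} \<in> sets M" if "n \<ge> N1" "g \<in> grid n" for n g
  proof -
    have [measurable]: "W n (grid_point n g) \<in> borel_measurable M"
      using that by (intro meas grid_point_in_cube) (auto simp: N1_def)
    show ?thesis by measurable
  qed
  have s1: "{\<omega> \<in> space M. \<bar>W n (grid_point (Suc (n + j)) g) \<omega> - W n (grid_point (n + j) (grid_parent g)) \<omega>\<bar> \<ge> \<delta> * real n * a ^ j} \<in> sets M"
    if "n \<ge> N1" "g \<in> grid (Suc (n + j))" for n j g
  proof -
    have [measurable]: "W n (grid_point (Suc (n + j)) g) \<in> borel_measurable M"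
      "W n (grid_point (n + j) (grid_parent g)) \<in> borel_measurable M"
      using that grid_parent_props(1)[OF that(2)] by (auto intro!: meas grid_point_in_cube simp: N1_def)
    show ?thesis by measurable
  qed
  have m0: "B0 n \<in> sets M" if "n \<ge> N1" for n
    unfolding B0_def by (intro sets.finite_UN finite_grid s0 that)
  have m1: "B1 n j \<in> sets M" if "n \<ge> N1" for n j
    unfolding B1_def by (intro sets.finite_UN finite_grid s1 that)
  have p0: "measure M (B0 n) \<le> 8 ^ Suc n * (A * exp (- D * (real n)\<^sup>2))" if n: "n \<ge> N1" for n
  proof -
    have n0: "real n > 0" "n \<ge> N0" using n by (auto simp: N1_def)
    have "measure M (B0 n) \<le> (\<Sum>g\<in>grid n. measure M {\<omega> \<in> space M. \<bar>W n (grid_point n g) \<omega>\<bar> \<ge> \<delta> * real n})"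
      unfolding B0_def by (intro measure_UNION_le finite_grid s0 n)
    also have "\<dots> \<le> (\<Sum>g\<in>grid n. A * exp (- D * (real n)\<^sup>2))"
    proof (rule sum_mono)
      fix g assume g: "g \<in> grid n"
      have "measure M {\<omega> \<in> space M. \<bar>W n (grid_point n g) \<omega>\<bar> \<ge> \<delta> * real n} \<le> A * exp (- (\<delta> * real n)\<^sup>2 / C)"
        by (intro t0 n0 grid_point_in_cube g mult_pos_pos \<delta>)
      also have "- (\<delta> * real n)\<^sup>2 / C = - D * (real n)\<^sup>2" by (simp add: D_def power_mult_distrib)
      finally show "measure M {\<omega> \<in> space M. \<bar>W n (grid_point n g) \<omega>\<bar> \<ge> \<delta> * real n} \<le> A * exp (- D * (real n)\<^sup>2)" .
    qed
    also have "\<dots> = real (card (grid n)) * (A * exp (- D * (real n)\<^sup>2))" by simp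
    also have "\<dots> \<le> 8 ^ Suc n * (A * exp (- D * (real n)\<^sup>2))"
      by (intro mult_right_mono card_grid mult_nonneg_nonneg A0) simp
    finally show ?thesis .
  qed
  have p1: "measure M (B1 n j) \<le> 8 ^ Suc (Suc n) * (A * exp (- D * (real n)\<^sup>2)) * (8 * exp (- D * \<eta> * (real n)\<^sup>2)) ^ j"
    if n: "n \<ge> N1" for n j
  proof -
    have n0: "real n > 0" "n \<ge> N0" using n by (auto simp: N1_def)
    have tp: "\<delta> * real n * a ^ j > 0" using \<delta> n0 a by simp
    have ex: "- (\<delta> * real n * a ^ j)\<^sup>2 / (C * (a ^ 4) ^ j) \<le> - D * (real n)\<^sup>2 + real j * (- D * \<eta> * (real n)\<^sup>2)"
    proof -
      have aj: "a ^ j > 0" using a by simp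
      have "(a ^ 4) ^ j = (a ^ j) ^ 4" unfolding power_mult[symmetric] by (simp only: mult.commute)
      then have a4: "(a ^ 4) ^ j = (a ^ j)\<^sup>2 * (a ^ j)\<^sup>2" by (simp only: power4_eq_xxxx power2_eq_square mult.assoc)
      have a2: "(a\<^sup>2) ^ j = (a ^ j)\<^sup>2" unfolding power_mult[symmetric] by (simp only: mult.commute)
      have "(\<delta> * real n * a ^ j)\<^sup>2 / (C * (a ^ 4) ^ j) = (\<delta> * real n)\<^sup>2 / (C * (a ^ j)\<^sup>2)"
      proof -
        have cancel: "c * x / (C * (x * x)) = c / (C * x)" if "x \<noteq> 0" for c x :: real using that by simp
        have "(a ^ j)\<^sup>2 \<noteq> 0" using a by simp
        then show ?thesis unfolding a4 power_mult_distrib[of "\<delta> * real n" "a ^ j"] by (rule cancel)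
      qed
      also have "\<dots> = D * (real n)\<^sup>2 * (1 / a\<^sup>2) ^ j"
        unfolding power_divide a2 by (simp add: D_def power_mult_distrib)
      finally have eq: "(\<delta> * real n * a ^ j)\<^sup>2 / (C * (a ^ 4) ^ j) = D * (real n)\<^sup>2 * (1 + \<eta>) ^ j" by (simp add: \<eta>_def)
      \<comment> \<open>Linear growth of the exponent in \<open>j\<close> is enough, and makes the bounds a geometric series.\<close>
      have "1 + real j * \<eta> \<le> (1 + \<eta>) ^ j" using Bernoulli_inequality[of \<eta> j] \<eta> by simp
      then have "D * (real n)\<^sup>2 * (1 + real j * \<eta>) \<le> D * (real n)\<^sup>2 * (1 + \<eta>) ^ j" using D by (intro mult_left_mono) auto
      moreover have "D * (real n)\<^sup>2 * (1 + real j * \<eta>) = D * (real n)\<^sup>2 - real j * (- D * \<eta> * (real n)\<^sup>2)" by (simp add: algebra_simps)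
      moreover have "- (\<delta> * real n * a ^ j)\<^sup>2 / (C * (a ^ 4) ^ j) = - ((\<delta> * real n * a ^ j)\<^sup>2 / (C * (a ^ 4) ^ j))" by simp
      ultimately show ?thesis using eq by linarith
    qed
    have "measure M (B1 n j) \<le> (\<Sum>g\<in>grid (Suc (n + j)). measure M
      {\<omega> \<in> space M. \<bar>W n (grid_point (Suc (n + j)) g) \<omega> - W n (grid_point (n + j) (grid_parent g)) \<omega>\<bar> \<ge> \<delta> * real n * a ^ j})"
      unfolding B1_def by (intro measure_UNION_le finite_grid s1 n)
    also have "\<dots> \<le> (\<Sum>g\<in>grid (Suc (n + j)). A * exp (- D * (real n)\<^sup>2 + real j * (- D * \<eta> * (real n)\<^sup>2)))"
    proof (rule sum_mono)
      fix g assume g: "g \<in> grid (Suc (n + j))"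
      have "measure M {\<omega> \<in> space M. \<bar>W n (grid_point (Suc (n + j)) g) \<omega> - W n (grid_point (n + j) (grid_parent g)) \<omega>\<bar> \<ge> \<delta> * real n * a ^ j}
        \<le> A * exp (- (\<delta> * real n * a ^ j)\<^sup>2 / (C * (a ^ 4) ^ j))"
        by (rule t1[OF n0(2) grid_point_in_cube[OF g] grid_point_in_cube[OF grid_parent_props(1)[OF g]] grid_parent_props(2)[OF g] tp])
      also have "\<dots> \<le> A * exp (- D * (real n)\<^sup>2 + real j * (- D * \<eta> * (real n)\<^sup>2))"
        by (intro mult_left_mono A0 exp_le_cancel_iff[THEN iffD2] ex)
      finally show "measure M {\<omega> \<in> space M. \<bar>W n (grid_point (Suc (n + j)) g) \<omega> - W n (grid_point (n + j) (grid_parent g)) \<omega>\<bar> \<ge> \<delta> * real n * a ^ j}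
        \<le> A * exp (- D * (real n)\<^sup>2 + real j * (- D * \<eta> * (real n)\<^sup>2))" .
    qed
    also have "\<dots> = real (card (grid (Suc (n + j)))) * (A * exp (- D * (real n)\<^sup>2 + real j * (- D * \<eta> * (real n)\<^sup>2)))" by simp
    also have "\<dots> \<le> 8 ^ Suc (Suc (n + j)) * (A * exp (- D * (real n)\<^sup>2 + real j * (- D * \<eta> * (real n)\<^sup>2)))"
      by (intro mult_right_mono card_grid mult_nonneg_nonneg A0) simp
    also have "\<dots> = 8 ^ Suc (Suc n) * (A * exp (- D * (real n)\<^sup>2)) * (8 * exp (- D * \<eta> * (real n)\<^sup>2)) ^ j"
      unfolding exp_add exp_of_nat_mult by (simp add: power_add power_mult_distrib mult_ac)
    finally show ?thesis .
  qed
  have DE: "D * \<eta> > 0" using D \<eta> by simp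
  have e16: "(1/16 :: real) > 0" by simp
  have ev: "\<forall>\<^sub>F n in sequentially. measure M (Bad n) \<le> 192 * A * (1/2) ^ n"
    using eventually_exp_square_small[OF D e16] eventually_exp_square_small[OF DE e16] eventually_ge_at_top[of N1]
  proof eventually_elim
    case (elim n)
    have n1: "real n \<ge> 1" using elim(3) by (simp add: N1_def)
    have nn: "real n \<le> (real n)\<^sup>2" using n1 by (simp add: power2_eq_square mult_le_cancel_left1)
    define y where "y = 8 * exp (- D * \<eta> * (real n)\<^sup>2)"
    define X where "X = 8 ^ Suc (Suc n) * (A * exp (- D * (real n)\<^sup>2))"
    have X0: "X \<ge> 0" using A0 by (simp add: X_def)
    have y: "0 \<le> y" "y \<le> 1/2"
    proof -
      have "D * \<eta> * real n \<le> D * \<eta> * (real n)\<^sup>2" using nn DE by (intro mult_left_mono) auto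
      then have "exp (- D * \<eta> * (real n)\<^sup>2) \<le> exp (- (D * \<eta>) * real n)" by simp
      from order_trans[OF this elim(2)] show "y \<le> 1/2" by (simp add: y_def)
    qed (simp add: y_def)
    have sy: "summable (\<lambda>j. X * y ^ j)" using y by (intro summable_mult summable_geometric) auto
    have sm: "summable (\<lambda>j. measure M (B1 n j))"
      by (rule summable_comparison_test[OF _ sy]) (use p1[OF elim(3)] in \<open>auto simp: X_def y_def\<close>)
    have "measure M (\<Union>j. B1 n j) \<le> (\<Sum>j. measure M (B1 n j))"
      by (rule finite_measure_subadditive_countably) (use m1[OF elim(3)] sm in auto)
    also have "\<dots> \<le> (\<Sum>j. X * y ^ j)"
      by (rule suminf_le[OF _ sm sy]) (use p1[OF elim(3)] in \<open>simp add: X_def y_def\<close>)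
    also have "\<dots> = X * (1 / (1 - y))" using y by (simp add: suminf_mult suminf_geometric summable_geometric)
    also have "\<dots> \<le> X * 2" using y X0 by (intro mult_left_mono) (auto simp: divide_le_eq)
    finally have u1: "measure M (\<Union>j. B1 n j) \<le> X * 2" .
    have "8 ^ Suc n * (A * exp (- D * (real n)\<^sup>2)) \<le> X"
      unfolding X_def using A0 by (intro mult_right_mono) auto
    then have u0: "measure M (B0 n) \<le> X" using p0[OF elim(3)] by linarith
    have mU: "(\<Union>j. B1 n j) \<in> sets M" using m1[OF elim(3)] by auto
    have "measure M (Bad n) \<le> measure M (B0 n) + measure M (\<Union>j. B1 n j)"
      unfolding Bad_def using elim(3) measure_Un_le[OF m0[OF elim(3)] mU] by simp
    also have "\<dots> \<le> 3 * X" using u0 u1 by simp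
    also have "X \<le> 64 * A * (1/2) ^ n"
    proof -
      have "exp (- D * (real n)\<^sup>2) = exp (real n * (- D * real n))"
        by (simp add: power2_eq_square mult_ac)
      also have "\<dots> = exp (- D * real n) ^ n" by (rule exp_of_nat_mult)
      also have "\<dots> \<le> (1/16) ^ n" using elim(1) by (intro power_mono) auto
      finally have "8 ^ n * exp (- D * (real n)\<^sup>2) \<le> 8 ^ n * (1/16) ^ n" by (intro mult_left_mono) auto
      also have "8 ^ n * (1/16 :: real) ^ n = (1/2) ^ n" by (simp add: power_mult_distrib[symmetric])
      finally have "64 * A * (8 ^ n * exp (- D * (real n)\<^sup>2)) \<le> 64 * A * (1/2) ^ n"
        using A0 by (intro mult_left_mono) auto
      then show ?thesis by (simp add: X_def mult_ac)
    qed
    finally show ?case by simp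
  qed
  have Bs: "Bad n \<in> sets M" for n unfolding Bad_def using m0 m1 by auto
  have "summable (\<lambda>n. 192 * A * (1/2 :: real) ^ n)" by (intro summable_mult summable_geometric) simp
  then have sB: "summable (\<lambda>n. measure M (Bad n))"
    by (rule summable_comparison_test_ev[rotated]) (use ev in simp)
  have "AE \<omega> in M. eventually (\<lambda>n. \<omega> \<in> space M - Bad n) sequentially"
    by (rule borel_cantelli_AE1) (use Bs sB in \<open>auto simp: emeasure_eq_measure\<close>)
  then show ?thesis using cont
  proof eventually_elim
    case (elim \<omega>)
    show ?case using elim(1) eventually_ge_at_top[of N1]
    proof eventually_elim
      case (elim n)
      have N0: "n \<ge> N0" using elim(2) by (simp add: N1_def)
      have \<omega>: "\<omega> \<in> space M" "\<omega> \<notin> B0 n" "\<And>j. \<omega> \<notin> B1 n j" using elim by (auto simp: Bad_def)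
      show ?case
      proof
        fix u assume u: "u \<in> unit_cube"
        show "\<bar>W n u \<omega>\<bar> \<le> (\<delta> * real n) * (1 + 1 / (1 - a))"
        proof (rule chaining_bound[where W = "\<lambda>u. W n u \<omega>" and n = n])
          show "continuous_on unit_cube (\<lambda>u. W n u \<omega>)" using \<open>\<forall>n\<ge>N0. continuous_on unit_cube (\<lambda>u. W n u \<omega>)\<close> N0 by blast
          show "\<bar>W n (grid_point n g) \<omega>\<bar> < \<delta> * real n" if "g \<in> grid n" for g
            using \<omega>(1,2) that unfolding B0_def by (auto simp: not_le)
          show "\<bar>W n (grid_point (Suc (n + j)) g) \<omega> - W n (grid_point (n + j) (grid_parent g)) \<omega>\<bar> < \<delta> * real n * a ^ j"
            if "g \<in> grid (Suc (n + j))" for j g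
            using \<omega>(1) \<omega>(3)[of j] that unfolding B1_def by (auto simp: not_le)
        qed (use a \<delta> u in auto)
      qed
    qed
  qed
qed

section \<open>Thick points do not depend on the mollifier\<close>

lemma Liminf_le_of_diff_tendsto_0:
  fixes f g :: "real \<Rightarrow> real"
  assumes "((\<lambda>\<epsilon>. f \<epsilon> - g \<epsilon>) \<longlongrightarrow> 0) F" "F \<noteq> bot"
  shows "Liminf F (\<lambda>\<epsilon>. ereal (f \<epsilon>)) \<le> Liminf F (\<lambda>\<epsilon>. ereal (g \<epsilon>))"
    and "Limsup F (\<lambda>\<epsilon>. ereal (f \<epsilon>)) \<le> Limsup F (\<lambda>\<epsilon>. ereal (g \<epsilon>))"
proof -
  have ev: "\<forall>\<^sub>F \<epsilon> in F. ereal (f \<epsilon>) \<le> ereal (g \<epsilon>) + ereal e" if "e > 0" for e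
  proof -
    have "\<forall>\<^sub>F \<epsilon> in F. f \<epsilon> - g \<epsilon> < e" by (rule order_tendstoD(2)[OF assms(1) that])
    then show ?thesis by (rule eventually_mono) simp
  qed
  show "Liminf F (\<lambda>\<epsilon>. ereal (f \<epsilon>)) \<le> Liminf F (\<lambda>\<epsilon>. ereal (g \<epsilon>))"
  proof (rule ereal_le_epsilon2)
    fix e :: real assume e: "0 < e"
    have "Liminf F (\<lambda>\<epsilon>. ereal (f \<epsilon>)) \<le> Liminf F (\<lambda>\<epsilon>. ereal (g \<epsilon>) + ereal e)" by (rule Liminf_mono[OF ev[OF e]])
    also have "\<dots> = Liminf F (\<lambda>\<epsilon>. ereal (g \<epsilon>)) + ereal e" by (rule Liminf_add_ereal_right[OF assms(2)]) simp
    finally show "Liminf F (\<lambda>\<epsilon>. ereal (f \<epsilon>)) \<le> Liminf F (\<lambda>\<epsilon>. ereal (g \<epsilon>)) + ereal e" .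
  qed
  show "Limsup F (\<lambda>\<epsilon>. ereal (f \<epsilon>)) \<le> Limsup F (\<lambda>\<epsilon>. ereal (g \<epsilon>))"
  proof (rule ereal_le_epsilon2)
    fix e :: real assume e: "0 < e"
    have "Limsup F (\<lambda>\<epsilon>. ereal (f \<epsilon>)) \<le> Limsup F (\<lambda>\<epsilon>. ereal (g \<epsilon>) + ereal e)" by (rule Limsup_mono[OF ev[OF e]])
    also have "\<dots> = Limsup F (\<lambda>\<epsilon>. ereal (g \<epsilon>)) + ereal e" by (rule Limsup_add_ereal_right[OF assms(2)]) simp
    finally show "Limsup F (\<lambda>\<epsilon>. ereal (f \<epsilon>)) \<le> Limsup F (\<lambda>\<epsilon>. ereal (g \<epsilon>)) + ereal e" .
  qed
qed

lemma has_limit_of_type_cong: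
  assumes "((\<lambda>\<epsilon>. f \<epsilon> - g \<epsilon>) \<longlongrightarrow> 0) (at_right 0)"
  shows "has_limit_of_type star f \<alpha> \<longleftrightarrow> has_limit_of_type star g \<alpha>"
proof -
  have ne: "at_right (0::real) \<noteq> bot" by simp
  have "((\<lambda>\<epsilon>. - (f \<epsilon> - g \<epsilon>)) \<longlongrightarrow> - 0) (at_right 0)" by (rule tendsto_minus[OF assms])
  then have swap: "((\<lambda>\<epsilon>. g \<epsilon> - f \<epsilon>) \<longlongrightarrow> 0) (at_right 0)" by simp
  show ?thesis
  proof (cases star)
    case LimInf
    show ?thesis unfolding LimInf has_limit_of_type.simps
      using order.antisym[OF Liminf_le_of_diff_tendsto_0(1)[OF assms ne] Liminf_le_of_diff_tendsto_0(1)[OF swap ne]] by simp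
  next
    case LimSup
    show ?thesis unfolding LimSup has_limit_of_type.simps
      using order.antisym[OF Liminf_le_of_diff_tendsto_0(2)[OF assms ne] Liminf_le_of_diff_tendsto_0(2)[OF swap ne]] by simp
  next
    case Lim
    show ?thesis unfolding Lim has_limit_of_type.simps
      using tendsto_add[OF _ assms, of g \<alpha>] tendsto_add[OF _ swap, of f \<alpha>] by auto
  qed
qed

definition square_point :: "complex \<Rightarrow> real \<Rightarrow> real \<Rightarrow> real \<Rightarrow> complex" where
  "square_point c d x y = c + d *\<^sub>R Complex x y"

lemma square_point_dist:
  assumes "d \<ge> 0"
  shows "norm (square_point c d x y - square_point c d x' y') \<le> d * (\<bar>x - x'\<bar> + \<bar>y - y'\<bar>)"
proof -
  have "square_point c d x y - square_point c d x' y' = d *\<^sub>R Complex (x - x') (y - y')"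
    by (simp add: square_point_def complex_eq_iff algebra_simps)
  then have "norm (square_point c d x y - square_point c d x' y') = d * norm (Complex (x - x') (y - y'))"
    using assms by simp
  also have "norm (Complex (x - x') (y - y')) \<le> \<bar>x - x'\<bar> + \<bar>y - y'\<bar>"
    using cmod_le[of "Complex (x - x') (y - y')"] by simp
  finally show ?thesis using assms by (simp add: mult_left_mono)
qed

text \<open>The frontier is nonempty because the plane is connected; the distance to an empty set would
  be 0 by convention.\<close>

lemma less_infdist_frontier:
  fixes S :: "complex set"
  assumes S: "open S" "S \<noteq> UNIV" and b: "cball z r \<subseteq> S" "0 \<le> \<epsilon>" "\<epsilon> < r"
  shows "z \<in> S" "\<epsilon> < infdist z (frontier S)"
proof -
  show z: "z \<in> S" using b by auto
  then have ne: "frontier S \<noteq> {}" using S(2) unfolding frontier_eq_empty by blast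
  have "r \<le> dist z a" if a: "a \<in> frontier S" for a
  proof (rule ccontr)
    assume "\<not> r \<le> dist z a"
    then have "a \<in> S" using b(1) by auto
    then show False using a S(1) by (simp add: frontier_def interior_open)
  qed
  then have "r \<le> infdist z (frontier S)" unfolding infdist_notempty[OF ne] using ne by (intro cINF_greatest)
  then show "\<epsilon> < infdist z (frontier S)" using b(3) by simp
qed

context gff_comparison
begin

text \<open>At scale \<open>n\<close>, put \<open>\<epsilon> = 2^(-n-1) (1 + s)\<close>.  As \<open>(x, y, s)\<close> ranges over the unit cube, the
  differences of the two regularisations form the process to which chaining applies, and
  \<open>ln (1/\<epsilon>)\<close> is comparable to \<open>n\<close>.\<close>

lemma regularisations_close_on_square:
  assumes \<rho>: "admissible_mollifier \<rho>" and \<sigma>: "admissible_mollifier \<sigma>"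
    and p: "0 < p" "p \<le> 1" and A\<rho>: "condition_A M h \<rho> p" and A\<sigma>: "condition_A M h \<sigma> p"
    and H\<rho>: "continuous_regularisation N D hD \<rho> H\<rho>" and H\<sigma>: "continuous_regularisation N D hD \<sigma> H\<sigma>"
    and DU: "D \<noteq> UNIV" and d: "0 < d" "d \<le> 1/4" and cD: "cball c (8 * d) \<subseteq> D"
  shows "AE \<omega> in N. \<forall>x\<in>{0..1}. \<forall>y\<in>{0..1}.
    ((\<lambda>\<epsilon>. H\<rho> (square_point c d x y) \<epsilon> \<omega> / ln (1 / \<epsilon>) - H\<sigma> (square_point c d x y) \<epsilon> \<omega> / ln (1 / \<epsilon>)) \<longlongrightarrow> 0) (at_right 0)"
proof -
  have dp\<rho>: "disc_prob \<rho>" and dp\<sigma>: "disc_prob \<sigma>" using disc_prob_admissible \<rho> \<sigma> by auto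
  have en\<rho>: "finite_log_energy \<rho>" and en\<sigma>: "finite_log_energy \<sigma>" using \<rho> \<sigma> by (auto simp: admissible_mollifier_def)
  define K where "K = cball c (4 * d)"
  have K: "compact K" "K \<subseteq> D"
  proof -
    have "cball c (4 * d) \<subseteq> cball c (8 * d)" using d by (intro subset_cball) simp
    then show "K \<subseteq> D" using cD unfolding K_def by blast
  qed (simp add: K_def)
  define P where "P = (\<lambda>x y. square_point c d x y)"
  have Pc: "norm (P x y - c) \<le> 2 * d" if "x \<in> {0..1}" "y \<in> {0..1}" for x y
  proof -
    have "square_point c d 0 0 = c" by (simp add: square_point_def complex_eq_iff)
    then have "norm (P x y - c) \<le> d * (\<bar>x - 0\<bar> + \<bar>y - 0\<bar>)" unfolding P_def using square_point_dist[of d c x y 0 0] d by simp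
    also have "\<dots> \<le> d * 2" using that d by (intro mult_left_mono) auto
    finally show ?thesis by simp
  qed
  have PK: "cball (P x y) (\<epsilon> + d) \<subseteq> K" if "x \<in> {0..1}" "y \<in> {0..1}" "\<epsilon> \<le> d" for x y \<epsilon>
    unfolding K_def
  proof
    fix w assume "w \<in> cball (P x y) (\<epsilon> + d)"
    then have "norm (w - P x y) \<le> 2 * d" using that(3) by (simp add: dist_norm norm_minus_commute)
    then have "norm (w - c) \<le> 4 * d"
      using Pc[OF that(1,2)] norm_triangle_ineq[of "w - P x y" "P x y - c"] by simp
    then show "w \<in> cball c (4 * d)" by (simp add: dist_norm norm_minus_commute)
  qed
  have dom: "P x y \<in> D \<and> \<epsilon> < infdist (P x y) (frontier D)" if "x \<in> {0..1}" "y \<in> {0..1}" "0 < \<epsilon>" "\<epsilon> \<le> d" for x y \<epsilon>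
  proof -
    have "cball (P x y) (\<epsilon> + d) \<subseteq> D" using PK[OF that(1,2,4)] K(2) by blast
    from less_infdist_frontier[OF openD DU this, of \<epsilon>] show ?thesis using that d by simp
  qed
  have pair\<rho>: "field_pairing N hD (scaled_measure \<rho> (P x y) \<epsilon>) (H\<rho> (P x y) \<epsilon>)"
    if "x \<in> {0..1}" "y \<in> {0..1}" "0 < \<epsilon>" "\<epsilon> \<le> d" for x y \<epsilon>
    using H\<rho> dom[OF that] that(3) unfolding continuous_regularisation_def by simp
  have pair\<sigma>: "field_pairing N hD (scaled_measure \<sigma> (P x y) \<epsilon>) (H\<sigma> (P x y) \<epsilon>)"
    if "x \<in> {0..1}" "y \<in> {0..1}" "0 < \<epsilon>" "\<epsilon> \<le> d" for x y \<epsilon>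
    using H\<sigma> dom[OF that] that(3) unfolding continuous_regularisation_def by simp
  define sc where "sc = (\<lambda>n s. (1 / 2 ^ Suc n) * (1 + s) :: real)"
  obtain N0 where N0: "(1/2) ^ N0 < d" using real_arch_pow_inv[OF d(1), of "1/2"] by auto
  have sc: "1 / 2 ^ Suc n \<le> sc n s \<and> sc n s \<le> d \<and> 0 < sc n s" if "n \<ge> N0" "s \<in> {0..1}" for n s
  proof -
    have "sc n s \<le> (1 / 2 ^ Suc n) * 2" unfolding sc_def using that by (intro mult_left_mono) auto
    also have "\<dots> = (1/2) ^ n" by (simp add: power_divide)
    also have "\<dots> \<le> (1/2) ^ N0" using that by (intro power_decreasing) auto
    finally have "sc n s \<le> d" using N0 by linarith
    moreover have "(1 / 2 ^ Suc n) * 1 \<le> sc n s" unfolding sc_def using that by (intro mult_left_mono) auto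
    moreover have "(0::real) < 1 / 2 ^ Suc n" by simp
    ultimately show ?thesis by linarith
  qed
  have sc2: "sc n s \<le> 2 * (1 / 2 ^ Suc n)" if "s \<in> {0..1}" for n s
  proof -
    have "sc n s \<le> (1 / 2 ^ Suc n) * 2" unfolding sc_def using that by (intro mult_left_mono) auto
    then show ?thesis by (simp only: mult.commute)
  qed
  have sc_diff: "sc n s - sc n s' = (1 / 2 ^ Suc n) * (s - s')" for n s s'
  proof -
    have "c * (1 + s) - c * (1 + s') = c * (s - s')" for c :: real by (simp add: algebra_simps)
    then show ?thesis unfolding sc_def .
  qed
  define W where "W = (\<lambda>n (u::point3) \<omega>. H\<rho> (P (fst u) (fst (snd u))) (sc n (snd (snd u))) \<omega>
    - H\<sigma> (P (fst u) (fst (snd u))) (sc n (snd (snd u))) \<omega>)"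
  have cube: "fst u \<in> {0..1} \<and> fst (snd u) \<in> {0..1} \<and> snd (snd u) \<in> {0..1}" if "u \<in> unit_cube" for u
    using that unfolding unit_cube_def by auto
  \<comment> \<open>Points of the cube at distance \<open>2^(-n-1-j)\<close> are at relative distance \<open>2^(-j)\<close> with respect to the
    scale, so the variance of the increment is of order \<open>2^(-p j) = (a^4)^j\<close>.\<close>
  define a where "a = 2 powr (- p / 4)"
  have a: "0 < a" "a < 1" using p powr_less_mono[of "- p / 4" 0 2] by (auto simp: a_def)
  have a4: "(a ^ 4) ^ j = (1 / 2 ^ j) powr p" for j
  proof -
    have "a ^ 4 = 2 powr (- p)" unfolding a_def by (subst powr_realpow[symmetric]) (auto simp: powr_powr)
    then have "(a ^ 4) ^ j = 2 powr (- p * real j)" by (subst powr_realpow[symmetric]) (auto simp: powr_powr)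
    also have "\<dots> = (2 powr (- real j)) powr p" by (simp add: powr_powr mult.commute)
    also have "2 powr (- real j) = 1 / 2 ^ j" by (simp add: powr_minus_divide powr_realpow)
    finally show ?thesis .
  qed
  obtain C0 where C0: "C0 > 0" and C0': "\<And>z \<epsilon> H1 H2 t. \<epsilon> > 0 \<Longrightarrow> cball z (\<epsilon> + d) \<subseteq> K \<Longrightarrow> t > 0 \<Longrightarrow>
    field_pairing N hD (scaled_measure \<rho> z \<epsilon>) H1 \<Longrightarrow> field_pairing N hD (scaled_measure \<sigma> z \<epsilon>) H2 \<Longrightarrow>
    measure N {\<omega> \<in> space N. \<bar>H1 \<omega> - H2 \<omega>\<bar> \<ge> t} \<le> 2 * exp (- t\<^sup>2 / C0)"
    by (rule same_point_tail[OF K d(1) dp\<rho> en\<rho> dp\<sigma> en\<sigma>]) (rule that)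
  have incr: "\<exists>C>0. \<forall>n\<ge>N0. \<forall>j. \<forall>u\<in>unit_cube. \<forall>v\<in>unit_cube. \<forall>t>0. close3 (1 / 2 ^ Suc (n + j)) u v \<longrightarrow>
      measure N {\<omega> \<in> space N. \<bar>H (P (fst u) (fst (snd u))) (sc n (snd (snd u))) \<omega>
        - H (P (fst v) (fst (snd v))) (sc n (snd (snd v))) \<omega>\<bar> \<ge> t} \<le> 2 * exp (- t\<^sup>2 / (C * (a ^ 4) ^ j))"
    if dp: "disc_prob \<mu>" and Ap: "condition_A M h \<mu> p"
      and pr: "\<And>x y \<epsilon>. x \<in> {0..1} \<Longrightarrow> y \<in> {0..1} \<Longrightarrow> 0 < \<epsilon> \<Longrightarrow> \<epsilon> \<le> d \<Longrightarrow>
        field_pairing N hD (scaled_measure \<mu> (P x y) \<epsilon>) (H (P x y) \<epsilon>)" for \<mu> and H :: "complex \<Rightarrow> real \<Rightarrow> 'b \<Rightarrow> real"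
  proof -
    obtain C where C: "C > 0" and C': "\<And>z \<epsilon> w r H1 H2 t e. \<epsilon> \<in> {0<..1} \<Longrightarrow> r \<in> {0<..1} \<Longrightarrow> 1/2 \<le> \<epsilon> / r \<Longrightarrow> \<epsilon> / r \<le> 2 \<Longrightarrow>
      cball z (\<epsilon> + d) \<subseteq> K \<Longrightarrow> cball w (r + d) \<subseteq> K \<Longrightarrow>
      norm (z - w) + \<bar>\<epsilon> - r\<bar> \<le> e \<Longrightarrow> 0 < e \<Longrightarrow> e \<le> min \<epsilon> r \<Longrightarrow> t > 0 \<Longrightarrow>
      field_pairing N hD (scaled_measure \<mu> z \<epsilon>) H1 \<Longrightarrow> field_pairing N hD (scaled_measure \<mu> w r) H2 \<Longrightarrow>
      measure N {\<omega> \<in> space N. \<bar>H1 \<omega> - H2 \<omega>\<bar> \<ge> t} \<le> 2 * exp (- t\<^sup>2 / (C * (e / min \<epsilon> r) powr p))"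
      by (rule increment_tail[OF K d(1) dp Ap p]) (rule that)
    show ?thesis
    proof (intro exI[of _ C] conjI C allI ballI impI)
      fix n j :: nat and u v :: point3 and t :: real
      assume n: "n \<ge> N0" and uv: "u \<in> unit_cube" "v \<in> unit_cube" and t: "t > 0" and cl: "close3 (1 / 2 ^ Suc (n + j)) u v"
      obtain x y s where u: "u = (x, y, s)" by (cases u)
      obtain x' y' s' where v: "v = (x', y', s')" by (cases v)
      have I: "x \<in> {0..1}" "y \<in> {0..1}" "s \<in> {0..1}" "x' \<in> {0..1}" "y' \<in> {0..1}" "s' \<in> {0..1}"
        using cube[OF uv(1)] cube[OF uv(2)] unfolding u v by auto
      define e where "e = (1 / 2 ^ Suc (n + j) :: real)"
      have e0: "e > 0" by (simp add: e_def)
      have cl': "\<bar>x - x'\<bar> \<le> e" "\<bar>y - y'\<bar> \<le> e" "\<bar>s - s'\<bar> \<le> e"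
        using cl unfolding u v close3_def e_def by auto
      define \<epsilon> where "\<epsilon> = sc n s"
      define r where "r = sc n s'"
      have b: "1 / 2 ^ Suc n \<le> \<epsilon>" "\<epsilon> \<le> d" "0 < \<epsilon>" "1 / 2 ^ Suc n \<le> r" "r \<le> d" "0 < r"
        using sc[OF n I(3)] sc[OF n I(6)] unfolding \<epsilon>_def r_def by auto
      have up: "\<epsilon> \<le> 2 * (1 / 2 ^ Suc n)" "r \<le> 2 * (1 / 2 ^ Suc n)"
        using sc2[OF I(3), of n] sc2[OF I(6), of n] unfolding \<epsilon>_def r_def by auto
      have "\<epsilon> \<le> 2 * r" "r \<le> 2 * \<epsilon>" using up b by linarith+
      then have ratio: "1/2 \<le> \<epsilon> / r" "\<epsilon> / r \<le> 2" using b by (auto simp: le_divide_eq divide_le_eq)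
      have one: "\<epsilon> \<in> {0<..1}" "r \<in> {0<..1}" using b d by auto
      have "norm (P x y - P x' y') \<le> d * (\<bar>x - x'\<bar> + \<bar>y - y'\<bar>)" unfolding P_def using d by (intro square_point_dist) simp
      also have "\<dots> \<le> 1/4 * (e + e)" using d cl' by (intro mult_mono add_mono) auto
      finally have dz: "norm (P x y - P x' y') \<le> e / 2" by simp
      have de: "\<bar>\<epsilon> - r\<bar> \<le> e / 2"
      proof -
        have "\<epsilon> - r = (1 / 2 ^ Suc n) * (s - s')" unfolding \<epsilon>_def r_def by (rule sc_diff)
        then have "\<bar>\<epsilon> - r\<bar> = (1 / 2 ^ Suc n) * \<bar>s - s'\<bar>" by (simp add: abs_mult)
        also have "\<dots> \<le> (1 / 2) * e" using cl' by (intro mult_mono) (auto simp: divide_le_eq)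
        finally show ?thesis by simp
      qed
      have min: "1 / 2 ^ Suc n \<le> min \<epsilon> r" using b by simp
      have en: "e \<le> 1 / 2 ^ Suc n" unfolding e_def by (intro divide_left_mono) (auto intro: power_increasing)
      have q: "(e / min \<epsilon> r) powr p \<le> (a ^ 4) ^ j"
      proof -
        have "e / min \<epsilon> r \<le> e / (1 / 2 ^ Suc n)" using min b e0 by (intro divide_left_mono mult_pos_pos) auto
        also have "\<dots> = 1 / 2 ^ j" by (simp add: e_def power_add)
        finally have "e / min \<epsilon> r \<le> 1 / 2 ^ j" .
        then show ?thesis unfolding a4 using e0 b p by (intro powr_mono2) auto
      qed
      have qp: "0 < (e / min \<epsilon> r) powr p" using e0 b by simp
      have "measure N {\<omega> \<in> space N. \<bar>H (P x y) \<epsilon> \<omega> - H (P x' y') r \<omega>\<bar> \<ge> t} \<le> 2 * exp (- t\<^sup>2 / (C * (e / min \<epsilon> r) powr p))"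
      proof (rule C'[OF one ratio PK[OF I(1,2) b(2)] PK[OF I(4,5) b(5)] _ e0 _ t pr[OF I(1,2) b(3,2)] pr[OF I(4,5) b(6,5)]])
        show "norm (P x y - P x' y') + \<bar>\<epsilon> - r\<bar> \<le> e" using dz de by linarith
        show "e \<le> min \<epsilon> r" using en min by linarith
      qed
      also have "\<dots> \<le> 2 * exp (- t\<^sup>2 / (C * (a ^ 4) ^ j))"
      proof -
        have "t\<^sup>2 / (C * (a ^ 4) ^ j) \<le> t\<^sup>2 / (C * (e / min \<epsilon> r) powr p)"
          using q qp C a by (intro divide_left_mono mult_left_mono mult_pos_pos) auto
        then show ?thesis by simp
      qed
      finally show "measure N {\<omega> \<in> space N. \<bar>H (P (fst u) (fst (snd u))) (sc n (snd (snd u))) \<omega>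
        - H (P (fst v) (fst (snd v))) (sc n (snd (snd v))) \<omega>\<bar> \<ge> t} \<le> 2 * exp (- t\<^sup>2 / (C * (a ^ 4) ^ j))"
        by (simp only: u v fst_conv snd_conv \<epsilon>_def r_def)
    qed
  qed
  obtain C1 where C1: "C1 > 0" and C1': "\<forall>n\<ge>N0. \<forall>j. \<forall>u\<in>unit_cube. \<forall>v\<in>unit_cube. \<forall>t>0. close3 (1 / 2 ^ Suc (n + j)) u v \<longrightarrow>
      measure N {\<omega> \<in> space N. \<bar>H\<rho> (P (fst u) (fst (snd u))) (sc n (snd (snd u))) \<omega>
        - H\<rho> (P (fst v) (fst (snd v))) (sc n (snd (snd v))) \<omega>\<bar> \<ge> t} \<le> 2 * exp (- t\<^sup>2 / (C1 * (a ^ 4) ^ j))"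
    by (rule exE[OF incr[of \<rho> H\<rho>, OF dp\<rho> A\<rho>]], rule pair\<rho>, assumption+, elim conjE) (rule that)
  obtain C2 where C2: "C2 > 0" and C2': "\<forall>n\<ge>N0. \<forall>j. \<forall>u\<in>unit_cube. \<forall>v\<in>unit_cube. \<forall>t>0. close3 (1 / 2 ^ Suc (n + j)) u v \<longrightarrow>
      measure N {\<omega> \<in> space N. \<bar>H\<sigma> (P (fst u) (fst (snd u))) (sc n (snd (snd u))) \<omega>
        - H\<sigma> (P (fst v) (fst (snd v))) (sc n (snd (snd v))) \<omega>\<bar> \<ge> t} \<le> 2 * exp (- t\<^sup>2 / (C2 * (a ^ 4) ^ j))"
    by (rule exE[OF incr[of \<sigma> H\<sigma>, OF dp\<sigma> A\<sigma>]], rule pair\<sigma>, assumption+, elim conjE) (rule that)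
  \<comment> \<open>An increment of the difference is the difference of two increments, each of which gets height
    \<open>t/2\<close>; this costs the factor 4.\<close>
  define C where "C = C0 + 4 * C1 + 4 * C2"
  have C: "C > 0" "C0 \<le> C" "4 * C1 \<le> C" "4 * C2 \<le> C" using C0 C1 C2 by (auto simp: C_def)
  have m\<rho>: "H\<rho> (P (fst u) (fst (snd u))) (sc n (snd (snd u))) \<in> borel_measurable N"
    and m\<sigma>: "H\<sigma> (P (fst u) (fst (snd u))) (sc n (snd (snd u))) \<in> borel_measurable N"
    if "n \<ge> N0" "u \<in> unit_cube" for n u
  proof -
    have I: "fst u \<in> {0..1}" "fst (snd u) \<in> {0..1}" "snd (snd u) \<in> {0..1}" using cube[OF that(2)] by blast+
    have s: "0 < sc n (snd (snd u))" "sc n (snd (snd u)) \<le> d" using sc[OF that(1) I(3)] by blast+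
    show "H\<rho> (P (fst u) (fst (snd u))) (sc n (snd (snd u))) \<in> borel_measurable N"
      by (rule field_pairing_avg(1)[OF pair\<rho>[OF I(1,2) s] dp\<rho>])
    show "H\<sigma> (P (fst u) (fst (snd u))) (sc n (snd (snd u))) \<in> borel_measurable N"
      by (rule field_pairing_avg(1)[OF pair\<sigma>[OF I(1,2) s] dp\<sigma>])
  qed
  have exp_le: "2 * exp (- t\<^sup>2 / X) \<le> 2 * exp (- t\<^sup>2 / Y)" if "0 < X" "X \<le> Y" for t X Y :: real
  proof -
    have "t\<^sup>2 / Y \<le> t\<^sup>2 / X" using that by (intro divide_left_mono) auto
    then show ?thesis by simp
  qed
  define \<kappa> where "\<kappa> = 1 + 1 / (1 - a)"
  have \<kappa>: "\<kappa> > 0" using a by (simp add: \<kappa>_def add_pos_pos)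
  have "AE \<omega> in N. \<forall>\<^sub>F n in sequentially. \<forall>u\<in>unit_cube. \<bar>W n u \<omega>\<bar> \<le> (\<delta> * real n) * (1 + 1 / (1 - a))" if \<delta>: "\<delta> > 0" for \<delta>
  proof (rule N.chaining[where ?N0.0 = N0 and C = C and A = 4, OF _ a C(1) _ _ _ \<delta>])
    show "W n u \<in> borel_measurable N" if "n \<ge> N0" "u \<in> unit_cube" for n u
      unfolding W_def using m\<rho>[OF that] m\<sigma>[OF that] by measurable
    show "measure N {\<omega> \<in> space N. \<bar>W n u \<omega>\<bar> \<ge> t} \<le> 4 * exp (- t\<^sup>2 / C)" if "n \<ge> N0" "u \<in> unit_cube" "t > 0" for n u t
    proof -
      have I: "fst u \<in> {0..1}" "fst (snd u) \<in> {0..1}" "snd (snd u) \<in> {0..1}" using cube[OF that(2)] by blast+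
      have s: "0 < sc n (snd (snd u))" "sc n (snd (snd u)) \<le> d" using sc[OF that(1) I(3)] by blast+
      have "measure N {\<omega> \<in> space N. \<bar>W n u \<omega>\<bar> \<ge> t} \<le> 2 * exp (- t\<^sup>2 / C0)"
        unfolding W_def by (rule C0'[OF s(1) PK[OF I(1,2) s(2)] that(3) pair\<rho>[OF I(1,2) s] pair\<sigma>[OF I(1,2) s]])
      also have "\<dots> \<le> 2 * exp (- t\<^sup>2 / C)" by (rule exp_le[OF C0 C(2)])
      also have "\<dots> \<le> 4 * exp (- t\<^sup>2 / C)" by simp
      finally show ?thesis .
    qed
    show "measure N {\<omega> \<in> space N. \<bar>W n u \<omega> - W n v \<omega>\<bar> \<ge> t} \<le> 4 * exp (- t\<^sup>2 / (C * (a ^ 4) ^ j))"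
      if n: "n \<ge> N0" and uv: "u \<in> unit_cube" "v \<in> unit_cube" and cl: "close3 (1 / 2 ^ Suc (n + j)) u v" and t: "t > 0" for n j u v t
    proof -
      let ?R = "\<lambda>u. H\<rho> (P (fst u) (fst (snd u))) (sc n (snd (snd u)))"
      let ?S = "\<lambda>u. H\<sigma> (P (fst u) (fst (snd u))) (sc n (snd (snd u)))"
      let ?A = "{\<omega> \<in> space N. \<bar>?R u \<omega> - ?R v \<omega>\<bar> \<ge> t / 2}"
      let ?B = "{\<omega> \<in> space N. \<bar>?S u \<omega> - ?S v \<omega>\<bar> \<ge> t / 2}"
      have [measurable]: "?R u \<in> borel_measurable N" "?R v \<in> borel_measurable N" "?S u \<in> borel_measurable N" "?S v \<in> borel_measurable N"
        using m\<rho>[OF n] m\<sigma>[OF n] uv by blast+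
      have mAB: "?A \<in> sets N" "?B \<in> sets N" by measurable
      have t2: "t / 2 > 0" using t by simp
      have aj: "(a ^ 4) ^ j > 0" using a by simp
      have "measure N {\<omega> \<in> space N. \<bar>W n u \<omega> - W n v \<omega>\<bar> \<ge> t} \<le> measure N (?A \<union> ?B)"
      proof (rule N.finite_measure_mono)
        show "{\<omega> \<in> space N. \<bar>W n u \<omega> - W n v \<omega>\<bar> \<ge> t} \<subseteq> ?A \<union> ?B"
        proof (rule subsetI)
          fix \<omega> assume w: "\<omega> \<in> {\<omega> \<in> space N. \<bar>W n u \<omega> - W n v \<omega>\<bar> \<ge> t}"
          have "\<bar>W n u \<omega> - W n v \<omega>\<bar> \<le> \<bar>?R u \<omega> - ?R v \<omega>\<bar> + \<bar>?S u \<omega> - ?S v \<omega>\<bar>" unfolding W_def by linarith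
          then have "t / 2 \<le> \<bar>?R u \<omega> - ?R v \<omega>\<bar> \<or> t / 2 \<le> \<bar>?S u \<omega> - ?S v \<omega>\<bar>" using w by auto
          then show "\<omega> \<in> ?A \<union> ?B" using w by blast
        qed
      qed (use mAB in auto)
      also have "\<dots> \<le> measure N ?A + measure N ?B" by (rule measure_Un_le[OF mAB])
      also have "measure N ?A \<le> 2 * exp (- (t / 2)\<^sup>2 / (C1 * (a ^ 4) ^ j))"
        by (rule C1'[rule_format, OF n uv t2 cl])
      also have "\<dots> = 2 * exp (- t\<^sup>2 / (4 * C1 * (a ^ 4) ^ j))" by (simp add: power_divide mult.assoc)
      also have "\<dots> \<le> 2 * exp (- t\<^sup>2 / (C * (a ^ 4) ^ j))"
        using C C1 aj by (intro exp_le mult_pos_pos mult_right_mono) auto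
      also have "measure N ?B \<le> 2 * exp (- (t / 2)\<^sup>2 / (C2 * (a ^ 4) ^ j))"
        by (rule C2'[rule_format, OF n uv t2 cl])
      also have "\<dots> = 2 * exp (- t\<^sup>2 / (4 * C2 * (a ^ 4) ^ j))" by (simp add: power_divide mult.assoc)
      also have "\<dots> \<le> 2 * exp (- t\<^sup>2 / (C * (a ^ 4) ^ j))"
        using C C2 aj by (intro exp_le mult_pos_pos mult_right_mono) auto
      finally show ?thesis by simp
    qed
    show "AE \<omega> in N. \<forall>n\<ge>N0. continuous_on unit_cube (\<lambda>u. W n u \<omega>)"
    proof -
      let ?dom = "{(z, \<epsilon>). z \<in> D \<and> 0 < \<epsilon> \<and> \<epsilon> < infdist z (frontier D)}"
      have "AE \<omega> in N. continuous_on ?dom (\<lambda>(z, \<epsilon>). H\<rho> z \<epsilon> \<omega>)" "AE \<omega> in N. continuous_on ?dom (\<lambda>(z, \<epsilon>). H\<sigma> z \<epsilon> \<omega>)"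
        using H\<rho> H\<sigma> by (auto simp: continuous_regularisation_def)
      then show ?thesis
      proof eventually_elim
        case (elim \<omega>)
        show ?case
        proof (intro allI impI)
          fix n assume n: "n \<ge> N0"
          define f where "f = (\<lambda>u::point3. (P (fst u) (fst (snd u)), sc n (snd (snd u))))"
          have fc: "continuous_on unit_cube f"
            unfolding f_def P_def square_point_def sc_def Complex_eq by (intro continuous_intros)
          have fim: "f ` unit_cube \<subseteq> ?dom"
          proof (rule image_subsetI)
            fix u assume u: "u \<in> unit_cube"
            have I: "fst u \<in> {0..1}" "fst (snd u) \<in> {0..1}" "snd (snd u) \<in> {0..1}" using cube[OF u] by blast+
            have s: "0 < sc n (snd (snd u))" "sc n (snd (snd u)) \<le> d" using sc[OF n I(3)] by blast+
            show "f u \<in> ?dom" unfolding f_def using dom[OF I(1,2) s] s by simp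
          qed
          have "continuous_on unit_cube (\<lambda>u. (\<lambda>(z, \<epsilon>). H\<rho> z \<epsilon> \<omega>) (f u) - (\<lambda>(z, \<epsilon>). H\<sigma> z \<epsilon> \<omega>) (f u))"
            by (intro continuous_on_diff continuous_on_compose2[OF elim(1) fc fim] continuous_on_compose2[OF elim(2) fc fim])
          then show "continuous_on unit_cube (\<lambda>u. W n u \<omega>)" by (simp add: W_def f_def)
        qed
      qed
    qed
  qed
  note chained = this
  have "AE \<omega> in N. \<forall>\<^sub>F n in sequentially. \<forall>u\<in>unit_cube. \<bar>W n u \<omega>\<bar> \<le> (1 / real (Suc m) * real n) * \<kappa>" for m
    unfolding \<kappa>_def by (rule chained) simp
  then have "AE \<omega> in N. \<forall>m. \<forall>\<^sub>F n in sequentially. \<forall>u\<in>unit_cube. \<bar>W n u \<omega>\<bar> \<le> (1 / real (Suc m) * real n) * \<kappa>"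
    by (subst AE_all_countable) blast
  then show ?thesis
  proof (rule AE_mp, intro AE_I2 impI ballI)
    fix \<omega> x y
    assume main: "\<forall>m. \<forall>\<^sub>F n in sequentially. \<forall>u\<in>unit_cube. \<bar>W n u \<omega>\<bar> \<le> (1 / real (Suc m) * real n) * \<kappa>"
      and xy: "x \<in> {0..1::real}" "y \<in> {0..1::real}"
    define Z where "Z = (\<lambda>\<epsilon>. H\<rho> (P x y) \<epsilon> \<omega> - H\<sigma> (P x y) \<epsilon> \<omega>)"
    have "((\<lambda>\<epsilon>. Z \<epsilon> / ln (1 / \<epsilon>)) \<longlongrightarrow> 0) (at_right 0)"
    proof (rule tendstoI)
      fix e :: real assume e: "e > 0"
      define e' where "e' = e * ln 2 / \<kappa>"
      have e': "e' > 0" using e \<kappa> by (simp add: e'_def)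
      obtain m where m: "1 / real (Suc m) < e'" using nat_approx_posE[OF e'] by blast
      obtain n1 where n1: "\<And>n u. n \<ge> n1 \<Longrightarrow> u \<in> unit_cube \<Longrightarrow> \<bar>W n u \<omega>\<bar> \<le> (1 / real (Suc m) * real n) * \<kappa>"
        using main unfolding eventually_sequentially by blast
      define n2 where "n2 = Suc n1"
      have "\<forall>\<^sub>F \<epsilon> in at_right 0. \<epsilon> < 1 / 2 ^ n2 \<and> 0 < (\<epsilon>::real)"
        by (rule eventually_at_rightI[of 0 "1 / 2 ^ n2"]) auto
      then show "\<forall>\<^sub>F \<epsilon> in at_right 0. dist (Z \<epsilon> / ln (1 / \<epsilon>)) 0 < e"
      proof (rule eventually_mono)
        fix \<epsilon> :: real assume \<epsilon>: "\<epsilon> < 1 / 2 ^ n2 \<and> 0 < \<epsilon>"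
        define L where "L = log 2 (1 / \<epsilon>)"
        define n where "n = nat \<lfloor>L\<rfloor>"
        have i: "2 ^ n2 < 1 / \<epsilon>" using \<epsilon> by (simp add: less_divide_eq mult.commute)
        have L: "real n2 < L"
          unfolding L_def using i \<epsilon> by (subst less_log_iff) (auto simp: powr_realpow)
        have nL: "real n \<le> L" "L < real n + 1" using L unfolding n_def by linarith+
        have nn: "n \<ge> n1" "n \<ge> 1"
        proof -
          have "real n2 < real n + 1" using L nL by linarith
          then have "n2 \<le> n" by linarith
          then show "n \<ge> n1" "n \<ge> 1" by (simp_all add: n2_def)
        qed
        have eL: "2 powr L = 1 / \<epsilon>" using \<epsilon> by (simp add: L_def)
        have "2 powr (real n) \<le> 2 powr L" using nL(1) by simp
        then have e1: "2 ^ n * \<epsilon> \<le> 1" using \<epsilon> unfolding eL by (simp add: powr_realpow le_divide_eq)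
        have "2 powr L \<le> 2 powr (real (Suc n))" using nL(2) by (intro powr_mono) auto
        then have "1 / \<epsilon> \<le> 2 ^ Suc n" unfolding eL by (simp only: powr_realpow zero_less_numeral)
        then have e2: "1 \<le> 2 ^ Suc n * \<epsilon>" using \<epsilon> by (simp add: divide_le_eq)
        define s where "s = 2 ^ Suc n * \<epsilon> - 1"
        have s: "s \<in> {0..1}" using e1 e2 by (simp add: s_def)
        have scs: "sc n s = \<epsilon>" by (simp add: sc_def s_def)
        have "(x, y, s) \<in> unit_cube" using xy s by (simp add: unit_cube_def)
        from n1[OF nn(1) this] have Zle: "\<bar>Z \<epsilon>\<bar> \<le> (1 / real (Suc m) * real n) * \<kappa>"
          by (simp only: W_def Z_def fst_conv snd_conv scs)
        have n0: "real n > 0" using nn(2) by simp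
        have lnL: "ln (1 / \<epsilon>) = L * ln 2" by (simp add: L_def log_def)
        have lge: "real n * ln 2 \<le> ln (1 / \<epsilon>)" unfolding lnL using nL(1) by (intro mult_right_mono) auto
        have lpos: "ln (1 / \<epsilon>) > 0" using lge mult_pos_pos[OF n0 ln_gt_zero[of "2::real"]] by linarith
        have "\<bar>Z \<epsilon>\<bar> < e' * real n * \<kappa>"
        proof -
          have "1 / real (Suc m) * real n * \<kappa> < e' * real n * \<kappa>"
            using m n0 \<kappa> by (intro mult_strict_right_mono) auto
          then show ?thesis using Zle by linarith
        qed
        also have "e' * real n * \<kappa> = e * (real n * ln 2)" using \<kappa> by (simp add: e'_def)
        also have "\<dots> \<le> e * ln (1 / \<epsilon>)" using lge e by (intro mult_left_mono) auto
        finally have "\<bar>Z \<epsilon>\<bar> / ln (1 / \<epsilon>) < e" using lpos by (simp only: pos_divide_less_eq)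
        then show "dist (Z \<epsilon> / ln (1 / \<epsilon>)) 0 < e" using lpos by (simp add: dist_real_def abs_divide)
      qed
    qed
    then show "((\<lambda>\<epsilon>. H\<rho> (square_point c d x y) \<epsilon> \<omega> / ln (1 / \<epsilon>) - H\<sigma> (square_point c d x y) \<epsilon> \<omega> / ln (1 / \<epsilon>)) \<longlongrightarrow> 0) (at_right 0)"
      by (simp only: Z_def P_def diff_divide_distrib)
  qed
qed

text \<open>By the Lindelof property, countably many squares cover \<open>D\<close>.\<close>

lemma regularisations_close:
  assumes \<rho>: "admissible_mollifier \<rho>" and \<sigma>: "admissible_mollifier \<sigma>"
    and p: "0 < p" "p \<le> 1" and A\<rho>: "condition_A M h \<rho> p" and A\<sigma>: "condition_A M h \<sigma> p"
    and H\<rho>: "continuous_regularisation N D hD \<rho> H\<rho>" and H\<sigma>: "continuous_regularisation N D hD \<sigma> H\<sigma>"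
  shows "AE \<omega> in N. \<forall>z\<in>D. ((\<lambda>\<epsilon>. H\<rho> z \<epsilon> \<omega> / ln (1 / \<epsilon>) - H\<sigma> z \<epsilon> \<omega> / ln (1 / \<epsilon>)) \<longlongrightarrow> 0) (at_right 0)"
proof -
  have DU: "D \<noteq> UNIV" using not_green_function_UNIV green by blast
  have "\<forall>z\<in>D. \<exists>d. 0 < d \<and> d \<le> 1/4 \<and> cball z (9 * d) \<subseteq> D"
  proof
    fix z assume "z \<in> D"
    then obtain r where r: "r > 0" "cball z r \<subseteq> D" using openD open_contains_cball by blast
    have "cball z (9 * min (1/4) (r / 9)) \<subseteq> cball z r" by (intro subset_cball) auto
    then show "\<exists>d. 0 < d \<and> d \<le> 1/4 \<and> cball z (9 * d) \<subseteq> D" using r by (intro exI[of _ "min (1/4) (r / 9)"]) auto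
  qed
  from bchoice[OF this] obtain \<delta> where \<delta>: "\<forall>z\<in>D. 0 < \<delta> z \<and> \<delta> z \<le> 1/4 \<and> cball z (9 * \<delta> z) \<subseteq> D" by (rule exE)
  have "\<forall>S\<in>(\<lambda>z. ball z (\<delta> z / 2)) ` D. open S" by auto
  then obtain \<F> where \<F>: "\<F> \<subseteq> (\<lambda>z. ball z (\<delta> z / 2)) ` D" "countable \<F>" "\<Union>\<F> = \<Union>((\<lambda>z. ball z (\<delta> z / 2)) ` D)"
    using Lindelof[of "(\<lambda>z. ball z (\<delta> z / 2)) ` D"] by blast
  from countable_subset_image[THEN iffD1, OF conjI[OF \<F>(2,1)]]
  obtain Z0 where Z0: "countable Z0" "Z0 \<subseteq> D" "\<F> = (\<lambda>z. ball z (\<delta> z / 2)) ` Z0" by (elim exE conjE) (rule that)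
  \<comment> \<open>The lower left corner of the square of side \<open>\<delta> z\<close> that is centred at \<open>z\<close>.\<close>
  define c where "c = (\<lambda>z. z - (\<delta> z / 2) *\<^sub>R Complex 1 1)"
  have cz: "norm (c z - z) \<le> \<delta> z" if "z \<in> D" for z
  proof -
    have "c z - z = - ((\<delta> z / 2) *\<^sub>R Complex 1 1)" by (simp add: c_def)
    then have "norm (c z - z) = \<bar>\<delta> z / 2\<bar> * norm (Complex 1 1)" by (simp only: norm_minus_cancel norm_scaleR)
    also have "\<bar>\<delta> z / 2\<bar> = \<delta> z / 2" using \<delta>[rule_format, OF that] by simp
    also have "norm (Complex 1 1) \<le> 2" using cmod_le[of "Complex 1 1"] by simp
    finally show ?thesis using \<delta> that by (simp add: mult_left_mono)
  qed
  have "AE \<omega> in N. \<forall>z\<in>Z0. \<forall>x\<in>{0..1}. \<forall>y\<in>{0..1}.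
    ((\<lambda>\<epsilon>. H\<rho> (square_point (c z) (\<delta> z) x y) \<epsilon> \<omega> / ln (1 / \<epsilon>) - H\<sigma> (square_point (c z) (\<delta> z) x y) \<epsilon> \<omega> / ln (1 / \<epsilon>)) \<longlongrightarrow> 0) (at_right 0)"
  proof (rule AE_ball_countable'[OF _ Z0(1)])
    fix z assume "z \<in> Z0"
    then have z: "z \<in> D" using Z0(2) by blast
    have "cball (c z) (8 * \<delta> z) \<subseteq> cball z (9 * \<delta> z)"
    proof
      fix w assume "w \<in> cball (c z) (8 * \<delta> z)"
      then have "norm (w - c z) \<le> 8 * \<delta> z" by (simp add: dist_norm norm_minus_commute)
      then have "norm (w - z) \<le> 9 * \<delta> z" using cz[OF z] norm_triangle_ineq[of "w - c z" "c z - z"] by simp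
      then show "w \<in> cball z (9 * \<delta> z)" by (simp add: dist_norm norm_minus_commute)
    qed
    then have "cball (c z) (8 * \<delta> z) \<subseteq> D" using \<delta> z by blast
    then show "AE \<omega> in N. \<forall>x\<in>{0..1}. \<forall>y\<in>{0..1}.
      ((\<lambda>\<epsilon>. H\<rho> (square_point (c z) (\<delta> z) x y) \<epsilon> \<omega> / ln (1 / \<epsilon>) - H\<sigma> (square_point (c z) (\<delta> z) x y) \<epsilon> \<omega> / ln (1 / \<epsilon>)) \<longlongrightarrow> 0) (at_right 0)"
      by (intro regularisations_close_on_square[OF \<rho> \<sigma> p A\<rho> A\<sigma> H\<rho> H\<sigma> DU]) (use \<delta> z in auto)
  qed
  then show ?thesis
  proof (rule AE_mp, intro AE_I2 impI ballI)
    fix \<omega> w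
    assume main: "\<forall>z\<in>Z0. \<forall>x\<in>{0..1}. \<forall>y\<in>{0..1}.
      ((\<lambda>\<epsilon>. H\<rho> (square_point (c z) (\<delta> z) x y) \<epsilon> \<omega> / ln (1 / \<epsilon>) - H\<sigma> (square_point (c z) (\<delta> z) x y) \<epsilon> \<omega> / ln (1 / \<epsilon>)) \<longlongrightarrow> 0) (at_right 0)"
      and w: "w \<in> D"
    have "w \<in> ball w (\<delta> w / 2)" using \<delta> w by simp
    then have "w \<in> \<Union>\<F>" unfolding \<F>(3) using w by blast
    then obtain z where z: "z \<in> Z0" "w \<in> ball z (\<delta> z / 2)" unfolding Z0(3) by blast
    have dz: "\<delta> z > 0" using \<delta> z(1) Z0(2) by blast
    have nz: "norm (w - z) < \<delta> z / 2" using z(2) by (simp add: dist_norm norm_minus_commute)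
    define x where "x = 1/2 + Re (w - z) / \<delta> z"
    define y where "y = 1/2 + Im (w - z) / \<delta> z"
    have re: "\<bar>Re (w - z) / \<delta> z\<bar> \<le> 1/2"
    proof -
      have "\<bar>Re (w - z)\<bar> \<le> \<delta> z / 2" using abs_Re_le_cmod[of "w - z"] nz by linarith
      then show ?thesis using dz by (simp add: abs_divide divide_le_eq)
    qed
    have im: "\<bar>Im (w - z) / \<delta> z\<bar> \<le> 1/2"
    proof -
      have "\<bar>Im (w - z)\<bar> \<le> \<delta> z / 2" using abs_Im_le_cmod[of "w - z"] nz by linarith
      then show ?thesis using dz by (simp add: abs_divide divide_le_eq)
    qed
    have x: "x \<in> {0..1}" using re unfolding x_def abs_le_iff atLeastAtMost_iff by linarith
    have y: "y \<in> {0..1}" using im unfolding y_def abs_le_iff atLeastAtMost_iff by linarith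
    have half: "\<delta> z * (1/2 + b / \<delta> z) = \<delta> z / 2 + b" for b using dz by (simp add: distrib_left)
    have "\<delta> z * x = \<delta> z / 2 + Re (w - z)" "\<delta> z * y = \<delta> z / 2 + Im (w - z)"
      unfolding x_def y_def by (rule half)+
    then have "square_point (c z) (\<delta> z) x y = w"
      by (simp add: square_point_def c_def complex_eq_iff)
    with main[rule_format, OF z(1) x y]
    show "((\<lambda>\<epsilon>. H\<rho> w \<epsilon> \<omega> / ln (1 / \<epsilon>) - H\<sigma> w \<epsilon> \<omega> / ln (1 / \<epsilon>)) \<longlongrightarrow> 0) (at_right 0)" by (simp only:)
  qed
qed

end

theorem theorem1p10:
  fixes M :: "'a measure" and h :: "'a \<Rightarrow> (complex \<Rightarrow> real) \<Rightarrow> real"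
    and N :: "'b measure" and hD :: "'b \<Rightarrow> (complex \<Rightarrow> real) \<Rightarrow> real"
    and D :: "complex set" and G :: "complex \<Rightarrow> complex \<Rightarrow> real"
    and \<rho> \<sigma> :: "complex measure"
    and H\<rho> H\<sigma> :: "complex \<Rightarrow> real \<Rightarrow> 'b \<Rightarrow> real"
  assumes "log_correlated_field M h"
    and "open D" and "connected D" and "harmonically_nontrivial_boundary D"
    and "green_function D G" and "zero_boundary_GFF N D G hD"
    and "admissible_mollifier \<rho>" and "admissible_mollifier \<sigma>"
    and "\<exists>p. 0 < p \<and> p \<le> 1 \<and> condition_A M h \<rho> p \<and> condition_A M h \<sigma> p"
    and "continuous_regularisation N D hD \<rho> H\<rho>"
    and "continuous_regularisation N D hD \<sigma> H\<sigma>"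
  shows "AE \<omega> in N. \<forall>\<alpha> star. thick_points D H\<rho> \<omega> \<alpha> star = thick_points D H\<sigma> \<omega> \<alpha> star"
proof -
  interpret gff_comparison M h N hD D G by unfold_locales fact+
  obtain p where p: "0 < p" "p \<le> 1" "condition_A M h \<rho> p" "condition_A M h \<sigma> p" using assms(9) by blast
  have "AE \<omega> in N. \<forall>z\<in>D. ((\<lambda>\<epsilon>. H\<rho> z \<epsilon> \<omega> / ln (1 / \<epsilon>) - H\<sigma> z \<epsilon> \<omega> / ln (1 / \<epsilon>)) \<longlongrightarrow> 0) (at_right 0)"
    by (rule regularisations_close[OF assms(7,8) p assms(10,11)])
  then show ?thesis
  proof (rule AE_mp, intro AE_I2 impI allI)
    fix \<omega> \<alpha> star
    assume *: "\<forall>z\<in>D. ((\<lambda>\<epsilon>. H\<rho> z \<epsilon> \<omega> / ln (1 / \<epsilon>) - H\<sigma> z \<epsilon> \<omega> / ln (1 / \<epsilon>)) \<longlongrightarrow> 0) (at_right 0)"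
    show "thick_points D H\<rho> \<omega> \<alpha> star = thick_points D H\<sigma> \<omega> \<alpha> star"
      unfolding thick_points_def using has_limit_of_type_cong[OF *[rule_format]] by blast
  qed
qed

end
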